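(* Let $H$ be a finite-dimensional hereditary algebra over a field, let $\mathcal T$ be an $\operatorname{Ext}$-configuration in $\mathcal D=D^b(H)$, and let $M$ be in $\operatorname{ind}\mathcal D$. Then $M$ is in $\mathcal T$ if and only if $FM$ is in $\mathcal T$.
   Context: $\mathcal D=D^b(H)$ is the bounded derived category of finitely generated $H$-modules, with shift $[1]$ and Auslander–Reiten translation $\tau$ (an autoequivalence); $F=\tau^{-1}[1]$. $\operatorname{ind}\mathcal D$ is the set of isomorphism classes of indecomposable objects, and $\operatorname{Ext}^1_{\mathcal D}(U,V)=\operatorname{Hom}_{\mathcal D}(U,V[1])$. A set $\mathcal T$ of non-isomorphic indecomposable objects of $\mathcal D$ is an $\operatorname{Ext}$-configuration if (E1) $\operatorname{Ext}^1_{\mathcal D}(X,Y)=0$ for all $X,Y\in\mathcal T$, and (E2) for every indecomposable $Z\notin\mathcal T$ there is some $X\in\mathcal T$ with $\operatorname{Ext}^1_{\mathcal D}(X,Z)\neq0$. Membership in $\mathcal T$ is understood up to isomorphism. *)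

theory Defs
  imports Complex_Main "HOL-Library.Function_Algebras"
begin

section \<open>Finite-dimensional algebras\<close>

locale fd_algebra = vector_space scale
  for scale :: "'k::field \<Rightarrow> 'h::ring_1 \<Rightarrow> 'h" +
  assumes scale_mult_left: "scale c (x * y) = scale c x * y"
    and scale_mult_right: "scale c (x * y) = x * scale c y"
    and finite_spanning_set: "\<exists>B. finite B \<and> span B = UNIV"


section \<open>Modules over a noncommutative ring\<close>

text \<open>
  A left module has as its carrier a subgroup of some type of class \<open>ab_group_add\<close>; the value of
  \<open>act\<close> outside the carrier is irrelevant, and so are the values of homomorphisms there.
\<close>

record ('h, 'm) hmod =
  car :: "'m set"
  act :: "'h \<Rightarrow> 'm \<Rightarrow> 'm"

definition hmodule :: "('h::ring_1, 'm::ab_group_add) hmod \<Rightarrow> bool" where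
  "hmodule M \<longleftrightarrow>
     0 \<in> car M \<and> (\<forall>x\<in>car M. \<forall>y\<in>car M. x - y \<in> car M) \<and>
     (\<forall>a. \<forall>x\<in>car M. act M a x \<in> car M) \<and>
     (\<forall>a. \<forall>x\<in>car M. \<forall>y\<in>car M. act M a (x + y) = act M a x + act M a y) \<and>
     (\<forall>a b. \<forall>x\<in>car M. act M (a + b) x = act M a x + act M b x) \<and>
     (\<forall>a b. \<forall>x\<in>car M. act M (a * b) x = act M a (act M b x)) \<and>
     (\<forall>x\<in>car M. act M 1 x = x)"

definition fin_gen :: "('h::ring_1, 'm::ab_group_add) hmod \<Rightarrow> bool" where
  "fin_gen M \<longleftrightarrow>
     (\<exists>S. finite S \<and> S \<subseteq> car M \<and> (\<forall>x\<in>car M. \<exists>r. x = (\<Sum>s\<in>S. act M (r s) s)))"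

definition mod_hom ::
    "('h::ring_1, 'm::ab_group_add) hmod \<Rightarrow> ('h, 'n::ab_group_add) hmod \<Rightarrow> ('m \<Rightarrow> 'n) \<Rightarrow> bool" where
  "mod_hom M N f \<longleftrightarrow>
     (\<forall>x\<in>car M. f x \<in> car N) \<and>
     (\<forall>x\<in>car M. \<forall>y\<in>car M. f (x + y) = f x + f y) \<and>
     (\<forall>a. \<forall>x\<in>car M. f (act M a x) = act N a (f x))"

text \<open>
  The modules from which complexes are built have carriers in the type \<open>nat \<Rightarrow> 'h\<close>. Over a
  finite-dimensional algebra this loses nothing: if the algebra is nonzero, a finitely generated
  module is additively isomorphic to some \<open>k\<^sup>n\<close>, which embeds into \<open>nat \<Rightarrow> 'h\<close> because \<open>k\<close> embeds into
  \<open>'h\<close>, and its action can be transported along the embedding since \<open>act\<close> is arbitrary. For the same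
  reason (each \<open>H\<^sup>n\<close> is such a module) testing projectivity of a finitely generated module against
  epimorphisms between these modules is no restriction.
\<close>

type_synonym 'h elt = "nat \<Rightarrow> 'h"

definition projective :: "('h::ring_1, 'm::ab_group_add) hmod \<Rightarrow> bool" where
  "projective P \<longleftrightarrow> hmodule P \<and>
     (\<forall>(M :: ('h, 'h elt) hmod) (N :: ('h, 'h elt) hmod) g f.
        hmodule M \<and> hmodule N \<and> mod_hom M N g \<and> g ` car M = car N \<and> mod_hom P N f \<longrightarrow>
        (\<exists>h. mod_hom P M h \<and> (\<forall>x\<in>car P. g (h x) = f x)))"

definition left_ideal :: "'h::ring_1 set \<Rightarrow> bool" where
  "left_ideal I \<longleftrightarrow> 0 \<in> I \<and> (\<forall>x\<in>I. \<forall>y\<in>I. x - y \<in> I) \<and> (\<forall>a. \<forall>x\<in>I. a * x \<in> I)"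

definition hereditary :: "'h::ring_1 itself \<Rightarrow> bool" where
  "hereditary _ \<longleftrightarrow>
     (\<forall>I :: 'h set. left_ideal I \<longrightarrow> projective \<lparr>car = I, act = (*)\<rparr>)"


section \<open>Bounded complexes of finitely generated modules\<close>

record 'h cplx =
  ob :: "int \<Rightarrow> ('h, 'h elt) hmod"
  dif :: "int \<Rightarrow> 'h elt \<Rightarrow> 'h elt"

type_synonym 'h cmap = "int \<Rightarrow> 'h elt \<Rightarrow> 'h elt"

definition bcplx :: "'h::ring_1 cplx \<Rightarrow> bool" where
  "bcplx X \<longleftrightarrow>
     (\<forall>i. hmodule (ob X i) \<and> fin_gen (ob X i)) \<and>
     (\<forall>i. mod_hom (ob X i) (ob X (i + 1)) (dif X i)) \<and>
     (\<forall>i. \<forall>x\<in>car (ob X i). dif X (i + 1) (dif X i x) = 0) \<and>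
     finite {i. car (ob X i) \<noteq> {0}}"

definition chain_map :: "'h::ring_1 cplx \<Rightarrow> 'h cplx \<Rightarrow> 'h cmap \<Rightarrow> bool" where
  "chain_map X Y f \<longleftrightarrow>
     (\<forall>i. mod_hom (ob X i) (ob Y i) (f i)) \<and>
     (\<forall>i. \<forall>x\<in>car (ob X i). f (i + 1) (dif X i x) = dif Y i (f i x))"

definition cycles :: "'h::ring_1 cplx \<Rightarrow> int \<Rightarrow> 'h elt set" where
  "cycles X i = {x \<in> car (ob X i). dif X i x = 0}"

definition boundaries :: "'h::ring_1 cplx \<Rightarrow> int \<Rightarrow> 'h elt set" where
  "boundaries X i = dif X (i - 1) ` car (ob X (i - 1))"

text \<open>The last two conjuncts: the map induced on \<open>cycles / boundaries\<close> is injective, surjective.\<close>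

definition quasi_iso :: "'h::ring_1 cplx \<Rightarrow> 'h cplx \<Rightarrow> 'h cmap \<Rightarrow> bool" where
  "quasi_iso X Y f \<longleftrightarrow> chain_map X Y f \<and>
     (\<forall>i. \<forall>x\<in>cycles X i. f i x \<in> boundaries Y i \<longrightarrow> x \<in> boundaries X i) \<and>
     (\<forall>i. \<forall>y\<in>cycles Y i. \<exists>x\<in>cycles X i. y - f i x \<in> boundaries Y i)"

definition zero_cplx :: "'h::ring_1 cplx" where
  "zero_cplx = \<lparr>ob = (\<lambda>i. \<lparr>car = {0}, act = (\<lambda>a x. 0)\<rparr>), dif = (\<lambda>i x. 0)\<rparr>"

definition shift :: "'h::ring_1 cplx \<Rightarrow> 'h cplx" where
  "shift X = \<lparr>ob = (\<lambda>i. ob X (i + 1)), dif = (\<lambda>i x. - dif X (i + 1) x)\<rparr>"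

text \<open>
  Interleaving sequences identifies \<open>'h elt \<times> 'h elt\<close> with \<open>'h elt\<close>, so that direct sums of
  modules stay inside this type; \<open>lft\<close> and \<open>rgt\<close> are the two projections.
\<close>

definition pr :: "'h elt \<Rightarrow> 'h elt \<Rightarrow> 'h elt" where
  "pr x y = (\<lambda>n. if even n then x (n div 2) else y (n div 2))"

definition lft :: "'h elt \<Rightarrow> 'h elt" where
  "lft z = (\<lambda>n. z (2 * n))"

definition rgt :: "'h elt \<Rightarrow> 'h elt" where
  "rgt z = (\<lambda>n. z (2 * n + 1))"

definition mod_sum :: "('h::ring_1, 'h elt) hmod \<Rightarrow> ('h, 'h elt) hmod \<Rightarrow> ('h, 'h elt) hmod" where
  "mod_sum M N = \<lparr>car = {pr x y | x y. x \<in> car M \<and> y \<in> car N},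
                  act = (\<lambda>a z. pr (act M a (lft z)) (act N a (rgt z)))\<rparr>"

definition cplx_sum :: "'h::ring_1 cplx \<Rightarrow> 'h cplx \<Rightarrow> 'h cplx" where
  "cplx_sum X Y = \<lparr>ob = (\<lambda>i. mod_sum (ob X i) (ob Y i)),
                   dif = (\<lambda>i z. pr (dif X i (lft z)) (dif Y i (rgt z)))\<rparr>"

definition cone :: "'h::ring_1 cplx \<Rightarrow> 'h cplx \<Rightarrow> 'h cmap \<Rightarrow> 'h cplx" where
  "cone X Y f = \<lparr>ob = (\<lambda>i. mod_sum (ob X (i + 1)) (ob Y i)),
                 dif = (\<lambda>i z. pr (- dif X (i + 1) (lft z)) (f (i + 1) (lft z) + dif Y i (rgt z)))\<rparr>"

definition cone_in :: "'h::ring_1 cmap" where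
  "cone_in = (\<lambda>i y. pr 0 y)"

definition cone_out :: "'h::ring_1 cmap" where
  "cone_out = (\<lambda>i z. lft z)"


section \<open>The bounded derived category\<close>

text \<open>
  \<open>D\<^sup>b(H)\<close> is the localization of the category of bounded complexes at the quasi-isomorphisms
  (Gabriel--Zisman): a morphism is represented by a word of composable letters, each a chain map or
  the formal inverse of a quasi-isomorphism, and \<open>deq X Y\<close> is the equality of the morphisms
  \<open>X \<rightarrow> Y\<close> that two words represent. Words compose by concatenation and are read from left to right
  (diagrammatic order), and the empty word is the identity.
\<close>

datatype 'h letter =
    Arr "'h cplx" "'h cmap" "'h cplx"
  | Inv "'h cplx" "'h cmap" "'h cplx"  \<comment> \<open>\<open>Inv X s Y\<close> goes from \<open>Y\<close> to \<open>X\<close>\<close>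

fun src :: "'h letter \<Rightarrow> 'h cplx" where
  "src (Arr X f Y) = X"
| "src (Inv X s Y) = Y"

fun tgt :: "'h letter \<Rightarrow> 'h cplx" where
  "tgt (Arr X f Y) = Y"
| "tgt (Inv X s Y) = X"

fun valid :: "'h::ring_1 letter \<Rightarrow> bool" where
  "valid (Arr X f Y) \<longleftrightarrow> bcplx X \<and> bcplx Y \<and> chain_map X Y f"
| "valid (Inv X s Y) \<longleftrightarrow> bcplx X \<and> bcplx Y \<and> quasi_iso X Y s"

fun dmor :: "'h::ring_1 cplx \<Rightarrow> 'h cplx \<Rightarrow> 'h letter list \<Rightarrow> bool" where
  "dmor X Y [] \<longleftrightarrow> bcplx X \<and> X = Y"
| "dmor X Y (l # w) \<longleftrightarrow> valid l \<and> src l = X \<and> dmor (tgt l) Y w"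

inductive deq :: "'h::ring_1 cplx \<Rightarrow> 'h cplx \<Rightarrow> 'h letter list \<Rightarrow> 'h letter list \<Rightarrow> bool" where
  deq_refl: "dmor X Y w \<Longrightarrow> deq X Y w w"
| deq_sym: "deq X Y w w' \<Longrightarrow> deq X Y w' w"
| deq_trans: "deq X Y w w' \<Longrightarrow> deq X Y w' w'' \<Longrightarrow> deq X Y w w''"
| deq_cong: "dmor X A u \<Longrightarrow> deq A B w w' \<Longrightarrow> dmor B Y v \<Longrightarrow> deq X Y (u @ w @ v) (u @ w' @ v)"
| deq_ext: "valid (Arr X f Y) \<Longrightarrow> valid (Arr X g Y) \<Longrightarrow> (\<And>i x. x \<in> car (ob X i) \<Longrightarrow> f i x = g i x) \<Longrightarrow>
    deq X Y [Arr X f Y] [Arr X g Y]"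
| deq_ident: "bcplx X \<Longrightarrow> deq X X [Arr X (\<lambda>i. id) X] []"
| deq_comp: "valid (Arr X f Y) \<Longrightarrow> valid (Arr Y g Z) \<Longrightarrow>
    deq X Z [Arr X f Y, Arr Y g Z] [Arr X (\<lambda>i. g i \<circ> f i) Z]"
| deq_inv_right: "valid (Inv X s Y) \<Longrightarrow> deq X X [Arr X s Y, Inv X s Y] []"
| deq_inv_left: "valid (Inv X s Y) \<Longrightarrow> deq Y Y [Inv X s Y, Arr X s Y] []"

definition zero_mor :: "'h::ring_1 cplx \<Rightarrow> 'h cplx \<Rightarrow> 'h letter list" where
  "zero_mor X Y = [Arr X (\<lambda>i x. 0) Y]"

definition hom_vanishes :: "'h::ring_1 cplx \<Rightarrow> 'h cplx \<Rightarrow> bool" where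
  "hom_vanishes X Y \<longleftrightarrow> (\<forall>w. dmor X Y w \<longrightarrow> deq X Y w (zero_mor X Y))"

definition ext1_vanishes :: "'h::ring_1 cplx \<Rightarrow> 'h cplx \<Rightarrow> bool" where
  "ext1_vanishes U V \<longleftrightarrow> hom_vanishes U (shift V)"

definition d_isomorphism :: "'h::ring_1 cplx \<Rightarrow> 'h cplx \<Rightarrow> 'h letter list \<Rightarrow> bool" where
  "d_isomorphism X Y w \<longleftrightarrow> dmor X Y w \<and>
     (\<exists>v. dmor Y X v \<and> deq X X (w @ v) [] \<and> deq Y Y (v @ w) [])"

definition d_iso :: "'h::ring_1 cplx \<Rightarrow> 'h cplx \<Rightarrow> bool" where
  "d_iso X Y \<longleftrightarrow> (\<exists>w. d_isomorphism X Y w)"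

definition indecomposable :: "'h::ring_1 cplx \<Rightarrow> bool" where
  "indecomposable X \<longleftrightarrow> bcplx X \<and> \<not> d_iso X zero_cplx \<and>
     (\<forall>A B. bcplx A \<and> bcplx B \<and> d_iso X (cplx_sum A B) \<longrightarrow> d_iso A zero_cplx \<or> d_iso B zero_cplx)"

fun shift_letter :: "'h::ring_1 letter \<Rightarrow> 'h letter" where
  "shift_letter (Arr X f Y) = Arr (shift X) (\<lambda>i. f (i + 1)) (shift Y)"
| "shift_letter (Inv X s Y) = Inv (shift X) (\<lambda>i. s (i + 1)) (shift Y)"

definition shift_mor :: "'h::ring_1 letter list \<Rightarrow> 'h letter list" where
  "shift_mor w = map shift_letter w"


section \<open>Auslander--Reiten translation\<close>

text \<open>
  Distinguished triangles \<open>X \<rightarrow> Y \<rightarrow> Z \<rightarrow> X[1]\<close>: those isomorphic to the triangle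
  \<open>A \<rightarrow> B \<rightarrow> cone f \<rightarrow> A[1]\<close> of some chain map \<open>f : A \<rightarrow> B\<close>.
\<close>

definition distinguished ::
    "'h::ring_1 cplx \<Rightarrow> 'h cplx \<Rightarrow> 'h cplx \<Rightarrow>
     'h letter list \<Rightarrow> 'h letter list \<Rightarrow> 'h letter list \<Rightarrow> bool" where
  "distinguished X Y Z u v w \<longleftrightarrow>
     dmor X Y u \<and> dmor Y Z v \<and> dmor Z (shift X) w \<and>
     (\<exists>A B f a b c.
        bcplx A \<and> bcplx B \<and> chain_map A B f \<and>
        d_isomorphism X A a \<and> d_isomorphism Y B b \<and> d_isomorphism Z (cone A B f) c \<and>
        deq X B (u @ b) (a @ [Arr A f B]) \<and>
        deq Y (cone A B f) (v @ c) (b @ [Arr B cone_in (cone A B f)]) \<and>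
        deq Z (shift A) (w @ shift_mor a) (c @ [Arr (cone A B f) cone_out (shift A)]))"

definition retraction :: "'h::ring_1 cplx \<Rightarrow> 'h cplx \<Rightarrow> 'h letter list \<Rightarrow> bool" where
  "retraction W Z p \<longleftrightarrow> dmor W Z p \<and> (\<exists>q. dmor Z W q \<and> deq Z Z (q @ p) [])"

text \<open>Auslander--Reiten triangles in the sense of Happel.\<close>

definition ar_triangle ::
    "'h::ring_1 cplx \<Rightarrow> 'h cplx \<Rightarrow> 'h cplx \<Rightarrow>
     'h letter list \<Rightarrow> 'h letter list \<Rightarrow> 'h letter list \<Rightarrow> bool" where
  "ar_triangle X Y Z u v w \<longleftrightarrow>
     bcplx Y \<and> distinguished X Y Z u v w \<and> indecomposable X \<and> indecomposable Z \<and>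
     \<not> deq Z (shift X) w (zero_mor Z (shift X)) \<and>
     (\<forall>W p. bcplx W \<and> dmor W Z p \<and> \<not> retraction W Z p \<longrightarrow>
        (\<exists>q. dmor W Y q \<and> deq W Z (q @ v) p))"

text \<open>\<open>is_tau X Z\<close> says \<open>X \<cong> \<tau> Z\<close>; the starting term of an Auslander--Reiten triangle ending at
  \<open>Z\<close> is determined by \<open>Z\<close> up to isomorphism, and conversely.\<close>

definition is_tau :: "'h::ring_1 cplx \<Rightarrow> 'h cplx \<Rightarrow> bool" where
  "is_tau X Z \<longleftrightarrow> (\<exists>Y u v w. ar_triangle X Y Z u v w)"

definition tau_inv :: "'h::ring_1 cplx \<Rightarrow> 'h cplx" where
  "tau_inv M = (SOME N. is_tau M N)"

definition F_obj :: "'h::ring_1 cplx \<Rightarrow> 'h cplx" where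
  "F_obj M = shift (tau_inv M)"


section \<open>Ext-configurations\<close>

definition mem_iso :: "'h::ring_1 cplx \<Rightarrow> 'h cplx set \<Rightarrow> bool" where
  "mem_iso M T \<longleftrightarrow> (\<exists>X\<in>T. d_iso M X)"

definition ext_configuration :: "'h::ring_1 cplx set \<Rightarrow> bool" where
  "ext_configuration T \<longleftrightarrow>
     (\<forall>X\<in>T. indecomposable X) \<and>
     (\<forall>X\<in>T. \<forall>Y\<in>T. d_iso X Y \<longrightarrow> X = Y) \<and>
     (\<forall>X\<in>T. \<forall>Y\<in>T. ext1_vanishes X Y) \<and>
     (\<forall>Z. indecomposable Z \<and> \<not> mem_iso Z T \<longrightarrow> (\<exists>X\<in>T. \<not> ext1_vanishes X Z))"

end

theory Submission
  imports Defs
begin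

text \<open>
  Over a hereditary algebra every bounded complex has a bounded resolution \<open>P\<close> by finitely generated
  projectives, and morphisms of the derived category out of \<open>P\<close> are homotopy classes of chain maps.
  Applying the Nakayama functor degreewise to \<open>P\<close> gives a complex of injectives whose resolution \<open>R\<close>
  is a Serre partner of \<open>P\<close>: \<open>Hom(P, Q)\<close> is dual to \<open>Hom(Q, R)\<close> for every \<open>Q\<close>. Conversely, every
  complex is such a partner, because over a hereditary algebra it also has a finite injective
  resolution. When \<open>End(P)\<close> is local, a functional on \<open>End(P)\<close> vanishing on the nonunits is
  represented by a morphism \<open>\<omega> : P \<rightarrow> R\<close> whose fibre gives an Auslander--Reiten triangle, so
  \<open>\<tau>\<^sup>-\<^sup>1 M\<close> exists for every indecomposable \<open>M\<close>.

  In an Auslander--Reiten triangle \<open>M \<rightarrow> E \<rightarrow> N \<rightarrow> M[1]\<close>, with \<open>N = \<tau>\<^sup>-\<^sup>1 M\<close>, every nonzero morphism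
  out of \<open>N\<close> or into \<open>M[1]\<close> is a factor of the connecting morphism. Hence \<open>Hom(X, M[1]) \<noteq> 0\<close> iff
  \<open>Hom(N, X) \<noteq> 0\<close> iff \<open>Hom(N[1], X[1]) \<noteq> 0\<close>, that is, \<open>Ext\<^sup>1(X, M) \<noteq> 0\<close> iff \<open>Ext\<^sup>1(FM, X) \<noteq> 0\<close>. If
  \<open>FM\<close> is in the configuration, then the second side vanishes for all its members \<open>X\<close>, so \<open>M\<close> is in
  it by maximality. If \<open>M\<close> is in it but \<open>FM\<close> is not, some member \<open>X\<close> has \<open>Ext\<^sup>1(X, FM) \<noteq> 0\<close>. Let \<open>B\<close>
  be the Serre partner of \<open>X\<close> and \<open>Z = B[-2]\<close>, which is \<open>F\<^sup>-\<^sup>1 X\<close>; by duality and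
  maximality, \<open>Z\<close> is in the configuration, and again by duality \<open>Hom(N[2], B) \<noteq> 0\<close>, so \<open>Hom(N, Z) \<noteq> 0\<close> and
  \<open>Ext\<^sup>1(Z, M) \<noteq> 0\<close>, a contradiction.
\<close>

section \<open>Modules and homomorphisms\<close>

text \<open>The rules that generate \<open>deq\<close> pass through arbitrary complexes, so two
  words are told apart only by an invariant: the action of a word on homotopy classes of chain maps
  out of a complex of projectives (\<open>wact\<close>). It turns every nonvanishing statement into
  one about chain maps.

  \<open>tau_inv\<close> is a bare choice, so nothing is known of it beyond the triangle it sits in.
  It is never compared with a Serre partner: FM is handled only through the factorization property
  of the connecting morphism of its triangle, while Serre partners show that a triangle exists and
  provide the object B[-2]. Duality in turn is recorded by one linear functional on Hom(P, R) for
  which composition is a perfect pairing. No functor on morphisms and no naturality has to be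
  constructed; endomorphisms of P and of R correspond as adjoints for the pairing.

  Complexes of submodules of free modules serve as models because they are finite-dimensional over k
  with scalars acting coordinatewise. Fitting's lemma and duality then become linear algebra on
  actual chain maps.\<close>

lemma hmod_zero: "hmodule M \<Longrightarrow> 0 \<in> car M"
  and hmod_diff: "hmodule M \<Longrightarrow> x \<in> car M \<Longrightarrow> y \<in> car M \<Longrightarrow> x - y \<in> car M"
  and hmod_act: "hmodule M \<Longrightarrow> x \<in> car M \<Longrightarrow> act M a x \<in> car M"
  and act_add: "hmodule M \<Longrightarrow> x \<in> car M \<Longrightarrow> y \<in> car M \<Longrightarrow> act M a (x + y) = act M a x + act M a y"
  and add_act: "hmodule M \<Longrightarrow> x \<in> car M \<Longrightarrow> act M (a + b) x = act M a x + act M b x"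
  and mult_act: "hmodule M \<Longrightarrow> x \<in> car M \<Longrightarrow> act M (a * b) x = act M a (act M b x)"
  and one_act: "hmodule M \<Longrightarrow> x \<in> car M \<Longrightarrow> act M 1 x = x"
  unfolding hmodule_def by blast+

lemma hmod_uminus: "hmodule M \<Longrightarrow> x \<in> car M \<Longrightarrow> - x \<in> car M"
  using hmod_diff[of M 0 x] hmod_zero[of M] by simp

lemma hmod_add: "hmodule M \<Longrightarrow> x \<in> car M \<Longrightarrow> y \<in> car M \<Longrightarrow> x + y \<in> car M"
  using hmod_diff[of M x "- y"] hmod_uminus[of M y] by simp

lemma hmod_sum: "hmodule M \<Longrightarrow> (\<And>i. i \<in> I \<Longrightarrow> f i \<in> car M) \<Longrightarrow> sum f I \<in> car M"
  by (induction I rule: infinite_finite_induct) (auto simp: hmod_zero hmod_add)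

lemma act_zero: "hmodule M \<Longrightarrow> act M a 0 = 0"
  using act_add[of M 0 0 a] hmod_zero[of M] by simp

lemma zero_act: "hmodule M \<Longrightarrow> x \<in> car M \<Longrightarrow> act M 0 x = 0"
  using add_act[of M x 0 0] by simp

lemma act_uminus: "hmodule M \<Longrightarrow> x \<in> car M \<Longrightarrow> act M a (- x) = - act M a x"
  using act_add[of M x "- x" a] hmod_uminus[of M x] act_zero[of M a]
  by (simp add: minus_unique)

lemma act_sum: "hmodule M \<Longrightarrow> (\<And>i. i \<in> I \<Longrightarrow> f i \<in> car M) \<Longrightarrow> act M a (sum f I) = (\<Sum>i\<in>I. act M a (f i))"
  by (induction I rule: infinite_finite_induct) (auto simp: act_zero act_add hmod_sum)

lemma sum_act: "hmodule M \<Longrightarrow> x \<in> car M \<Longrightarrow> act M (sum f I) x = (\<Sum>i\<in>I. act M (f i) x)"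
  by (induction I rule: infinite_finite_induct) (auto simp: zero_act add_act)

lemma hom_car: "mod_hom M N f \<Longrightarrow> x \<in> car M \<Longrightarrow> f x \<in> car N"
  and hom_add: "mod_hom M N f \<Longrightarrow> x \<in> car M \<Longrightarrow> y \<in> car M \<Longrightarrow> f (x + y) = f x + f y"
  and hom_act: "mod_hom M N f \<Longrightarrow> x \<in> car M \<Longrightarrow> f (act M a x) = act N a (f x)"
  unfolding mod_hom_def by blast+

lemma hom_zero: "hmodule M \<Longrightarrow> mod_hom M N f \<Longrightarrow> f 0 = 0"
  using hom_add[of M N f 0 0] hmod_zero[of M] by simp

lemma hom_uminus: "hmodule M \<Longrightarrow> mod_hom M N f \<Longrightarrow> x \<in> car M \<Longrightarrow> f (- x) = - f x"
  using hom_add[of M N f x "- x"] hmod_uminus[of M x] hom_zero[of M N f]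
  by (simp add: minus_unique)

lemma hom_diff: "hmodule M \<Longrightarrow> mod_hom M N f \<Longrightarrow> x \<in> car M \<Longrightarrow> y \<in> car M \<Longrightarrow> f (x - y) = f x - f y"
  using hom_add[of M N f x "- y"] hmod_uminus[of M y] hom_uminus[of M N f y] by simp

lemma hom_sum: "hmodule M \<Longrightarrow> mod_hom M N f \<Longrightarrow> (\<And>i. i \<in> I \<Longrightarrow> g i \<in> car M) \<Longrightarrow> f (sum g I) = (\<Sum>i\<in>I. f (g i))"
  by (induction I rule: infinite_finite_induct) (auto simp: hom_zero hom_add hmod_sum)

lemma mod_hom_comp: "mod_hom M N f \<Longrightarrow> mod_hom N L g \<Longrightarrow> mod_hom M L (\<lambda>x. g (f x))"
  unfolding mod_hom_def by auto

lemma mod_hom_id: "mod_hom M M (\<lambda>x. x)"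
  unfolding mod_hom_def by auto

lemma mod_hom_zero: "hmodule N \<Longrightarrow> mod_hom M N (\<lambda>x. 0)"
  unfolding mod_hom_def by (auto simp: hmod_zero act_zero)

lemma mod_hom_add: "hmodule N \<Longrightarrow> mod_hom M N f \<Longrightarrow> mod_hom M N g \<Longrightarrow> mod_hom M N (\<lambda>x. f x + g x)"
  unfolding mod_hom_def by (auto simp: hmod_add act_add algebra_simps)

lemma mod_hom_uminus: "hmodule N \<Longrightarrow> mod_hom M N f \<Longrightarrow> mod_hom M N (\<lambda>x. - f x)"
  unfolding mod_hom_def by (auto simp: hmod_uminus act_uminus algebra_simps)

lemma mod_hom_diff: "hmodule N \<Longrightarrow> mod_hom M N f \<Longrightarrow> mod_hom M N g \<Longrightarrow> mod_hom M N (\<lambda>x. f x - g x)"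
  using mod_hom_add[of N M f "\<lambda>x. - g x"] mod_hom_uminus[of N M g] by simp

lemma mod_hom_cong: "hmodule M \<Longrightarrow> mod_hom M N f \<Longrightarrow> (\<And>x. x \<in> car M \<Longrightarrow> f x = g x) \<Longrightarrow> mod_hom M N g"
  unfolding mod_hom_def by (simp add: hmod_add hmod_act)

text \<open>\<open>fin_gen\<close> speaks of a set of generators. For an indexed family the
  coefficients of generators that coincide are added up.\<close>

lemma fin_genI:
  assumes M: "hmodule M" and I: "finite I" and s: "\<And>i. i \<in> I \<Longrightarrow> s i \<in> car M"
    and gen: "\<And>x. x \<in> car M \<Longrightarrow> \<exists>r. x = (\<Sum>i\<in>I. act M (r i) (s i))"
  shows "fin_gen M"
  unfolding fin_gen_def
proof (intro exI[of _ "s ` I"] conjI ballI)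
  show "finite (s ` I)" "s ` I \<subseteq> car M" using I s by auto
  fix x assume "x \<in> car M"
  then obtain r where x: "x = (\<Sum>i\<in>I. act M (r i) (s i))" using gen by blast
  have "x = (\<Sum>y\<in>s ` I. \<Sum>i\<in>{i\<in>I. s i = y}. act M (r i) (s i))"
    unfolding x using sum.image_gen[OF I] by blast
  also have "\<dots> = (\<Sum>y\<in>s ` I. act M (\<Sum>i\<in>{i\<in>I. s i = y}. r i) y)"
    by (rule sum.cong) (auto simp: sum_act M s)
  finally show "\<exists>r. x = (\<Sum>y\<in>s ` I. act M (r y) y)"
    by (intro exI[of _ "\<lambda>y. \<Sum>i\<in>{i\<in>I. s i = y}. r i"])
qed

lemma fin_genE:
  assumes "fin_gen M"
  obtains n s where "\<And>j. j < (n::nat) \<Longrightarrow> s j \<in> car M"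
    "\<And>x. x \<in> car M \<Longrightarrow> \<exists>r. x = (\<Sum>j<n. act M (r j) (s j))"
proof -
  obtain S where S: "finite S" "S \<subseteq> car M" "\<And>x. x \<in> car M \<Longrightarrow> \<exists>r. x = (\<Sum>s\<in>S. act M (r s) s)"
    using assms unfolding fin_gen_def by blast
  obtain s where s: "bij_betw s {..<card S} S"
    using ex_bij_betw_nat_finite[OF S(1)] by (auto simp: atLeast0LessThan)
  show thesis
  proof (rule that[of "card S" s])
    fix j assume "j < card S" then show "s j \<in> car M" using s S(2) by (auto simp: bij_betw_def)
  next
    fix x assume "x \<in> car M"
    then obtain r where "x = (\<Sum>s\<in>S. act M (r s) s)" using S(3) by blast
    also have "\<dots> = (\<Sum>j<card S. act M (r (s j)) (s j))"
      using sum.reindex_bij_betw[OF s, of "\<lambda>y. act M (r y) y"] by simp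
    finally show "\<exists>r. x = (\<Sum>j<card S. act M (r j) (s j))" by (intro exI[of _ "\<lambda>j. r (s j)"])
  qed
qed

section \<open>Direct sums of modules by interleaving sequences\<close>

lemma lft_pr [simp]: "lft (pr x y) = x" and rgt_pr [simp]: "rgt (pr x y) = y"
  by (auto simp: lft_def rgt_def pr_def)

lemma pr_lft_rgt [simp]: "pr (lft z) (rgt z) = z"
proof
  fix n :: nat
  show "pr (lft z) (rgt z) n = z n"
    by (cases "even n") (auto simp: pr_def lft_def rgt_def elim: oddE)
qed

lemma pr_eq_iff [simp]: "pr x y = pr x' y' \<longleftrightarrow> x = x' \<and> y = y'"
  by (metis lft_pr rgt_pr)

lemma eq_pr_iff: "z = pr x y \<longleftrightarrow> lft z = x \<and> rgt z = y"
  by (metis lft_pr rgt_pr pr_lft_rgt)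

lemma elt_eqI: "lft z = lft z' \<Longrightarrow> rgt z = rgt z' \<Longrightarrow> z = z'"
  by (metis pr_lft_rgt)

lemma lft_add [simp]: "lft (x + y) = lft x + lft y" and rgt_add [simp]: "rgt (x + y) = rgt x + rgt y"
  and lft_diff [simp]: "lft (x - y) = lft x - lft y" and rgt_diff [simp]: "rgt (x - y) = rgt x - rgt y"
  and lft_minus [simp]: "lft (- x) = - lft x" and rgt_minus [simp]: "rgt (- x) = - rgt x"
  and lft_0 [simp]: "lft 0 = 0" and rgt_0 [simp]: "rgt 0 = 0"
  for x y :: "'h::ring_1 elt"
  by (auto simp: lft_def rgt_def fun_eq_iff)

lemma pr_add: "pr x y + pr x' y' = pr (x + x') (y + y')" for x y :: "'h::ring_1 elt"
  and x' y' :: "'h::ring_1 elt" by (simp add: eq_pr_iff)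

lemma pr_minus: "- pr x y = pr (- x) (- y)" for x y :: "'h::ring_1 elt"
  by (simp add: eq_pr_iff)

lemma pr_zero [simp]: "pr 0 0 = (0 :: 'h::ring_1 elt)"
  by (metis lft_0 rgt_0 pr_lft_rgt)

lemma pr_eq_zero_iff [simp]: "pr x y = 0 \<longleftrightarrow> x = 0 \<and> y = 0" for x :: "'h::ring_1 elt"
  by (metis lft_pr rgt_pr pr_zero)

text \<open>Elements of modules are functions themselves. Evaluating their sums pointwise would
  destroy the module-level algebra, so these rules are invoked only where coordinates
  matter.\<close>

declare plus_fun_apply [simp del] zero_fun_apply [simp del] minus_apply [simp del] uminus_apply [simp del]

lemma car_mod_sum [simp]: "z \<in> car (mod_sum M N) \<longleftrightarrow> lft z \<in> car M \<and> rgt z \<in> car N"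
proof -
  have "z \<in> car (mod_sum M N)" if "lft z \<in> car M" "rgt z \<in> car N"
    using that unfolding mod_sum_def by (auto intro: exI[of _ "lft z"] exI[of _ "rgt z"] simp: eq_pr_iff)
  then show ?thesis unfolding mod_sum_def by auto
qed

lemma act_mod_sum [simp]: "act (mod_sum M N) a z = pr (act M a (lft z)) (act N a (rgt z))"
  by (simp add: mod_sum_def)

lemma hmodule_mod_sum: "hmodule M \<Longrightarrow> hmodule N \<Longrightarrow> hmodule (mod_sum M N)"
  unfolding hmodule_def[of "mod_sum M N"]
  by (auto simp: hmod_zero hmod_diff hmod_act act_add add_act mult_act one_act pr_add)

lemma mod_hom_pr_iff: "mod_hom L (mod_sum M N) f \<longleftrightarrow> mod_hom L M (\<lambda>x. lft (f x)) \<and> mod_hom L N (\<lambda>x. rgt (f x))"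
proof
  assume f: "mod_hom L (mod_sum M N) f"
  show "mod_hom L M (\<lambda>x. lft (f x)) \<and> mod_hom L N (\<lambda>x. rgt (f x))"
    using hom_car[OF f] hom_add[OF f] hom_act[OF f] unfolding mod_hom_def by simp
next
  assume f: "mod_hom L M (\<lambda>x. lft (f x)) \<and> mod_hom L N (\<lambda>x. rgt (f x))"
  note l = hom_car[OF conjunct1[OF f]] hom_add[OF conjunct1[OF f]] hom_act[OF conjunct1[OF f]]
  note r = hom_car[OF conjunct2[OF f]] hom_add[OF conjunct2[OF f]] hom_act[OF conjunct2[OF f]]
  have "f (x + y) = f x + f y" if "x \<in> car L" "y \<in> car L" for x y
    by (rule elt_eqI) (use that in \<open>simp_all add: l r\<close>)
  then show "mod_hom L (mod_sum M N) f"
    unfolding mod_hom_def by (simp add: l r eq_pr_iff)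
qed

lemma mod_hom_lft: "mod_hom M L f \<Longrightarrow> mod_hom (mod_sum M N) L (\<lambda>z. f (lft z))"
  unfolding mod_hom_def by auto

lemma mod_hom_rgt: "mod_hom N L f \<Longrightarrow> mod_hom (mod_sum M N) L (\<lambda>z. f (rgt z))"
  unfolding mod_hom_def by auto

lemma sum_pr: "(\<Sum>i\<in>I. pr (f i) (g i)) = pr (sum f I) (sum g I)" for f :: "'i \<Rightarrow> 'h::ring_1 elt"
  by (induction I rule: infinite_finite_induct) (simp_all add: pr_add)

lemma fin_gen_mod_sum:
  assumes M: "hmodule M" "fin_gen M" and N: "hmodule N" "fin_gen N"
  shows "fin_gen (mod_sum M N)"
proof -
  obtain m s where s: "\<And>j. j < (m::nat) \<Longrightarrow> s j \<in> car M"
    "\<And>x. x \<in> car M \<Longrightarrow> \<exists>r. x = (\<Sum>j<m. act M (r j) (s j))" using fin_genE[OF M(2)] by metis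
  obtain n t where t: "\<And>j. j < (n::nat) \<Longrightarrow> t j \<in> car N"
    "\<And>x. x \<in> car N \<Longrightarrow> \<exists>r. x = (\<Sum>j<n. act N (r j) (t j))" using fin_genE[OF N(2)] by metis
  let ?u = "case_sum (\<lambda>j. pr (s j) 0) (\<lambda>j. pr 0 (t j))"
  show ?thesis
  proof (rule fin_genI[where I = "{..<m} <+> {..<n}" and s = ?u])
    show "hmodule (mod_sum M N)" using M N by (simp add: hmodule_mod_sum)
    show "?u i \<in> car (mod_sum M N)" if "i \<in> {..<m} <+> {..<n}" for i
      using that s(1) t(1) M N by (auto simp: hmod_zero)
    fix z assume "z \<in> car (mod_sum M N)"
    then obtain r q where "lft z = (\<Sum>j<m. act M (r j) (s j))" "rgt z = (\<Sum>j<n. act N (q j) (t j))"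
      using s(2) t(2) by (metis car_mod_sum)
    then have "z = (\<Sum>i\<in>{..<m} <+> {..<n}. act (mod_sum M N) (case_sum r q i) (?u i))"
      by (simp add: sum.Plus sum_pr act_zero M N pr_add eq_pr_iff)
    then show "\<exists>r. z = (\<Sum>i\<in>{..<m} <+> {..<n}. act (mod_sum M N) (r i) (?u i))" by blast
  qed auto
qed

section \<open>Complexes\<close>

lemma bcplx_hmod: "bcplx X \<Longrightarrow> hmodule (ob X i)"
  and bcplx_fg: "bcplx X \<Longrightarrow> fin_gen (ob X i)"
  and bcplx_dif: "bcplx X \<Longrightarrow> mod_hom (ob X i) (ob X (i + 1)) (dif X i)"
  and bcplx_dd: "bcplx X \<Longrightarrow> x \<in> car (ob X i) \<Longrightarrow> dif X (i + 1) (dif X i x) = 0"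
  and bcplx_fin: "bcplx X \<Longrightarrow> finite {i. car (ob X i) \<noteq> {0}}"
  unfolding bcplx_def by blast+

lemma bcplx_dif_car: "bcplx X \<Longrightarrow> x \<in> car (ob X i) \<Longrightarrow> dif X i x \<in> car (ob X (i + 1))"
  using bcplx_dif hom_car by blast

lemma bcplx_dif': "bcplx X \<Longrightarrow> mod_hom (ob X (i - 1)) (ob X i) (dif X (i - 1))"
  using bcplx_dif[of X "i - 1"] by simp

lemma bcplx_dif_car': "bcplx X \<Longrightarrow> x \<in> car (ob X (i - 1)) \<Longrightarrow> dif X (i - 1) x \<in> car (ob X i)"
  using bcplx_dif_car[of X x "i - 1"] by simp

lemma bcplx_dd': "bcplx X \<Longrightarrow> x \<in> car (ob X (i - 1)) \<Longrightarrow> dif X i (dif X (i - 1) x) = 0"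
  using bcplx_dd[of X x "i - 1"] by simp

lemma chain_hom: "chain_map X Y f \<Longrightarrow> mod_hom (ob X i) (ob Y i) (f i)"
  and chain_dif: "chain_map X Y f \<Longrightarrow> x \<in> car (ob X i) \<Longrightarrow> f (i + 1) (dif X i x) = dif Y i (f i x)"
  unfolding chain_map_def by blast+

lemma chain_car: "chain_map X Y f \<Longrightarrow> x \<in> car (ob X i) \<Longrightarrow> f i x \<in> car (ob Y i)"
  using chain_hom hom_car by blast

lemma chain_dif': "chain_map X Y f \<Longrightarrow> x \<in> car (ob X (i - 1)) \<Longrightarrow> f i (dif X (i - 1) x) = dif Y (i - 1) (f (i - 1) x)"
  using chain_dif[of X Y f x "i - 1"] by simp

lemma chain_map_id: "chain_map X X (\<lambda>i x. x)"
  unfolding chain_map_def by (auto intro: mod_hom_id)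

lemma chain_map_comp:
  assumes f: "chain_map X Y f" and g: "chain_map Y Z g"
  shows "chain_map X Z (\<lambda>i x. g i (f i x))"
  unfolding chain_map_def
  by (simp add: mod_hom_comp[OF chain_hom[OF f] chain_hom[OF g]] chain_dif[OF f] chain_dif[OF g] chain_car[OF f])

lemma chain_map_zero: "bcplx X \<Longrightarrow> bcplx Y \<Longrightarrow> chain_map X Y (\<lambda>i x. 0)"
  unfolding chain_map_def by (simp add: mod_hom_zero bcplx_hmod hom_zero[OF bcplx_hmod bcplx_dif])

lemma chain_map_add:
  assumes Y: "bcplx Y" and f: "chain_map X Y f" and g: "chain_map X Y g"
  shows "chain_map X Y (\<lambda>i x. f i x + g i x)"
  unfolding chain_map_def
  by (simp add: mod_hom_add bcplx_hmod Y chain_hom[OF f] chain_hom[OF g] chain_dif[OF f] chain_dif[OF g]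
      chain_car[OF f] chain_car[OF g] hom_add[OF bcplx_dif[OF Y]])

lemma chain_map_uminus:
  assumes Y: "bcplx Y" and f: "chain_map X Y f"
  shows "chain_map X Y (\<lambda>i x. - f i x)"
  unfolding chain_map_def
  by (simp add: mod_hom_uminus bcplx_hmod Y chain_hom[OF f] chain_dif[OF f]
      chain_car[OF f] hom_uminus[OF bcplx_hmod bcplx_dif, OF Y Y])

lemma chain_map_diff: "bcplx Y \<Longrightarrow> chain_map X Y f \<Longrightarrow> chain_map X Y g \<Longrightarrow> chain_map X Y (\<lambda>i x. f i x - g i x)"
  using chain_map_add[of Y X f "\<lambda>i x. - g i x"] chain_map_uminus[of Y X g] by simp

lemma chain_map_cong:
  assumes "bcplx X" "chain_map X Y f" "\<And>i x. x \<in> car (ob X i) \<Longrightarrow> f i x = g i x"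
  shows "chain_map X Y g"
  using assms unfolding chain_map_def
  by (metis (full_types) mod_hom_cong bcplx_hmod bcplx_dif_car)

text \<open>The two signs cancel, so this is an inverse of \<open>shift\<close> on the nose, and
  passing between X and X[1] never costs an isomorphism.\<close>

definition unshift :: "'h::ring_1 cplx \<Rightarrow> 'h cplx" where
  "unshift X = \<lparr>ob = (\<lambda>i. ob X (i - 1)), dif = (\<lambda>i x. - dif X (i - 1) x)\<rparr>"

lemma shift_unshift [simp]: "shift (unshift X) = X" and unshift_shift [simp]: "unshift (shift X) = X"
  by (auto simp: shift_def unshift_def)

lemma ob_shift [simp]: "ob (shift X) i = ob X (i + 1)"
  and dif_shift [simp]: "dif (shift X) i x = - dif X (i + 1) x"
  and ob_unshift [simp]: "ob (unshift X) i = ob X (i - 1)"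
  and dif_unshift [simp]: "dif (unshift X) i x = - dif X (i - 1) x"
  by (auto simp: shift_def unshift_def)

lemma bcplx_shift: assumes X: "bcplx X" shows "bcplx (shift X)"
proof -
  have fin: "finite {i. car (ob (shift X) i) \<noteq> {0}}"
    using finite_vimageI[OF bcplx_fin[OF X], of "\<lambda>i. i + 1"] by (simp add: vimage_def inj_def)
  have "mod_hom (ob X (i + 1)) (ob X (i + 1 + 1)) (\<lambda>x. - dif X (i + 1) x)" for i
    by (rule mod_hom_uminus[OF bcplx_hmod[OF X] bcplx_dif[OF X]])
  then have hom: "mod_hom (ob (shift X) i) (ob (shift X) (i + 1)) (dif (shift X) i)" for i
    by (simp only: ob_shift shift_def cplx.simps)
  have "- dif X (i + 1 + 1) (- dif X (i + 1) x) = 0" if "x \<in> car (ob X (i + 1))" for i x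
    by (simp only: hom_uminus[OF bcplx_hmod[OF X] bcplx_dif[OF X] bcplx_dif_car[OF X that]]
        bcplx_dd[OF X that] minus_zero)
  then have dd: "dif (shift X) (i + 1) (dif (shift X) i x) = 0" if "x \<in> car (ob (shift X) i)" for i x
    using that by (simp only: ob_shift dif_shift)
  show ?thesis unfolding bcplx_def using fin hom dd bcplx_hmod[OF X] bcplx_fg[OF X] by simp
qed

lemma bcplx_unshift: assumes X: "bcplx X" shows "bcplx (unshift X)"
proof -
  have fin: "finite {i. car (ob (unshift X) i) \<noteq> {0}}"
    using finite_vimageI[OF bcplx_fin[OF X], of "\<lambda>i. i - 1"] by (simp add: vimage_def inj_def)
  have hom: "mod_hom (ob (unshift X) i) (ob (unshift X) (i + 1)) (dif (unshift X) i)" for i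
    using mod_hom_uminus[OF bcplx_hmod[OF X] bcplx_dif'[OF X], of i] by (simp add: unshift_def)
  have dd: "dif (unshift X) (i + 1) (dif (unshift X) i x) = 0" if "x \<in> car (ob (unshift X) i)" for i x
    using that hom_uminus[OF bcplx_hmod[OF X] bcplx_dif[OF X] bcplx_dif_car'[OF X], of x i]
    by (simp add: bcplx_dd'[OF X])
  show ?thesis unfolding bcplx_def using fin hom dd bcplx_hmod[OF X] bcplx_fg[OF X] by simp
qed

lemma ob_cone [simp]: "ob (cone X Y f) i = mod_sum (ob X (i + 1)) (ob Y i)"
  and dif_cone [simp]: "dif (cone X Y f) i z = pr (- dif X (i + 1) (lft z)) (f (i + 1) (lft z) + dif Y i (rgt z))"
  by (auto simp: cone_def)

lemma ob_cplx_sum [simp]: "ob (cplx_sum X Y) i = mod_sum (ob X i) (ob Y i)"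
  and dif_cplx_sum [simp]: "dif (cplx_sum X Y) i z = pr (dif X i (lft z)) (dif Y i (rgt z))"
  by (auto simp: cplx_sum_def)

lemma mod_sum_trivial:
  assumes "car M = {0}" "car N = {0}"
  shows "car (mod_sum M N) = {0 :: 'h::ring_1 elt}"
proof -
  have "lft z = 0 \<and> rgt z = 0 \<longleftrightarrow> z = 0" for z :: "'h elt"
    using elt_eqI[of z 0] by auto
  then have "z \<in> car (mod_sum M N) \<longleftrightarrow> z = 0" for z using assms by simp
  then show ?thesis by blast
qed

lemma finite_support_mod_sum:
  assumes "finite {i::int. car (M i) \<noteq> {0 :: 'h::ring_1 elt}}" "finite {i. car (N i) \<noteq> {0}}"
  shows "finite {i. car (mod_sum (M i) (N i)) \<noteq> {0}}"
proof (rule finite_subset[OF _ finite_UnI[OF assms]])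
  show "{i. car (mod_sum (M i) (N i)) \<noteq> {0}} \<subseteq> {i. car (M i) \<noteq> {0}} \<union> {i. car (N i) \<noteq> {0}}"
    using mod_sum_trivial by blast
qed

lemma bcplx_cone:
  assumes X: "bcplx X" and Y: "bcplx Y" and f: "chain_map X Y f"
  shows "bcplx (cone X Y f)"
  unfolding bcplx_def
proof (intro conjI allI ballI)
  fix i
  show "hmodule (ob (cone X Y f) i)" "fin_gen (ob (cone X Y f) i)"
    using X Y by (auto intro!: hmodule_mod_sum fin_gen_mod_sum bcplx_hmod bcplx_fg)
  show "mod_hom (ob (cone X Y f) i) (ob (cone X Y f) (i + 1)) (dif (cone X Y f) i)"
    unfolding ob_cone mod_hom_pr_iff dif_cone lft_pr rgt_pr
    by (intro conjI mod_hom_add bcplx_hmod[OF Y] mod_hom_lft[OF chain_hom[OF f]] mod_hom_rgt[OF bcplx_dif[OF Y]]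
        mod_hom_lft[OF mod_hom_uminus[OF bcplx_hmod[OF X] bcplx_dif[OF X]]])
  fix z assume "z \<in> car (ob (cone X Y f) i)"
  then have z: "lft z \<in> car (ob X (i + 1))" "rgt z \<in> car (ob Y i)" by auto
  then show "dif (cone X Y f) (i + 1) (dif (cone X Y f) i z) = 0"
    using hom_uminus[OF bcplx_hmod[OF X] bcplx_dif[OF X] bcplx_dif_car[OF X z(1)]]
      hom_uminus[OF bcplx_hmod[OF X] chain_hom[OF f] bcplx_dif_car[OF X z(1)]]
      chain_dif[OF f z(1)] hom_add[OF bcplx_dif[OF Y] chain_car[OF f z(1)] bcplx_dif_car[OF Y z(2)]]
      bcplx_dd[OF X z(1)] bcplx_dd[OF Y z(2)]
    by simp
next
  have "finite {i. car (ob (shift X) i) \<noteq> {0}}" by (rule bcplx_fin[OF bcplx_shift[OF X]])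
  then show "finite {i. car (ob (cone X Y f) i) \<noteq> {0}}"
    using finite_support_mod_sum[of "ob (shift X)" "ob Y"] bcplx_fin[OF Y] by simp
qed

lemma bcplx_cplx_sum:
  assumes X: "bcplx X" and Y: "bcplx Y"
  shows "bcplx (cplx_sum X Y)"
proof -
  have "mod_hom (ob (cplx_sum X Y) i) (ob (cplx_sum X Y) (i + 1)) (dif (cplx_sum X Y) i)" for i
    unfolding ob_cplx_sum mod_hom_pr_iff dif_cplx_sum lft_pr rgt_pr
    by (intro conjI mod_hom_lft mod_hom_rgt bcplx_dif X Y)
  then show ?thesis
    unfolding bcplx_def
    using finite_support_mod_sum[OF bcplx_fin[OF X] bcplx_fin[OF Y]]
    by (simp add: hmodule_mod_sum fin_gen_mod_sum bcplx_hmod bcplx_fg X Y bcplx_dd)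
qed

lemma bcplx_zero: "bcplx zero_cplx"
  unfolding bcplx_def zero_cplx_def by (auto simp: hmodule_def mod_hom_def fin_gen_def)

section \<open>Homotopies\<close>

definition null_htpy :: "'h::ring_1 cplx \<Rightarrow> 'h cplx \<Rightarrow> 'h cmap \<Rightarrow> bool" where
  "null_htpy X Y f \<longleftrightarrow> (\<exists>h. \<forall>i. mod_hom (ob X i) (ob Y (i - 1)) (h i) \<and>
     (\<forall>x\<in>car (ob X i). f i x = dif Y (i - 1) (h i x) + h (i + 1) (dif X i x)))"

definition htpc :: "'h::ring_1 cplx \<Rightarrow> 'h cplx \<Rightarrow> 'h cmap \<Rightarrow> 'h cmap \<Rightarrow> bool" where
  "htpc X Y f g \<longleftrightarrow> null_htpy X Y (\<lambda>i x. f i x - g i x)"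

lemma null_htpyI:
  assumes "\<And>i. mod_hom (ob X i) (ob Y (i - 1)) (h i)"
    and "\<And>i x. x \<in> car (ob X i) \<Longrightarrow> f i x = dif Y (i - 1) (h i x) + h (i + 1) (dif X i x)"
  shows "null_htpy X Y f"
  unfolding null_htpy_def using assms by blast

lemma null_htpyE:
  assumes "null_htpy X Y f"
  obtains h where "\<And>i. mod_hom (ob X i) (ob Y (i - 1)) (h i)"
    "\<And>i x. x \<in> car (ob X i) \<Longrightarrow> f i x = dif Y (i - 1) (h i x) + h (i + 1) (dif X i x)"
  using assms unfolding null_htpy_def by blast

lemma null_cong:
  "null_htpy X Y f \<Longrightarrow> (\<And>i x. x \<in> car (ob X i) \<Longrightarrow> f i x = g i x) \<Longrightarrow> null_htpy X Y g"
  unfolding null_htpy_def by metis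

lemma null_zero: "bcplx Y \<Longrightarrow> null_htpy X Y (\<lambda>i x. 0)"
  by (rule null_htpyI[where h = "\<lambda>i x. 0"])
    (simp_all add: mod_hom_zero bcplx_hmod hom_zero[OF bcplx_hmod bcplx_dif])

lemma null_add:
  assumes Y: "bcplx Y" and f: "null_htpy X Y f" and g: "null_htpy X Y g"
  shows "null_htpy X Y (\<lambda>i x. f i x + g i x)"
proof -
  obtain h where h: "\<And>i. mod_hom (ob X i) (ob Y (i - 1)) (h i)"
    "\<And>i x. x \<in> car (ob X i) \<Longrightarrow> f i x = dif Y (i - 1) (h i x) + h (i + 1) (dif X i x)"
    using f by (rule null_htpyE) blast
  obtain k where k: "\<And>i. mod_hom (ob X i) (ob Y (i - 1)) (k i)"
    "\<And>i x. x \<in> car (ob X i) \<Longrightarrow> g i x = dif Y (i - 1) (k i x) + k (i + 1) (dif X i x)"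
    using g by (rule null_htpyE) blast
  show ?thesis
  proof (rule null_htpyI[where h = "\<lambda>i x. h i x + k i x"])
    show "mod_hom (ob X i) (ob Y (i - 1)) (\<lambda>x. h i x + k i x)" for i
      by (rule mod_hom_add[OF bcplx_hmod[OF Y] h(1) k(1)])
    show "f i x + g i x = dif Y (i - 1) (h i x + k i x) + (h (i + 1) (dif X i x) + k (i + 1) (dif X i x))"
      if "x \<in> car (ob X i)" for i x
      using hom_add[OF bcplx_dif[OF Y] hom_car[OF h(1) that] hom_car[OF k(1) that]]
      by (simp add: h(2)[OF that] k(2)[OF that] algebra_simps)
  qed
qed

lemma null_uminus:
  assumes Y: "bcplx Y" and f: "null_htpy X Y f"
  shows "null_htpy X Y (\<lambda>i x. - f i x)"
proof -
  obtain h where h: "\<And>i. mod_hom (ob X i) (ob Y (i - 1)) (h i)"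
    "\<And>i x. x \<in> car (ob X i) \<Longrightarrow> f i x = dif Y (i - 1) (h i x) + h (i + 1) (dif X i x)"
    using f by (rule null_htpyE) blast
  show ?thesis
  proof (rule null_htpyI[where h = "\<lambda>i x. - h i x"])
    show "mod_hom (ob X i) (ob Y (i - 1)) (\<lambda>x. - h i x)" for i
      by (rule mod_hom_uminus[OF bcplx_hmod[OF Y] h(1)])
    show "- f i x = dif Y (i - 1) (- h i x) + - h (i + 1) (dif X i x)"
      if "x \<in> car (ob X i)" for i x
      using hom_uminus[OF bcplx_hmod[OF Y] bcplx_dif[OF Y] hom_car[OF h(1) that]]
      by (simp add: h(2)[OF that] algebra_simps)
  qed
qed

lemma null_left:
  assumes g: "chain_map Y Z g" and f: "null_htpy X Y f" and X: "bcplx X" and Y: "bcplx Y"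
  shows "null_htpy X Z (\<lambda>i x. g i (f i x))"
proof -
  obtain h where h: "\<And>i. mod_hom (ob X i) (ob Y (i - 1)) (h i)"
    "\<And>i x. x \<in> car (ob X i) \<Longrightarrow> f i x = dif Y (i - 1) (h i x) + h (i + 1) (dif X i x)"
    using f by (rule null_htpyE) blast
  show ?thesis
  proof (rule null_htpyI[where h = "\<lambda>i x. g (i - 1) (h i x)"])
    show "mod_hom (ob X i) (ob Z (i - 1)) (\<lambda>x. g (i - 1) (h i x))" for i
      by (rule mod_hom_comp[OF h(1) chain_hom[OF g]])
    fix i x assume x: "x \<in> car (ob X i)"
    have "h (i + 1) (dif X i x) \<in> car (ob Y i)"
      using hom_car[OF h(1) bcplx_dif_car[OF X x]] by simp
    then show "g i (f i x) = dif Z (i - 1) (g (i - 1) (h i x)) + g (i + 1 - 1) (h (i + 1) (dif X i x))"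
      using hom_add[OF chain_hom[OF g] bcplx_dif_car'[OF Y hom_car[OF h(1) x]]]
        chain_dif'[OF g hom_car[OF h(1) x]] by (simp add: h(2)[OF x])
  qed
qed

lemma null_right:
  assumes g: "chain_map W X g" and f: "null_htpy X Y f"
  shows "null_htpy W Y (\<lambda>i x. f i (g i x))"
proof -
  obtain h where h: "\<And>i. mod_hom (ob X i) (ob Y (i - 1)) (h i)"
    "\<And>i x. x \<in> car (ob X i) \<Longrightarrow> f i x = dif Y (i - 1) (h i x) + h (i + 1) (dif X i x)"
    using f by (rule null_htpyE) blast
  show ?thesis
  proof (rule null_htpyI[where h = "\<lambda>i x. h i (g i x)"])
    show "mod_hom (ob W i) (ob Y (i - 1)) (\<lambda>x. h i (g i x))" for i
      by (rule mod_hom_comp[OF chain_hom[OF g] h(1)])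
    show "f i (g i x) = dif Y (i - 1) (h i (g i x)) + h (i + 1) (g (i + 1) (dif W i x))"
      if "x \<in> car (ob W i)" for i x
      using that by (simp add: h(2) chain_car[OF g] chain_dif[OF g])
  qed
qed

lemma htpc_refl: "bcplx Y \<Longrightarrow> htpc X Y f f"
  by (simp add: htpc_def null_zero)

lemma htpc_sym: "bcplx Y \<Longrightarrow> htpc X Y f g \<Longrightarrow> htpc X Y g f"
  unfolding htpc_def using null_uminus[of Y X "\<lambda>i x. f i x - g i x"] by simp

lemma htpc_trans: "bcplx Y \<Longrightarrow> htpc X Y f g \<Longrightarrow> htpc X Y g k \<Longrightarrow> htpc X Y f k"
  unfolding htpc_def using null_add[of Y X "\<lambda>i x. f i x - g i x" "\<lambda>i x. g i x - k i x"] by simp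

lemma htpc_left:
  assumes g: "chain_map Y Z g" and f: "htpc X Y f f'" and X: "bcplx X" and Y: "bcplx Y"
    and c: "chain_map X Y f" "chain_map X Y f'"
  shows "htpc X Z (\<lambda>i x. g i (f i x)) (\<lambda>i x. g i (f' i x))"
  unfolding htpc_def
  by (rule null_cong[OF null_left[OF g f[unfolded htpc_def] X Y]])
    (rule hom_diff[OF bcplx_hmod[OF Y] chain_hom[OF g] chain_car[OF c(1)] chain_car[OF c(2)]])

lemma htpc_right:
  assumes "chain_map W X g" and "htpc X Y f f'"
  shows "htpc W Y (\<lambda>i x. f i (g i x)) (\<lambda>i x. f' i (g i x))"
  unfolding htpc_def by (rule null_right[OF assms[unfolded htpc_def]])

lemma htpc_null: "bcplx Y \<Longrightarrow> htpc X Y f g \<Longrightarrow> null_htpy X Y g \<Longrightarrow> null_htpy X Y f"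
  unfolding htpc_def using null_add[of Y X "\<lambda>i x. f i x - g i x" g] by simp

lemma htpc_null': "bcplx Y \<Longrightarrow> htpc X Y f g \<Longrightarrow> null_htpy X Y f \<Longrightarrow> null_htpy X Y g"
  using htpc_null[of Y X g f] htpc_sym[of Y X f g] by blast

section \<open>Quasi-isomorphisms and complexes of projectives\<close>

definition proj_cplx :: "'h::ring_1 cplx \<Rightarrow> bool" where
  "proj_cplx P \<longleftrightarrow> bcplx P \<and> (\<forall>i. projective (ob P i))"

definition acyclic_cplx :: "'h::ring_1 cplx \<Rightarrow> bool" where
  "acyclic_cplx Z \<longleftrightarrow> (\<forall>i. cycles Z i \<subseteq> boundaries Z i)"

lemma hmodule_sub:
  assumes M: "hmodule M" and "0 \<in> A" "\<And>x y. x \<in> A \<Longrightarrow> y \<in> A \<Longrightarrow> x - y \<in> A"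
    "\<And>a x. x \<in> A \<Longrightarrow> act M a x \<in> A" "A \<subseteq> car M"
  shows "hmodule \<lparr>car = A, act = act M\<rparr>"
proof -
  have "x \<in> car M" if "x \<in> A" for x using that assms(5) by blast
  then show ?thesis
    unfolding hmodule_def by (simp add: assms(2-4) act_add[OF M] add_act[OF M] mult_act[OF M] one_act[OF M])
qed

lemma hmodule_image:
  assumes M: "hmodule M" and N: "hmodule N" and f: "mod_hom M N f"
  shows "hmodule \<lparr>car = f ` car M, act = act N\<rparr>"
proof (rule hmodule_sub[OF N])
  show "0 \<in> f ` car M" using hom_zero[OF M f] hmod_zero[OF M] by (metis image_eqI)
  show "x - y \<in> f ` car M" if "x \<in> f ` car M" "y \<in> f ` car M" for x y
    using that by (auto simp: hom_diff[OF M f, symmetric] intro!: imageI hmod_diff[OF M])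
  show "act N a x \<in> f ` car M" if "x \<in> f ` car M" for a x
    using that by (auto simp: hom_act[OF f, symmetric] intro!: imageI hmod_act[OF M])
  show "f ` car M \<subseteq> car N" using hom_car[OF f] by blast
qed

text \<open>The lifting property is postulated for epimorphisms. Replacing the target by the image
  of \<open>g\<close> extends it to every map with values in that image, the form in which it meets
  boundaries inside cycles.\<close>

lemma projectiveE:
  fixes M N :: "('h::ring_1, 'h elt) hmod"
  assumes P: "projective P" and M: "hmodule M" and N: "hmodule N" and g: "mod_hom M N g"
    and f: "mod_hom P N f" and sub: "\<And>x. x \<in> car P \<Longrightarrow> f x \<in> g ` car M"
  obtains h where "mod_hom P M h" "\<And>x. x \<in> car P \<Longrightarrow> g (h x) = f x"
proof -
  let ?N = "\<lparr>car = g ` car M, act = act N\<rparr>"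
  have "hmodule ?N" by (rule hmodule_image[OF M N g])
  moreover have "mod_hom M ?N g" "mod_hom P ?N f"
    using g f sub unfolding mod_hom_def by auto
  moreover have "g ` car M = car ?N" by simp
  ultimately obtain h where "mod_hom P M h \<and> (\<forall>x\<in>car P. g (h x) = f x)"
    using P M unfolding projective_def by blast
  then show thesis using that by blast
qed

lemma bcplx_bound:
  assumes "bcplx X" obtains b where "\<And>i. i > b \<Longrightarrow> car (ob X i) = {0}"
proof -
  let ?S = "insert 0 {i. car (ob X i) \<noteq> {0}}"
  have fin: "finite ?S" using bcplx_fin[OF assms] by simp
  have "car (ob X i) = {0}" if "i > Max ?S" for i
  proof (rule ccontr)
    assume "car (ob X i) \<noteq> {0}"
    then have "i \<le> Max ?S" using Max_ge[OF fin] by blast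
    then show False using that by simp
  qed
  then show thesis using that by blast
qed

text \<open>One step of a descending construction, with the homotopy known in degree i + 1 as
  \<open>k\<close>. By \<open>inv\<close>, f - k d takes values in cycles, hence in boundaries, and
  projectivity lifts it through the differential.\<close>

lemma null_htpy_step:
  assumes P: "proj_cplx P" and Z: "bcplx Z" "acyclic_cplx Z" and f: "chain_map P Z f"
    and k: "mod_hom (ob P (i + 1)) (ob Z i) k"
    and inv: "\<And>x. x \<in> car (ob P i) \<Longrightarrow> f (i + 1) (dif P i x) = dif Z i (k (dif P i x))"
  obtains k' where "mod_hom (ob P i) (ob Z (i - 1)) k'"
    "\<And>x. x \<in> car (ob P i) \<Longrightarrow> f i x = dif Z (i - 1) (k' x) + k (dif P i x)"
proof -
  have bP: "bcplx P" and pP: "projective (ob P i)" using P unfolding proj_cplx_def by auto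
  have kd: "mod_hom (ob P i) (ob Z i) (\<lambda>x. k (dif P i x))"
    by (rule mod_hom_comp[OF bcplx_dif[OF bP] k])
  have F: "mod_hom (ob P i) (ob Z i) (\<lambda>x. f i x - k (dif P i x))"
    by (rule mod_hom_diff[OF bcplx_hmod[OF Z(1)] chain_hom[OF f] kd])
  have "f i x - k (dif P i x) \<in> dif Z (i - 1) ` car (ob Z (i - 1))" if x: "x \<in> car (ob P i)" for x
  proof -
    have "dif Z i (f i x - k (dif P i x)) = 0"
      using hom_diff[OF bcplx_hmod[OF Z(1)] bcplx_dif[OF Z(1)] chain_car[OF f x] hom_car[OF kd x]]
        chain_dif[OF f x] inv[OF x] by simp
    then have "f i x - k (dif P i x) \<in> cycles Z i"
      using hom_car[OF F x] unfolding cycles_def by blast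
    then show ?thesis using Z(2) unfolding acyclic_cplx_def boundaries_def by blast
  qed
  then obtain k' where k': "mod_hom (ob P i) (ob Z (i - 1)) k'"
    "\<And>x. x \<in> car (ob P i) \<Longrightarrow> dif Z (i - 1) (k' x) = f i x - k (dif P i x)"
    using projectiveE[OF pP bcplx_hmod[OF Z(1)] bcplx_hmod[OF Z(1)] bcplx_dif'[OF Z(1)] F] by blast
  show thesis by (rule that[OF k'(1)]) (simp add: k'(2))
qed

text \<open>The homotopy is built downwards, starting above the highest nonzero degree of
  \<open>P\<close>, where it is zero.\<close>

lemma null_of_acyclic:
  assumes P: "proj_cplx P" and Z: "bcplx Z" "acyclic_cplx Z" and f: "chain_map P Z f"
  shows "null_htpy P Z f"
proof -
  have bP: "bcplx P" using P unfolding proj_cplx_def by auto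
  obtain b where b: "\<And>i. i > b \<Longrightarrow> car (ob P i) = {0}" using bcplx_bound[OF bP] by blast
  \<comment> \<open>The n-th choice is the component of the homotopy in degree b + 1 - n. The
    invariant \<open>?I\<close> is the hypothesis of the step lemma in degree b - n, and
    \<open>?Q\<close> is the homotopy equation there.\<close>
  let ?I = "\<lambda>(n::nat) k. mod_hom (ob P (b + 1 - int n)) (ob Z (b - int n)) k \<and>
    (\<forall>x\<in>car (ob P (b - int n)). f (b + 1 - int n) (dif P (b - int n) x) = dif Z (b - int n) (k (dif P (b - int n) x)))"
  let ?Q = "\<lambda>(n::nat) k k'. \<forall>x\<in>car (ob P (b - int n)).
     f (b - int n) x = dif Z (b - int n - 1) (k' x) + k (dif P (b - int n) x)"
  have "\<exists>s. \<forall>n. ?I n (s n) \<and> ?Q n (s n) (s (Suc n))"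
  proof (rule dependent_nat_choice)
    have d0: "dif P b x = 0" if "x \<in> car (ob P b)" for x
      using bcplx_dif_car[OF bP that] b[of "b + 1"] by simp
    show "\<exists>k. ?I 0 k"
      by (intro exI[of _ "\<lambda>x. 0"])
        (auto simp: d0 mod_hom_zero bcplx_hmod[OF Z(1)] hom_zero[OF bcplx_hmod[OF bP] chain_hom[OF f]]
          hom_zero[OF bcplx_hmod[OF Z(1)] bcplx_dif[OF Z(1)]])
  next
    fix k n assume I: "?I n k"
    define i where "i = b - int n"
    have e: "b + 1 - int n = i + 1" "b + 1 - int (Suc n) = i" "b - int (Suc n) = i - 1" "b - int n = i"
      by (auto simp: i_def)
    have I': "mod_hom (ob P (i + 1)) (ob Z i) k"
      "\<And>x. x \<in> car (ob P i) \<Longrightarrow> f (i + 1) (dif P i x) = dif Z i (k (dif P i x))"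
      using I unfolding e by auto
    obtain k' where k': "mod_hom (ob P i) (ob Z (i - 1)) k'"
      "\<And>x. x \<in> car (ob P i) \<Longrightarrow> f i x = dif Z (i - 1) (k' x) + k (dif P i x)"
      using null_htpy_step[OF P Z f I'] by blast
    have "f i (dif P (i - 1) x) = dif Z (i - 1) (k' (dif P (i - 1) x))" if x: "x \<in> car (ob P (i - 1))" for x
      using k'(2)[OF bcplx_dif_car'[OF bP x]] hom_zero[OF bcplx_hmod[OF bP] I'(1)] bcplx_dd'[OF bP x] by simp
    then show "\<exists>k'. ?I (Suc n) k' \<and> ?Q n k k'"
      unfolding e using k' by blast
  qed
  then obtain s where s: "\<And>n. ?I n (s n)" "\<And>n. ?Q n (s n) (s (Suc n))" by blast
  define h where "h i = (if i > b then (\<lambda>x. 0) else s (Suc (nat (b - i))))" for i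
  show ?thesis
  proof (rule null_htpyI[where h = h])
    show "mod_hom (ob P i) (ob Z (i - 1)) (h i)" for i
    proof (cases "i > b")
      case True then show ?thesis by (simp add: h_def mod_hom_zero bcplx_hmod[OF Z(1)])
    next
      case False
      then have "b + 1 - int (Suc (nat (b - i))) = i" "b - int (Suc (nat (b - i))) = i - 1" by auto
      then show ?thesis using s(1)[of "Suc (nat (b - i))"] False by (simp add: h_def)
    qed
    fix i x assume x: "x \<in> car (ob P i)"
    show "f i x = dif Z (i - 1) (h i x) + h (i + 1) (dif P i x)"
    proof (cases "i > b")
      case True
      then have "x = 0" using b x by auto
      then show ?thesis
        using True hom_zero[OF bcplx_hmod[OF bP] chain_hom[OF f]] hom_zero[OF bcplx_hmod[OF Z(1)] bcplx_dif[OF Z(1)]]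
        by (simp add: h_def)
    next
      case False
      then have e: "b - int (nat (b - i)) = i" by auto
      have eq: "f i x = dif Z (i - 1) (h i x) + s (nat (b - i)) (dif P i x)"
        using s(2)[of "nat (b - i)"] x False unfolding e by (simp add: h_def)
      have "s (nat (b - i)) (dif P i x) = h (i + 1) (dif P i x)"
      proof (cases "i = b")
        case True
        then have "dif P i x = 0" using bcplx_dif_car[OF bP x] b[of "b + 1"] by simp
        then show ?thesis
          using True hom_zero[OF bcplx_hmod[OF bP], of "b + 1" "ob Z b" "s 0"] s(1)[of 0] by (simp add: h_def)
      next
        case ne: False
        then have "Suc (nat (b - (i + 1))) = nat (b - i)" using False by auto
        then show ?thesis using False ne by (simp add: h_def)
      qed
      then show ?thesis using eq by simp
    qed
  qed
qed

lemma quasi_iso_chain: "quasi_iso X Y s \<Longrightarrow> chain_map X Y s"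
  unfolding quasi_iso_def by blast

text \<open>For a cycle (x, y) of the cone, s x is a boundary, so x = d x' by injectivity on
  cohomology. Then s x' + y is a cycle, and surjectivity writes it as s x'' + d y'. The element (x''
  - x', y') bounds (x, y).\<close>

lemma acyclic_cone:
  assumes X: "bcplx X" and Y: "bcplx Y" and s: "quasi_iso X Y s"
  shows "acyclic_cplx (cone X Y s)"
  unfolding acyclic_cplx_def
proof (intro allI subsetI)
  note sc = quasi_iso_chain[OF s]
  fix i z assume "z \<in> cycles (cone X Y s) i"
  then have z: "lft z \<in> car (ob X (i + 1))" "rgt z \<in> car (ob Y i)"
    "dif X (i + 1) (lft z) = 0" "s (i + 1) (lft z) + dif Y i (rgt z) = 0"
    by (auto simp: cycles_def)
  have "dif Y i (- rgt z) = s (i + 1) (lft z)"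
    using eq_neg_iff_add_eq_0[THEN iffD2, OF z(4)] hom_uminus[OF bcplx_hmod[OF Y] bcplx_dif[OF Y] z(2)] by simp
  then have "s (i + 1) (lft z) \<in> boundaries Y (i + 1)"
    unfolding boundaries_def using hmod_uminus[OF bcplx_hmod[OF Y] z(2)] by (auto intro!: image_eqI)
  then have "lft z \<in> boundaries X (i + 1)"
    using s z(1,3) unfolding quasi_iso_def cycles_def by auto
  then obtain x' where x': "x' \<in> car (ob X i)" "lft z = dif X i x'"
    unfolding boundaries_def by auto
  have sx: "s i x' \<in> car (ob Y i)" by (rule chain_car[OF sc x'(1)])
  have "dif Y i (s i x' + rgt z) = 0"
    using hom_add[OF bcplx_dif[OF Y] sx z(2)] chain_dif[OF sc x'(1)] z(4) x'(2) by simp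
  then have "s i x' + rgt z \<in> cycles Y i"
    using hmod_add[OF bcplx_hmod[OF Y] sx z(2)] unfolding cycles_def by simp
  then obtain x'' where "x'' \<in> cycles X i" "s i x' + rgt z - s i x'' \<in> boundaries Y i"
    using s unfolding quasi_iso_def by blast
  then obtain y where x'': "x'' \<in> car (ob X i)" "dif X i x'' = 0"
    and y: "y \<in> car (ob Y (i - 1))" "s i x' + rgt z - s i x'' = dif Y (i - 1) y"
    unfolding boundaries_def cycles_def by auto
  let ?u = "pr (x'' - x') y"
  have u: "?u \<in> car (ob (cone X Y s) (i - 1))"
    using x' x'' y hmod_diff[OF bcplx_hmod[OF X]] by simp
  have "- dif X i (x'' - x') = lft z"
    using hom_diff[OF bcplx_hmod[OF X] bcplx_dif[OF X] x''(1) x'(1)] by (simp only: x'(2) x''(2)) simp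
  moreover have "s i (x'' - x') + dif Y (i - 1) y = rgt z"
    using hom_diff[OF bcplx_hmod[OF X] chain_hom[OF sc] x''(1) x'(1)] y(2)
    by (simp only: y(2)[symmetric]) (simp add: algebra_simps)
  ultimately have "dif (cone X Y s) (i - 1) ?u = z" by simp
  then show "z \<in> boundaries (cone X Y s) i"
    unfolding boundaries_def using u by blast
qed

text \<open>The chain map x \<mapsto> (0, g x) into the acyclic cone of \<open>s\<close> is
  null-homotopic. The first coordinate of its contraction is the lift, the second is the homotopy
  between g and s f.\<close>

lemma lift_quasi_iso:
  assumes P: "proj_cplx P" and X: "bcplx X" and Y: "bcplx Y" and s: "quasi_iso X Y s"
    and g: "chain_map P Y g"
  obtains f where "chain_map P X f" "htpc P Y (\<lambda>i x. s i (f i x)) g"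
proof -
  let ?C = "cone X Y s"
  note sc = quasi_iso_chain[OF s]
  have bP: "bcplx P" using P unfolding proj_cplx_def by auto
  have bC: "bcplx ?C" by (rule bcplx_cone[OF X Y sc])
  have c: "chain_map P ?C (\<lambda>i x. pr 0 (g i x))"
    unfolding chain_map_def mod_hom_pr_iff ob_cone
    by (auto simp: mod_hom_zero bcplx_hmod X chain_hom[OF g] chain_dif[OF g] hom_zero[OF bcplx_hmod[OF X] bcplx_dif[OF X]]
       hom_zero[OF bcplx_hmod[OF X] chain_hom[OF sc]])
  obtain h where h: "\<And>i. mod_hom (ob P i) (ob ?C (i - 1)) (h i)"
    "\<And>i x. x \<in> car (ob P i) \<Longrightarrow> pr 0 (g i x) = dif ?C (i - 1) (h i x) + h (i + 1) (dif P i x)"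
    using null_of_acyclic[OF P bC acyclic_cone[OF X Y s] c] by (rule null_htpyE) blast
  have l: "mod_hom (ob P i) (ob X i) (\<lambda>x. lft (h i x))" "mod_hom (ob P i) (ob Y (i - 1)) (\<lambda>x. rgt (h i x))" for i
    using h(1)[of i] by (simp_all add: mod_hom_pr_iff)
  have e: "lft (h (i + 1) (dif P i x)) = dif X i (lft (h i x))"
    "g i x = s i (lft (h i x)) + dif Y (i - 1) (rgt (h i x)) + rgt (h (i + 1) (dif P i x))"
    if x: "x \<in> car (ob P i)" for i x
    using arg_cong[OF h(2)[OF x], of lft] arg_cong[OF h(2)[OF x], of rgt] by simp_all
  have f: "chain_map P X (\<lambda>i x. lft (h i x))"
    unfolding chain_map_def using l e by blast
  have "null_htpy P Y (\<lambda>i x. g i x - s i (lft (h i x)))"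
    by (rule null_htpyI[where h = "\<lambda>i x. rgt (h i x)"]) (simp_all add: l e(2))
  then have "htpc P Y g (\<lambda>i x. s i (lft (h i x)))" by (simp add: htpc_def)
  from htpc_sym[OF Y this] show thesis by (rule that[OF f])
qed

text \<open>A homotopy k for s f makes x \<mapsto> (f x, - k x) a chain map into the shifted cone of
  \<open>s\<close>, which is acyclic as well. The first coordinate of its contraction is a homotopy
  for f.\<close>

lemma quasi_iso_mono:
  assumes P: "proj_cplx P" and X: "bcplx X" and Y: "bcplx Y" and s: "quasi_iso X Y s"
    and f: "chain_map P X f" and n: "null_htpy P Y (\<lambda>i x. s i (f i x))"
  shows "null_htpy P X f"
proof -
  let ?C = "cone X Y s"
  note sc = quasi_iso_chain[OF s]
  have bP: "bcplx P" using P unfolding proj_cplx_def by auto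
  have bC: "bcplx ?C" by (rule bcplx_cone[OF X Y sc])
  have acyc: "acyclic_cplx (unshift ?C)"
    unfolding acyclic_cplx_def
  proof (intro allI subsetI)
    fix i z assume "z \<in> cycles (unshift ?C) i"
    then have "z \<in> cycles ?C (i - 1)" unfolding cycles_def by simp
    then have "z \<in> boundaries ?C (i - 1)" using acyclic_cone[OF X Y s] unfolding acyclic_cplx_def by blast
    then obtain u where u: "u \<in> car (ob ?C (i - 1 - 1))" "z = dif ?C (i - 1 - 1) u"
      unfolding boundaries_def by blast
    have "z = dif (unshift ?C) (i - 1) (- u)"
      using hom_uminus[OF bcplx_hmod[OF bC] bcplx_dif[OF bC] u(1)] unfolding u(2) dif_unshift by simp
    moreover have "- u \<in> car (ob (unshift ?C) (i - 1))"
      using hmod_uminus[OF bcplx_hmod[OF bC] u(1)] by (simp only: ob_unshift)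
    ultimately show "z \<in> boundaries (unshift ?C) i" unfolding boundaries_def by blast
  qed
  obtain k where k: "\<And>i. mod_hom (ob P i) (ob Y (i - 1)) (k i)"
    "\<And>i x. x \<in> car (ob P i) \<Longrightarrow> s i (f i x) = dif Y (i - 1) (k i x) + k (i + 1) (dif P i x)"
    using n by (rule null_htpyE) blast
  have c: "chain_map P (unshift ?C) (\<lambda>i x. pr (f i x) (- k i x))"
    unfolding chain_map_def
  proof (intro conjI allI ballI)
    fix i
    show "mod_hom (ob P i) (ob (unshift ?C) i) (\<lambda>x. pr (f i x) (- k i x))"
      using chain_hom[OF f, of i] mod_hom_uminus[OF bcplx_hmod[OF Y] k(1), of i] by (simp add: mod_hom_pr_iff)
    fix x assume x: "x \<in> car (ob P i)"
    then show "pr (f (i + 1) (dif P i x)) (- k (i + 1) (dif P i x)) = dif (unshift ?C) i (pr (f i x) (- k i x))"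
      using chain_dif[OF f x] hom_uminus[OF bcplx_hmod[OF Y] bcplx_dif[OF Y] hom_car[OF k(1) x]] k(2)[OF x]
      by (simp add: pr_minus)
  qed
  obtain h where h: "\<And>i. mod_hom (ob P i) (ob (unshift ?C) (i - 1)) (h i)"
    "\<And>i x. x \<in> car (ob P i) \<Longrightarrow> pr (f i x) (- k i x) = dif (unshift ?C) (i - 1) (h i x) + h (i + 1) (dif P i x)"
    using null_of_acyclic[OF P bcplx_unshift[OF bC] acyc c] by (rule null_htpyE) blast
  show ?thesis
  proof (rule null_htpyI[where h = "\<lambda>i x. lft (h i x)"])
    show "mod_hom (ob P i) (ob X (i - 1)) (\<lambda>x. lft (h i x))" for i
      using h(1)[of i] by (simp add: mod_hom_pr_iff)
    show "f i x = dif X (i - 1) (lft (h i x)) + lft (h (i + 1) (dif P i x))" if x: "x \<in> car (ob P i)" for i x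
      using arg_cong[OF h(2)[OF x], of lft] by simp
  qed
qed

section \<open>Morphisms of the derived category out of complexes of projectives\<close>

lemma valid_bcplx: "valid l \<Longrightarrow> bcplx (src l)" "valid l \<Longrightarrow> bcplx (tgt l)"
  by (cases l; simp)+

lemma dmor_bcplx: "dmor X Y w \<Longrightarrow> bcplx X \<and> bcplx Y"
  by (induction w arbitrary: X) (auto dest: valid_bcplx)

lemma dmor_append: "dmor X A u \<Longrightarrow> dmor A Y v \<Longrightarrow> dmor X Y (u @ v)"
  by (induction u arbitrary: X) auto

lemma deq_dmor: "deq X Y w w' \<Longrightarrow> dmor X Y w \<and> dmor X Y w'"
proof (induction rule: deq.induct)
  case (deq_cong X A u B w w' Y v) then show ?case by (auto intro!: dmor_append)
next
  case (deq_ident X) then show ?case using chain_map_id[of X] by (simp add: id_def)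
next
  case (deq_comp X f Y g Z) then show ?case using chain_map_comp[of X Y f Z g] by (simp add: comp_def)
qed (auto simp: quasi_iso_def)

lemma deq_app:
  assumes "deq X A u u'" "deq A Y v v'"
  shows "deq X Y (u @ v) (u' @ v')"
proof -
  have d: "dmor X A u'" "dmor A Y v" "dmor X X []" "dmor Y Y []"
    using assms deq_dmor dmor_bcplx by (metis dmor.simps(1))+
  have "deq X Y ([] @ u @ v) ([] @ u' @ v)" by (rule deq_cong[OF d(3) assms(1) d(2)])
  moreover have "deq X Y (u' @ v @ []) (u' @ v' @ [])" by (rule deq_cong[OF d(1) assms(2) d(4)])
  ultimately show ?thesis using deq_trans by simp
qed

lemma deq_comp': "chain_map X Y f \<Longrightarrow> chain_map Y Z g \<Longrightarrow> bcplx X \<Longrightarrow> bcplx Y \<Longrightarrow> bcplx Z \<Longrightarrow>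
    deq X Z [Arr X f Y, Arr Y g Z] [Arr X (\<lambda>i x. g i (f i x)) Z]"
  using deq_comp[of X f Y g Z] by (simp add: comp_def)

lemma deq_ident': "bcplx X \<Longrightarrow> deq X X [Arr X (\<lambda>i x. x) X] []"
  using deq_ident[of X] by (simp add: id_def)

lemma deq_ext': "bcplx X \<Longrightarrow> bcplx Y \<Longrightarrow> chain_map X Y f \<Longrightarrow> (\<And>i x. x \<in> car (ob X i) \<Longrightarrow> f i x = g i x) \<Longrightarrow>
    deq X Y [Arr X f Y] [Arr X g Y]"
  by (rule deq_ext) (auto intro: chain_map_cong)

text \<open>\<open>wact P w Y g g'\<close>: following \<open>g\<close> by the word \<open>w\<close> can yield \<open>g'\<close>, where a formal inverse acts by lifting
  along its quasi-isomorphism. If the source \<open>P\<close> consists of projectives, such lifts exist and are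
  unique up to homotopy, which makes the relation compatible with \<open>deq\<close>.\<close>

fun wact :: "'h::ring_1 cplx \<Rightarrow> 'h letter list \<Rightarrow> 'h cplx \<Rightarrow> 'h cmap \<Rightarrow> 'h cmap \<Rightarrow> bool" where
  "wact P [] Y g g' \<longleftrightarrow> htpc P Y g g'"
| "wact P (Arr X f Z # w) Y g g' \<longleftrightarrow> wact P w Y (\<lambda>i x. f i (g i x)) g'"
| "wact P (Inv X s Z # w) Y g g' \<longleftrightarrow>
     (\<exists>k. chain_map P X k \<and> htpc P Z (\<lambda>i x. s i (k i x)) g \<and> wact P w Y k g')"

context
  fixes P :: "'h::ring_1 cplx"
  assumes P: "proj_cplx P"
begin

lemma wact_ex: "dmor X Y w \<Longrightarrow> chain_map P X g \<Longrightarrow> \<exists>g'. chain_map P Y g' \<and> wact P w Y g g'"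
proof (induction w arbitrary: X g)
  case Nil
  then show ?case using htpc_refl by auto
next
  case (Cons l w)
  show ?case
  proof (cases l)
    case (Arr A f B)
    with Cons show ?thesis by (auto intro!: chain_map_comp)
  next
    case (Inv A s B)
    with Cons.prems have "bcplx A" "bcplx B" "quasi_iso A B s" "chain_map P B g" "dmor A Y w" by auto
    note A = this
    obtain k where k: "chain_map P A k" "htpc P B (\<lambda>i x. s i (k i x)) g"
      using lift_quasi_iso[OF P A(1-4)] by blast
    obtain g' where "chain_map P Y g'" "wact P w Y k g'" using Cons.IH[OF A(5) k(1)] by blast
    then show ?thesis using k Inv by auto
  qed
qed

lemma wact_src:
  "dmor X Y w \<Longrightarrow> chain_map P X g \<Longrightarrow> chain_map P X k \<Longrightarrow> htpc P X g k \<Longrightarrow> wact P w Y g g' \<Longrightarrow> wact P w Y k g'"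
proof (induction w arbitrary: X g k)
  case Nil
  then show ?case using htpc_trans[of Y P k g g'] htpc_sym[of Y P g k] by auto
next
  case (Cons l w)
  have bP: "bcplx P" using P by (auto simp: proj_cplx_def)
  show ?case
  proof (cases l)
    case (Arr A f B)
    with Cons.prems have A: "bcplx A" "chain_map A B f" "X = A" "dmor B Y w" by auto
    have c: "chain_map P A g" "chain_map P A k" "htpc P A g k" using Cons.prems A by auto
    show ?thesis
      using Cons.IH[OF A(4) chain_map_comp[OF c(1) A(2)] chain_map_comp[OF c(2) A(2)]
        htpc_left[OF A(2) c(3) bP A(1) c(1,2)]] Cons.prems Arr by simp
  next
    case (Inv A s B)
    then show ?thesis using Cons.prems htpc_trans[of B P _ g k] by auto
  qed
qed

text \<open>Lifts along a quasi-isomorphism are unique up to homotopy. This makes a formal inverse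
  act as a function on homotopy classes.\<close>

lemma htpc_quasi_iso_cancel:
  assumes X: "bcplx X" and Y: "bcplx Y" and s: "quasi_iso X Y s"
    and f: "chain_map P X f" and g: "chain_map P X g"
    and h: "htpc P Y (\<lambda>i x. s i (f i x)) (\<lambda>i x. s i (g i x))"
  shows "htpc P X f g"
  unfolding htpc_def
proof (rule quasi_iso_mono[OF P X Y s chain_map_diff[OF X f g]])
  show "null_htpy P Y (\<lambda>i x. s i (f i x - g i x))"
    by (rule null_cong[OF h[unfolded htpc_def]])
      (rule hom_diff[OF bcplx_hmod[OF X] chain_hom[OF quasi_iso_chain[OF s]] chain_car[OF f] chain_car[OF g], symmetric])
qed

text \<open>The intermediate chain map is determined only up to homotopy, and
  \<open>wact_src\<close> absorbs the ambiguity.\<close>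

lemma wact_append:
  "dmor X A u \<Longrightarrow> dmor A Y v \<Longrightarrow> chain_map P X g \<Longrightarrow>
    wact P (u @ v) Y g g' \<longleftrightarrow> (\<exists>m. chain_map P A m \<and> wact P u A g m \<and> wact P v Y m g')"
proof (induction u arbitrary: X g)
  case Nil
  then have A: "bcplx A" "X = A" by auto
  show ?case
  proof
    assume "wact P ([] @ v) Y g g'"
    then show "\<exists>m. chain_map P A m \<and> wact P [] A g m \<and> wact P v Y m g'"
      using Nil A htpc_refl[OF A(1), of P g] by auto
  next
    assume "\<exists>m. chain_map P A m \<and> wact P [] A g m \<and> wact P v Y m g'"
    then obtain m where "chain_map P A m" "htpc P A g m" "wact P v Y m g'" by auto
    then show "wact P ([] @ v) Y g g'"
      using wact_src[OF Nil(2), of m g g'] Nil(3) htpc_sym[OF A(1)] A by simp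
  qed
next
  case (Cons l u)
  show ?case
  proof (cases l)
    case (Arr B f C)
    then show ?thesis using Cons by (auto intro!: Cons.IH[of C] chain_map_comp)
  next
    case (Inv B s C)
    then have "dmor B A u" using Cons.prems by auto
    then show ?thesis using Cons.IH[of B] Cons.prems Inv by auto blast
  qed
qed

text \<open>Every generating relation of the localization preserves the action. Of the two inverse
  laws, one rests on the uniqueness of lifts and the other on their existence; the remaining rules
  are formal.\<close>

lemma deq_wact: "deq X Y w w' \<Longrightarrow> chain_map P X g \<Longrightarrow> wact P w Y g g' \<longleftrightarrow> wact P w' Y g g'"
proof (induction arbitrary: g g' rule: deq.induct)
  case (deq_refl X Y w) then show ?case by simp
next
  case (deq_sym X Y w w') then show ?case by simp
next
  case (deq_trans X Y w w' w'') then show ?case by simp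
next
  case (deq_cong X A u B w w' Y v)
  have d: "dmor A B w" "dmor A B w'" using deq_dmor[OF deq_cong(2)] by auto
  have "wact P (w @ v) Y m g' \<longleftrightarrow> wact P (w' @ v) Y m g'" if m: "chain_map P A m" for m
    using wact_append[OF d(1) deq_cong(3) m] wact_append[OF d(2) deq_cong(3) m] deq_cong(4)[OF m] by simp
  then show ?case
    using wact_append[OF deq_cong(1) dmor_append[OF d(1) deq_cong(3)] deq_cong(5)]
      wact_append[OF deq_cong(1) dmor_append[OF d(2) deq_cong(3)] deq_cong(5)] by auto
next
  case (deq_ext X f Y k)
  have b: "bcplx Y" "dmor Y Y []" using deq_ext by auto
  have h: "htpc P Y (\<lambda>i x. f i (g i x)) (\<lambda>i x. k i (g i x))"
    unfolding htpc_def by (rule null_cong[OF null_zero[OF b(1)]]) (simp add: deq_ext(3) chain_car[OF deq_ext(4)])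
  have c: "chain_map P Y (\<lambda>i x. f i (g i x))" "chain_map P Y (\<lambda>i x. k i (g i x))"
    using deq_ext by (auto intro!: chain_map_comp[OF deq_ext(4)])
  show ?case
    using wact_src[OF b(2) c(1) c(2) h] wact_src[OF b(2) c(2) c(1) htpc_sym[OF b(1) h]] by auto
next
  case (deq_ident X) then show ?case by simp
next
  case (deq_comp X f Y k Z) then show ?case by simp
next
  case (deq_inv_right X s Y)
  then have b: "bcplx X" "bcplx Y" "quasi_iso X Y s" by auto
  show ?case
  proof
    assume "wact P [Arr X s Y, Inv X s Y] X g g'"
    then obtain k where k: "chain_map P X k" "htpc P Y (\<lambda>i x. s i (k i x)) (\<lambda>i x. s i (g i x))" "htpc P X k g'" by auto
    show "wact P [] X g g'"
      using htpc_trans[OF b(1) htpc_sym[OF b(1) htpc_quasi_iso_cancel[OF b k(1) deq_inv_right(2) k(2)]] k(3)] by simp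
  next
    assume "wact P [] X g g'"
    then show "wact P [Arr X s Y, Inv X s Y] X g g'"
      using deq_inv_right(2) htpc_refl[OF b(2)] by auto
  qed
next
  case (deq_inv_left X s Y)
  then have b: "bcplx X" "bcplx Y" "quasi_iso X Y s" by auto
  show ?case
  proof
    assume "wact P [Inv X s Y, Arr X s Y] Y g g'"
    then obtain k where k: "chain_map P X k" "htpc P Y (\<lambda>i x. s i (k i x)) g" "htpc P Y (\<lambda>i x. s i (k i x)) g'" by auto
    show "wact P [] Y g g'"
      using htpc_trans[OF b(2) htpc_sym[OF b(2) k(2)] k(3)] by simp
  next
    assume "wact P [] Y g g'"
    moreover obtain k where "chain_map P X k" "htpc P Y (\<lambda>i x. s i (k i x)) g"
      using lift_quasi_iso[OF P b deq_inv_left(2)] by blast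
    ultimately show "wact P [Inv X s Y, Arr X s Y] Y g g'"
      using htpc_trans[OF b(2)] by auto
  qed
qed

end

lemma zero_boundary: "bcplx X \<Longrightarrow> 0 \<in> boundaries X i"
  unfolding boundaries_def
  by (rule image_eqI[of _ _ 0]) (simp_all add: hom_zero[OF bcplx_hmod bcplx_dif] hmod_zero bcplx_hmod)

lemma quasi_iso_id: "bcplx X \<Longrightarrow> quasi_iso X X (\<lambda>i x. x)"
  unfolding quasi_iso_def by (auto simp: chain_map_id zero_boundary intro!: bexI)

text \<open>The inclusions \<open>x \<mapsto> (x, 0)\<close> and \<open>x \<mapsto> (x, (0, x))\<close> of \<open>X\<close> into \<open>X \<oplus> cone(id)\<close> are both
  inverse to the projection, hence equal in the derived category; a homotopy from \<open>f\<close> to \<open>g\<close> is a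
  map out of \<open>X \<oplus> cone(id)\<close> that restricts to \<open>g\<close> and \<open>f\<close> along them.\<close>

lemma htpc_deq:
  assumes X: "bcplx X" and Y: "bcplx Y" and f: "chain_map X Y f" and g: "chain_map X Y g"
    and fg: "htpc X Y f g"
  shows "deq X Y [Arr X f Y] [Arr X g Y]"
proof -
  let ?C = "cone X X (\<lambda>i x. x)" let ?S = "cplx_sum X ?C"
  let ?p = "\<lambda>i::int. lft" let ?j = "\<lambda>(i::int) x. pr x 0" let ?k = "\<lambda>(i::int) x. pr x (pr 0 x)"
  have C: "bcplx ?C" by (rule bcplx_cone[OF X X chain_map_id])
  have S: "bcplx ?S" by (rule bcplx_cplx_sum[OF X C])
  have d0: "dif X i 0 = 0" for i by (rule hom_zero[OF bcplx_hmod[OF X] bcplx_dif[OF X]])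
  have z: "0 \<in> car (ob X i)" for i by (rule hmod_zero[OF bcplx_hmod[OF X]])
  have p: "chain_map ?S X ?p"
    unfolding chain_map_def by (simp add: mod_hom_lft[OF mod_hom_id])
  have j: "chain_map X ?S ?j" and k: "chain_map X ?S ?k"
    unfolding chain_map_def by (simp_all add: mod_hom_pr_iff mod_hom_id mod_hom_zero bcplx_hmod X d0)
  have q: "quasi_iso ?S X ?p"
    unfolding quasi_iso_def
  proof (intro conjI allI ballI impI)
    show "chain_map ?S X ?p" by (rule p)
    fix i u assume u: "u \<in> cycles ?S i" "lft u \<in> boundaries X i"
    then have "rgt u \<in> cycles ?C i" by (auto simp: cycles_def)
    then have "rgt u \<in> boundaries ?C i"
      using acyclic_cone[OF X X quasi_iso_id[OF X]] unfolding acyclic_cplx_def by blast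
    then obtain a b where "a \<in> car (ob X (i - 1))" "lft u = dif X (i - 1) a"
      "b \<in> car (ob ?C (i - 1))" "rgt u = dif ?C (i - 1) b"
      using u(2) unfolding boundaries_def by blast
    then have "u = dif ?S (i - 1) (pr a b)" "pr a b \<in> car (ob ?S (i - 1))"
      by (simp_all only: eq_pr_iff dif_cplx_sum lft_pr rgt_pr ob_cplx_sum car_mod_sum simp_thms)
    then show "u \<in> boundaries ?S i" unfolding boundaries_def by blast
  next
    fix i y assume y: "y \<in> cycles X i"
    then have "?j i y \<in> cycles ?S i" by (simp add: cycles_def z d0)
    moreover have "y - lft (?j i y) \<in> boundaries X i"
      using d0 z by (auto simp: boundaries_def intro!: image_eqI[of _ _ 0])
    ultimately show "\<exists>u\<in>cycles ?S i. y - lft u \<in> boundaries X i" by blast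
  qed
  obtain h where h: "\<And>i. mod_hom (ob X i) (ob Y (i - 1)) (h i)"
    "\<And>i x. x \<in> car (ob X i) \<Longrightarrow> f i x - g i x = dif Y (i - 1) (h i x) + h (i + 1) (dif X i x)"
    using fg[unfolded htpc_def] by (rule null_htpyE) blast
  have h': "mod_hom (ob X (i + 1)) (ob Y i) (h (i + 1))" for i using h(1)[of "i + 1"] by simp
  \<comment> \<open>An element of the cone of the identity is a pair (a, b), and the map takes it to
    (f - g) b + h a. This commutes with the differentials because h is a homotopy for f - g.\<close>
  let ?F = "\<lambda>i u. g i (lft u) + ((f i (rgt (rgt u)) - g i (rgt (rgt u))) + h (i + 1) (lft (rgt u)))"
  have F: "chain_map ?S Y ?F"
    unfolding chain_map_def
  proof (intro conjI allI ballI)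
    fix i
    show "mod_hom (ob ?S i) (ob Y i) (?F i)"
      unfolding ob_cplx_sum ob_cone
      by (intro mod_hom_add mod_hom_diff bcplx_hmod Y mod_hom_lft mod_hom_rgt chain_hom[OF f] chain_hom[OF g]
        mod_hom_lft[OF chain_hom[OF g]] mod_hom_rgt[OF mod_hom_rgt[OF chain_hom[OF g]]]
        mod_hom_rgt[OF mod_hom_rgt[OF chain_hom[OF f]]] mod_hom_rgt[OF mod_hom_lft[OF h']])
    fix u assume "u \<in> car (ob ?S i)"
    then have u: "lft u \<in> car (ob X i)" "lft (rgt u) \<in> car (ob X (i + 1))" "rgt (rgt u) \<in> car (ob X i)" by auto
    let ?a = "lft (rgt u)" and ?b = "rgt (rgt u)"
    note e = bcplx_dif_car[OF X u(3)] bcplx_dif_car[OF X u(2)]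
    have 1: "f (i + 1) (?a + dif X i ?b) = f (i + 1) ?a + dif Y i (f i ?b)"
      by (simp add: hom_add[OF chain_hom[OF f] u(2) e(1)] chain_dif[OF f u(3)])
    have 2: "g (i + 1) (?a + dif X i ?b) = g (i + 1) ?a + dif Y i (g i ?b)"
      by (simp add: hom_add[OF chain_hom[OF g] u(2) e(1)] chain_dif[OF g u(3)])
    have 3: "h (i + 1 + 1) (- dif X (i + 1) ?a) = - h (i + 1 + 1) (dif X (i + 1) ?a)"
      by (rule hom_uminus[OF bcplx_hmod[OF X] h' e(2)])
    have 4: "f (i + 1) ?a - g (i + 1) ?a = dif Y i (h (i + 1) ?a) + h (i + 1 + 1) (dif X (i + 1) ?a)"
      using h(2)[OF u(2)] by simp
    have 5: "g (i + 1) (dif X i (lft u)) = dif Y i (g i (lft u))" by (rule chain_dif[OF g u(1)])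
    have Fu: "g i (lft u) \<in> car (ob Y i)" "f i ?b \<in> car (ob Y i)" "g i ?b \<in> car (ob Y i)" "h (i + 1) ?a \<in> car (ob Y i)"
      "f i ?b - g i ?b \<in> car (ob Y i)" "f i ?b - g i ?b + h (i + 1) ?a \<in> car (ob Y i)"
      using u by (auto intro!: hmod_add hmod_diff bcplx_hmod Y chain_car[OF f] chain_car[OF g] hom_car[OF h'])
    have "?F (i + 1) (dif ?S i u) = dif Y i (g i (lft u)) + (f (i + 1) (?a + dif X i ?b) - g (i + 1) (?a + dif X i ?b)
        + h (i + 1 + 1) (- dif X (i + 1) ?a))"
      using 5 by (simp only: dif_cplx_sum dif_cone lft_pr rgt_pr)
    also have "\<dots> = dif Y i (g i (lft u)) + (dif Y i (f i ?b) - dif Y i (g i ?b) + dif Y i (h (i + 1) ?a))"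
      unfolding 1 2 3 using 4 by (simp add: algebra_simps)
    also have "\<dots> = dif Y i (?F i u)"
      by (simp only: hom_add[OF bcplx_dif[OF Y]] hom_diff[OF bcplx_hmod[OF Y] bcplx_dif[OF Y]] Fu)
    finally show "?F (i + 1) (dif ?S i u) = dif Y i (?F i u)" .
  qed
  have inv: "deq X ?S [Arr X m ?S] [Inv ?S ?p X]" if m: "chain_map X ?S m" and e: "\<And>i x. lft (m i x) = x" for m
  proof -
    have "deq X X [Arr X m ?S, Arr ?S ?p X] [Arr X (\<lambda>i x. x) X]"
      using deq_comp'[OF m p X S X] by (simp add: e)
    then have 1: "deq X X [Arr X m ?S, Arr ?S ?p X] []" using deq_trans deq_ident'[OF X] by blast
    have "deq X ?S ([Arr X m ?S, Arr ?S ?p X] @ [Inv ?S ?p X]) ([] @ [Inv ?S ?p X])"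
      by (rule deq_app[OF 1 deq_refl]) (simp add: S X q)
    then have 2: "deq X ?S [Arr X m ?S, Arr ?S ?p X, Inv ?S ?p X] [Inv ?S ?p X]" by simp
    have "deq X ?S ([Arr X m ?S] @ [Arr ?S ?p X, Inv ?S ?p X]) ([Arr X m ?S] @ [])"
      by (rule deq_app[OF deq_refl deq_inv_right]) (simp_all add: S X q m)
    then have 3: "deq X ?S [Arr X m ?S, Arr ?S ?p X, Inv ?S ?p X] [Arr X m ?S]" by simp
    show ?thesis by (rule deq_trans[OF deq_sym[OF 3] 2])
  qed
  have "deq X ?S [Arr X ?k ?S] [Arr X ?j ?S]"
    by (rule deq_trans[OF inv[OF k] deq_sym[OF inv[OF j]]]) simp_all
  then have "deq X Y ([Arr X ?k ?S] @ [Arr ?S ?F Y]) ([Arr X ?j ?S] @ [Arr ?S ?F Y])"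
    by (rule deq_app[OF _ deq_refl]) (simp add: S Y F)
  then have eq: "deq X Y [Arr X ?k ?S, Arr ?S ?F Y] [Arr X ?j ?S, Arr ?S ?F Y]" by simp
  have eqf: "deq X Y [Arr X ?k ?S, Arr ?S ?F Y] [Arr X f Y]"
    by (rule deq_trans[OF deq_comp'[OF k F X S Y] deq_ext'[OF X Y chain_map_comp[OF k F]]])
      (use z in \<open>simp add: hom_zero[OF bcplx_hmod[OF X] h']\<close>)
  have eqg: "deq X Y [Arr X ?j ?S, Arr ?S ?F Y] [Arr X g Y]"
    by (rule deq_trans[OF deq_comp'[OF j F X S Y] deq_ext'[OF X Y chain_map_comp[OF j F]]])
      (simp add: hom_zero[OF bcplx_hmod[OF X] h'] hom_zero[OF bcplx_hmod[OF X] chain_hom[OF f]]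
        hom_zero[OF bcplx_hmod[OF X] chain_hom[OF g]])
  show ?thesis by (rule deq_trans[OF deq_trans[OF deq_sym[OF eqf] eq] eqg])
qed

context
  fixes P :: "'h::ring_1 cplx"
  assumes P: "proj_cplx P"
begin

lemma bP: "bcplx P" using P by (auto simp: proj_cplx_def)

text \<open>The action is not only an invariant: the chain map it computes also represents the
  composite. Together with \<open>deq_wact\<close> this identifies morphisms out of \<open>P\<close>
  with homotopy classes.\<close>

lemma wact_deq:
  "dmor X Y w \<Longrightarrow> chain_map P X g \<Longrightarrow> chain_map P Y g' \<Longrightarrow> wact P w Y g g' \<Longrightarrow> deq P Y (Arr P g X # w) [Arr P g' Y]"
proof (induction w arbitrary: X g)
  case Nil
  then show ?case using htpc_deq[OF bP] by auto
next
  case (Cons l w)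
  show ?case
  proof (cases l)
    case (Arr A f B)
    with Cons.prems have A: "bcplx A" "bcplx B" "chain_map A B f" "X = A" "dmor B Y w" by auto
    have g: "chain_map P A g" using Cons.prems A by simp
    have "deq P Y ([Arr P g A, Arr A f B] @ w) ([Arr P (\<lambda>i x. f i (g i x)) B] @ w)"
      by (rule deq_app[OF deq_comp'[OF g A(3) bP A(1,2)] deq_refl[OF A(5)]])
    moreover have "deq P Y (Arr P (\<lambda>i x. f i (g i x)) B # w) [Arr P g' Y]"
      by (rule Cons.IH[OF A(5) chain_map_comp[OF g A(3)] Cons.prems(3)]) (use Cons.prems(4) Arr in simp)
    ultimately show ?thesis using Arr A(4) deq_trans by (metis append_Cons append_Nil)
  next
    case (Inv A s B)
    with Cons.prems have A: "bcplx A" "bcplx B" "quasi_iso A B s" "X = B" "dmor A Y w" by auto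
    note sc = quasi_iso_chain[OF A(3)]
    obtain k where k: "chain_map P A k" "htpc P B (\<lambda>i x. s i (k i x)) g" "wact P w Y k g'"
      using Cons.prems(4) Inv by auto
    have g: "chain_map P B g" using Cons.prems A by simp
    have ks: "deq P B [Arr P k A, Arr A s B] [Arr P g B]"
      using deq_trans[OF deq_comp'[OF k(1) sc bP A(1,2)] htpc_deq[OF bP A(2) chain_map_comp[OF k(1) sc] g k(2)]] .
    have "deq P Y ([Arr P k A, Arr A s B] @ Inv A s B # w) ([Arr P g B] @ Inv A s B # w)"
      by (rule deq_app[OF ks deq_refl]) (simp add: A)
    moreover have m: "deq A Y ([Arr A s B, Inv A s B] @ w) ([] @ w)"
      by (rule deq_app[OF deq_inv_right deq_refl]) (simp_all add: A)
    have "deq P Y ([Arr P k A] @ [Arr A s B, Inv A s B] @ w) ([Arr P k A] @ [] @ w)"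
      by (rule deq_app[OF deq_refl m]) (simp add: A bP k)
    moreover have "deq P Y (Arr P k A # w) [Arr P g' Y]"
      by (rule Cons.IH[OF A(5) k(1) Cons.prems(3) k(3)])
    ultimately show ?thesis using Inv A(4) deq_trans deq_sym by (metis append_Cons append_Nil)
  qed
qed

lemma word_rep:
  assumes w: "dmor P Y w"
  obtains f where "chain_map P Y f" "deq P Y w [Arr P f Y]"
proof -
  obtain f where f: "chain_map P Y f" "wact P w Y (\<lambda>i x. x) f"
    using wact_ex[OF P w chain_map_id] by blast
  have "deq P Y (Arr P (\<lambda>i x. x) P # w) [Arr P f Y]" by (rule wact_deq[OF w chain_map_id f])
  moreover have "deq P Y ([Arr P (\<lambda>i x. x) P] @ w) ([] @ w)"
    by (rule deq_app[OF deq_ident'[OF bP] deq_refl[OF w]])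
  ultimately show thesis using that[OF f(1)] deq_trans deq_sym by (metis append_Cons append_Nil)
qed

text \<open>Equal words act equally on the identity of \<open>P\<close>, and the action of an arrow
  on the identity recovers its homotopy class.\<close>

lemma deq_Arr_iff:
  assumes Y: "bcplx Y" and f: "chain_map P Y f" and g: "chain_map P Y g"
  shows "deq P Y [Arr P f Y] [Arr P g Y] \<longleftrightarrow> htpc P Y f g"
proof
  assume "deq P Y [Arr P f Y] [Arr P g Y]"
  then have "wact P [Arr P f Y] Y (\<lambda>i x. x) g \<longleftrightarrow> wact P [Arr P g Y] Y (\<lambda>i x. x) g"
    by (rule deq_wact[OF P _ chain_map_id])
  then show "htpc P Y f g" using htpc_refl[OF Y, of P g] by simp
qed (rule htpc_deq[OF bP Y f g])

end

section \<open>Zero morphisms, isomorphisms and indecomposability in the derived category\<close>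

lemma deq_zero_left: "dmor X Y u \<Longrightarrow> bcplx Z \<Longrightarrow> deq X Z (u @ zero_mor Y Z) (zero_mor X Z)"
proof (induction u arbitrary: X)
  case Nil
  then show ?case by (auto simp: zero_mor_def intro!: deq_refl chain_map_zero)
next
  case (Cons l u)
  have z: "chain_map A Z (\<lambda>i x. 0)" if "bcplx A" for A by (rule chain_map_zero[OF that Cons.prems(2)])
  have IH: "deq (tgt l) Z (u @ zero_mor Y Z) (zero_mor (tgt l) Z)" using Cons by auto
  have "deq X Z ([l] @ (u @ zero_mor Y Z)) ([l] @ zero_mor (tgt l) Z)"
    by (rule deq_app[OF deq_refl IH]) (use Cons.prems in \<open>auto dest: valid_bcplx\<close>)
  moreover have "deq X Z ([l] @ zero_mor (tgt l) Z) (zero_mor X Z)"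
  proof (cases l)
    case (Arr A f B)
    then have "bcplx A" "bcplx B" "chain_map A B f" "X = A" using Cons.prems by auto
    then show ?thesis
      using deq_comp'[of A B f Z "\<lambda>i x. 0"] z Cons.prems(2) Arr by (simp add: zero_mor_def)
  next
    case (Inv A s B)
    then have A: "bcplx A" "bcplx B" "quasi_iso A B s" "X = B" using Cons.prems by auto
    note sc = quasi_iso_chain[OF A(3)]
    \<comment> \<open>\<open>deq\<close> has no rule for zero. The zero arrow out of A is s followed
      by the zero arrow out of B, and this s cancels against its formal inverse.\<close>
    have "deq B Z ([Inv A s B] @ [Arr A s B, Arr B (\<lambda>i x. 0) Z]) ([Inv A s B] @ [Arr A (\<lambda>i x. 0) Z])"
      by (rule deq_app[OF deq_refl deq_comp'[OF sc z[OF A(2)] A(1,2) Cons.prems(2)]]) (simp add: A)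
    then have 1: "deq B Z [Inv A s B, Arr A s B, Arr B (\<lambda>i x. 0) Z] [Inv A s B, Arr A (\<lambda>i x. 0) Z]" by simp
    have "deq B Z ([Inv A s B, Arr A s B] @ [Arr B (\<lambda>i x. 0) Z]) ([] @ [Arr B (\<lambda>i x. 0) Z])"
      by (rule deq_app[OF deq_inv_left deq_refl]) (simp_all add: A z Cons.prems)
    then have 2: "deq B Z [Inv A s B, Arr A s B, Arr B (\<lambda>i x. 0) Z] [Arr B (\<lambda>i x. 0) Z]" by simp
    show ?thesis using deq_trans[OF deq_sym[OF 1] 2] Inv A(4) by (simp add: zero_mor_def)
  qed
  ultimately show ?case using deq_trans by simp
qed

lemma deq_zero_right: "dmor Y Z v \<Longrightarrow> bcplx X \<Longrightarrow> deq X Z (zero_mor X Y @ v) (zero_mor X Z)"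
proof (induction v arbitrary: Y)
  case Nil
  then show ?case by (auto simp: zero_mor_def intro!: deq_refl chain_map_zero)
next
  case (Cons l v)
  have z: "chain_map X A (\<lambda>i x. 0)" if "bcplx A" for A by (rule chain_map_zero[OF Cons.prems(2) that])
  have v: "dmor (tgt l) Z v" using Cons.prems by auto
  have "deq X (tgt l) (zero_mor X Y @ [l]) (zero_mor X (tgt l))"
  proof (cases l)
    case (Arr A f B)
    then have A: "bcplx A" "bcplx B" "chain_map A B f" "Y = A" using Cons.prems by auto
    then have "f i 0 = 0" for i
      using hom_zero[OF bcplx_hmod chain_hom] by fast
    then show ?thesis
      using deq_comp'[OF z[OF A(1)] A(3) Cons.prems(2) A(1,2)] Arr A by (simp add: zero_mor_def)
  next
    case (Inv A s B)
    then have A: "bcplx A" "bcplx B" "quasi_iso A B s" "Y = B" using Cons.prems by auto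
    note sc = quasi_iso_chain[OF A(3)]
    have "s i 0 = 0" for i
      by (rule hom_zero[OF bcplx_hmod[OF A(1)] chain_hom[OF sc]])
    then have "deq X B [Arr X (\<lambda>i x. 0) A, Arr A s B] [Arr X (\<lambda>i x. 0) B]"
      using deq_comp'[OF z[OF A(1)] sc Cons.prems(2) A(1,2)] by simp
    then have "deq X A ([Arr X (\<lambda>i x. 0) A, Arr A s B] @ [Inv A s B]) ([Arr X (\<lambda>i x. 0) B] @ [Inv A s B])"
      by (rule deq_app[OF _ deq_refl]) (simp add: A)
    then have 1: "deq X A [Arr X (\<lambda>i x. 0) A, Arr A s B, Inv A s B] [Arr X (\<lambda>i x. 0) B, Inv A s B]" by simp
    have "deq X A ([Arr X (\<lambda>i x. 0) A] @ [Arr A s B, Inv A s B]) ([Arr X (\<lambda>i x. 0) A] @ [])"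
      by (rule deq_app[OF deq_refl deq_inv_right]) (simp_all add: A z Cons.prems)
    then have 2: "deq X A [Arr X (\<lambda>i x. 0) A, Arr A s B, Inv A s B] [Arr X (\<lambda>i x. 0) A]" by simp
    show ?thesis using deq_trans[OF deq_sym[OF 1] 2] Inv A(4) by (simp add: zero_mor_def)
  qed
  then have "deq X Z ((zero_mor X Y @ [l]) @ v) (zero_mor X (tgt l) @ v)"
    by (rule deq_app[OF _ deq_refl[OF v]])
  then show ?case using deq_trans[OF _ Cons.IH[OF v Cons.prems(2)]] by simp
qed

lemma dmor_zero: "bcplx X \<Longrightarrow> bcplx Y \<Longrightarrow> dmor X Y (zero_mor X Y)"
  by (simp add: zero_mor_def chain_map_zero)

lemma d_isoE:
  assumes "d_iso X Y"
  obtains w v where "dmor X Y w" "dmor Y X v" "deq X X (w @ v) []" "deq Y Y (v @ w) []"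
  using assms unfolding d_iso_def d_isomorphism_def by blast

lemma d_isoI: "dmor X Y w \<Longrightarrow> dmor Y X v \<Longrightarrow> deq X X (w @ v) [] \<Longrightarrow> deq Y Y (v @ w) [] \<Longrightarrow> d_iso X Y"
  unfolding d_iso_def d_isomorphism_def by blast

lemma d_iso_bcplx: "d_iso X Y \<Longrightarrow> bcplx X \<and> bcplx Y"
  by (meson d_isoE dmor_bcplx)

lemma d_iso_refl: "bcplx X \<Longrightarrow> d_iso X X"
  by (rule d_isoI[of X X "[]" "[]"]) (auto intro: deq_refl)

lemma d_iso_sym: "d_iso X Y \<Longrightarrow> d_iso Y X"
  by (meson d_isoE d_isoI)

lemma deq_cancel:
  assumes "dmor X A u" "deq A A w []" "dmor A Y v"
  shows "deq X Y (u @ w @ v) (u @ v)"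
  using deq_cong[OF assms] by simp

lemma d_iso_trans:
  assumes "d_iso X Y" "d_iso Y Z" shows "d_iso X Z"
proof -
  obtain w v where 1: "dmor X Y w" "dmor Y X v" "deq X X (w @ v) []" "deq Y Y (v @ w) []"
    using assms(1) by (rule d_isoE)
  obtain w' v' where 2: "dmor Y Z w'" "dmor Z Y v'" "deq Y Y (w' @ v') []" "deq Z Z (v' @ w') []"
    using assms(2) by (rule d_isoE)
  show ?thesis
  proof (rule d_isoI[OF dmor_append[OF 1(1) 2(1)] dmor_append[OF 2(2) 1(2)]])
    show "deq X X ((w @ w') @ v' @ v) []"
      using deq_trans[OF deq_cancel[OF 1(1) 2(3) 1(2)] 1(3)] by simp
    show "deq Z Z ((v' @ v) @ w @ w') []"
      using deq_trans[OF deq_cancel[OF 2(2) 1(4) 2(1)] 2(4)] by simp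
  qed
qed

lemma d_iso_quasi_iso: "bcplx X \<Longrightarrow> bcplx Y \<Longrightarrow> quasi_iso X Y s \<Longrightarrow> d_iso X Y"
  by (rule d_isoI[of X Y "[Arr X s Y]" "[Inv X s Y]"])
    (auto simp: quasi_iso_chain intro: deq_inv_left deq_inv_right)

lemma d_iso_htpc:
  assumes X: "bcplx X" and Y: "bcplx Y" and f: "chain_map X Y f" and g: "chain_map Y X g"
    and "htpc X X (\<lambda>i x. g i (f i x)) (\<lambda>i x. x)" "htpc Y Y (\<lambda>i x. f i (g i x)) (\<lambda>i x. x)"
  shows "d_iso X Y"
proof (rule d_isoI[of X Y "[Arr X f Y]" "[Arr Y g X]"])
  show "deq X X ([Arr X f Y] @ [Arr Y g X]) []"
    using deq_trans[OF deq_trans[OF deq_comp'[OF f g X Y X] htpc_deq[OF X X chain_map_comp[OF f g] chain_map_id assms(5)]] deq_ident'[OF X]] by simp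
  show "deq Y Y ([Arr Y g X] @ [Arr X f Y]) []"
    using deq_trans[OF deq_trans[OF deq_comp'[OF g f Y X Y] htpc_deq[OF Y Y chain_map_comp[OF g f] chain_map_id assms(6)]] deq_ident'[OF Y]] by simp
qed (simp_all add: X Y f g)

lemma hom_vanishes_iso:
  assumes X: "d_iso X X'" and Y: "d_iso Y Y'" and v: "hom_vanishes X Y"
  shows "hom_vanishes X' Y'"
  unfolding hom_vanishes_def
proof (intro allI impI)
  fix w assume w: "dmor X' Y' w"
  obtain a b where a: "dmor X X' a" "dmor X' X b" "deq X' X' (b @ a) []" using X by (rule d_isoE)
  obtain c d where c: "dmor Y Y' c" "dmor Y' Y d" "deq Y' Y' (d @ c) []" using Y by (rule d_isoE)
  have awd: "dmor X Y (a @ w @ d)" by (blast intro: dmor_append a c w)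
  then have "deq X Y (a @ w @ d) (zero_mor X Y)" using v unfolding hom_vanishes_def by blast
  then have "deq X' Y' (b @ (a @ w @ d) @ c) (b @ zero_mor X Y @ c)"
    by (rule deq_cong[OF a(2) _ c(1)])
  moreover have "deq X' Y' (b @ (a @ w @ d) @ c) w"
  proof -
    have "deq X' Y' ([] @ (b @ a) @ (w @ d @ c)) ([] @ w @ d @ c)"
      by (rule deq_cancel[OF _ a(3)]) (use a w c dmor_bcplx[OF w] in \<open>auto intro!: dmor_append\<close>)
    moreover have "deq X' Y' (w @ (d @ c) @ []) (w @ [])"
      by (rule deq_cancel[OF w c(3)]) (use dmor_bcplx[OF w] in auto)
    ultimately show ?thesis using deq_trans by simp
  qed
  moreover have "deq X' Y' (b @ zero_mor X Y @ c) (zero_mor X' Y')"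
  proof -
    have b: "bcplx X" "bcplx X'" "bcplx Y" "bcplx Y'" using dmor_bcplx a(1) c(1) by auto
    have "deq X' Y' ((b @ zero_mor X Y) @ c) (zero_mor X' Y @ c)"
      by (rule deq_app[OF deq_zero_left[OF a(2) b(3)] deq_refl[OF c(1)]])
    then show ?thesis using deq_trans[OF _ deq_zero_right[OF c(1) b(2)]] by simp
  qed
  ultimately show "deq X' Y' w (zero_mor X' Y')" using deq_trans deq_sym by metis
qed

lemma deq_zero_iff:
  assumes P: "proj_cplx P" and Y: "bcplx Y" and f: "chain_map P Y f"
  shows "deq P Y [Arr P f Y] (zero_mor P Y) \<longleftrightarrow> null_htpy P Y f"
  using deq_Arr_iff[OF P Y f chain_map_zero[OF bP[OF P] Y]] by (simp add: zero_mor_def htpc_def)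

lemma hom_vanishes_iff:
  assumes P: "proj_cplx P" and Y: "bcplx Y"
  shows "hom_vanishes P Y \<longleftrightarrow> (\<forall>f. chain_map P Y f \<longrightarrow> null_htpy P Y f)"
proof
  assume "hom_vanishes P Y"
  then show "\<forall>f. chain_map P Y f \<longrightarrow> null_htpy P Y f"
    unfolding hom_vanishes_def using deq_zero_iff[OF P Y] Y bP[OF P] by fastforce
next
  assume n: "\<forall>f. chain_map P Y f \<longrightarrow> null_htpy P Y f"
  show "hom_vanishes P Y"
    unfolding hom_vanishes_def
  proof (intro allI impI)
    fix w assume "dmor P Y w"
    then obtain f where "chain_map P Y f" "deq P Y w [Arr P f Y]" using word_rep[OF P] by blast
    then show "deq P Y w (zero_mor P Y)" using n deq_zero_iff[OF P Y] deq_trans by blast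
  qed
qed

lemma d_iso_zero_null:
  assumes P: "proj_cplx P" and z: "d_iso P zero_cplx"
  shows "null_htpy P P (\<lambda>i x. x)"
proof -
  have "hom_vanishes P zero_cplx"
    unfolding hom_vanishes_iff[OF P bcplx_zero]
  proof (intro allI impI)
    fix f assume f: "chain_map P zero_cplx f"
    show "null_htpy P zero_cplx f"
      by (rule null_cong[OF null_zero[OF bcplx_zero]]) (use chain_car[OF f] in \<open>simp add: zero_cplx_def\<close>)
  qed
  then have "hom_vanishes P P"
    by (rule hom_vanishes_iso[OF d_iso_refl[OF bP[OF P]] d_iso_sym[OF z]])
  then show ?thesis unfolding hom_vanishes_iff[OF P bP[OF P]] using chain_map_id by blast
qed

lemma d_iso_zeroI:
  assumes A: "bcplx A" and n: "deq A A [] (zero_mor A A)"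
  shows "d_iso A zero_cplx"
proof (rule d_isoI[OF dmor_zero[OF A bcplx_zero] dmor_zero[OF bcplx_zero A]])
  show "deq A A (zero_mor A zero_cplx @ zero_mor zero_cplx A) []"
    using deq_trans[OF deq_zero_left[OF dmor_zero[OF A bcplx_zero] A] deq_sym[OF n]] .
  have "deq zero_cplx zero_cplx (zero_mor zero_cplx zero_cplx) [Arr zero_cplx (\<lambda>i x. x) zero_cplx]"
    unfolding zero_mor_def
    by (rule deq_ext'[OF bcplx_zero bcplx_zero chain_map_zero[OF bcplx_zero bcplx_zero]]) (simp add: zero_cplx_def)
  then show "deq zero_cplx zero_cplx (zero_mor zero_cplx A @ zero_mor A zero_cplx) []"
    using deq_trans[OF deq_zero_left[OF dmor_zero[OF bcplx_zero A] bcplx_zero] deq_trans[OF _ deq_ident'[OF bcplx_zero]]] by blast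
qed

text \<open>This is the criterion for indecomposability that can be moved around: unlike
  decompositions, idempotents have adjoints for the Serre pairing and pass through the
  shift.\<close>

definition triv_idem :: "'h::ring_1 cplx \<Rightarrow> bool" where
  "triv_idem P \<longleftrightarrow> \<not> null_htpy P P (\<lambda>i x. x) \<and>
     (\<forall>e. chain_map P P e \<and> htpc P P (\<lambda>i x. e i (e i x)) e \<longrightarrow> null_htpy P P e \<or> htpc P P e (\<lambda>i x. x))"

lemma indecomposable_iso:
  assumes "indecomposable X" "d_iso X Y" shows "indecomposable Y"
  using assms unfolding indecomposable_def by (meson d_iso_trans d_iso_sym d_iso_bcplx)

text \<open>A decomposition into A and B gives the idempotent e of P that projects onto A. If e = 0,
  then compressing e to A shows that the identity of A is zero. If e = 1, then the identity of B
  factors through the zero map from B to A.\<close>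

lemma indecomposableI:
  assumes P: "proj_cplx P" and t: "triv_idem P"
  shows "indecomposable P"
  unfolding indecomposable_def
proof (intro conjI allI impI)
  note bP = bP[OF P]
  show "bcplx P" by (rule bP)
  show "\<not> d_iso P zero_cplx" using d_iso_zero_null[OF P] t unfolding triv_idem_def by blast
  fix A B assume "bcplx A \<and> bcplx B \<and> d_iso P (cplx_sum A B)"
  then have A: "bcplx A" and B: "bcplx B" and iso: "d_iso P (cplx_sum A B)" by auto
  let ?S = "cplx_sum A B"
  have S: "bcplx ?S" by (rule bcplx_cplx_sum[OF A B])
  obtain w v where w: "dmor P ?S w" "dmor ?S P v" "deq P P (w @ v) []" "deq ?S ?S (v @ w) []"
    using iso by (rule d_isoE)
  have c: "chain_map ?S A (\<lambda>i. lft)" "chain_map ?S B (\<lambda>i. rgt)"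
    unfolding chain_map_def by (simp_all add: mod_hom_lft[OF mod_hom_id] mod_hom_rgt[OF mod_hom_id])
  have j: "chain_map A ?S (\<lambda>i x. pr x 0)" "chain_map B ?S (\<lambda>i x. pr 0 x)"
    unfolding chain_map_def by (simp_all add: mod_hom_pr_iff mod_hom_id mod_hom_zero bcplx_hmod A B
        hom_zero[OF bcplx_hmod bcplx_dif, OF A A] hom_zero[OF bcplx_hmod bcplx_dif, OF B B])
  let ?pA = "[Arr ?S (\<lambda>i. lft) A]" and ?pB = "[Arr ?S (\<lambda>i. rgt) B]"
  let ?jA = "[Arr A (\<lambda>i x. pr x 0) ?S]" and ?jB = "[Arr B (\<lambda>i x. pr 0 x) ?S]"
  have d: "dmor ?S A ?pA" "dmor ?S B ?pB" "dmor A ?S ?jA" "dmor B ?S ?jB" using S A B c j by auto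
  have jpA: "deq A A (?jA @ ?pA) []" using deq_trans[OF deq_comp'[OF j(1) c(1) A S A]] deq_ident'[OF A] by simp
  have jpB: "deq B B (?jB @ ?pB) []" using deq_trans[OF deq_comp'[OF j(2) c(2) B S B]] deq_ident'[OF B] by simp
  have jBA: "deq B A (?jB @ ?pA) (zero_mor B A)" using deq_comp'[OF j(2) c(1) B S A] by (simp add: zero_mor_def)
  let ?e = "w @ ?pA @ ?jA @ v"
  have de: "dmor P P ?e" by (blast intro: dmor_append w d)
  obtain e where e: "chain_map P P e" "deq P P ?e [Arr P e P]" using word_rep[OF P de] by blast
  have ee: "deq P P (?e @ ?e) ?e"
  proof -
    have "deq P P ((w @ ?pA @ ?jA) @ (v @ w) @ (?pA @ ?jA @ v)) ((w @ ?pA @ ?jA) @ (?pA @ ?jA @ v))"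
      by (rule deq_cancel[OF _ w(4)]) (blast intro: dmor_append w d)+
    moreover have "deq P P ((w @ ?pA) @ (?jA @ ?pA) @ (?jA @ v)) ((w @ ?pA) @ (?jA @ v))"
      by (rule deq_cancel[OF _ jpA]) (blast intro: dmor_append w d)+
    ultimately show ?thesis using deq_trans by simp
  qed
  have ec: "deq P P (?e @ ?e) [Arr P (\<lambda>i x. e i (e i x)) P]"
    using deq_trans[OF deq_app[OF e(2) e(2)]] deq_comp'[OF e(1) e(1) bP bP bP] by simp
  have "deq P P [Arr P (\<lambda>i x. e i (e i x)) P] [Arr P e P]"
    by (rule deq_trans[OF deq_sym[OF ec] deq_trans[OF ee e(2)]])
  then have "htpc P P (\<lambda>i x. e i (e i x)) e"
    using deq_Arr_iff[OF P bP chain_map_comp[OF e(1) e(1)] e(1)] by simp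
  then consider "null_htpy P P e" | "htpc P P e (\<lambda>i x. x)"
    using t e(1) unfolding triv_idem_def by blast
  then show "d_iso A zero_cplx \<or> d_iso B zero_cplx"
  proof cases
    case 1
    then have z: "deq P P ?e (zero_mor P P)"
      using e deq_zero_iff[OF P bP e(1)] deq_trans by blast
    have u: "dmor A P (?jA @ v)" and u': "dmor P A (w @ ?pA)" by (blast intro: dmor_append w d)+
    have "deq A A ((?jA @ v) @ ?e @ (w @ ?pA)) ((?jA @ v) @ zero_mor P P @ (w @ ?pA))"
      by (rule deq_cong[OF u z u'])
    moreover have "deq A A ((?jA @ v) @ zero_mor P P @ (w @ ?pA)) ((?jA @ v) @ zero_mor P A)"
      by (rule deq_app[OF deq_refl[OF u] deq_zero_right[OF u' bP]])
    moreover have "deq A A ((?jA @ v) @ zero_mor P A) (zero_mor A A)" by (rule deq_zero_left[OF u A])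
    moreover have "deq A A ((?jA @ v) @ ?e @ (w @ ?pA)) []"
    proof -
      have 1: "deq A A (?jA @ (v @ w) @ (?pA @ ?jA @ v @ w @ ?pA)) (?jA @ (?pA @ ?jA @ v @ w @ ?pA))"
        by (rule deq_cancel[OF _ w(4)]) (blast intro: dmor_append w d)+
      have 2: "deq A A ((?jA @ ?pA @ ?jA) @ (v @ w) @ ?pA) ((?jA @ ?pA @ ?jA) @ ?pA)"
        by (rule deq_cancel[OF _ w(4)]) (blast intro: dmor_append w d)+
      have 3: "deq A A ((?jA @ ?pA) @ (?jA @ ?pA)) ([] @ [])"
        by (rule deq_app[OF jpA jpA])
      show ?thesis using deq_trans[OF deq_trans[OF 1[simplified] 2[simplified]] 3[simplified]] by simp
    qed
    ultimately have "deq A A [] (zero_mor A A)" by (meson deq_trans deq_sym)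
    then show ?thesis using d_iso_zeroI[OF A] by blast
  next
    case 2
    then have i: "deq P P ?e []"
      using e deq_Arr_iff[OF P bP e(1) chain_map_id] deq_ident'[OF bP] deq_trans by blast
    have u: "dmor B P (?jB @ v)" and u': "dmor P B (w @ ?pB)" by (blast intro: dmor_append w d)+
    have 1: "deq B B ((?jB @ v) @ ?e @ (w @ ?pB)) ((?jB @ v) @ (w @ ?pB))"
      by (rule deq_cancel[OF u i u'])
    have 2: "deq B B (?jB @ (v @ w) @ ?pB) (?jB @ ?pB)"
      by (rule deq_cancel[OF d(4) w(4) d(2)])
    have 3: "deq B B (?jB @ (v @ w) @ (?pA @ ?jA @ v @ w @ ?pB)) (?jB @ (?pA @ ?jA @ v @ w @ ?pB))"
      by (rule deq_cancel[OF _ w(4)]) (blast intro: dmor_append w d)+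
    have 4: "deq B B ((?jB @ ?pA) @ (?jA @ v @ w @ ?pB)) (zero_mor B A @ (?jA @ v @ w @ ?pB))"
      by (rule deq_app[OF jBA deq_refl]) (blast intro: dmor_append w d)+
    have 5: "deq B B (zero_mor B A @ (?jA @ v @ w @ ?pB)) (zero_mor B B)"
      by (rule deq_zero_right[OF _ B]) (blast intro: dmor_append w d)+
    have "deq B B [] ((?jB @ v) @ ?e @ (w @ ?pB))"
      using deq_sym[OF deq_trans[OF deq_trans[OF 1[simplified] 2[simplified]] jpB[simplified]]] by simp
    moreover have "deq B B ((?jB @ v) @ ?e @ (w @ ?pB)) (zero_mor B B)"
      using deq_trans[OF deq_trans[OF 3[simplified] 4[simplified]] 5[simplified]] by simp
    ultimately have "deq B B [] (zero_mor B B)" by (rule deq_trans)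
    then show ?thesis using d_iso_zeroI[OF B] by blast
  qed
qed

subsection \<open>The shift functor\<close>

lemma chain_map_shift:
  assumes f: "chain_map X Y f" and X: "bcplx X"
  shows "chain_map (shift X) (shift Y) (\<lambda>i. f (i + 1))"
  unfolding chain_map_def
proof (intro conjI allI ballI)
  fix i x
  show "mod_hom (ob (shift X) i) (ob (shift Y) i) (f (i + 1))" using chain_hom[OF f] by simp
  assume "x \<in> car (ob (shift X) i)"
  then have x: "x \<in> car (ob X (i + 1))" by simp
  show "f (i + 1 + 1) (dif (shift X) i x) = dif (shift Y) i (f (i + 1) x)"
    using hom_uminus[OF bcplx_hmod[OF X] chain_hom[OF f] bcplx_dif_car[OF X x]] chain_dif[OF f x] by simp
qed

lemma cycles_shift: "cycles (shift X) i = cycles X (i + 1)"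
  by (simp add: cycles_def)

lemma boundaries_shift: assumes X: "bcplx X" shows "boundaries (shift X) i = boundaries X (i + 1)"
proof -
  have m: "- x \<in> car (ob X i)" "dif X i (- x) = - dif X i x" if "x \<in> car (ob X i)" for x
    using that hmod_uminus[OF bcplx_hmod[OF X]] hom_uminus[OF bcplx_hmod[OF X] bcplx_dif[OF X]] by auto
  have "(\<lambda>x. - dif X i x) ` car (ob X i) = dif X i ` car (ob X i)"
  proof (intro subset_antisym subsetI)
    fix y assume "y \<in> (\<lambda>x. - dif X i x) ` car (ob X i)"
    then obtain x where "x \<in> car (ob X i)" "y = - dif X i x" by blast
    then show "y \<in> dif X i ` car (ob X i)" using m[of x] by (intro image_eqI[of _ _ "- x"]) auto
  next
    fix y assume "y \<in> dif X i ` car (ob X i)"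
    then obtain x where "x \<in> car (ob X i)" "y = dif X i x" by blast
    then show "y \<in> (\<lambda>x. - dif X i x) ` car (ob X i)" using m[of x] by (intro image_eqI[of _ _ "- x"]) auto
  qed
  then show ?thesis by (simp add: boundaries_def)
qed

lemma quasi_iso_shift:
  assumes X: "bcplx X" and Y: "bcplx Y" and s: "quasi_iso X Y s"
  shows "quasi_iso (shift X) (shift Y) (\<lambda>i. s (i + 1))"
  using s chain_map_shift[OF _ X, of Y s]
  unfolding quasi_iso_def cycles_shift boundaries_shift[OF X] boundaries_shift[OF Y] by blast

lemma valid_shift: "valid l \<Longrightarrow> valid (shift_letter l)"
  by (cases l) (auto simp: bcplx_shift chain_map_shift quasi_iso_shift)

lemma src_shift: "src (shift_letter l) = shift (src l)" and tgt_shift: "tgt (shift_letter l) = shift (tgt l)"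
  by (cases l; simp)+

lemma dmor_shift: "dmor X Y w \<Longrightarrow> dmor (shift X) (shift Y) (shift_mor w)"
  by (induction w arbitrary: X) (auto simp: shift_mor_def bcplx_shift valid_shift src_shift tgt_shift)

lemma deq_shift: "deq X Y w w' \<Longrightarrow> deq (shift X) (shift Y) (shift_mor w) (shift_mor w')"
proof (induction rule: deq.induct)
  case (deq_refl X Y w) then show ?case by (intro deq.deq_refl dmor_shift)
next
  case (deq_sym X Y w w') then show ?case using deq.deq_sym by blast
next
  case (deq_trans X Y w w' w'') then show ?case using deq.deq_trans by blast
next
  case (deq_cong X A u B w w' Y v)
  then show ?case using deq.deq_cong[OF dmor_shift[OF deq_cong(1)] deq_cong(4) dmor_shift[OF deq_cong(3)]]
    by (simp add: shift_mor_def)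
next
  case (deq_ext X f Y g)
  then show ?case
    using deq.deq_ext[of "shift X" "\<lambda>i. f (i + 1)" "shift Y" "\<lambda>i. g (i + 1)"] valid_shift[OF deq_ext(1)] valid_shift[OF deq_ext(2)]
    by (simp add: shift_mor_def)
next
  case (deq_ident X)
  then show ?case using deq.deq_ident[OF bcplx_shift[OF deq_ident]] by (simp add: shift_mor_def)
next
  case (deq_comp X f Y g Z)
  then show ?case
    using deq.deq_comp[of "shift X" "\<lambda>i. f (i + 1)" "shift Y" "\<lambda>i. g (i + 1)" "shift Z"] valid_shift[OF deq_comp(1)] valid_shift[OF deq_comp(2)]
    by (simp add: shift_mor_def)
next
  case (deq_inv_right X s Y)
  then show ?case using deq.deq_inv_right[of "shift X" "\<lambda>i. s (i + 1)" "shift Y"] valid_shift[OF deq_inv_right]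
    by (simp add: shift_mor_def)
next
  case (deq_inv_left X s Y)
  then show ?case using deq.deq_inv_left[of "shift X" "\<lambda>i. s (i + 1)" "shift Y"] valid_shift[OF deq_inv_left]
    by (simp add: shift_mor_def)
qed

lemma d_iso_shift: assumes "d_iso X Y" shows "d_iso (shift X) (shift Y)"
proof -
  obtain w v where w: "dmor X Y w" "dmor Y X v" "deq X X (w @ v) []" "deq Y Y (v @ w) []"
    using assms by (rule d_isoE)
  show ?thesis
    by (rule d_isoI[OF dmor_shift[OF w(1)] dmor_shift[OF w(2)]])
      (use deq_shift[OF w(3)] deq_shift[OF w(4)] in \<open>simp_all add: shift_mor_def\<close>)
qed

lemma chain_map_unshift:
  assumes f: "chain_map X Y f" and X: "bcplx X"
  shows "chain_map (unshift X) (unshift Y) (\<lambda>i. f (i - 1))"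
  unfolding chain_map_def
proof (intro conjI allI ballI)
  fix i x
  show "mod_hom (ob (unshift X) i) (ob (unshift Y) i) (f (i - 1))" using chain_hom[OF f] by simp
  assume "x \<in> car (ob (unshift X) i)"
  then have x: "x \<in> car (ob X (i - 1))" by simp
  show "f (i + 1 - 1) (dif (unshift X) i x) = dif (unshift Y) i (f (i - 1) x)"
    using hom_uminus[OF bcplx_hmod[OF X] chain_hom[OF f] bcplx_dif_car'[OF X x]] chain_dif'[OF f x] by simp
qed

lemma null_shift:
  assumes n: "null_htpy X Y f" and Y: "bcplx Y" and X: "bcplx X"
  shows "null_htpy (shift X) (shift Y) (\<lambda>i. f (i + 1))"
proof -
  obtain h where h: "\<And>i. mod_hom (ob X i) (ob Y (i - 1)) (h i)"
    "\<And>i x. x \<in> car (ob X i) \<Longrightarrow> f i x = dif Y (i - 1) (h i x) + h (i + 1) (dif X i x)"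
    using n by (rule null_htpyE) blast
  have h': "mod_hom (ob X (i + 1)) (ob Y i) (h (i + 1))" for i using h(1)[of "i + 1"] by simp
  show ?thesis
  \<comment> \<open>The differentials of the shifted complexes carry a sign, so the homotopy has to
    change its sign too.\<close>
  proof (rule null_htpyI[where h = "\<lambda>i x. - h (i + 1) x"])
    show "mod_hom (ob (shift X) i) (ob (shift Y) (i - 1)) (\<lambda>x. - h (i + 1) x)" for i
      using mod_hom_uminus[OF bcplx_hmod[OF Y] h', of i] by simp
    fix i x assume "x \<in> car (ob (shift X) i)"
    then have x: "x \<in> car (ob X (i + 1))" by simp
    show "f (i + 1) x = dif (shift Y) (i - 1) (- h (i + 1) x) + - h (i + 1 + 1) (dif (shift X) i x)"
      using h(2)[OF x] hom_uminus[OF bcplx_hmod[OF Y] bcplx_dif[OF Y] hom_car[OF h' x]]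
        hom_uminus[OF bcplx_hmod[OF X] h' bcplx_dif_car[OF X x]] by simp
  qed
qed

lemma null_unshift:
  assumes n: "null_htpy X Y f" and Y: "bcplx Y" and X: "bcplx X"
  shows "null_htpy (unshift X) (unshift Y) (\<lambda>i. f (i - 1))"
proof -
  obtain h where h: "\<And>i. mod_hom (ob X i) (ob Y (i - 1)) (h i)"
    "\<And>i x. x \<in> car (ob X i) \<Longrightarrow> f i x = dif Y (i - 1) (h i x) + h (i + 1) (dif X i x)"
    using n by (rule null_htpyE) blast
  show ?thesis
  proof (rule null_htpyI[where h = "\<lambda>i x. - h (i - 1) x"])
    show "mod_hom (ob (unshift X) i) (ob (unshift Y) (i - 1)) (\<lambda>x. - h (i - 1) x)" for i
      using mod_hom_uminus[OF bcplx_hmod[OF Y] h(1), of "i - 1"] by simp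
    fix i x assume "x \<in> car (ob (unshift X) i)"
    then have x: "x \<in> car (ob X (i - 1))" by simp
    show "f (i - 1) x = dif (unshift Y) (i - 1) (- h (i - 1) x) + - h (i + 1 - 1) (dif (unshift X) i x)"
      using h(2)[OF x] hom_uminus[OF bcplx_hmod[OF Y] bcplx_dif'[OF Y] hom_car[OF h(1) x]]
        hom_uminus[OF bcplx_hmod[OF X] h(1) bcplx_dif_car'[OF X x]] by simp
  qed
qed

lemma null_shift_iff:
  assumes "bcplx X" "bcplx Y"
  shows "null_htpy (shift X) (shift Y) (\<lambda>i. f (i + 1)) \<longleftrightarrow> null_htpy X Y f"
  using null_shift[of X Y f] null_unshift[of "shift X" "shift Y" "\<lambda>i. f (i + 1)"] assms bcplx_shift by auto

lemma null_unshift_iff: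
  assumes "bcplx X" "bcplx Y"
  shows "null_htpy (unshift X) (unshift Y) (\<lambda>i. f (i - 1)) \<longleftrightarrow> null_htpy X Y f"
  using null_unshift[of X Y f] null_shift[of "unshift X" "unshift Y" "\<lambda>i. f (i - 1)"] assms bcplx_unshift by auto

lemma triv_idem_shift:
  assumes P: "bcplx P" and t: "triv_idem P" shows "triv_idem (shift P)"
proof -
  have 1: "null_htpy (shift P) (shift P) f \<longleftrightarrow> null_htpy P P (\<lambda>i. f (i - 1))" for f
    using null_shift_iff[OF P P, of "\<lambda>i. f (i - 1)"] by simp
  have "chain_map P P (\<lambda>i. f (i - 1))" if "chain_map (shift P) (shift P) f" for f
    using chain_map_unshift[OF that bcplx_shift[OF P]] by simp
  then show ?thesis using t unfolding triv_idem_def 1 htpc_def by auto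
qed

lemma triv_idem_unshift:
  assumes P: "bcplx P" and t: "triv_idem P" shows "triv_idem (unshift P)"
proof -
  have 1: "null_htpy (unshift P) (unshift P) f \<longleftrightarrow> null_htpy P P (\<lambda>i. f (i + 1))" for f
    using null_unshift_iff[OF P P, of "\<lambda>i. f (i + 1)"] by simp
  have "chain_map P P (\<lambda>i. f (i + 1))" if "chain_map (unshift P) (unshift P) f" for f
    using chain_map_shift[OF that bcplx_unshift[OF P]] by simp
  then show ?thesis using t unfolding triv_idem_def 1 htpc_def by auto
qed

section \<open>Submodules of free modules\<close>

definition smul :: "'h::ring_1 \<Rightarrow> 'h elt \<Rightarrow> 'h elt" where
  "smul a x = (\<lambda>n. a * x n)"

definition free :: "nat \<Rightarrow> 'h::ring_1 elt set" where
  "free n = {x. \<forall>j\<ge>n. x j = 0}"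

definition std :: "'h::ring_1 elt set \<Rightarrow> ('h, 'h elt) hmod" where
  "std A = \<lparr>car = A, act = smul\<rparr>"

definition unit_elt :: "nat \<Rightarrow> 'h::ring_1 \<Rightarrow> 'h elt" where
  "unit_elt j a = (\<lambda>i. if i = j then a else 0)"

text \<open>The concrete projectives of the proof. Over a hereditary algebra a submodule of a free
  module is projective, and a common action makes \<open>k\<close> act by the same formula on all of
  them.\<close>

definition pmod :: "('h::ring_1, 'h elt) hmod \<Rightarrow> bool" where
  "pmod M \<longleftrightarrow> hmodule M \<and> act M = smul \<and> (\<exists>n. car M \<subseteq> free n)"

definition pcplx :: "'h::ring_1 cplx \<Rightarrow> bool" where
  "pcplx P \<longleftrightarrow> bcplx P \<and> (\<forall>i. pmod (ob P i))"

lemmas fun_apply = plus_fun_apply minus_apply uminus_apply zero_fun_apply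

lemma car_std [simp]: "car (std A) = A" and act_std [simp]: "act (std A) = smul"
  by (simp_all add: std_def)

lemma sum_fun_eval: "sum f I j = (\<Sum>i\<in>I. f i j)" for f :: "'i \<Rightarrow> 'j \<Rightarrow> 'b::ab_group_add"
  by (induction I rule: infinite_finite_induct) (simp_all add: fun_apply)

lemma smul_pr: "pr (smul a (lft z)) (smul a (rgt z)) = smul a z"
  unfolding smul_def pr_def lft_def rgt_def by (auto elim: oddE)

lemma smul_add: "smul a (x + y) = smul a x + smul a y" and smul_diff: "smul a (x - y) = smul a x - smul a y"
  and add_smul: "smul (a + b) x = smul a x + smul b x" and mult_smul: "smul (a * b) x = smul a (smul b x)"
  and one_smul: "smul 1 x = x"
  by (auto simp: smul_def fun_apply algebra_simps)

lemma hmodule_smulI: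
  assumes "act M = smul" "0 \<in> car M" "\<And>x y. x \<in> car M \<Longrightarrow> y \<in> car M \<Longrightarrow> x - y \<in> car M"
    "\<And>a x. x \<in> car M \<Longrightarrow> smul a x \<in> car M"
  shows "hmodule M"
  unfolding hmodule_def by (simp add: assms smul_add add_smul mult_smul one_smul)

lemma hmodule_free: "hmodule (std (free n))"
  by (rule hmodule_smulI) (auto simp: free_def smul_def fun_apply)

lemma free_0: "free 0 = {0}"
  by (auto simp: free_def fun_eq_iff fun_apply)

lemma pmod_free: "pmod (std (free n))"
  unfolding pmod_def using hmodule_free by auto

lemma pmodD: "pmod M \<Longrightarrow> hmodule M" "pmod M \<Longrightarrow> act M = smul" by (auto simp: pmod_def)

text \<open>Interleaving moves coordinate k to 2k or 2k + 1, and 2(m + n) bounds both.\<close>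

lemma mod_sum_free:
  assumes "car M \<subseteq> free m" "car N \<subseteq> free n"
  shows "car (mod_sum M N) \<subseteq> free (2 * (m + n))"
proof
  fix z assume "z \<in> car (mod_sum M N)"
  then have l: "lft z \<in> free m" and r: "rgt z \<in> free n" using assms by auto
  have "z j = 0" if "j \<ge> 2 * (m + n)" for j
  proof (cases "even j")
    case True
    then obtain k where "j = 2 * k" by blast
    then show ?thesis using l that by (simp add: free_def lft_def)
  next
    case False
    then obtain k where "j = 2 * k + 1" by (rule oddE)
    then show ?thesis using r that by (simp add: free_def rgt_def)
  qed
  then show "z \<in> free (2 * (m + n))" by (simp add: free_def)
qed

lemma pmod_mod_sum:
  assumes M: "pmod M" and N: "pmod N" shows "pmod (mod_sum M N)"
proof -
  have "act (mod_sum M N) = smul"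
    using pmodD(2)[OF M] pmodD(2)[OF N] by (intro ext) (simp add: smul_pr)
  then show ?thesis
    using hmodule_mod_sum[OF pmodD(1)[OF M] pmodD(1)[OF N]] M N mod_sum_free unfolding pmod_def by metis
qed

lemma pmod_sub:
  assumes M: "pmod M" and "A \<subseteq> car M" "hmodule (std A)"
  shows "pmod (std A)"
  using assms unfolding pmod_def by auto

lemma pmod_kernel:
  assumes M: "pmod M" and f: "mod_hom M N f"
  shows "pmod (std {x \<in> car M. f x = 0})"
proof (rule pmod_sub[OF M])
  note H = pmodD(1)[OF M]
  \<comment> \<open>\<open>N\<close> is not assumed to be a module, so this is deduced through
    \<open>f\<close>.\<close>
  have "act N a 0 = 0" for a
    using hom_act[OF f hmod_zero[OF H], of a] hom_zero[OF H f] act_zero[OF H] by simp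
  then show "hmodule (std {x \<in> car M. f x = 0})"
    using hmod_zero[OF H] hmod_diff[OF H] hmod_act[OF H] hom_zero[OF H f] hom_diff[OF H f] hom_act[OF f] pmodD(2)[OF M]
    by (intro hmodule_smulI) auto
qed auto

text \<open>Split off the last coordinate: its values form a left ideal.\<close>

lemma projective_sub_free:
  assumes her: "hereditary TYPE('h::ring_1)"
  shows "hmodule M \<Longrightarrow> act M = smul \<Longrightarrow> car M \<subseteq> free n \<Longrightarrow> projective (M :: ('h, 'h elt) hmod)"
proof (induction n arbitrary: M)
  case 0
  then have "car M = {0}" using hmod_zero[OF 0(1)] by (auto simp: free_0)
  then show ?case
    unfolding projective_def using 0(1) hom_zero[OF 0(1)]
    by (metis hom_zero mod_hom_zero singletonD)
next
  case (Suc n)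
  note M = Suc.prems(1) and aM = Suc.prems(2) and sub = Suc.prems(3)
  define I where "I = (\<lambda>x. x n) ` car M"
  have li: "left_ideal I"
    unfolding left_ideal_def
  proof (intro conjI ballI allI)
    show "0 \<in> I" unfolding I_def using hmod_zero[OF M] by (auto simp: fun_apply intro!: image_eqI[of _ _ 0])
    fix a x assume "x \<in> I"
    then obtain x' where x': "x = x' n" "x' \<in> car M" by (auto simp: I_def)
    show "a * x \<in> I" unfolding I_def
      by (rule image_eqI[of _ _ "smul a x'"]) (use hmod_act[OF M x'(2)] in \<open>simp_all add: x' smul_def aM\<close>)
    fix y assume "y \<in> I"
    then obtain y' where y': "y = y' n" "y' \<in> car M" by (auto simp: I_def)
    show "x - y \<in> I" unfolding I_def
      by (rule image_eqI[of _ _ "x' - y'"]) (simp_all add: x' y' fun_apply hmod_diff[OF M])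
  qed
  define PI where "PI = \<lparr>car = I, act = ((*) :: 'h \<Rightarrow> 'h \<Rightarrow> 'h)\<rparr>"
  have prI: "projective PI" using her li unfolding hereditary_def PI_def by blast
  \<comment> \<open>Projectivity is tested only against modules whose elements have type
    \<open>'h elt\<close>, so the ideal is copied into coordinate n.\<close>
  define N where "N = std (unit_elt n ` I)"
  have u: "unit_elt n (x - y) = unit_elt n x - unit_elt n y" "unit_elt n (x + y) = unit_elt n x + unit_elt n y"
     "unit_elt n (a * x) = smul a (unit_elt n x)" "unit_elt n 0 = 0" for x y a :: 'h
    by (auto simp: unit_elt_def smul_def fun_apply fun_eq_iff)
  have hN: "hmodule N"
  proof (rule hmodule_smulI)
    show "0 \<in> car N" using li u(4) unfolding N_def left_ideal_def by (metis car_std image_eqI)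
    show "x - y \<in> car N" if "x \<in> car N" "y \<in> car N" for x y
      using that li unfolding N_def left_ideal_def by (auto simp: u(1)[symmetric])
    show "smul a x \<in> car N" if "x \<in> car N" for a x
      using that li unfolding N_def left_ideal_def by (auto simp: u(3)[symmetric])
  qed (simp add: N_def)
  have 1: "mod_hom M N (\<lambda>x. unit_elt n (x n))"
    unfolding mod_hom_def N_def I_def by (simp add: aM fun_apply u(2)) (simp add: smul_def u(3))
  have 2: "(\<lambda>x. unit_elt n (x n)) ` car M = car N" by (auto simp: N_def I_def)
  have 3: "mod_hom PI N (unit_elt n)" unfolding mod_hom_def by (auto simp: PI_def N_def u)
  have carPI: "car PI = I" by (simp add: PI_def)
  have sub': "unit_elt n a \<in> (\<lambda>x. unit_elt n (x n)) ` car M" if "a \<in> car PI" for a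
    unfolding 2 by (rule hom_car[OF 3 that])
  obtain s where s: "mod_hom PI M s" "\<And>a. a \<in> I \<Longrightarrow> unit_elt n (s a n) = unit_elt n a"
    using projectiveE[OF prI M hN 1 3 sub'] unfolding carPI by blast
  have sn: "s a n = a" if "a \<in> I" for a
    using fun_cong[OF s(2)[OF that], of n] by (simp add: unit_elt_def)
  define M0 where "M0 = std (car M \<inter> free n)"
  have hM0: "hmodule M0"
    unfolding M0_def using hmod_zero[OF M] hmod_diff[OF M] hmod_act[OF M] hmod_zero[OF hmodule_free[of n]] hmod_diff[OF hmodule_free[of n]] hmod_act[OF hmodule_free[of n]]
    by (intro hmodule_smulI) (auto simp: aM)
  have pM0: "projective M0" by (rule Suc.IH[OF hM0]) (auto simp: M0_def)
  \<comment> \<open>\<open>s\<close> splits the evaluation of coordinate n, so \<open>r\<close>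
    projects M onto \<open>M0\<close>, the elements of M with vanishing coordinate n, and M is the
    direct sum of \<open>M0\<close> and s(I).\<close>
  define r where "r x = x - s (x n)" for x
  have rM: "r x \<in> car M0" if x: "x \<in> car M" for x
  proof -
    have xI: "x n \<in> I" using x by (auto simp: I_def)
    then have sx: "s (x n) \<in> car M" using hom_car[OF s(1)] by (simp add: PI_def)
    have rx: "r x \<in> car M" unfolding r_def by (rule hmod_diff[OF M x sx])
    have "r x n = 0" by (simp add: r_def fun_apply sn[OF xI])
    moreover have "r x j = 0" if "j \<ge> Suc n" for j using rx sub that by (auto simp: free_def)
    ultimately have "r x \<in> free n" by (auto simp: free_def) (metis Suc_leI le_eq_less_or_eq)
    then show ?thesis using rx by (simp add: M0_def)
  qed
  have rhom: "mod_hom M M0 r"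
    unfolding mod_hom_def
  proof (intro conjI ballI allI)
    fix x assume x: "x \<in> car M"
    then have xI: "x n \<in> car PI" by (auto simp: I_def PI_def)
    show "r x \<in> car M0" by (rule rM[OF x])
    show "r (act M a x) = act M0 a (r x)" for a
      using hom_act[OF s(1) xI, of a] by (simp add: r_def M0_def aM smul_diff PI_def) (simp add: smul_def)
    fix y assume y: "y \<in> car M"
    then have yI: "y n \<in> car PI" by (auto simp: I_def PI_def)
    show "r (x + y) = r x + r y"
      using hom_add[OF s(1) xI yI] by (simp add: r_def fun_apply(1))
  qed
  have ev: "mod_hom M PI (\<lambda>x. x n)"
    unfolding mod_hom_def by (simp add: PI_def I_def aM fun_apply) (simp add: smul_def)
  show ?case
    unfolding projective_def
  proof (intro conjI allI impI)
    show "hmodule M" by (rule M)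
    fix A B :: "('h, 'h elt) hmod" and g f
    assume "hmodule A \<and> hmodule B \<and> mod_hom A B g \<and> g ` car A = car B \<and> mod_hom M B f"
    then have A: "hmodule A" "hmodule B" "mod_hom A B g" "g ` car A = car B" "mod_hom M B f" by auto
    have "mod_hom M0 B f" using A(5) unfolding mod_hom_def M0_def by (simp add: aM)
    then obtain h0 where h0: "mod_hom M0 A h0" "\<And>x. x \<in> car M0 \<Longrightarrow> g (h0 x) = f x"
      using projectiveE[OF pM0 A(1-3) \<open>mod_hom M0 B f\<close>] hom_car[OF \<open>mod_hom M0 B f\<close>] unfolding A(4) by blast
    have fs: "mod_hom PI B (\<lambda>a. f (s a))" by (rule mod_hom_comp[OF s(1) A(5)])
    then obtain h1 where h1: "mod_hom PI A h1" "\<And>a. a \<in> I \<Longrightarrow> g (h1 a) = f (s a)"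
      using projectiveE[OF prI A(1-3) fs] hom_car[OF fs] unfolding A(4) carPI by blast
    have "mod_hom M A (\<lambda>x. h0 (r x) + h1 (x n))"
      by (rule mod_hom_add[OF A(1) mod_hom_comp[OF rhom h0(1)] mod_hom_comp[OF ev h1(1)]])
    moreover have "g (h0 (r x) + h1 (x n)) = f x" if x: "x \<in> car M" for x
    proof -
      have xI: "x n \<in> I" using x by (auto simp: I_def)
      have sx: "s (x n) \<in> car M" using hom_car[OF s(1)] xI by (simp add: PI_def)
      have h1x: "h1 (x n) \<in> car A" using hom_car[OF h1(1)] xI by (simp add: PI_def)
      have "g (h0 (r x) + h1 (x n)) = g (h0 (r x)) + g (h1 (x n))"
        by (rule hom_add[OF A(3) hom_car[OF h0(1) rM[OF x]] h1x])
      also have "\<dots> = f (r x) + f (s (x n))" by (simp add: h0(2)[OF rM[OF x]] h1(2)[OF xI])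
      also have "\<dots> = f x" by (simp add: r_def hom_diff[OF M A(5) x sx])
      finally show ?thesis .
    qed
    ultimately show "\<exists>h. mod_hom M A h \<and> (\<forall>x\<in>car M. g (h x) = f x)" by blast
  qed
qed

lemma free_expand:
  assumes "x \<in> free n" shows "x = (\<Sum>j<n. smul (x j) (unit_elt j 1))"
proof
  fix i
  have "(\<Sum>j<n. smul (x j) (unit_elt j 1)) i = (\<Sum>j<n. if i = j then x j else 0)"
    unfolding sum_fun_eval by (rule sum.cong) (auto simp: smul_def unit_elt_def)
  also have "\<dots> = x i" using assms by (auto simp: free_def)
  finally show "x i = (\<Sum>j<n. smul (x j) (unit_elt j 1)) i" by simp
qed

lemma unit_free: "j < n \<Longrightarrow> unit_elt j a \<in> free n"
  by (auto simp: free_def unit_elt_def)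

definition free_hom :: "('h::ring_1, 'm::ab_group_add) hmod \<Rightarrow> nat \<Rightarrow> (nat \<Rightarrow> 'm) \<Rightarrow> 'h elt \<Rightarrow> 'm" where
  "free_hom M n s x = (\<Sum>j<n. act M (x j) (s j))"

lemma free_hom:
  assumes M: "hmodule M" and s: "\<And>j. j < n \<Longrightarrow> s j \<in> car M"
  shows "mod_hom (std (free n)) M (free_hom M n s)"
proof -
  have "(\<Sum>j<n. act M (x j) (s j)) \<in> car M" for x by (rule hmod_sum[OF M]) (simp add: hmod_act M s)
  moreover have "act M a (\<Sum>j<n. act M (x j) (s j)) = (\<Sum>j<n. act M a (act M (x j) (s j)))" for a x
    by (rule act_sum[OF M]) (simp add: hmod_act M s)
  ultimately show ?thesis
    unfolding mod_hom_def free_hom_def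
    by (simp add: fun_apply smul_def add_act mult_act M s sum.distrib)
qed

lemma free_hom_unit:
  assumes M: "hmodule M" and s: "\<And>j. j < n \<Longrightarrow> s j \<in> car M" and j: "j < n"
  shows "free_hom M n s (unit_elt j 1) = s j"
proof -
  have "free_hom M n s (unit_elt j 1) = (\<Sum>i<n. if i = j then s j else 0)"
    unfolding free_hom_def by (rule sum.cong) (auto simp: unit_elt_def one_act zero_act M s)
  then show ?thesis using j by simp
qed

text \<open>The last clause keeps complexes assembled from such covers bounded.\<close>

lemma free_cover:
  assumes M: "hmodule M" and fg: "fin_gen M"
  obtains n \<pi> where "mod_hom (std (free n)) M \<pi>" "\<pi> ` free n = car M" "car M = {0} \<Longrightarrow> n = 0"
proof (cases "car M = {0}")
  case True
  show thesis
  proof (rule that[of 0 "\<lambda>x. 0"])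
    show "mod_hom (std (free 0)) M (\<lambda>x. 0)" by (rule mod_hom_zero[OF M])
    show "(\<lambda>x. 0) ` free 0 = car M" using True by (auto simp: free_0)
  qed simp
next
  case False
  obtain n s where s: "\<And>j. j < (n::nat) \<Longrightarrow> s j \<in> car M" "\<And>x. x \<in> car M \<Longrightarrow> \<exists>r. x = (\<Sum>j<n. act M (r j) (s j))"
    using fin_genE[OF fg] by metis
  show thesis
  proof (rule that[OF free_hom[OF M s(1)]])
    show "free_hom M n s ` free n = car M"
    proof (intro subset_antisym subsetI)
      fix x assume "x \<in> free_hom M n s ` free n"
      then show "x \<in> car M" using hom_car[OF free_hom[OF M s(1)]] by auto
    next
      fix x assume "x \<in> car M"
      then obtain r where r: "x = (\<Sum>j<n. act M (r j) (s j))" using s(2) by blast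
      show "x \<in> free_hom M n s ` free n"
        by (rule image_eqI[of _ _ "\<lambda>j. if j < n then r j else 0"]) (auto simp: r free_hom_def free_def intro!: sum.cong)
    qed
  qed (use False in auto)
qed

section \<open>Linear functionals\<close>

definition lin_on :: "('k::field \<Rightarrow> 'b::ab_group_add \<Rightarrow> 'b) \<Rightarrow> 'b set \<Rightarrow> ('b \<Rightarrow> 'k) \<Rightarrow> bool" where
  "lin_on sc V \<phi> \<longleftrightarrow> (\<forall>x\<in>V. \<forall>y\<in>V. \<phi> (x + y) = \<phi> x + \<phi> y) \<and> (\<forall>c. \<forall>x\<in>V. \<phi> (sc c x) = c * \<phi> x)"

lemma lin_on_add: "lin_on sc V \<phi> \<Longrightarrow> x \<in> V \<Longrightarrow> y \<in> V \<Longrightarrow> \<phi> (x + y) = \<phi> x + \<phi> y"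
  and lin_on_scale: "lin_on sc V \<phi> \<Longrightarrow> x \<in> V \<Longrightarrow> \<phi> (sc c x) = c * \<phi> x"
  unfolding lin_on_def by auto

lemma lin_on_zero: "lin_on sc V \<phi> \<Longrightarrow> 0 \<in> V \<Longrightarrow> \<phi> 0 = 0"
  using lin_on_add[of sc V \<phi> 0 0] by (metis add.right_neutral add_left_cancel)

lemma lin_on_diff: "lin_on sc V \<phi> \<Longrightarrow> x - y \<in> V \<Longrightarrow> y \<in> V \<Longrightarrow> \<phi> (x - y) = \<phi> x - \<phi> y"
  using lin_on_add[of sc V \<phi> "x - y" y] by (simp add: algebra_simps)

lemma lin_on_sum:
  "lin_on sc UNIV \<phi> \<Longrightarrow> \<phi> (sum f I) = (\<Sum>i\<in>I. \<phi> (f i))"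
  by (induction I rule: infinite_finite_induct) (auto simp: lin_on_add lin_on_zero)

context vector_space
begin

lemma functional_on_basis:
  assumes "independent B"
  obtains \<Phi> where "lin_on scale UNIV \<Phi>" "\<And>x. x \<in> B \<Longrightarrow> \<Phi> x = f x"
proof -
  interpret vs: vector_space_pair scale "(*) :: 'a \<Rightarrow> 'a \<Rightarrow> 'a"
    by unfold_locales (auto simp: algebra_simps)
  obtain g where g: "Vector_Spaces.linear scale (*) g" "\<forall>x\<in>B. g x = f x"
    using vs.linear_independent_extend[OF assms] by blast
  interpret g: Vector_Spaces.linear scale "(*)" g by (rule g(1))
  show thesis using that[of g] g(2) g.add g.scale by (auto simp: lin_on_def)
qed

lemma span_subspace_eq: "B \<subseteq> V \<Longrightarrow> subspace V \<Longrightarrow> V \<subseteq> span B \<Longrightarrow> span B = V"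
  using span_minimal by blast

lemma functional_extend:
  assumes V: "subspace V" and \<phi>: "lin_on scale V \<phi>"
  obtains \<Phi> where "lin_on scale UNIV \<Phi>" "\<And>x. x \<in> V \<Longrightarrow> \<Phi> x = \<phi> x"
proof -
  obtain B where B: "B \<subseteq> V" "independent B" "V \<subseteq> span B" using maximal_independent_subset by metis
  obtain \<Phi> where \<Phi>: "lin_on scale UNIV \<Phi>" "\<And>x. x \<in> B \<Longrightarrow> \<Phi> x = \<phi> x"
    using functional_on_basis[OF B(2)] by metis
  have sV: "span B = V" by (rule span_subspace_eq[OF B(1) V B(3)])
  have "x \<in> V \<and> \<Phi> x = \<phi> x" if "x \<in> span B" for x
    using that
  proof (induction rule: span_induct_alt)
    case base
    show ?case using lin_on_zero[OF \<Phi>(1)] lin_on_zero[OF \<phi> subspace_0[OF V]] subspace_0[OF V] by simp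
  next
    case (step c x y)
    then have V': "x \<in> V" "y \<in> V" "scale c x \<in> V" using B(1) subspace_scale[OF V] by auto
    show ?case
      using step \<Phi>(2)[OF step(1)] by (simp add: subspace_add[OF V V'(3,2)]) (simp add: lin_on_add[OF \<Phi>(1)] lin_on_scale[OF \<Phi>(1)]
        lin_on_add[OF \<phi> V'(3,2)] lin_on_scale[OF \<phi> V'(1)])
  qed
  then show thesis using that \<Phi>(1) sV by blast
qed

lemma functional_separate:
  assumes V: "subspace V" and x: "x \<notin> V"
  obtains \<Phi> where "lin_on scale UNIV \<Phi>" "\<And>y. y \<in> V \<Longrightarrow> \<Phi> y = 0" "\<Phi> x = 1"
proof -
  obtain B where B: "B \<subseteq> V" "independent B" "V \<subseteq> span B" using maximal_independent_subset by metis
  have sV: "span B = V" by (rule span_subspace_eq[OF B(1) V B(3)])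
  have ind: "independent (insert x B)" using x B sV by (simp add: independent_insert)
  obtain \<Phi> where \<Phi>: "lin_on scale UNIV \<Phi>" "\<And>y. y \<in> insert x B \<Longrightarrow> \<Phi> y = (if y = x then 1 else 0)"
    by (rule functional_on_basis[OF ind, where f = "\<lambda>y. if y = x then 1 else 0"]) blast
  have "\<Phi> y = 0" if "y \<in> span B" for y
    using that
  proof (induction rule: span_induct_alt)
    case base show ?case using lin_on_zero[OF \<Phi>(1)] by simp
  next
    case (step c z y)
    then have "\<Phi> z = 0" using \<Phi>(2)[of z] x B(1) by auto
    then show ?case using step by (simp add: lin_on_add[OF \<Phi>(1)] lin_on_scale[OF \<Phi>(1)])
  qed
  then have "\<Phi> y = 0" if "y \<in> V" for y using that sV by simp
  moreover have "\<Phi> x = 1" using \<Phi>(2)[of x] by simp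
  ultimately show thesis by (rule that[OF \<Phi>(1)])
qed

text \<open>Extend a basis of V to one of W and take the coordinate functionals of the added basis
  vectors.\<close>

lemma separating_functionals:
  assumes V: "subspace V" and W: "subspace W" and VW: "V \<subseteq> W" and F: "finite F" "W \<subseteq> span F"
  obtains n \<eta> where "\<And>j. j < (n::nat) \<Longrightarrow> lin_on scale UNIV (\<eta> j)"
    "\<And>x. x \<in> W \<Longrightarrow> (\<forall>j<n. \<eta> j x = 0) \<longleftrightarrow> x \<in> V"
proof -
  obtain B where B: "B \<subseteq> V" "independent B" "V \<subseteq> span B" using maximal_independent_subset by metis
  have sV: "span B = V" by (rule span_subspace_eq[OF B(1) V B(3)])
  have BW: "B \<subseteq> W" using B(1) VW by blast
  obtain C where C: "B \<subseteq> C" "C \<subseteq> W" "independent C" "W \<subseteq> span C"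
    using maximal_independent_subset_extend[OF BW B(2)] by metis
  have fC: "finite C" using independent_span_bound[OF F(1) C(3)] C(2) F(2) by blast
  obtain b where b: "bij_betw b {..<card (C - B)} (C - B)"
    using ex_bij_betw_nat_finite[of "C - B"] fC by (auto simp: atLeast0LessThan)
  have "\<exists>\<Phi>. lin_on scale UNIV \<Phi> \<and> (\<forall>x\<in>C. \<Phi> x = (if x = b j then 1 else 0))" for j
    by (rule functional_on_basis[OF C(3), where f = "\<lambda>x. if x = b j then 1 else 0"]) blast
  then obtain \<eta> where \<eta>: "\<And>j. lin_on scale UNIV (\<eta> j)" "\<And>j x. x \<in> C \<Longrightarrow> \<eta> j x = (if x = b j then 1 else 0)"
    by metis
  show thesis
  proof (rule that[of "card (C - B)" \<eta>])
    show "lin_on scale UNIV (\<eta> j)" for j by (rule \<eta>(1))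
    fix x assume "x \<in> W"
    then obtain u where u: "x = (\<Sum>c\<in>C. scale (u c) c)"
      using C(4) span_finite[OF fC] by auto
    have \<eta>x: "\<eta> j x = u (b j)" if j: "j < card (C - B)" for j
    proof -
      have bj: "b j \<in> C" using b j by (auto simp: bij_betw_def)
      have "\<eta> j x = (\<Sum>c\<in>C. u c * \<eta> j c)"
        unfolding u lin_on_sum[OF \<eta>(1)] by (simp add: lin_on_scale[OF \<eta>(1)])
      also have "\<dots> = (\<Sum>c\<in>C. if c = b j then u c else 0)" by (rule sum.cong) (auto simp: \<eta>(2))
      finally show ?thesis using bj fC by simp
    qed
    show "(\<forall>j<card (C - B). \<eta> j x = 0) \<longleftrightarrow> x \<in> V"
    proof
      assume z: "\<forall>j<card (C - B). \<eta> j x = 0"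
      have "u c = 0" if "c \<in> C - B" for c
      proof -
        obtain j where "j < card (C - B)" "c = b j" using b \<open>c \<in> C - B\<close> unfolding bij_betw_def by blast
        then show ?thesis using z \<eta>x by auto
      qed
      then have "x = (\<Sum>c\<in>B. scale (u c) c)"
        unfolding u using fC C(1) by (intro sum.mono_neutral_right) auto
      then show "x \<in> V" using B(1) by (auto intro!: subspace_sum[OF V] subspace_scale[OF V])
    next
      assume "x \<in> V"
      then have "x \<in> span B" using sV by simp
      then have "\<eta> j x = 0" if j: "j < card (C - B)" for j
      proof (induction rule: span_induct_alt)
        case base show ?case using lin_on_zero[OF \<eta>(1)] by simp
      next
        case (step c z y)
        have "b j \<in> C - B" using b j by (auto simp: bij_betw_def)
        then have "\<eta> j z = 0" using \<eta>(2)[of z j] step(1) C(1) by auto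
        then show ?case using step by (simp add: lin_on_add[OF \<eta>(1)] lin_on_scale[OF \<eta>(1)])
      qed
      then show "\<forall>j<card (C - B). \<eta> j x = 0" by blast
    qed
  qed
qed

lemma subspace_dim_eq:
  assumes U: "subspace U" and UW: "U \<subseteq> W" and F: "finite F" "W \<subseteq> span F" and d: "dim U = dim W"
  shows "U = W"
proof (rule ccontr)
  assume ne: "U \<noteq> W"
  obtain B where B: "B \<subseteq> U" "independent B" "U \<subseteq> span B" "card B = dim U" using basis_exists by metis
  obtain C where C: "C \<subseteq> W" "independent C" "W \<subseteq> span C" "card C = dim W" using basis_exists by metis
  have sB: "span B = U" by (rule span_subspace_eq[OF B(1) U B(3)])
  obtain x where x: "x \<in> W" "x \<notin> U" using ne UW by blast
  have fC: "finite C" using independent_span_bound[OF F(1) C(2)] C(1) F(2) by blast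
  have "independent (insert x B)" using x B sB by (simp add: independent_insert)
  moreover have "insert x B \<subseteq> span C" using x B(1) UW C(3) by blast
  ultimately have "finite (insert x B) \<and> card (insert x B) \<le> card C" by (rule independent_span_bound[OF fC])
  moreover have "x \<notin> B" using x(2) B(1) by blast
  ultimately show False using B(4) C(4) d by auto
qed

lemma dim_bound: assumes "finite F" "W \<subseteq> span F" shows "dim W \<le> card F"
proof -
  obtain C where C: "C \<subseteq> W" "independent C" "W \<subseteq> span C" "card C = dim W" using basis_exists by metis
  then show ?thesis using independent_span_bound[OF assms(1) C(2)] assms(2) by auto
qed

lemma dim_mono':
  assumes "finite F" "W \<subseteq> span F" "U \<subseteq> W" shows "dim U \<le> dim W"
proof -
  obtain B where B: "B \<subseteq> U" "independent B" "U \<subseteq> span B" "card B = dim U" using basis_exists by metis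
  obtain C where C: "C \<subseteq> W" "independent C" "W \<subseteq> span C" "card C = dim W" using basis_exists by metis
  have fC: "finite C" using independent_span_bound[OF assms(1) C(2)] C(1) assms(2) by blast
  have "B \<subseteq> span C" using B(1) assms(3) C(3) by blast
  then show ?thesis using independent_span_bound[OF fC B(2)] B(4) C(4) by simp
qed

text \<open>Meant for the ascending kernels and descending images in Fitting's lemma. The dimension
  attains its maximum or minimum along the chain, and from there on the chain is constant.\<close>

lemma subspace_chain_stable:
  assumes F: "finite F" and U: "\<And>n::nat. subspace (U n)" "\<And>n. U n \<subseteq> span F"
    and mono: "(\<forall>n. U n \<subseteq> U (Suc n)) \<or> (\<forall>n. U (Suc n) \<subseteq> U n)"
  obtains n where "\<And>m. m \<ge> n \<Longrightarrow> U m = U n"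
proof (cases "\<forall>n. U n \<subseteq> U (Suc n)")
  case True
  have le: "U n \<subseteq> U m" if "n \<le> m" for n m using that True by (simp add: lift_Suc_mono_le)
  have "finite (range (\<lambda>n. dim (U n)))"
    by (rule finite_subset[of _ "{..card F}"]) (auto simp: dim_bound[OF F U(2)])
  then have "Max (range (\<lambda>n. dim (U n))) \<in> range (\<lambda>n. dim (U n))" by (intro Max_in) auto
  then obtain n where n: "dim (U n) = Max (range (\<lambda>n. dim (U n)))" by force
  have "U m = U n" if "m \<ge> n" for m
  proof -
    have "dim (U m) \<le> dim (U n)" unfolding n using \<open>finite (range (\<lambda>n. dim (U n)))\<close> by (intro Max_ge) auto
    then have "dim (U n) = dim (U m)" using dim_mono'[OF F U(2) le[OF that]] by simp
    then show ?thesis using subspace_dim_eq[OF U(1) le[OF that] F U(2)] by simp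
  qed
  then show thesis using that by blast
next
  case False
  then have "\<And>n. U (Suc n) \<subseteq> U n" using mono by blast
  then have le: "U m \<subseteq> U n" if "n \<le> m" for n m using that by (simp add: lift_Suc_antimono_le)
  obtain n where n: "\<And>m. dim (U n) \<le> dim (U m)" using ex_has_least_nat[of "\<lambda>_. True" _ "\<lambda>n. dim (U n)"] by auto
  have "U m = U n" if "m \<ge> n" for m
  proof -
    have "dim (U m) = dim (U n)" using dim_mono'[OF F U(2) le[OF that]] n[of m] by simp
    then show ?thesis using subspace_dim_eq[OF U(1) le[OF that] F U(2)] by simp
  qed
  then show thesis using that by blast
qed

end

section \<open>Resolutions\<close>

locale hereditary_algebra = fd_algebra scale for scale :: "'k::field \<Rightarrow> 'h::ring_1 \<Rightarrow> 'h" +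
  assumes hereditary: "hereditary TYPE('h)"
begin

text \<open>The structure map of the algebra. Homomorphisms are \<open>k\<close>-linear because they
  commute with the action of its values.\<close>

definition kap :: "'k \<Rightarrow> 'h" where "kap c = scale c 1"

definition scaleE :: "'k \<Rightarrow> 'h elt \<Rightarrow> 'h elt" where "scaleE c x = (\<lambda>n. scale c (x n))"

sublocale E: vector_space scaleE
  by unfold_locales (auto simp: scaleE_def fun_apply scale_right_distrib scale_left_distrib)

lemma smul_kap: "smul (kap c) x = scaleE c x"
  by (simp add: smul_def kap_def scaleE_def scale_mult_left[symmetric])

lemma pmod_subspace: assumes M: "pmod (M :: ('h, 'h elt) hmod)" shows "E.subspace (car M)"
  using hmod_zero[OF pmodD(1)[OF M]] hmod_add[OF pmodD(1)[OF M]] hmod_act[OF pmodD(1)[OF M]] pmodD(2)[OF M]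
  by (auto intro!: E.subspaceI simp: smul_kap[symmetric])

lemma free_span: obtains F :: "'h elt set" where "finite F" "free n \<subseteq> E.span F"
proof -
  obtain B where B: "finite B" "span B = (UNIV :: 'h set)" using finite_spanning_set by blast
  let ?F = "(\<lambda>(j, b). unit_elt j b) ` ({..<n} \<times> B)"
  show thesis
  proof (rule that[of ?F])
    show "finite ?F" using B(1) by simp
    show "free n \<subseteq> E.span ?F"
    proof
      fix x :: "'h elt" assume x: "x \<in> free n"
      have "smul (x j) (unit_elt j 1) \<in> E.span ?F" if j: "j < n" for j
      proof -
        have "x j \<in> span B" using B(2) by simp
        then obtain u where u: "x j = (\<Sum>b\<in>B. scale (u b) b)" using span_finite[OF B(1)] by auto
        have "smul (x j) (unit_elt j 1) = (\<Sum>b\<in>B. scaleE (u b) (unit_elt j b))"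
          unfolding u by (rule ext) (auto simp: sum_fun_eval smul_def unit_elt_def scaleE_def)
        also have "\<dots> \<in> E.span ?F"
          using j by (intro E.span_sum E.span_scale E.span_base) auto
        finally show ?thesis .
      qed
      then have "(\<Sum>j<n. smul (x j) (unit_elt j 1)) \<in> E.span ?F" by (auto intro: E.span_sum)
      then show "x \<in> E.span ?F" using free_expand[OF x] by simp
    qed
  qed
qed

lemma pmod_span: assumes "pmod (M :: ('h, 'h elt) hmod)" obtains F where "finite F" "car M \<subseteq> E.span F"
  using assms free_span unfolding pmod_def by (metis order_trans)

text \<open>A \<open>k\<close>-basis is finite, since free modules of finite rank are
  finite-dimensional, and it generates over the algebra with coefficients in the image of
  \<open>kap\<close>.\<close>

lemma pmod_fin_gen: assumes M: "pmod (M :: ('h, 'h elt) hmod)" shows "fin_gen M"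
proof -
  obtain F where F: "finite F" "car M \<subseteq> E.span F" using pmod_span[OF M] by blast
  obtain B where B: "B \<subseteq> car M" "E.independent B" "car M \<subseteq> E.span B"
    using E.maximal_independent_subset by metis
  have fB: "finite B" using E.independent_span_bound[OF F(1) B(2)] B(1) F(2) by blast
  show ?thesis
  proof (rule fin_genI[where I = B and s = "\<lambda>x. x", OF pmodD(1)[OF M] fB])
    fix x assume "x \<in> car M"
    then obtain u where "x = (\<Sum>b\<in>B. scaleE (u b) b)" using B(3) E.span_finite[OF fB] by auto
    then have "x = (\<Sum>b\<in>B. act M (kap (u b)) b)" by (simp add: pmodD(2)[OF M] smul_kap)
    then show "\<exists>r. x = (\<Sum>b\<in>B. act M (r b) b)" by (rule exI[of _ "\<lambda>b. kap (u b)"])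
  qed (use B in auto)
qed

lemma pmod_projective: "pmod (M :: ('h, 'h elt) hmod) \<Longrightarrow> projective M"
  using projective_sub_free[OF hereditary] unfolding pmod_def by blast

lemma pcplx_proj: "pcplx (P :: 'h cplx) \<Longrightarrow> proj_cplx P"
  unfolding pcplx_def proj_cplx_def using pmod_projective by blast

lemma pcplx_bcplx: "pcplx (P :: 'h cplx) \<Longrightarrow> bcplx P" and pcplx_pmod: "pcplx P \<Longrightarrow> pmod (ob P i)"
  unfolding pcplx_def by auto

lemma pcplxI:
  assumes "\<And>i. pmod (ob P i)" "\<And>i. mod_hom (ob P i) (ob P (i + 1)) (dif P i)"
    "\<And>i x. x \<in> car (ob P i) \<Longrightarrow> dif P (i + 1) (dif P i x) = 0" "finite {i. car (ob P i) \<noteq> {0}}"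
  shows "pcplx (P :: 'h cplx)"
  unfolding pcplx_def bcplx_def using assms pmod_fin_gen by (auto simp: pmodD)

lemma pcplx_sub:
  assumes P: "pcplx (P :: 'h cplx)" and A: "\<And>i. A i \<subseteq> car (ob P i)" "\<And>i. hmodule (std (A i))"
    and d: "\<And>i x. x \<in> A i \<Longrightarrow> dif P i x \<in> A (i + 1)"
  shows "pcplx \<lparr>ob = (\<lambda>i. std (A i)), dif = dif P\<rparr>"
proof (rule pcplxI)
  note bP = pcplx_bcplx[OF P]
  have sub: "x \<in> car (ob P i)" if "x \<in> A i" for x i using that A(1) by blast
  fix i
  show "pmod (ob \<lparr>ob = (\<lambda>i. std (A i)), dif = dif P\<rparr> i)"
    using pmod_sub[OF pcplx_pmod[OF P] A] by simp
  show "mod_hom (ob \<lparr>ob = (\<lambda>i. std (A i)), dif = dif P\<rparr> i) (ob \<lparr>ob = (\<lambda>i. std (A i)), dif = dif P\<rparr> (i + 1))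
     (dif \<lparr>ob = (\<lambda>i. std (A i)), dif = dif P\<rparr> i)"
    using bcplx_dif[OF bP, of i] d sub pmodD(2)[OF pcplx_pmod[OF P]] unfolding mod_hom_def by simp
  show "finite {i. car (ob \<lparr>ob = (\<lambda>i. std (A i)), dif = dif P\<rparr> i) \<noteq> {0}}"
  proof (rule finite_subset[OF _ bcplx_fin[OF bP]], intro subsetI CollectI notI)
    fix i assume "i \<in> {i. car (ob \<lparr>ob = (\<lambda>i. std (A i)), dif = dif P\<rparr> i) \<noteq> {0}}" "car (ob P i) = {0}"
    then show False using A(1)[of i] hmod_zero[OF A(2)[of i]] by auto
  qed
  fix x assume "x \<in> car (ob \<lparr>ob = (\<lambda>i. std (A i)), dif = dif P\<rparr> i)"
  then show "dif \<lparr>ob = (\<lambda>i. std (A i)), dif = dif P\<rparr> (i + 1) (dif \<lparr>ob = (\<lambda>i. std (A i)), dif = dif P\<rparr> i x) = 0"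
    using bcplx_dd[OF bP sub] by simp
qed

lemma pcplx_cone: "pcplx (X :: 'h cplx) \<Longrightarrow> pcplx Y \<Longrightarrow> chain_map X Y f \<Longrightarrow> pcplx (cone X Y f)"
  unfolding pcplx_def using bcplx_cone pmod_mod_sum by (metis ob_cone)

lemma pcplx_shift: "pcplx (X :: 'h cplx) \<Longrightarrow> pcplx (shift X)" and pcplx_unshift: "pcplx X \<Longrightarrow> pcplx (unshift X)"
  unfolding pcplx_def using bcplx_shift bcplx_unshift by auto

text \<open>A complex of free modules surjects onto \<open>X\<close>; the kernel \<open>K\<close> of \<open>F \<rightarrow> X\<close> consists of
  projectives because the algebra is hereditary, and the cone of \<open>K \<rightarrow> F\<close> resolves \<open>X\<close>.\<close>

lemma resolution:
  assumes X: "bcplx (X :: 'h cplx)"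
  obtains P s where "pcplx P" "quasi_iso P X s"
proof -
  have "\<exists>n \<pi>. mod_hom (std (free n)) (ob X i) \<pi> \<and> \<pi> ` free n = car (ob X i) \<and> (car (ob X i) = {0} \<longrightarrow> n = 0)" for i
    using free_cover[OF bcplx_hmod[OF X] bcplx_fg[OF X]] by metis
  then obtain n \<pi> where \<pi>: "\<And>i. mod_hom (std (free (n i))) (ob X i) (\<pi> i)" "\<And>i. \<pi> i ` free (n i) = car (ob X i)"
    and n: "\<And>i. car (ob X i) = {0} \<Longrightarrow> n i = 0"
    by metis
  let ?G = "\<lambda>i. std (free (n i)) :: ('h, 'h elt) hmod"
  \<comment> \<open>The contractible complex with \<open>?G i\<close> in degrees i and i + 1, joined
    by the identity. Chain maps out of it amount to arbitrary maps in each degree, so the covers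
    \<open>\<pi> i\<close> induce \<open>\<phi>\<close>.\<close>
  define F where "F = \<lparr>ob = (\<lambda>i. mod_sum (?G i) (?G (i - 1))), dif = (\<lambda>i z. pr 0 (lft z))\<rparr>"
  have obF: "ob F i = mod_sum (?G i) (?G (i - 1))" and dF: "dif F i z = pr 0 (lft z)" for i z by (simp_all add: F_def)
  have G: "hmodule (?G i)" for i by (rule hmodule_free)
  have F: "pcplx F"
  proof (rule pcplxI)
    show "pmod (ob F i)" for i unfolding obF by (rule pmod_mod_sum[OF pmod_free pmod_free])
    show "mod_hom (ob F i) (ob F (i + 1)) (dif F i)" for i
      unfolding obF mod_hom_pr_iff dF lft_pr rgt_pr by (simp add: mod_hom_lft[OF mod_hom_id] mod_hom_zero[OF hmodule_free])
    show "dif F (i + 1) (dif F i x) = 0" for i x by (simp add: dF)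
    have f1: "finite {i. car (?G i) \<noteq> {0}}"
      by (rule finite_subset[OF _ bcplx_fin[OF X]]) (use n in \<open>auto simp: free_0\<close>)
    then have f2: "finite {i. car (?G (i - 1)) \<noteq> {0}}"
      using finite_vimageI[OF f1, of "\<lambda>i. i - 1"] by (simp add: vimage_def inj_def)
    show "finite {i. car (ob F i) \<noteq> {0}}" unfolding obF by (rule finite_support_mod_sum[OF f1 f2])
  qed
  note bF = pcplx_bcplx[OF F]
  define \<phi> where "\<phi> i z = \<pi> i (lft z) + dif X (i - 1) (\<pi> (i - 1) (rgt z))" for i z
  have \<phi>: "chain_map F X \<phi>"
    unfolding chain_map_def
  proof (intro conjI allI ballI)
    fix i
    show "mod_hom (ob F i) (ob X i) (\<phi> i)"
      unfolding \<phi>_def obF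
      by (rule mod_hom_add[OF bcplx_hmod[OF X] mod_hom_lft[OF \<pi>(1)] mod_hom_rgt[OF mod_hom_comp[OF \<pi>(1) bcplx_dif'[OF X]]]])
    fix z assume "z \<in> car (ob F i)"
    then have z: "lft z \<in> car (?G i)" "rgt z \<in> car (?G (i - 1))" by (auto simp: obF)
    show "\<phi> (i + 1) (dif F i z) = dif X i (\<phi> i z)"
      using hom_zero[OF G \<pi>(1), of "i + 1"] hom_add[OF bcplx_dif[OF X] hom_car[OF \<pi>(1) z(1)] bcplx_dif_car'[OF X hom_car[OF \<pi>(1) z(2)]]]
        bcplx_dd'[OF X hom_car[OF \<pi>(1) z(2)]]
      by (simp add: \<phi>_def dF)
  qed
  have \<phi>surj: "\<exists>z\<in>car (ob F i). \<phi> i z = x" if x: "x \<in> car (ob X i)" for i x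
  proof -
    obtain y where y: "y \<in> free (n i)" "x = \<pi> i y" using x \<pi>(2) by blast
    have "\<pi> (i - 1) 0 = 0" "dif X (i - 1) 0 = 0"
      by (rule hom_zero[OF G \<pi>(1)], rule hom_zero[OF bcplx_hmod[OF X] bcplx_dif[OF X]])
    then have "\<phi> i (pr y 0) = x" using y by (simp add: \<phi>_def)
    then show ?thesis using y hmod_zero[OF G] by (intro bexI[of _ "pr y 0"]) (simp_all add: obF)
  qed
  define K where "K = \<lparr>ob = (\<lambda>i. std {x \<in> car (ob F i). \<phi> i x = 0}), dif = dif F\<rparr>"
  have obK: "car (ob K i) = {x \<in> car (ob F i). \<phi> i x = 0}" and dK: "dif K = dif F" and aK: "act (ob K i) = smul" for i
    by (simp_all add: K_def)
  have K: "pcplx K"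
    unfolding K_def
  proof (rule pcplx_sub[OF F])
    show "hmodule (std {x \<in> car (ob F i). \<phi> i x = 0})" for i
      by (rule pmodD(1)[OF pmod_kernel[OF pcplx_pmod[OF F] chain_hom[OF \<phi>]]])
    show "dif F i x \<in> {x \<in> car (ob F (i + 1)). \<phi> (i + 1) x = 0}" if "x \<in> {x \<in> car (ob F i). \<phi> i x = 0}" for i x
      using that bcplx_dif_car[OF bF] chain_dif[OF \<phi>] hom_zero[OF bcplx_hmod[OF X] bcplx_dif[OF X]] by auto
  qed auto
  have inc: "chain_map K F (\<lambda>i x. x)"
    unfolding chain_map_def mod_hom_def by (auto simp: obK dK aK pmodD(2)[OF pcplx_pmod[OF F]])
  let ?P = "cone K F (\<lambda>i x. x)"
  note FH = bcplx_hmod[OF bF] and Fd = bcplx_dif[OF bF]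
  have P: "pcplx ?P" by (rule pcplx_cone[OF K F inc])
  have "quasi_iso ?P X (\<lambda>i z. \<phi> i (rgt z))"
    unfolding quasi_iso_def
  proof (intro conjI allI ballI impI)
    show "chain_map ?P X (\<lambda>i z. \<phi> i (rgt z))"
      unfolding chain_map_def
    proof (intro conjI allI ballI)
      fix i show "mod_hom (ob ?P i) (ob X i) (\<lambda>z. \<phi> i (rgt z))"
        unfolding ob_cone by (rule mod_hom_rgt[OF chain_hom[OF \<phi>]])
      fix z assume "z \<in> car (ob ?P i)"
      then have z: "lft z \<in> car (ob F (i + 1))" "\<phi> (i + 1) (lft z) = 0" "rgt z \<in> car (ob F i)" by (auto simp: obK)
      show "\<phi> (i + 1) (rgt (dif ?P i z)) = dif X i (\<phi> i (rgt z))"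
        using hom_add[OF chain_hom[OF \<phi>] z(1) bcplx_dif_car[OF bF z(3)]] z(2) chain_dif[OF \<phi> z(3)] by simp
    qed
  next
    fix i u assume u: "u \<in> cycles ?P i" "\<phi> i (rgt u) \<in> boundaries X i"
    then have u': "lft u \<in> car (ob F (i + 1))" "rgt u \<in> car (ob F i)" "lft u + dif F i (rgt u) = 0"
      by (auto simp: cycles_def obK)
    obtain x' where x': "x' \<in> car (ob X (i - 1))" "\<phi> i (rgt u) = dif X (i - 1) x'" using u(2) unfolding boundaries_def by blast
    obtain z' where z': "z' \<in> car (ob F (i - 1))" "\<phi> (i - 1) z' = x'" using \<phi>surj[OF x'(1)] by blast
    \<comment> \<open>With u = (x, y) and \<phi> y = d x', lift x' along \<phi> to z'. Then y - d z'
      lies in the kernel K, and (y - d z', z') bounds u.\<close>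
    let ?k = "rgt u - dif F (i - 1) z'"
    note dz = bcplx_dif_car'[OF bF z'(1)]
    have k: "?k \<in> car (ob K i)"
      unfolding obK using hmod_diff[OF FH u'(2) dz] hom_diff[OF FH chain_hom[OF \<phi>] u'(2) dz] chain_dif'[OF \<phi> z'(1)] x' z'(2) by simp
    have "- dif F i ?k = lft u"
      using hom_diff[OF FH Fd u'(2) dz] bcplx_dd'[OF bF z'(1)] eq_neg_iff_add_eq_0[THEN iffD2, OF u'(3)] by simp
    then have "u = dif ?P (i - 1) (pr ?k z')" by (simp add: eq_pr_iff dK)
    moreover have "pr ?k z' \<in> car (ob ?P (i - 1))" using k z' by simp
    ultimately show "u \<in> boundaries ?P i" unfolding boundaries_def by blast
  next
    fix i y assume "y \<in> cycles X i"
    then have y: "y \<in> car (ob X i)" "dif X i y = 0" by (auto simp: cycles_def)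
    obtain z where z: "z \<in> car (ob F i)" "\<phi> i z = y" using \<phi>surj[OF y(1)] by blast
    note dz = bcplx_dif_car[OF bF z(1)]
    let ?u = "pr (- dif F i z) z"
    have "- dif F i z \<in> car (ob K (i + 1))"
      unfolding obK using hmod_uminus[OF FH dz] hom_uminus[OF FH chain_hom[OF \<phi>] dz] chain_dif[OF \<phi> z(1)] y z by simp
    moreover have "dif F (i + 1) (- dif F i z) = 0"
      using hom_uminus[OF FH Fd dz] bcplx_dd[OF bF z(1)] by simp
    ultimately have "?u \<in> cycles ?P i" using z by (simp add: cycles_def dK)
    moreover have "y - \<phi> i (rgt ?u) \<in> boundaries X i" using z zero_boundary[OF X] by simp
    ultimately show "\<exists>u\<in>cycles ?P i. y - \<phi> i (rgt u) \<in> boundaries X i" by blast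
  qed
  then show thesis using that[OF P] by blast
qed

lemma resolution_iso:
  assumes X: "bcplx (X :: 'h cplx)"
  obtains P where "pcplx P" "d_iso P X"
  using resolution[OF X] d_iso_quasi_iso[OF pcplx_bcplx X] by metis

end

section \<open>Endomorphism rings of indecomposable complexes\<close>

lemma htpc_eq: "bcplx Y \<Longrightarrow> (\<And>i x. x \<in> car (ob X i) \<Longrightarrow> f i x = g i x) \<Longrightarrow> htpc X Y f g"
  unfolding htpc_def by (rule null_cong[OF null_zero]) auto

text \<open>A left and a right inverse are asked for separately, which spares the proof that they
  agree up to homotopy.\<close>

definition htpy_unit :: "'h::ring_1 cplx \<Rightarrow> 'h cmap \<Rightarrow> bool" where
  "htpy_unit P a \<longleftrightarrow> (\<exists>b. chain_map P P b \<and> htpc P P (\<lambda>i x. b i (a i x)) (\<lambda>i x. x)) \<and>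
     (\<exists>c. chain_map P P c \<and> htpc P P (\<lambda>i x. a i (c i x)) (\<lambda>i x. x))"

definition local_end :: "'h::ring_1 cplx \<Rightarrow> bool" where
  "local_end P \<longleftrightarrow> \<not> null_htpy P P (\<lambda>i x. x) \<and>
     (\<forall>a. chain_map P P a \<longrightarrow> htpy_unit P a \<or> htpy_unit P (\<lambda>i x. x - a i x))"

text \<open>If e is a unit, it can be cancelled in e e = e. If 1 - e is a unit, then (1 - e) e = 0
  forces e = 0.\<close>

lemma triv_idem_of_local:
  assumes P: "bcplx P" and l: "local_end P" shows "triv_idem P"
  unfolding triv_idem_def
proof (intro conjI allI impI)
  show "\<not> null_htpy P P (\<lambda>i x. x)" using l by (simp add: local_end_def)
  fix e assume "chain_map P P e \<and> htpc P P (\<lambda>i x. e i (e i x)) e"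
  then have e: "chain_map P P e" "htpc P P (\<lambda>i x. e i (e i x)) e" by auto
  note ee = chain_map_comp[OF e(1) e(1)]
  consider "htpy_unit P e" | "htpy_unit P (\<lambda>i x. x - e i x)" using l e(1) unfolding local_end_def by blast
  then show "null_htpy P P e \<or> htpc P P e (\<lambda>i x. x)"
  proof cases
    case 1
    then obtain b where b: "chain_map P P b" "htpc P P (\<lambda>i x. b i (e i x)) (\<lambda>i x. x)"
      unfolding htpy_unit_def by blast
    have "htpc P P (\<lambda>i x. b i (e i (e i x))) (\<lambda>i x. e i x)"
      using htpc_right[OF e(1) b(2)] .
    moreover have "htpc P P (\<lambda>i x. b i (e i (e i x))) (\<lambda>i x. b i (e i x))"
      by (rule htpc_left[OF b(1) e(2) P P ee e(1)])
    ultimately show ?thesis using b(2) htpc_trans[OF P] htpc_sym[OF P] by (metis (no_types, lifting))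
  next
    case 2
    then obtain b where b: "chain_map P P b" "htpc P P (\<lambda>i x. b i (x - e i x)) (\<lambda>i x. x)"
      unfolding htpy_unit_def by blast
    have "htpc P P (\<lambda>i x. b i (e i x - e i (e i x))) e"
      using htpc_right[OF e(1) b(2)] .
    moreover have "null_htpy P P (\<lambda>i x. b i (e i x - e i (e i x)))"
      using null_left[OF b(1) htpc_sym[OF P e(2), unfolded htpc_def] P P] .
    ultimately show ?thesis using htpc_null'[OF P] by blast
  qed
qed

context hereditary_algebra
begin

text \<open>An idempotent of the complex itself splits it into two subcomplexes of projectives, the
  kernels of 1 - e and of e. One of them is zero in the derived category, hence contractible, and e
  or 1 - e factors through it.\<close>

lemma strict_idempotent:
  assumes P: "pcplx (P :: 'h cplx)" and ind: "indecomposable P" and e: "chain_map P P e"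
    and idem: "\<And>i x. x \<in> car (ob P i) \<Longrightarrow> e i (e i x) = e i x"
  shows "null_htpy P P e \<or> htpc P P e (\<lambda>i x. x)"
proof -
  note bP = pcplx_bcplx[OF P]
  note H = bcplx_hmod[OF bP] and eh = chain_hom[OF e] and ec = chain_car[OF e]
  let ?A = "\<lambda>i. {x \<in> car (ob P i). x - e i x = 0}" and ?B = "\<lambda>i. {x \<in> car (ob P i). e i x = 0}"
  define A where "A = \<lparr>ob = (\<lambda>i. std (?A i)), dif = dif P\<rparr>"
  define B where "B = \<lparr>ob = (\<lambda>i. std (?B i)), dif = dif P\<rparr>"
  have aP: "act (ob P i) = smul" for i by (rule pmodD(2)[OF pcplx_pmod[OF P]])
  have obA: "car (ob A i) = ?A i" "act (ob A i) = smul" "dif A = dif P"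
    and obB: "car (ob B i) = ?B i" "act (ob B i) = smul" "dif B = dif P" for i
    by (simp_all add: A_def B_def)
  have pA: "pcplx A" unfolding A_def
  proof (rule pcplx_sub[OF P])
    show "hmodule (std (?A i))" for i
      by (rule pmodD(1)[OF pmod_kernel[OF pcplx_pmod[OF P] mod_hom_diff[OF H mod_hom_id eh]]])
    show "dif P i x \<in> ?A (i + 1)" if "x \<in> ?A i" for i x
      using that bcplx_dif_car[OF bP] chain_dif[OF e] by simp
  qed auto
  have pB: "pcplx B" unfolding B_def
  proof (rule pcplx_sub[OF P])
    show "hmodule (std (?B i))" for i by (rule pmodD(1)[OF pmod_kernel[OF pcplx_pmod[OF P] eh]])
    show "dif P i x \<in> ?B (i + 1)" if "x \<in> ?B i" for i x
      using that bcplx_dif_car[OF bP] chain_dif[OF e] hom_zero[OF H bcplx_dif[OF bP]] by simp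
  qed auto
  note bA = pcplx_bcplx[OF pA] and bB = pcplx_bcplx[OF pB]
  let ?S = "cplx_sum A B"
  have S: "bcplx ?S" by (rule bcplx_cplx_sum[OF bA bB])
  have iA: "chain_map A P (\<lambda>i x. x)" and iB: "chain_map B P (\<lambda>i x. x)"
    unfolding chain_map_def mod_hom_def by (auto simp: obA obB aP)
  have rA: "chain_map P A e"
    unfolding chain_map_def
  proof (intro conjI allI ballI)
    fix i show "mod_hom (ob P i) (ob A i) (e i)"
      using eh[of i] idem unfolding mod_hom_def obA by (simp add: aP)
  qed (simp add: chain_dif[OF e] obA)
  have rB: "chain_map P B (\<lambda>i x. x - e i x)"
    unfolding chain_map_def
  proof (intro conjI allI ballI)
    fix i
    have "e i (x - e i x) = 0" if "x \<in> car (ob P i)" for x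
      using hom_diff[OF H eh that ec[OF that]] idem[OF that] by simp
    then show "mod_hom (ob P i) (ob B i) (\<lambda>x. x - e i x)"
      using mod_hom_diff[OF H mod_hom_id eh, of i] unfolding mod_hom_def obB by (simp add: aP)
    fix x assume "x \<in> car (ob P i)"
    then show "dif P i x - e (i + 1) (dif P i x) = dif B i (x - e i x)"
      using hom_diff[OF H bcplx_dif[OF bP] _ ec] by (simp add: obB chain_dif[OF e])
  qed
  have f: "chain_map P ?S (\<lambda>i x. pr (e i x) (x - e i x))"
    using chain_hom[OF rA] chain_hom[OF rB] chain_dif[OF rA] chain_dif[OF rB]
    unfolding chain_map_def by (simp add: mod_hom_pr_iff)
  have g: "chain_map ?S P (\<lambda>i z. lft z + rgt z)"
    unfolding chain_map_def
  proof (intro conjI allI ballI)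
    fix i show "mod_hom (ob ?S i) (ob P i) (\<lambda>z. lft z + rgt z)"
      unfolding ob_cplx_sum
      by (rule mod_hom_add[OF H mod_hom_lft[OF chain_hom[OF iA]] mod_hom_rgt[OF chain_hom[OF iB]]])
    fix z assume "z \<in> car (ob ?S i)"
    then show "lft (dif ?S i z) + rgt (dif ?S i z) = dif P i (lft z + rgt z)"
      using hom_add[OF bcplx_dif[OF bP]] by (simp add: obA obB)
  qed
  have "d_iso P ?S"
  proof (rule d_iso_htpc[OF bP S f g])
    show "htpc P P (\<lambda>i x. lft (pr (e i x) (x - e i x)) + rgt (pr (e i x) (x - e i x))) (\<lambda>i x. x)"
      by (rule htpc_eq[OF bP]) simp
    show "htpc ?S ?S (\<lambda>i x. pr (e i (lft x + rgt x)) (lft x + rgt x - e i (lft x + rgt x))) (\<lambda>i x. x)"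
    proof (rule htpc_eq[OF S])
      fix i z assume "z \<in> car (ob ?S i)"
      then have z: "lft z \<in> car (ob P i)" "e i (lft z) = lft z" "rgt z \<in> car (ob P i)" "e i (rgt z) = 0"
        by (simp_all add: obA obB)
      then have "e i (lft z + rgt z) = lft z" using hom_add[OF eh z(1,3)] by simp
      then show "pr (e i (lft z + rgt z)) (lft z + rgt z - e i (lft z + rgt z)) = z" by simp
    qed
  qed
  then have "d_iso A zero_cplx \<or> d_iso B zero_cplx"
    using ind bA bB unfolding indecomposable_def by blast
  then show ?thesis
  proof
    assume "d_iso A zero_cplx"
    then have "null_htpy A A (\<lambda>i x. x)" by (rule d_iso_zero_null[OF pcplx_proj[OF pA]])
    then have "null_htpy P P e"
      using null_left[OF iA null_right[OF rA] bP bA] by blast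
    then show ?thesis by blast
  next
    assume "d_iso B zero_cplx"
    then have "null_htpy B B (\<lambda>i x. x)" by (rule d_iso_zero_null[OF pcplx_proj[OF pB]])
    then have "null_htpy P P (\<lambda>i x. x - e i x)"
      using null_left[OF iB null_right[OF rB] bP bB] by blast
    then have "htpc P P e (\<lambda>i x. x)" using null_uminus[OF bP] by (fastforce simp: htpc_def)
    then show ?thesis by blast
  qed
qed

lemma chain_map_funpow: "chain_map P P a \<Longrightarrow> chain_map P P (\<lambda>i. a i ^^ n)"
proof (induction n)
  case 0 then show ?case using chain_map_id[of P] by (simp add: id_def)
next
  case (Suc n)
  then show ?case using chain_map_comp[OF Suc.IH[OF Suc.prems] Suc.prems] by (simp add: comp_def)
qed

text \<open>Kernels and images of the powers of \<open>a\<close> stabilize in every degree for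
  reasons of dimension. Only finitely many degrees are nonzero, so one exponent serves them
  all.\<close>

lemma power_stable:
  assumes P: "pcplx (P :: 'h cplx)" and a: "chain_map P P a"
  obtains n where "n \<ge> 1"
    "\<And>i m. m \<ge> n \<Longrightarrow> (a i ^^ m) ` car (ob P i) = (a i ^^ n) ` car (ob P i)"
    "\<And>i m x. m \<ge> n \<Longrightarrow> x \<in> car (ob P i) \<Longrightarrow> (a i ^^ m) x = 0 \<Longrightarrow> (a i ^^ n) x = 0"
proof -
  note bP = pcplx_bcplx[OF P] and pm = pcplx_pmod[OF P]
  note H = bcplx_hmod[OF bP]
  note h = chain_hom[OF chain_map_funpow[OF a]] and c = chain_car[OF chain_map_funpow[OF a]]
  let ?U = "\<lambda>i n. {x \<in> car (ob P i). (a i ^^ n) x = 0}" and ?W = "\<lambda>i n. (a i ^^ n) ` car (ob P i)"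
  have sub: "?U i n \<subseteq> car (ob P i)" "?W i n \<subseteq> car (ob P i)" for i n using c by auto
  have sU: "E.subspace (?U i n)" for i n using pmod_subspace[OF pmod_kernel[OF pm h]] by simp
  have "hmodule (std (?W i n))" for i n
    using hmodule_image[OF H H h, of n i] pmodD(2)[OF pm] by (simp add: std_def)
  then have sW: "E.subspace (?W i n)" for i n
    using pmod_subspace[OF pmod_sub[OF pm sub(2)]] by simp
  have Us: "?U i n \<subseteq> ?U i (Suc n)" for i n
    using hom_zero[OF H chain_hom[OF a]] by auto
  have Ws: "?W i (Suc n) \<subseteq> ?W i n" for i n
    using chain_car[OF a] by (auto simp: funpow_swap1)
  have "\<exists>n. \<forall>m\<ge>n. ?U i m = ?U i n \<and> ?W i m = ?W i n" for i
  proof -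
    obtain F where F: "finite F" "car (ob P i) \<subseteq> E.span F" using pmod_span[OF pm] by metis
    obtain n1 where n1: "\<And>m. m \<ge> n1 \<Longrightarrow> ?U i m = ?U i n1"
    proof (rule E.subspace_chain_stable[OF F(1), of "?U i"])
      show "?U i n \<subseteq> E.span F" for n using sub(1) F(2) by blast
    qed (use sU Us in auto)
    obtain n2 where n2: "\<And>m. m \<ge> n2 \<Longrightarrow> ?W i m = ?W i n2"
    proof (rule E.subspace_chain_stable[OF F(1), of "?W i"])
      show "?W i n \<subseteq> E.span F" for n using sub(2) F(2) by blast
    qed (use sW Ws in auto)
    show "\<exists>n. \<forall>m\<ge>n. ?U i m = ?U i n \<and> ?W i m = ?W i n"
    proof (intro exI[of _ "max n1 n2"] allI impI)
      fix m assume "max n1 n2 \<le> m"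
      then show "?U i m = ?U i (max n1 n2) \<and> ?W i m = ?W i (max n1 n2)"
        using n1[of m] n1[of "max n1 n2"] n2[of m] n2[of "max n1 n2"] by simp
    qed
  qed
  then have "\<forall>i. \<exists>n. \<forall>m\<ge>n. ?U i m = ?U i n \<and> ?W i m = ?W i n" by blast
  from choice[OF this] obtain N where
    N: "\<And>i m. m \<ge> N i \<Longrightarrow> ?U i m = ?U i (N i) \<and> ?W i m = ?W i (N i)" by blast
  \<comment> \<open>The inserted 1 makes \<open>a\<close> a factor of the chosen power, from which
    the inverse of \<open>a\<close> is later read off.\<close>
  define n where "n = Max (insert 1 (N ` {i. car (ob P i) \<noteq> {0}}))"
  have fin: "finite (insert 1 (N ` {i. car (ob P i) \<noteq> {0}}))" using bcplx_fin[OF bP] by simp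
  have n1: "n \<ge> 1" unfolding n_def using fin by (intro Max_ge) auto
  have nN: "n \<ge> N i" if "car (ob P i) \<noteq> {0}" for i
    unfolding n_def using fin that by (intro Max_ge) auto
  have z: "(a i ^^ m) 0 = 0" for i m by (rule hom_zero[OF H h])
  have UW: "?U i m = ?U i n \<and> ?W i m = ?W i n" if m: "m \<ge> n" for i m
  proof (cases "car (ob P i) = {0}")
    case True then show ?thesis using z by auto
  next
    case False
    then have "N i \<le> n" "N i \<le> m" using nN[of i] m by auto
    then show ?thesis using N[of i m] N[of i n] by simp
  qed
  show thesis
  proof (rule that[OF n1])
    show "?W i m = ?W i n" if "m \<ge> n" for i m using UW[OF that] by blast
    show "(a i ^^ n) x = 0" if "m \<ge> n" "x \<in> car (ob P i)" "(a i ^^ m) x = 0" for i m x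
      using UW[OF that(1)] that(2,3) by blast
  qed
qed

text \<open>Fitting's lemma, applied to the chain map itself rather than to its homotopy class: \<open>P\<close> is the
  direct sum of the kernel and the image of a high power of \<open>a\<close>.\<close>

lemma local_end_of_indecomposable:
  assumes P: "pcplx (P :: 'h cplx)" and ind: "indecomposable P"
  shows "local_end P"
  unfolding local_end_def
proof (intro conjI allI impI)
  note bP = pcplx_bcplx[OF P]
  note H = bcplx_hmod[OF bP]
  show "\<not> null_htpy P P (\<lambda>i x. x)"
  proof
    assume "null_htpy P P (\<lambda>i x. x)"
    then have "deq P P [Arr P (\<lambda>i x. x) P] (zero_mor P P)"
      using deq_zero_iff[OF pcplx_proj[OF P] bP chain_map_id] by blast
    then have "d_iso P zero_cplx"
      using d_iso_zeroI[OF bP deq_trans[OF deq_sym[OF deq_ident'[OF bP]]]] by blast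
    then show False using ind unfolding indecomposable_def by blast
  qed
  fix a assume a: "chain_map P P a"
  obtain n where n: "n \<ge> 1"
    "\<And>i m. m \<ge> n \<Longrightarrow> (a i ^^ m) ` car (ob P i) = (a i ^^ n) ` car (ob P i)"
    "\<And>i m x. m \<ge> n \<Longrightarrow> x \<in> car (ob P i) \<Longrightarrow> (a i ^^ m) x = 0 \<Longrightarrow> (a i ^^ n) x = 0"
    using power_stable[OF P a] by blast
  define p where "p i = a i ^^ n" for i
  have pc: "chain_map P P p" unfolding p_def by (rule chain_map_funpow[OF a])
  note ph = chain_hom[OF pc] and pcar = chain_car[OF pc]
  \<comment> \<open>Elements z = p y of the image of p are compared through p (p z), hence the
    stability at exponent 3n.\<close>
  have ppp: "(a i ^^ (n + n + n)) x = p i (p i (p i x))" for i x by (simp add: p_def funpow_add)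
  have im: "\<exists>y\<in>car (ob P i). p i x = p i (p i (p i y))" if "x \<in> car (ob P i)" for i x
  proof -
    have "p i x \<in> (a i ^^ (n + n + n)) ` car (ob P i)"
      using n(2)[of "n + n + n" i] that unfolding p_def by simp
    then show ?thesis by (auto simp: ppp)
  qed
  have ker: "p i x = 0" if "x \<in> car (ob P i)" "p i (p i (p i x)) = 0" for i x
    using n(3)[of "n + n + n" x i] that unfolding ppp p_def[symmetric] by simp
  have uniq: "z = z'" if zz: "z \<in> p i ` car (ob P i)" "z' \<in> p i ` car (ob P i)" "p i (p i z) = p i (p i z')" for i z z'
  proof -
    obtain u u' where u: "u \<in> car (ob P i)" "z = p i u" "u' \<in> car (ob P i)" "z' = p i u'" using zz by blast
    note d = hom_diff[OF H ph]
    have "p i (p i (p i (u - u'))) = 0"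
      using zz(3) u by (simp add: d pcar hmod_diff[OF H])
    then have "p i (u - u') = 0" using ker hmod_diff[OF H u(1,3)] by blast
    then show ?thesis using u by (simp add: d)
  qed
  \<comment> \<open>On the image of p, where p is bijective, q inverts p; on the kernel q is zero.
    Since the value is unique, q is linear and commutes with the differential, and p q is the
    projection onto the image along the kernel.\<close>
  define q where "q i x = (THE z. z \<in> p i ` car (ob P i) \<and> p i (p i z) = p i x)" for i x
  have q: "q i x \<in> p i ` car (ob P i) \<and> p i (p i (q i x)) = p i x" if x: "x \<in> car (ob P i)" for i x
  proof -
    obtain y where y: "y \<in> car (ob P i)" "p i x = p i (p i (p i y))" using im[OF x] by blast
    show ?thesis unfolding q_def
    proof (rule theI[of _ "p i y"])
      show "p i y \<in> p i ` car (ob P i) \<and> p i (p i (p i y)) = p i x" using y by simp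
      show "z = p i y" if "z \<in> p i ` car (ob P i) \<and> p i (p i z) = p i x" for z
        by (rule uniq[of _ i]) (use that y in simp_all)
    qed
  qed
  have qI: "q i x = z" if "x \<in> car (ob P i)" "z \<in> p i ` car (ob P i)" "p i (p i z) = p i x" for i x z
  proof (rule uniq[of _ i])
    show "q i x \<in> p i ` car (ob P i)" using q[OF that(1)] by (rule conjunct1)
    show "z \<in> p i ` car (ob P i)" by (rule that(2))
    show "p i (p i (q i x)) = p i (p i z)" unfolding that(3) using q[OF that(1)] by (rule conjunct2)
  qed
  have qcar: "q i x \<in> car (ob P i)" if x: "x \<in> car (ob P i)" for i x
    using q[OF x, THEN conjunct1] by (auto simp: pcar)
  have qc: "chain_map P P q"
    unfolding chain_map_def mod_hom_def
  proof (intro conjI allI ballI)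
    fix i x assume x: "x \<in> car (ob P i)"
    obtain u where u: "u \<in> car (ob P i)" "q i x = p i u" using q[OF x, THEN conjunct1] by auto
    show "q i x \<in> car (ob P i)" by (rule qcar[OF x])
    show "q i (act (ob P i) b x) = act (ob P i) b (q i x)" for b
    proof (rule qI[OF hmod_act[OF H x]])
      show "act (ob P i) b (q i x) \<in> p i ` car (ob P i)"
        unfolding u(2) hom_act[OF ph u(1), symmetric] by (rule imageI[OF hmod_act[OF H u(1)]])
      show "p i (p i (act (ob P i) b (q i x))) = p i (act (ob P i) b x)"
        using q[OF x] by (simp add: hom_act[OF ph] pcar qcar x)
    qed
    show "q (i + 1) (dif P i x) = dif P i (q i x)"
    proof (rule qI[OF bcplx_dif_car[OF bP x]])
      show "dif P i (q i x) \<in> p (i + 1) ` car (ob P (i + 1))"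
        unfolding u(2) chain_dif[OF pc u(1), symmetric] by (rule imageI[OF bcplx_dif_car[OF bP u(1)]])
      show "p (i + 1) (p (i + 1) (dif P i (q i x))) = p (i + 1) (dif P i x)"
        using q[OF x] by (simp add: chain_dif[OF pc] pcar qcar x)
    qed
    fix y assume y: "y \<in> car (ob P i)"
    obtain v where v: "v \<in> car (ob P i)" "q i y = p i v" using q[OF y, THEN conjunct1] by auto
    show "q i (x + y) = q i x + q i y"
    proof (rule qI[OF hmod_add[OF H x y]])
      show "q i x + q i y \<in> p i ` car (ob P i)"
        unfolding u(2) v(2) hom_add[OF ph u(1) v(1), symmetric] by (rule imageI[OF hmod_add[OF H u(1) v(1)]])
      show "p i (p i (q i x + q i y)) = p i (x + y)"
        using q[OF x] q[OF y] by (simp add: hom_add[OF ph] pcar qcar x y)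
    qed
  qed
  define e where "e i x = p i (q i x)" for i x
  have ec: "chain_map P P e" unfolding e_def by (rule chain_map_comp[OF qc pc])
  have qp: "q i (p i x) = e i x" if x: "x \<in> car (ob P i)" for i x
    by (rule qI[OF pcar[OF x]]) (use q[OF x] qcar[OF x] in \<open>auto simp: e_def\<close>)
  have pe: "p i (e i x) = p i x" if x: "x \<in> car (ob P i)" for i x using q[OF x] by (simp add: e_def)
  have ep: "e i (p i x) = p i x" if x: "x \<in> car (ob P i)" for i x
    using qp[OF x] pe[OF x] by (simp add: e_def)
  have idem: "e i (e i x) = e i x" if x: "x \<in> car (ob P i)" for i x
    using ep[OF qcar[OF x]] by (simp add: e_def)
  \<comment> \<open>The geometric sum, with (1 - a) S = S (1 - a) = 1 - \<open>a^m\<close>. If e is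
    null, then 1 - e is homotopic to 1 and annihilates p from either side, so the sum for m = n, cut
    down by 1 - e, inverts 1 - a.\<close>
  define S where "S = (\<lambda>m i x. \<Sum>j<m. (a i ^^ j) x)"
  have Sc: "chain_map P P (S m)" for m
    unfolding S_def
    by (induction m) (simp_all add: chain_map_zero bP chain_map_add[OF bP] chain_map_funpow[OF a])
  have S1: "S m i x - a i (S m i x) = x - (a i ^^ m) x" if x: "x \<in> car (ob P i)" for m i x
  proof (induction m)
    case 0 then show ?case by (simp add: S_def hom_zero[OF H chain_hom[OF a]])
  next
    case (Suc m)
    have "a i (S (Suc m) i x) = a i (S m i x) + a i ((a i ^^ m) x)"
      using hom_add[OF chain_hom[OF a] chain_car[OF Sc x] chain_car[OF chain_map_funpow[OF a] x]]
      by (simp add: S_def)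
    then show ?case using Suc by (simp add: S_def algebra_simps)
  qed
  have S2: "S m i (x - a i x) = x - (a i ^^ m) x" if x: "x \<in> car (ob P i)" for m i x
  proof (induction m)
    case 0 then show ?case by (simp add: S_def)
  next
    case (Suc m)
    have "(a i ^^ m) (x - a i x) = (a i ^^ m) x - (a i ^^ m) (a i x)"
      by (rule hom_diff[OF H chain_hom[OF chain_map_funpow[OF a]] x chain_car[OF a x]])
    then show ?case using Suc by (simp add: S_def funpow_swap1)
  qed
  consider "null_htpy P P e" | "htpc P P e (\<lambda>i x. x)"
    using strict_idempotent[OF P ind ec idem] by blast
  then show "htpy_unit P a \<or> htpy_unit P (\<lambda>i x. x - a i x)"
  proof cases
    case 1
    have e1: "htpc P P (\<lambda>i x. x - e i x) (\<lambda>i x. x)"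
      using null_uminus[OF bP 1] by (simp add: htpc_def)
    have dc: "chain_map P P (\<lambda>i x. x - e i x)" by (rule chain_map_diff[OF bP chain_map_id ec])
    have "htpc P P (\<lambda>i x. S n i (x - a i x) - e i (S n i (x - a i x))) (\<lambda>i x. x)"
    proof (rule htpc_trans[OF bP htpc_eq[OF bP] e1])
      fix i x assume x: "x \<in> car (ob P i)"
      have "e i (x - p i x) = e i x - p i x"
        using hom_diff[OF H chain_hom[OF ec] x pcar[OF x]] ep[OF x] by simp
      then show "S n i (x - a i x) - e i (S n i (x - a i x)) = x - e i x"
        using S2[OF x, of n] by (simp add: p_def[symmetric])
    qed
    moreover have "chain_map P P (\<lambda>i x. S n i x - e i (S n i x))"
      by (rule chain_map_diff[OF bP Sc chain_map_comp[OF Sc ec]])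
    moreover have "htpc P P (\<lambda>i x. S n i (x - e i x) - a i (S n i (x - e i x))) (\<lambda>i x. x)"
    proof (rule htpc_trans[OF bP htpc_eq[OF bP] e1])
      fix i x assume x: "x \<in> car (ob P i)"
      have "p i (x - e i x) = 0"
        using hom_diff[OF H ph x chain_car[OF ec x]] pe[OF x] by simp
      then show "S n i (x - e i x) - a i (S n i (x - e i x)) = x - e i x"
        using S1[OF chain_car[OF dc x], of n] by (simp add: p_def[symmetric])
    qed
    moreover have "chain_map P P (\<lambda>i x. S n i (x - e i x))" by (rule chain_map_comp[OF dc Sc])
    ultimately show ?thesis unfolding htpy_unit_def by blast
  next
    case 2
    \<comment> \<open>Here q p = p q = e is homotopic to 1 and p = \<open>a^(m+1)\<close>, so q with
      m factors a attached inverts a from either side.\<close>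
    obtain m where m: "n = Suc m" using n(1) by (cases n) auto
    let ?a = "\<lambda>i. a i ^^ m"
    have "htpc P P (\<lambda>i x. q i (?a i (a i x))) (\<lambda>i x. x)"
    proof (rule htpc_trans[OF bP htpc_eq[OF bP] 2])
      fix i x assume x: "x \<in> car (ob P i)"
      have "?a i (a i x) = p i x" by (simp add: p_def m funpow_swap1)
      then show "q i (?a i (a i x)) = e i x" using qp[OF x] by simp
    qed
    moreover have "htpc P P (\<lambda>i x. a i (?a i (q i x))) (\<lambda>i x. x)"
    proof (rule htpc_trans[OF bP htpc_eq[OF bP] 2])
      fix i x
      show "a i (?a i (q i x)) = e i x" by (simp add: e_def p_def m)
    qed
    moreover have "chain_map P P (\<lambda>i x. q i (?a i x))" "chain_map P P (\<lambda>i x. ?a i (q i x))"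
      by (rule chain_map_comp[OF chain_map_funpow[OF a] qc], rule chain_map_comp[OF qc chain_map_funpow[OF a]])
    ultimately show ?thesis unfolding htpy_unit_def by blast
  qed
qed

end

section \<open>Auslander--Reiten triangles\<close>

definition split_epi :: "'h::ring_1 cplx \<Rightarrow> 'h cplx \<Rightarrow> 'h cmap \<Rightarrow> bool" where
  "split_epi Q P p \<longleftrightarrow> (\<exists>q. chain_map P Q q \<and> htpc P P (\<lambda>i x. p i (q i x)) (\<lambda>i x. x))"

text \<open>The connecting morphism \<open>P \<rightarrow> R\<close> of an Auslander--Reiten triangle ending at \<open>P\<close>.\<close>

definition ar_mor :: "'h::ring_1 cplx \<Rightarrow> 'h cplx \<Rightarrow> 'h cmap \<Rightarrow> bool" where
  "ar_mor P R \<omega> \<longleftrightarrow> chain_map P R \<omega> \<and> \<not> null_htpy P R \<omega> \<and>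
     (\<forall>Q p. pcplx Q \<and> chain_map Q P p \<and> \<not> split_epi Q P p \<longrightarrow> null_htpy Q R (\<lambda>i x. \<omega> i (p i x)))"

section \<open>Homotopy fibres and the exactness of Hom on a triangle\<close>

context
  fixes P S :: "'h::ring_1 cplx" and f
  assumes P: "bcplx P" and S: "bcplx S" and f: "chain_map P S f"
begin

text \<open>The homotopy fibre of \<open>f\<close>: a chain map into it is a chain map g into
  \<open>P\<close> together with a homotopy that makes f g null.\<close>

definition fib :: "'h cplx" where "fib = unshift (cone P S f)"

lemma ob_fib [simp]: "ob fib i = mod_sum (ob P i) (ob S (i - 1))"
  and dif_fib [simp]: "dif fib i z = pr (dif P i (lft z)) (- (f i (lft z) + dif S (i - 1) (rgt z)))"
  by (simp_all add: fib_def pr_minus)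

lemma bcplx_fib: "bcplx fib"
  unfolding fib_def by (rule bcplx_unshift[OF bcplx_cone[OF P S f]])

lemma fib_lft: "chain_map fib P (\<lambda>i. lft)"
  unfolding chain_map_def by (simp add: mod_hom_lft[OF mod_hom_id])

lemma null_fib: "null_htpy fib S (\<lambda>i z. f i (lft z))"
proof (rule null_htpyI[where h = "\<lambda>i z. - rgt z"])
  show "mod_hom (ob fib i) (ob S (i - 1)) (\<lambda>z. - rgt z)" for i
    unfolding ob_fib by (rule mod_hom_uminus[OF bcplx_hmod[OF S] mod_hom_rgt[OF mod_hom_id]])
  fix i z assume "z \<in> car (ob fib i)"
  then show "f i (lft z) = dif S (i - 1) (- rgt z) + - rgt (dif fib i z)"
    using hom_uminus[OF bcplx_hmod[OF S] bcplx_dif[OF S], of "rgt z" "i - 1"] by simp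
qed

lemma fib_lift:
  assumes g: "chain_map Q P g" and n: "null_htpy Q S (\<lambda>i x. f i (g i x))"
  obtains g' where "chain_map Q fib g'" "\<And>i x. lft (g' i x) = g i x"
proof -
  obtain k where k: "\<And>i. mod_hom (ob Q i) (ob S (i - 1)) (k i)"
    "\<And>i x. x \<in> car (ob Q i) \<Longrightarrow> f i (g i x) = dif S (i - 1) (k i x) + k (i + 1) (dif Q i x)"
    using n by (rule null_htpyE) blast
  show thesis
  proof (rule that[of "\<lambda>i x. pr (g i x) (- k i x)"])
    show "chain_map Q fib (\<lambda>i x. pr (g i x) (- k i x))"
      unfolding chain_map_def
    proof (intro conjI allI ballI)
      fix i
      show "mod_hom (ob Q i) (ob fib i) (\<lambda>x. pr (g i x) (- k i x))"
        unfolding ob_fib mod_hom_pr_iff lft_pr rgt_pr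
        by (intro conjI chain_hom[OF g] mod_hom_uminus[OF bcplx_hmod[OF S] k(1)])
      fix x assume x: "x \<in> car (ob Q i)"
      show "pr (g (i + 1) (dif Q i x)) (- k (i + 1) (dif Q i x)) = dif fib i (pr (g i x) (- k i x))"
        using chain_dif[OF g x] k(2)[OF x] hom_uminus[OF bcplx_hmod[OF S] bcplx_dif[OF S] hom_car[OF k(1) x]]
        by simp
    qed
  qed simp
qed

text \<open>Exactness of Hom(-, R) at P in the triangle formed by the fibre, P and S. The
  null-homotopy splits into its restriction to S, which is the factor up to sign, and its
  restriction to P, which is the remaining homotopy.\<close>

lemma fib_factor:
  assumes R: "bcplx R" and w: "chain_map P R w" and n: "null_htpy fib R (\<lambda>i z. w i (lft z))"
  obtains h where "chain_map S R h" "htpc P R (\<lambda>i x. h i (f i x)) w"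
proof -
  obtain H where H: "\<And>i. mod_hom (ob fib i) (ob R (i - 1)) (H i)"
    "\<And>i z. z \<in> car (ob fib i) \<Longrightarrow> w i (lft z) = dif R (i - 1) (H i z) + H (i + 1) (dif fib i z)"
    using n by (rule null_htpyE) blast
  note FH = bcplx_hmod[OF bcplx_fib]
  have z: "0 \<in> car (ob P i)" "0 \<in> car (ob S i)" for i
    using hmod_zero[OF bcplx_hmod[OF P]] hmod_zero[OF bcplx_hmod[OF S]] by auto
  have d0: "dif P i 0 = 0" "dif S i 0 = 0" "f i 0 = 0" "w i 0 = 0" for i
    by (rule hom_zero[OF bcplx_hmod[OF P] bcplx_dif[OF P]] hom_zero[OF bcplx_hmod[OF S] bcplx_dif[OF S]]
      hom_zero[OF bcplx_hmod[OF P] chain_hom[OF f]] hom_zero[OF bcplx_hmod[OF P] chain_hom[OF w]])+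
  have H2: "mod_hom (ob S i) (ob R i) (\<lambda>y. H (i + 1) (pr 0 y))" for i
  proof -
    have "mod_hom (ob S i) (ob fib (i + 1)) (\<lambda>y. pr 0 y)"
      by (simp add: mod_hom_pr_iff mod_hom_id mod_hom_zero bcplx_hmod P)
    then show ?thesis using mod_hom_comp[OF _ H(1), of "ob S i" "i + 1"] by simp
  qed
  have H1: "mod_hom (ob P i) (ob R (i - 1)) (\<lambda>x. H i (pr x 0))" for i
  proof -
    have "mod_hom (ob P i) (ob fib i) (\<lambda>x. pr x 0)"
      by (simp add: mod_hom_pr_iff mod_hom_id mod_hom_zero bcplx_hmod S)
    then show ?thesis by (rule mod_hom_comp[OF _ H(1)])
  qed
  have neg: "H (i + 1) (pr 0 (- y)) = - H (i + 1) (pr 0 y)" if "y \<in> car (ob S i)" for i y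
    by (rule hom_uminus[OF bcplx_hmod[OF S] H2 that])
  have h: "chain_map S R (\<lambda>i y. - H (i + 1) (pr 0 y))"
    unfolding chain_map_def
  proof (intro conjI allI ballI)
    fix i show "mod_hom (ob S i) (ob R i) (\<lambda>y. - H (i + 1) (pr 0 y))"
      by (rule mod_hom_uminus[OF bcplx_hmod[OF R] H2])
    fix y assume y: "y \<in> car (ob S i)"
    have "pr 0 y \<in> car (ob fib (i + 1))" using y z by simp
    from H(2)[OF this] have "0 = dif R i (H (i + 1) (pr 0 y)) + H (i + 1 + 1) (pr 0 (- dif S i y))"
      by (simp add: d0)
    then have "dif R i (H (i + 1) (pr 0 y)) = H (i + 1 + 1) (pr 0 (dif S i y))"
      unfolding neg[OF bcplx_dif_car[OF S y]] by simp
    then show "- H (i + 1 + 1) (pr 0 (dif S i y)) = dif R i (- H (i + 1) (pr 0 y))"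
      using hom_uminus[OF bcplx_hmod[OF R] bcplx_dif[OF R] hom_car[OF H2 y]] by simp
  qed
  have "null_htpy P R (\<lambda>i x. w i x - - H (i + 1) (pr 0 (f i x)))"
  proof (rule null_htpyI[where h = "\<lambda>i x. H i (pr x 0)"])
    show "mod_hom (ob P i) (ob R (i - 1)) (\<lambda>x. H i (pr x 0))" for i by (rule H1)
    fix i x assume x: "x \<in> car (ob P i)"
    have x': "pr x 0 \<in> car (ob fib i)" using x z by simp
    have s: "pr (dif P i x) 0 \<in> car (ob fib (i + 1))" "pr 0 (- f i x) \<in> car (ob fib (i + 1))"
      using z bcplx_dif_car[OF P x] hmod_uminus[OF bcplx_hmod[OF S] chain_car[OF f x]] by simp_all
    have "w i x = dif R (i - 1) (H i (pr x 0)) + H (i + 1) (pr (dif P i x) (- f i x))"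
      using H(2)[OF x'] by (simp add: d0)
    also have "H (i + 1) (pr (dif P i x) (- f i x)) = H (i + 1) (pr (dif P i x) 0) + H (i + 1) (pr 0 (- f i x))"
      using hom_add[OF H(1) s] by (simp add: pr_add)
    finally show "w i x - - H (i + 1) (pr 0 (f i x)) = dif R (i - 1) (H i (pr x 0)) + H (i + 1) (pr (dif P i x) 0)"
      by (simp add: neg[OF chain_car[OF f x]])
  qed
  then have "htpc P R w (\<lambda>i x. - H (i + 1) (pr 0 (f i x)))" by (simp add: htpc_def)
  from htpc_sym[OF R this] show thesis by (rule that[OF h])
qed

lemma cone_in_chain: "chain_map S (cone P S f) (\<lambda>i y. pr 0 y)"
  unfolding chain_map_def
  by (simp add: mod_hom_pr_iff mod_hom_id mod_hom_zero bcplx_hmod P hom_zero[OF bcplx_hmod[OF P] bcplx_dif[OF P]]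
      hom_zero[OF bcplx_hmod[OF P] chain_hom[OF f]])

lemma null_cone_in: "null_htpy P (cone P S f) (\<lambda>i x. pr 0 (f i x))"
proof (rule null_htpyI[where h = "\<lambda>i x. pr x 0"])
  show "mod_hom (ob P i) (ob (cone P S f) (i - 1)) (\<lambda>x. pr x 0)" for i
    by (simp add: mod_hom_pr_iff mod_hom_id mod_hom_zero bcplx_hmod S)
qed (simp add: hom_zero[OF bcplx_hmod[OF S] bcplx_dif[OF S]] pr_add)

text \<open>Exactness of Hom(Q, -) at S in the triangle formed by P, S and the cone. The two
  coordinates of the null-homotopy are the lift and the remaining homotopy.\<close>

lemma cone_lift:
  assumes w: "chain_map Q S w" and n: "null_htpy Q (cone P S f) (\<lambda>i x. pr 0 (w i x))"
  obtains g where "chain_map Q P g" "htpc Q S (\<lambda>i x. f i (g i x)) w"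
proof -
  obtain k where k: "\<And>i. mod_hom (ob Q i) (ob (cone P S f) (i - 1)) (k i)"
    "\<And>i x. x \<in> car (ob Q i) \<Longrightarrow> pr 0 (w i x) = dif (cone P S f) (i - 1) (k i x) + k (i + 1) (dif Q i x)"
    using n by (rule null_htpyE) blast
  have l: "mod_hom (ob Q i) (ob P i) (\<lambda>x. lft (k i x))" "mod_hom (ob Q i) (ob S (i - 1)) (\<lambda>x. rgt (k i x))" for i
    using k(1)[of i] by (simp_all add: mod_hom_pr_iff)
  have e: "lft (k (i + 1) (dif Q i x)) = dif P i (lft (k i x))"
    "w i x = f i (lft (k i x)) + dif S (i - 1) (rgt (k i x)) + rgt (k (i + 1) (dif Q i x))"
    if x: "x \<in> car (ob Q i)" for i x
    using arg_cong[OF k(2)[OF x], of lft] arg_cong[OF k(2)[OF x], of rgt] by simp_all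
  have g: "chain_map Q P (\<lambda>i x. lft (k i x))" unfolding chain_map_def using l e by blast
  have "null_htpy Q S (\<lambda>i x. w i x - f i (lft (k i x)))"
    by (rule null_htpyI[where h = "\<lambda>i x. rgt (k i x)"]) (simp_all add: l e(2))
  then have "htpc Q S w (\<lambda>i x. f i (lft (k i x)))" by (simp add: htpc_def)
  from htpc_sym[OF S this] show thesis by (rule that[OF g])
qed

end

section \<open>Factorizations of the connecting morphism\<close>

context hereditary_algebra
begin

lemma pcplx_fib:
  assumes P: "pcplx (P :: 'h cplx)" and S: "pcplx S" and f: "chain_map P S f"
  shows "pcplx (fib P S f)"
  unfolding fib_def[OF pcplx_bcplx[OF P] pcplx_bcplx[OF S] f] by (rule pcplx_unshift[OF pcplx_cone[OF P S f]])

text \<open>The projection from the fibre of \<open>g\<close> to \<open>P\<close> becomes null after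
  \<open>g\<close>, so it cannot split unless \<open>g\<close> is null. Hence \<omega> vanishes on
  the fibre and factors through \<open>g\<close>.\<close>

lemma ar_mor_cofactor:
  assumes P: "pcplx (P :: 'h cplx)" and R: "pcplx R" and Q: "pcplx Q" and w: "ar_mor P R \<omega>"
    and g: "chain_map P Q g" and ng: "\<not> null_htpy P Q g"
  obtains f where "chain_map Q R f" "htpc P R (\<lambda>i x. f i (g i x)) \<omega>"
proof -
  note bP = pcplx_bcplx[OF P] and bQ = pcplx_bcplx[OF Q] and bR = pcplx_bcplx[OF R]
  let ?B = "fib P Q g"
  have wc: "chain_map P R \<omega>" using w by (simp add: ar_mor_def)
  note lf = fib_lft[OF bP bQ g]
  have "\<not> split_epi ?B P (\<lambda>i. lft)"
  proof
    assume "split_epi ?B P (\<lambda>i. lft)"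
    then obtain q where q: "chain_map P ?B q" "htpc P P (\<lambda>i x. lft (q i x)) (\<lambda>i x. x)"
      unfolding split_epi_def by blast
    have "null_htpy P Q (\<lambda>i x. g i (lft (q i x)))" by (rule null_right[OF q(1) null_fib[OF bP bQ g]])
    moreover have "htpc P Q (\<lambda>i x. g i (lft (q i x))) g"
      by (rule htpc_left[OF g q(2) bP bP chain_map_comp[OF q(1) lf] chain_map_id])
    ultimately show False using htpc_null'[OF bQ] ng by blast
  qed
  then have "null_htpy ?B R (\<lambda>i x. \<omega> i (lft x))"
    using w pcplx_fib[OF P Q g] lf unfolding ar_mor_def by blast
  then show thesis using fib_factor[OF bP bQ g bR wc] that by blast
qed

lemma ar_mor_left:
  assumes P: "pcplx (P :: 'h cplx)" and R: "pcplx R" and Q: "pcplx Q" and w: "ar_mor P R \<omega>"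
    and g: "chain_map P Q g" and ng: "\<not> null_htpy P Q g"
  obtains f where "chain_map Q R f" "\<not> null_htpy Q R f"
proof -
  obtain f where f: "chain_map Q R f" "htpc P R (\<lambda>i x. f i (g i x)) \<omega>"
    using ar_mor_cofactor[OF assms] by blast
  have "\<not> null_htpy Q R f"
  proof
    assume "null_htpy Q R f"
    then have "null_htpy P R \<omega>" using htpc_null'[OF pcplx_bcplx[OF R] f(2) null_right[OF g]] by blast
    then show False using w by (simp add: ar_mor_def)
  qed
  then show thesis using that f(1) by blast
qed

text \<open>If \<open>\<omega>\<close> did not lift along \<open>f\<close>, then some composite \<open>e : R \<rightarrow> cone f \<rightarrow> R\<close> would satisfy
  \<open>e \<circ> \<omega> = \<omega>\<close> and \<open>e \<circ> f = 0\<close>; since \<open>e\<close> or \<open>1 - e\<close> is a unit, \<open>f\<close> or \<open>\<omega>\<close> would be null.\<close>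

lemma ar_mor_right:
  assumes P: "pcplx (P :: 'h cplx)" and R: "pcplx R" and Q: "pcplx Q" and w: "ar_mor P R \<omega>"
    and l: "local_end R" and f: "chain_map Q R f" and nf: "\<not> null_htpy Q R f"
  obtains g where "chain_map P Q g" "\<not> null_htpy P Q g"
proof -
  note bP = pcplx_bcplx[OF P] and bQ = pcplx_bcplx[OF Q] and bR = pcplx_bcplx[OF R]
  let ?C = "cone Q R f" and ?s = "\<lambda>(i::int) y. pr 0 y"
  have wc: "chain_map P R \<omega>" and nw: "\<not> null_htpy P R \<omega>" using w by (auto simp: ar_mor_def)
  note C = pcplx_cone[OF Q R f] and s = cone_in_chain[OF bQ bR f]
  note bC = pcplx_bcplx[OF C]
  have n: "null_htpy P ?C (\<lambda>i x. pr 0 (\<omega> i x))"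
  proof (rule ccontr)
    assume "\<not> null_htpy P ?C (\<lambda>i x. pr 0 (\<omega> i x))"
    then obtain r where r: "chain_map ?C R r" "htpc P R (\<lambda>i x. r i (pr 0 (\<omega> i x))) \<omega>"
      using ar_mor_cofactor[OF P R C w chain_map_comp[OF wc s]] by blast
    let ?e = "\<lambda>i x. r i (pr 0 x)"
    have e: "chain_map R R ?e" by (rule chain_map_comp[OF s r(1)])
    consider "htpy_unit R ?e" | "htpy_unit R (\<lambda>i x. x - ?e i x)" using l e unfolding local_end_def by blast
    then show False
    proof cases
      case 1
      then obtain b where b: "chain_map R R b" "htpc R R (\<lambda>i x. b i (?e i x)) (\<lambda>i x. x)"
        unfolding htpy_unit_def by blast
      have "null_htpy Q R (\<lambda>i x. b i (r i (pr 0 (f i x))))"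
        using null_left[OF b(1) null_left[OF r(1) null_cone_in[OF bQ bR f] bQ bC] bQ bR] .
      moreover have "htpc Q R (\<lambda>i x. b i (r i (pr 0 (f i x)))) f" using htpc_right[OF f b(2)] .
      ultimately show False using htpc_null'[OF bR] nf by blast
    next
      case 2
      then obtain b where b: "chain_map R R b" "htpc R R (\<lambda>i x. b i (x - ?e i x)) (\<lambda>i x. x)"
        unfolding htpy_unit_def by blast
      have "null_htpy P R (\<lambda>i x. b i (\<omega> i x - ?e i (\<omega> i x)))"
        using null_left[OF b(1) htpc_sym[OF bR r(2), unfolded htpc_def] bP bR] .
      moreover have "htpc P R (\<lambda>i x. b i (\<omega> i x - ?e i (\<omega> i x))) \<omega>" using htpc_right[OF wc b(2)] .
      ultimately show False using htpc_null'[OF bR] nw by blast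
    qed
  qed
  obtain g where g: "chain_map P Q g" "htpc P R (\<lambda>i x. f i (g i x)) \<omega>"
    using cone_lift[OF bQ bR f wc n] by blast
  have "\<not> null_htpy P Q g"
  proof
    assume "null_htpy P Q g"
    from null_left[OF f this bP bQ] show False using htpc_null'[OF bR g(2)] nw by blast
  qed
  then show thesis using that g(1) by blast
qed

end

text \<open>After appending a[1] and its inverse, the two right-hand squares move the composite to
  the cone, where the second coordinate projects to zero on the nose.\<close>

lemma distinguished_comp_zero:
  assumes t: "distinguished X Y Z u v w"
  shows "deq Y (shift X) (v @ w) (zero_mor Y (shift X))"
proof -
  obtain A B f a b c where d: "dmor Y Z v" "dmor Z (shift X) w"
    and A: "bcplx A" "bcplx B" "chain_map A B f"
    and iso: "d_isomorphism X A a" "d_isomorphism Y B b" "d_isomorphism Z (cone A B f) c"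
    and e1: "deq Y (cone A B f) (v @ c) (b @ [Arr B cone_in (cone A B f)])"
    and e2: "deq Z (shift A) (w @ shift_mor a) (c @ [Arr (cone A B f) cone_out (shift A)])"
    using t unfolding distinguished_def by blast
  obtain a' where a: "dmor X A a" "dmor A X a'" "deq X X (a @ a') []"
    using iso(1) unfolding d_isomorphism_def by blast
  let ?C = "cone A B f"
  let ?i = "[Arr B cone_in ?C]" and ?o = "[Arr ?C cone_out (shift A)]"
  have b: "dmor Y B b" and c: "dmor Z ?C c" using iso unfolding d_isomorphism_def by auto
  have C: "bcplx ?C" by (rule bcplx_cone[OF A])
  have sA: "bcplx (shift A)" by (rule bcplx_shift[OF A(1)])
  have ci: "chain_map B ?C cone_in" using cone_in_chain[OF A] by (simp add: cone_in_def)
  have co: "chain_map ?C (shift A) cone_out"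
    unfolding chain_map_def cone_out_def by (simp add: mod_hom_lft[OF mod_hom_id])
  have io: "deq B (shift A) (?i @ ?o) (zero_mor B (shift A))"
    using deq_comp'[OF ci co A(2) C sA] by (simp add: zero_mor_def cone_in_def cone_out_def)
  note sa = dmor_shift[OF a(1)] and sa' = dmor_shift[OF a(2)]
  have saa: "deq (shift X) (shift X) (shift_mor a @ shift_mor a') []"
    using deq_shift[OF a(3)] by (simp add: shift_mor_def)
  have sX: "bcplx (shift X)" and Y: "bcplx Y" using dmor_bcplx d by blast+
  have o: "dmor ?C (shift A) ?o" and i: "dmor B ?C ?i" using C sA A co ci by auto
  have z: "dmor (shift X) (shift X) []" using sX by simp
  have 1: "deq Y (shift X) ((v @ w) @ (shift_mor a @ shift_mor a') @ []) ((v @ w) @ [])"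
    by (rule deq_cancel[OF dmor_append[OF d] saa z])
  have 2: "deq Y (shift X) (v @ (w @ shift_mor a) @ shift_mor a') (v @ (c @ ?o) @ shift_mor a')"
    by (rule deq_cong[OF d(1) e2 sa'])
  have 3: "deq Y (shift X) ((v @ c) @ (?o @ shift_mor a')) ((b @ ?i) @ (?o @ shift_mor a'))"
    by (rule deq_app[OF e1 deq_refl[OF dmor_append[OF o sa']]])
  have 4: "deq Y (shift X) (b @ (?i @ ?o) @ shift_mor a') (b @ zero_mor B (shift A) @ shift_mor a')"
    by (rule deq_cong[OF b io sa'])
  have 5: "deq Y (shift X) (b @ (zero_mor B (shift A) @ shift_mor a')) (b @ zero_mor B (shift X))"
    by (rule deq_app[OF deq_refl[OF b] deq_zero_right[OF sa' A(2)]])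
  have 6: "deq Y (shift X) (b @ zero_mor B (shift X)) (zero_mor Y (shift X))"
    by (rule deq_zero_left[OF b sX])
  show ?thesis
    using deq_trans[OF deq_sym[OF 1[simplified]] deq_trans[OF 2[simplified] deq_trans[OF 3[simplified]
      deq_trans[OF 4[simplified] deq_trans[OF 5[simplified] 6[simplified]]]]]] by simp
qed

context hereditary_algebra
begin

text \<open>Transport of the connecting morphism to projective models of N and M[1]. A chain map p
  that is not a split epimorphism lifts through v, and v followed by w is zero.\<close>

lemma ar_mor_of_triangle:
  assumes t: "ar_triangle M Y N u v w" and P: "pcplx (P :: 'h cplx)" and PN: "d_iso P N"
    and R: "pcplx R" and RM: "d_iso R (shift M)"
  obtains \<omega> where "ar_mor P R \<omega>"
proof -
  note bP = pcplx_bcplx[OF P] and bR = pcplx_bcplx[OF R] and pP = pcplx_proj[OF P]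
  have dist: "distinguished M Y N u v w" and Y: "bcplx Y"
    and nw: "\<not> deq N (shift M) w (zero_mor N (shift M))"
    and lift: "\<And>W p. bcplx W \<Longrightarrow> dmor W N p \<Longrightarrow> \<not> retraction W N p \<Longrightarrow> \<exists>q. dmor W Y q \<and> deq W N (q @ v) p"
    using t unfolding ar_triangle_def by blast+
  have v: "dmor Y N v" and w: "dmor N (shift M) w" using dist unfolding distinguished_def by blast+
  obtain d d' where d: "dmor P N d" "dmor N P d'" "deq P P (d @ d') []" "deq N N (d' @ d) []"
    using PN by (rule d_isoE)
  obtain c' c where c: "dmor R (shift M) c'" "dmor (shift M) R c" "deq R R (c' @ c) []" "deq (shift M) (shift M) (c @ c') []"
    using RM by (rule d_isoE)
  have N: "bcplx N" and sM: "bcplx (shift M)" using dmor_bcplx w by blast+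
  have dwc: "dmor P R (d @ w @ c)" by (blast intro: dmor_append d w c)
  obtain \<omega> where \<omega>: "chain_map P R \<omega>" "deq P R (d @ w @ c) [Arr P \<omega> R]"
    using word_rep[OF pP dwc] by blast
  have "ar_mor P R \<omega>"
    unfolding ar_mor_def
  proof (intro conjI allI impI)
    show "chain_map P R \<omega>" by (rule \<omega>(1))
    show "\<not> null_htpy P R \<omega>"
    proof
      assume "null_htpy P R \<omega>"
      then have z: "deq P R (d @ w @ c) (zero_mor P R)"
        using deq_trans[OF \<omega>(2)] deq_zero_iff[OF pP bR \<omega>(1)] by blast
      have 1: "deq N (shift M) (d' @ (d @ w @ c) @ c') (d' @ zero_mor P R @ c')"
        by (rule deq_cong[OF d(2) z c(1)])
      have 2: "deq N (shift M) (d' @ zero_mor P R @ c') (d' @ zero_mor P (shift M))"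
        by (rule deq_app[OF deq_refl[OF d(2)] deq_zero_right[OF c(1) bP]])
      have 3: "deq N (shift M) (d' @ zero_mor P (shift M)) (zero_mor N (shift M))"
        by (rule deq_zero_left[OF d(2) sM])
      have nil: "dmor N N []" "dmor (shift M) (shift M) []" using N sM by auto
      have 4: "deq N (shift M) ([] @ (d' @ d) @ (w @ c @ c')) ([] @ (w @ c @ c'))"
        by (rule deq_cancel[OF nil(1) d(4)]) (blast intro: dmor_append w c)
      have 5: "deq N (shift M) (w @ (c @ c') @ []) (w @ [])"
        by (rule deq_cancel[OF w c(4) nil(2)])
      have "deq N (shift M) w (zero_mor N (shift M))"
        using deq_trans[OF deq_sym[OF deq_trans[OF 4[simplified] 5[simplified]]]
          deq_trans[OF 1[simplified] deq_trans[OF 2 3]]] by simp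
      then show False using nw by blast
    qed
    fix Q p assume "pcplx Q \<and> chain_map Q P p \<and> \<not> split_epi Q P p"
    then have Q: "pcplx Q" and p: "chain_map Q P p" and ns: "\<not> split_epi Q P p" by auto
    note bQ = pcplx_bcplx[OF Q]
    let ?p = "[Arr Q p P]"
    have p': "dmor Q P ?p" using bQ bP p by simp
    have pd: "dmor Q N (?p @ d)" by (rule dmor_append[OF p' d(1)])
    have nr: "\<not> retraction Q N (?p @ d)"
    proof
      assume "retraction Q N (?p @ d)"
      then obtain q where q: "dmor N Q q" "deq N N (q @ ?p @ d) []" unfolding retraction_def by blast
      obtain q' where q': "chain_map P Q q'" "deq P Q (d @ q) [Arr P q' Q]"
        using word_rep[OF pP dmor_append[OF d(1) q(1)]] by blast
      have "deq P P ((d @ q) @ ?p) ([Arr P q' Q] @ ?p)" by (rule deq_app[OF q'(2) deq_refl[OF p']])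
      moreover have "deq P P ([Arr P q' Q] @ ?p) [Arr P (\<lambda>i x. p i (q' i x)) P]"
        using deq_comp'[OF q'(1) p bP bQ bP] by simp
      ultimately have 1: "deq P P (d @ q @ ?p) [Arr P (\<lambda>i x. p i (q' i x)) P]" using deq_trans by simp
      have nil: "dmor P P []" using bP by simp
      have 2: "deq P P ((d @ q @ ?p) @ (d @ d') @ []) ((d @ q @ ?p) @ [])"
        by (rule deq_cancel[OF _ d(3) nil]) (blast intro: dmor_append d q p')
      have 3: "deq P P (d @ (q @ ?p @ d) @ d') (d @ d')"
        by (rule deq_cancel[OF d(1) q(2) d(2)])
      have "deq P P (d @ q @ ?p) []"
        using deq_trans[OF deq_sym[OF 2[simplified]] deq_trans[OF 3[simplified] d(3)]] by simp
      then have "deq P P [Arr P (\<lambda>i x. p i (q' i x)) P] [Arr P (\<lambda>i x. x) P]"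
        using deq_trans[OF deq_sym[OF 1]] deq_sym[OF deq_ident'[OF bP]] deq_trans by blast
      then have "htpc P P (\<lambda>i x. p i (q' i x)) (\<lambda>i x. x)"
        using deq_Arr_iff[OF pP bP chain_map_comp[OF q'(1) p] chain_map_id] by blast
      then show False using ns q'(1) unfolding split_epi_def by blast
    qed
    obtain q where q: "dmor Q Y q" "deq Q N (q @ v) (?p @ d)" using lift[OF bQ pd nr] by blast
    have wc: "dmor N R (w @ c)" by (rule dmor_append[OF w c(2)])
    have 1: "deq Q R ((q @ v) @ (w @ c)) ((?p @ d) @ (w @ c))"
      by (rule deq_app[OF q(2) deq_refl[OF wc]])
    have 2: "deq Q R (q @ (v @ w) @ c) (q @ zero_mor Y (shift M) @ c)"
      by (rule deq_cong[OF q(1) distinguished_comp_zero[OF dist] c(2)])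
    have 3: "deq Q R (q @ (zero_mor Y (shift M) @ c)) (q @ zero_mor Y R)"
      by (rule deq_app[OF deq_refl[OF q(1)] deq_zero_right[OF c(2) Y]])
    have 4: "deq Q R (q @ zero_mor Y R) (zero_mor Q R)" by (rule deq_zero_left[OF q(1) bR])
    have 5: "deq Q R (?p @ (d @ w @ c)) (?p @ [Arr P \<omega> R])" by (rule deq_app[OF deq_refl[OF p'] \<omega>(2)])
    have 6: "deq Q R (?p @ [Arr P \<omega> R]) [Arr Q (\<lambda>i x. \<omega> i (p i x)) R]"
      using deq_comp'[OF p \<omega>(1) bQ bP bR] by simp
    have "deq Q R [Arr Q (\<lambda>i x. \<omega> i (p i x)) R] (zero_mor Q R)"
      using deq_trans[OF deq_sym[OF deq_trans[OF 5[simplified] 6[simplified]]]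
        deq_trans[OF deq_sym[OF 1[simplified]] deq_trans[OF 2[simplified] deq_trans[OF 3[simplified] 4[simplified]]]]] by simp
    then show "null_htpy Q R (\<lambda>i x. \<omega> i (p i x))"
      using deq_zero_iff[OF pcplx_proj[OF Q] bR chain_map_comp[OF p \<omega>(1)]] by blast
  qed
  then show thesis by (rule that)
qed

end

context hereditary_algebra
begin

text \<open>The triangle is \<open>S[-1] \<rightarrow> fib f \<rightarrow> P \<rightarrow> S\<close> for a chain map \<open>f : P \<rightarrow> S\<close>; the cone of its first
  map is homotopy equivalent to \<open>P\<close> via \<open>x \<mapsto> (f x, (x, 0))\<close>.\<close>

lemma distinguished_fib:
  fixes S :: "'h cplx"
  assumes P: "bcplx P" and S: "bcplx S" and f: "chain_map P S f"
  shows "distinguished (unshift S) (fib P S f) P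
    [Arr (unshift S) (\<lambda>i y. pr 0 y) (fib P S f)] [Arr (fib P S f) (\<lambda>i. lft) P] [Arr P f S]"
proof -
  let ?A = "unshift S" and ?B = "fib P S f" and ?\<phi> = "\<lambda>(i::int) y. pr 0 y"
  note A = bcplx_unshift[OF S] and B = bcplx_fib[OF P S f]
  note [simp] = ob_fib[OF P S f] dif_fib[OF P S f]
  note lf = fib_lft[OF P S f]
  have P0: "dif P i 0 = 0" "f i 0 = 0" and S0: "dif S i 0 = 0" for i
    by (rule hom_zero[OF bcplx_hmod[OF P] bcplx_dif[OF P]] hom_zero[OF bcplx_hmod[OF P] chain_hom[OF f]]
      hom_zero[OF bcplx_hmod[OF S] bcplx_dif[OF S]])+
  have \<phi>: "chain_map ?A ?B ?\<phi>"
    unfolding chain_map_def by (simp add: mod_hom_pr_iff mod_hom_id mod_hom_zero bcplx_hmod P P0)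
  let ?C = "cone ?A ?B ?\<phi>"
  have C: "bcplx ?C" by (rule bcplx_cone[OF A B \<phi>])
  let ?c = "\<lambda>i x. pr (f i x) (pr x 0)" and ?d = "\<lambda>(i::int) z. lft (rgt z)"
  have c: "chain_map P ?C ?c"
    unfolding chain_map_def
    by (simp add: mod_hom_pr_iff mod_hom_id mod_hom_zero bcplx_hmod S chain_hom[OF f] chain_dif[OF f] S0 pr_add)
  have d: "chain_map ?C P ?d"
    unfolding chain_map_def by (simp add: mod_hom_rgt[OF mod_hom_lft[OF mod_hom_id]])
  have cd: "htpc ?C ?C (\<lambda>i z. z) (\<lambda>i z. ?c i (?d i z))"
    unfolding htpc_def
  \<comment> \<open>For z = (s, (x, s')) the difference z - c d z is (s - f x, (0, s')). The
    homotopy moves s' into the first coordinate.\<close>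
  proof (rule null_htpyI[where h = "\<lambda>i z. pr (rgt (rgt z)) 0"])
    have "mod_hom (mod_sum L (mod_sum M N)) N (\<lambda>z. rgt (rgt z))" for L M N :: "('h, 'h elt) hmod"
      by (rule mod_hom_rgt[OF mod_hom_rgt[OF mod_hom_id]])
    then show "mod_hom (ob ?C i) (ob ?C (i - 1)) (\<lambda>z. pr (rgt (rgt z)) 0)" for i
      by (simp add: mod_hom_pr_iff mod_hom_zero hmodule_mod_sum bcplx_hmod P S)
    show "z - ?c i (?d i z) = dif ?C (i - 1) (pr (rgt (rgt z)) 0) + pr (rgt (rgt (dif ?C i z))) 0" for i z
      by (rule elt_eqI) (simp_all add: P0 S0 eq_pr_iff)
  qed
  have cd': "htpc ?C ?C (\<lambda>i z. ?c i (?d i z)) (\<lambda>i z. z)" by (rule htpc_sym[OF C cd])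
  have dc: "htpc P P (\<lambda>i x. ?d i (?c i x)) (\<lambda>i x. x)" by (rule htpc_eq[OF P]) simp
  have ci: "chain_map ?B ?C cone_in" using cone_in_chain[OF A B \<phi>] by (simp add: cone_in_def)
  have iso: "d_isomorphism P ?C [Arr P ?c ?C]"
    unfolding d_isomorphism_def
  proof (intro conjI exI[of _ "[Arr ?C ?d P]"])
    show "deq P P ([Arr P ?c ?C] @ [Arr ?C ?d P]) []"
      using deq_trans[OF deq_trans[OF deq_comp'[OF c d P C P] htpc_deq[OF P P chain_map_comp[OF c d] chain_map_id dc]] deq_ident'[OF P]] by simp
    show "deq ?C ?C ([Arr ?C ?d P] @ [Arr P ?c ?C]) []"
      using deq_trans[OF deq_trans[OF deq_comp'[OF d c C P C] htpc_deq[OF C C chain_map_comp[OF d c] chain_map_id cd']] deq_ident'[OF C]] by simp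
  qed (simp_all add: P C c d)
  have id: "d_isomorphism X X []" if "bcplx X" for X :: "'h cplx"
    unfolding d_isomorphism_def using that by (auto intro!: exI[of _ "[]"] deq_refl)
  have u: "dmor ?A ?B [Arr ?A ?\<phi> ?B]" using A B \<phi> by simp
  have v: "dmor ?B P [Arr ?B (\<lambda>i. lft) P]" using B P lf by simp
  have w: "dmor P S [Arr P f S]" using P S f by simp
  have vc: "deq ?B ?C ([Arr ?B (\<lambda>i. lft) P] @ [Arr P ?c ?C]) [Arr ?B cone_in ?C]"
  proof -
    have "htpc ?B ?C (\<lambda>i z. ?c i (?d i (cone_in i z))) (\<lambda>i z. cone_in i z)" by (rule htpc_right[OF ci cd'])
    then have h: "htpc ?B ?C (\<lambda>i z. ?c i (lft z)) cone_in" by (simp add: cone_in_def)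
    show ?thesis
      using deq_trans[OF deq_comp'[OF lf c B P C] htpc_deq[OF B C chain_map_comp[OF lf c] ci h]] by simp
  qed
  have co: "chain_map ?C S cone_out"
    unfolding chain_map_def cone_out_def by (simp add: mod_hom_lft[OF mod_hom_id])
  have wc: "deq P S [Arr P f S] ([Arr P ?c ?C] @ [Arr ?C cone_out S])"
    using deq_sym[OF deq_comp'[OF c co P C S]] by (simp add: cone_out_def)
  show ?thesis
    unfolding distinguished_def
    apply (intro conjI)
       apply (rule u)
      apply (rule v)
     apply (simp add: w del: dmor.simps)
    apply (rule exI[of _ ?A], rule exI[of _ ?B], rule exI[of _ ?\<phi>], rule exI[of _ "[]"], rule exI[of _ "[]"],
        rule exI[of _ "[Arr P ?c ?C]"])
    apply (intro conjI A B \<phi> id iso)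
      apply (use deq_refl[OF u] in simp)
     apply (use vc in simp)
    apply (use wc in \<open>simp add: shift_mor_def\<close>)
    done
qed

text \<open>The triangle is the fibre sequence of \<omega> followed by an isomorphism from R to
  M[1]. The lifting property for a general W is checked on a projective resolution Q of W, where
  words become chain maps and lifts into the fibre are null-homotopies.\<close>

lemma is_tau_of_ar_mor:
  assumes P: "pcplx (P :: 'h cplx)" and indP: "indecomposable P" and indM: "indecomposable M"
    and R: "pcplx R" and RM: "d_iso R (shift M)" and w: "ar_mor P R \<omega>"
  shows "is_tau M P"
proof -
  note bP = pcplx_bcplx[OF P] and bR = pcplx_bcplx[OF R] and pP = pcplx_proj[OF P]
  let ?S = "shift M"
  have S: "bcplx ?S" using d_iso_bcplx[OF RM] by blast
  have wc: "chain_map P R \<omega>" and nw: "\<not> null_htpy P R \<omega>" using w by (auto simp: ar_mor_def)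
  obtain c d where c: "dmor R ?S c" "dmor ?S R d" "deq R R (c @ d) []" using RM by (rule d_isoE)
  have wd: "dmor P R [Arr P \<omega> R]" using bP bR wc by simp
  obtain f where f: "chain_map P ?S f" "deq P ?S ([Arr P \<omega> R] @ c) [Arr P f ?S]"
    using word_rep[OF pP dmor_append[OF wd c(1)]] by blast
  have nf: "\<not> null_htpy P ?S f"
  proof
    assume "null_htpy P ?S f"
    then have z: "deq P ?S ([Arr P \<omega> R] @ c) (zero_mor P ?S)"
      using deq_trans[OF f(2)] deq_zero_iff[OF pP S f(1)] by blast
    have nil: "dmor R R []" using bR by simp
    have 1: "deq P R ([Arr P \<omega> R] @ (c @ d) @ []) ([Arr P \<omega> R] @ [])" by (rule deq_cancel[OF wd c(3) nil])
    have 2: "deq P R (([Arr P \<omega> R] @ c) @ d) (zero_mor P ?S @ d)" by (rule deq_app[OF z deq_refl[OF c(2)]])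
    have "deq P R [Arr P \<omega> R] (zero_mor P R)"
      using deq_trans[OF deq_sym[OF 1[simplified]] deq_trans[OF 2[simplified] deq_zero_right[OF c(2) bP]]] by simp
    then show False using nw deq_zero_iff[OF pP bR wc] by blast
  qed
  have comp_null: "null_htpy Q ?S (\<lambda>i x. f i (p i x))" if Q: "pcplx Q" and p: "chain_map Q P p" and ns: "\<not> split_epi Q P p" for Q p
  proof -
    note bQ = pcplx_bcplx[OF Q] and pQ = pcplx_proj[OF Q]
    have pd: "dmor Q P [Arr Q p P]" using bQ bP p by simp
    have n: "null_htpy Q R (\<lambda>i x. \<omega> i (p i x))" using w Q p ns unfolding ar_mor_def by blast
    have pw: "deq Q R [Arr Q p P, Arr P \<omega> R] (zero_mor Q R)"
      using deq_trans[OF deq_comp'[OF p wc bQ bP bR]] n deq_zero_iff[OF pQ bR chain_map_comp[OF p wc]] by blast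
    have 1: "deq Q ?S ([Arr Q p P, Arr P \<omega> R] @ c) (zero_mor Q R @ c)" by (rule deq_app[OF pw deq_refl[OF c(1)]])
    have 2: "deq Q ?S ([Arr Q p P] @ ([Arr P \<omega> R] @ c)) ([Arr Q p P] @ [Arr P f ?S])"
      by (rule deq_app[OF deq_refl[OF pd] f(2)])
    have 3: "deq Q ?S ([Arr Q p P] @ [Arr P f ?S]) [Arr Q (\<lambda>i x. f i (p i x)) ?S]"
      using deq_comp'[OF p f(1) bQ bP S] by simp
    have "deq Q ?S [Arr Q (\<lambda>i x. f i (p i x)) ?S] (zero_mor Q ?S)"
      using deq_trans[OF deq_sym[OF deq_trans[OF 2[simplified] 3[simplified]]]
        deq_trans[OF 1[simplified] deq_zero_right[OF c(1) bQ]]] by simp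
    then show ?thesis using deq_zero_iff[OF pQ S chain_map_comp[OF p f(1)]] by blast
  qed
  let ?B = "fib P ?S f" and ?v = "[Arr (fib P ?S f) (\<lambda>i. lft) P]"
  note B = bcplx_fib[OF bP S f(1)] and lf = fib_lft[OF bP S f(1)]
  have "ar_triangle M ?B P [Arr M (\<lambda>i y. pr 0 y) ?B] ?v [Arr P f ?S]"
    unfolding ar_triangle_def
  proof (intro conjI allI impI B indP indM)
    show "distinguished M ?B P [Arr M (\<lambda>i y. pr 0 y) ?B] ?v [Arr P f ?S]"
      using distinguished_fib[OF bP S f(1)] by simp
    show "\<not> deq P ?S [Arr P f ?S] (zero_mor P ?S)" using deq_zero_iff[OF pP S f(1)] nf by blast
    fix W p assume "bcplx W \<and> dmor W P p \<and> \<not> retraction W P p"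
    then have W: "bcplx W" and p: "dmor W P p" and nr: "\<not> retraction W P p" by auto
    obtain Q where Q: "pcplx Q" "d_iso Q W" using resolution_iso[OF W] by blast
    note bQ = pcplx_bcplx[OF Q(1)]
    obtain e e' where e: "dmor Q W e" "dmor W Q e'" "deq Q Q (e @ e') []" "deq W W (e' @ e) []"
      using Q(2) by (rule d_isoE)
    obtain g where g: "chain_map Q P g" "deq Q P (e @ p) [Arr Q g P]"
      using word_rep[OF pcplx_proj[OF Q(1)] dmor_append[OF e(1) p]] by blast
    have "\<not> split_epi Q P g"
    proof
      assume "split_epi Q P g"
      then obtain q where q: "chain_map P Q q" "htpc P P (\<lambda>i x. g i (q i x)) (\<lambda>i x. x)"
        unfolding split_epi_def by blast
      have qd: "dmor P Q [Arr P q Q]" using bP bQ q by simp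
      have 1: "deq P P ([Arr P q Q] @ (e @ p)) ([Arr P q Q] @ [Arr Q g P])"
        by (rule deq_app[OF deq_refl[OF qd] g(2)])
      have 2: "deq P P ([Arr P q Q] @ [Arr Q g P]) []"
        using deq_trans[OF deq_trans[OF deq_comp'[OF q(1) g(1) bP bQ bP] htpc_deq[OF bP bP chain_map_comp[OF q(1) g(1)] chain_map_id q(2)]] deq_ident'[OF bP]] by simp
      have "deq P P (([Arr P q Q] @ e) @ p) []" using deq_trans[OF 1 2] by simp
      then show False using nr p dmor_append[OF qd e(1)] unfolding retraction_def by blast
    qed
    then have "null_htpy Q ?S (\<lambda>i x. f i (g i x))" by (rule comp_null[OF Q(1) g(1)])
    then obtain g' where g': "chain_map Q ?B g'" "\<And>i x. lft (g' i x) = g i x"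
      using fib_lift[OF bP S f(1) g(1)] by metis
    have gd: "dmor Q ?B [Arr Q g' ?B]" using bQ B g' by simp
    have "deq Q P ([Arr Q g' ?B] @ ?v) [Arr Q g P]" using deq_comp'[OF g'(1) lf bQ B bP] g'(2) by simp
    then have 1: "deq Q P ([Arr Q g' ?B] @ ?v) (e @ p)" using deq_trans deq_sym[OF g(2)] by blast
    have 2: "deq W P (e' @ ([Arr Q g' ?B] @ ?v)) (e' @ (e @ p))" by (rule deq_app[OF deq_refl[OF e(2)] 1])
    have nil: "dmor W W []" using W by simp
    have 3: "deq W P ([] @ (e' @ e) @ p) ([] @ p)" by (rule deq_cancel[OF nil e(4) p])
    have "deq W P ((e' @ [Arr Q g' ?B]) @ ?v) p" using deq_trans[OF 2[simplified] 3[simplified]] by simp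
    then show "\<exists>q. dmor W ?B q \<and> deq W P (q @ ?v) p" using dmor_append[OF e(2) gd] by blast
  qed
  then show ?thesis unfolding is_tau_def by blast
qed

section \<open>Serre duality\<close>

lemma cmap_add: "f + g = (\<lambda>i x. f i x + g i x)" and cmap_zero: "0 = (\<lambda>i x. 0)" for f g :: "'h cmap"
  by (simp_all add: fun_eq_iff fun_apply)

lemma cmap_diff: "f - g = (\<lambda>i x. f i x - g i x)" for f g :: "'h cmap"
  by (simp add: fun_eq_iff fun_apply)

definition scaleC :: "'k \<Rightarrow> 'h cmap \<Rightarrow> 'h cmap" where "scaleC c f = (\<lambda>i x. scaleE c (f i x))"

sublocale C: vector_space scaleC
  by unfold_locales (simp_all add: scaleC_def cmap_add E.scale_right_distrib E.scale_left_distrib)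

text \<open>Chain maps are normalized to vanish outside the carriers, so that they form vector spaces.\<close>

definition Ch :: "'h cplx \<Rightarrow> 'h cplx \<Rightarrow> 'h cmap set" where
  "Ch P Q = {f. chain_map P Q f \<and> (\<forall>i x. x \<notin> car (ob P i) \<longrightarrow> f i x = 0)}"

definition Null :: "'h cplx \<Rightarrow> 'h cplx \<Rightarrow> 'h cmap set" where
  "Null P Q = {f \<in> Ch P Q. null_htpy P Q f}"

definition rst :: "'h cplx \<Rightarrow> 'h cmap \<Rightarrow> 'h cmap" where
  "rst P f = (\<lambda>i x. if x \<in> car (ob P i) then f i x else 0)"

lemma Ch_chain: "f \<in> Ch P Q \<Longrightarrow> chain_map P Q f" and Ch_out: "f \<in> Ch P Q \<Longrightarrow> x \<notin> car (ob P i) \<Longrightarrow> f i x = 0"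
  by (auto simp: Ch_def)

lemma rst_Ch: "bcplx P \<Longrightarrow> chain_map P Q f \<Longrightarrow> rst P f \<in> Ch P Q"
  unfolding Ch_def using chain_map_cong[of P Q f "rst P f"] by (auto simp: rst_def)

lemma Ch_comp:
  assumes "f \<in> Ch P Q" "chain_map Q R g" "bcplx Q" shows "(\<lambda>i x. g i (f i x)) \<in> Ch P R"
  using assms chain_map_comp[of P Q f R g] hom_zero[OF bcplx_hmod[OF assms(3)] chain_hom[OF assms(2)]]
  unfolding Ch_def by auto

lemma null_rst: "null_htpy P Q (rst P f) \<longleftrightarrow> null_htpy P Q f"
  using null_cong[of P Q f "rst P f"] null_cong[of P Q "rst P f" f] by (auto simp: rst_def)

lemma smul_scaleE: "smul a (scaleE c x) = scaleE c (smul a x)"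
  by (simp add: smul_def scaleE_def scale_mult_right)

lemma scaleE_hom:
  assumes "pmod (M :: ('h, 'h elt) hmod)" "pmod N" "mod_hom M N f" "x \<in> car M"
  shows "f (scaleE c x) = scaleE c (f x)" "scaleE c x \<in> car M"
  using assms hom_act[OF assms(3,4), of "kap c"] hmod_act[OF pmodD(1)[OF assms(1)] assms(4), of "kap c"]
  by (simp_all add: pmodD smul_kap)

lemma chain_map_scale:
  assumes P: "pcplx (P :: 'h cplx)" and Q: "pcplx Q" and f: "chain_map P Q f"
  shows "chain_map P Q (scaleC c f)"
  unfolding chain_map_def scaleC_def mod_hom_def
  using scaleE_hom(2)[OF pcplx_pmod[OF Q] pcplx_pmod[OF Q] mod_hom_id] chain_dif[OF f] chain_car[OF f]
    hom_add[OF chain_hom[OF f]] hom_act[OF chain_hom[OF f]]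
  by (auto simp: pmodD(2)[OF pcplx_pmod[OF P]] pmodD(2)[OF pcplx_pmod[OF Q]] smul_scaleE E.scale_right_distrib
      scaleE_hom(1)[OF pcplx_pmod[OF Q] pcplx_pmod[OF Q] bcplx_dif[OF pcplx_bcplx[OF Q]]])

lemma Ch_subspace:
  assumes P: "pcplx (P :: 'h cplx)" and Q: "pcplx Q" shows "C.subspace (Ch P Q)"
proof (rule C.subspaceI)
  note b = pcplx_bcplx[OF P] pcplx_bcplx[OF Q]
  show "0 \<in> Ch P Q" using chain_map_zero[OF b] by (simp add: Ch_def cmap_zero)
  show "x + y \<in> Ch P Q" if "x \<in> Ch P Q" "y \<in> Ch P Q" for x y
    using that chain_map_add[OF b(2), of P x y] by (simp add: Ch_def cmap_add)
  show "scaleC c x \<in> Ch P Q" if "x \<in> Ch P Q" for c x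
    using that chain_map_scale[OF P Q, of x c] by (simp add: Ch_def) (simp add: scaleC_def)
qed

lemma Null_subspace:
  assumes P: "pcplx (P :: 'h cplx)" and Q: "pcplx Q" shows "C.subspace (Null P Q)"
proof (rule C.subspaceI)
  note b = pcplx_bcplx[OF P] pcplx_bcplx[OF Q]
  note s = Ch_subspace[OF P Q]
  show "0 \<in> Null P Q" using C.subspace_0[OF s] null_zero[OF b(2)] by (simp add: Null_def cmap_zero)
  show "x + y \<in> Null P Q" if "x \<in> Null P Q" "y \<in> Null P Q" for x y
    using that C.subspace_add[OF s] null_add[OF b(2), of P x y] by (simp add: Null_def cmap_add)
  show "scaleC c x \<in> Null P Q" if "x \<in> Null P Q" for c x
  proof -
    have "chain_map Q Q (scaleC c (\<lambda>i x. x))" by (rule chain_map_scale[OF Q Q chain_map_id])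
    then have "null_htpy P Q (scaleC c x)"
      using that null_left[of Q Q "scaleC c (\<lambda>i x. x)" P x] b by (simp add: Null_def scaleC_def)
    then show ?thesis using that C.subspace_scale[OF s] by (simp add: Null_def)
  qed
qed

abbreviation cc :: "'h cmap \<Rightarrow> 'h cmap \<Rightarrow> 'h cmap" where "cc f g \<equiv> (\<lambda>i x. f i (g i x))"

text \<open>\<open>t\<close> induces a perfect pairing between \<open>Hom(P, Q)\<close> and \<open>Hom(Q, R)\<close>, for every \<open>Q\<close>.\<close>

definition serre :: "'h cplx \<Rightarrow> 'h cplx \<Rightarrow> ('h cmap \<Rightarrow> 'k) \<Rightarrow> bool" where
  "serre P R t \<longleftrightarrow> pcplx P \<and> pcplx R \<and> lin_on scaleC (Ch P R) t \<and> (\<forall>f\<in>Null P R. t f = 0) \<and>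
     (\<forall>Q \<phi>. pcplx Q \<and> lin_on scaleC (Ch P Q) \<phi> \<and> (\<forall>g\<in>Null P Q. \<phi> g = 0) \<longrightarrow>
        (\<exists>f\<in>Ch Q R. \<forall>g\<in>Ch P Q. t (cc f g) = \<phi> g)) \<and>
     (\<forall>Q \<psi>. pcplx Q \<and> lin_on scaleC (Ch Q R) \<psi> \<and> (\<forall>f\<in>Null Q R. \<psi> f = 0) \<longrightarrow>
        (\<exists>g\<in>Ch P Q. \<forall>f\<in>Ch Q R. t (cc f g) = \<psi> f))"

end

lemma lin_on_subset: "lin_on sc V \<phi> \<Longrightarrow> W \<subseteq> V \<Longrightarrow> lin_on sc W \<phi>"
  unfolding lin_on_def by blast

context hereditary_algebra
begin

lemma functional_nonnull:
  assumes P: "pcplx (P :: 'h cplx)" and Q: "pcplx Q" and n: "\<not> null_htpy P Q g"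
  obtains \<phi> where "lin_on scaleC UNIV \<phi>" "\<And>f. f \<in> Null P Q \<Longrightarrow> \<phi> f = 0" "\<phi> g = 1"
  using C.functional_separate[OF Null_subspace[OF P Q], of g] n unfolding Null_def by blast

context
  fixes P R :: "'h cplx" and t
  assumes serre: "serre P R t"
begin

lemma serre_P: "pcplx P" and serre_R: "pcplx R" and serre_lin: "lin_on scaleC (Ch P R) t"
  and serre_null: "f \<in> Ch P R \<Longrightarrow> null_htpy P R f \<Longrightarrow> t f = 0"
  using serre unfolding serre_def Null_def by auto

lemma serre_rep:
  assumes "pcplx Q" "lin_on scaleC (Ch P Q) \<phi>" "\<And>g. g \<in> Null P Q \<Longrightarrow> \<phi> g = 0"
  obtains f where "f \<in> Ch Q R" "\<And>g. g \<in> Ch P Q \<Longrightarrow> t (cc f g) = \<phi> g"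
proof -
  have "\<forall>Q \<phi>. pcplx Q \<and> lin_on scaleC (Ch P Q) \<phi> \<and> (\<forall>g\<in>Null P Q. \<phi> g = 0) \<longrightarrow>
        (\<exists>f\<in>Ch Q R. \<forall>g\<in>Ch P Q. t (cc f g) = \<phi> g)"
    using serre unfolding serre_def by (elim conjE) assumption
  from this[THEN spec, THEN spec, THEN mp, of Q \<phi>] assms
  have "\<exists>f\<in>Ch Q R. \<forall>g\<in>Ch P Q. t (cc f g) = \<phi> g" by simp
  then show thesis by (elim bexE) (rule that, auto)
qed

lemma serre_corep:
  assumes "pcplx Q" "lin_on scaleC (Ch Q R) \<psi>" "\<And>f. f \<in> Null Q R \<Longrightarrow> \<psi> f = 0"
  obtains g where "g \<in> Ch P Q" "\<And>f. f \<in> Ch Q R \<Longrightarrow> t (cc f g) = \<psi> f"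
proof -
  have "\<forall>Q \<psi>. pcplx Q \<and> lin_on scaleC (Ch Q R) \<psi> \<and> (\<forall>f\<in>Null Q R. \<psi> f = 0) \<longrightarrow>
        (\<exists>g\<in>Ch P Q. \<forall>f\<in>Ch Q R. t (cc f g) = \<psi> f)"
    using serre unfolding serre_def by (elim conjE) assumption
  from this[THEN spec, THEN spec, THEN mp, of Q \<psi>] assms
  have "\<exists>g\<in>Ch P Q. \<forall>f\<in>Ch Q R. t (cc f g) = \<psi> f" by simp
  then show thesis by (elim bexE) (rule that, auto)
qed

text \<open>A functional separates the class of \<open>g\<close> from the null maps, and the element
  that represents this functional is the partner.\<close>

lemma serre_nondeg_left:
  assumes Q: "pcplx Q" and g: "\<not> null_htpy P Q g" "g \<in> Ch P Q"
  obtains f where "f \<in> Ch Q R" "t (cc f g) = 1"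
proof -
  obtain \<phi> where \<phi>: "lin_on scaleC UNIV \<phi>" "\<And>f. f \<in> Null P Q \<Longrightarrow> \<phi> f = 0" "\<phi> g = 1"
    using functional_nonnull[OF serre_P Q g(1)] by blast
  obtain f where "f \<in> Ch Q R" "\<And>g. g \<in> Ch P Q \<Longrightarrow> t (cc f g) = \<phi> g"
    using serre_rep[OF Q lin_on_subset[OF \<phi>(1)] \<phi>(2)] by blast
  then show thesis using that \<phi>(3) g(2) by metis
qed

lemma serre_nondeg_right:
  assumes Q: "pcplx Q" and f: "\<not> null_htpy Q R f" "f \<in> Ch Q R"
  obtains g where "g \<in> Ch P Q" "t (cc f g) = 1"
proof -
  obtain \<psi> where \<psi>: "lin_on scaleC UNIV \<psi>" "\<And>f. f \<in> Null Q R \<Longrightarrow> \<psi> f = 0" "\<psi> f = 1"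
    using functional_nonnull[OF Q serre_R f(1)] by blast
  obtain g where "g \<in> Ch P Q" "\<And>f. f \<in> Ch Q R \<Longrightarrow> t (cc f g) = \<psi> f"
    using serre_corep[OF Q lin_on_subset[OF \<psi>(1)] \<psi>(2)] by blast
  then show thesis using that \<psi>(3) f(2) by metis
qed

lemma serre_bP: "bcplx P" and serre_bR: "bcplx R"
  using pcplx_bcplx serre_P serre_R by auto

lemma serre_hom_left:
  assumes Q: "pcplx Q" and g: "chain_map P Q g" "\<not> null_htpy P Q g"
  obtains f where "chain_map Q R f" "\<not> null_htpy Q R f"
proof -
  obtain f where f: "f \<in> Ch Q R" "t (cc f (rst P g)) = 1"
    using serre_nondeg_left[OF Q _ rst_Ch[OF serre_bP g(1)]] g(2) null_rst by blast
  have c: "cc f (rst P g) \<in> Ch P R"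
    by (rule Ch_comp[OF rst_Ch[OF serre_bP g(1)] Ch_chain[OF f(1)] pcplx_bcplx[OF Q]])
  have "\<not> null_htpy Q R f"
  proof
    assume "null_htpy Q R f"
    then have "null_htpy P R (cc f (rst P g))" by (rule null_right[OF Ch_chain[OF rst_Ch[OF serre_bP g(1)]]])
    then show False using serre_null[OF c] f(2) by simp
  qed
  then show thesis using that Ch_chain[OF f(1)] by blast
qed

lemma serre_hom_right:
  assumes Q: "pcplx Q" and f: "chain_map Q R f" "\<not> null_htpy Q R f"
  obtains g where "chain_map P Q g" "\<not> null_htpy P Q g"
proof -
  note bQ = pcplx_bcplx[OF Q]
  note rf = rst_Ch[OF bQ f(1)]
  obtain g where g: "g \<in> Ch P Q" "t (cc (rst Q f) g) = 1"
    using serre_nondeg_right[OF Q _ rf] f(2) null_rst by blast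
  have c: "cc (rst Q f) g \<in> Ch P R" by (rule Ch_comp[OF g(1) Ch_chain[OF rf] bQ])
  have "\<not> null_htpy P Q g"
  proof
    assume "null_htpy P Q g"
    then have "null_htpy P R (cc (rst Q f) g)" by (rule null_left[OF Ch_chain[OF rf] _ serre_bP bQ])
    then show False using serre_null[OF c] g(2) by simp
  qed
  then show thesis using that Ch_chain[OF g(1)] by blast
qed

abbreviation "idP \<equiv> rst P (\<lambda>i x. x)"
abbreviation "idR \<equiv> rst R (\<lambda>i x. x)"

lemma idP_Ch: "idP \<in> Ch P P" and idR_Ch: "idR \<in> Ch R R"
  by (rule rst_Ch[OF serre_bP chain_map_id], rule rst_Ch[OF serre_bR chain_map_id])

lemma null_id_iff: "null_htpy P P (\<lambda>i x. x) \<longleftrightarrow> null_htpy R R (\<lambda>i x. x)"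
proof
  assume n: "null_htpy P P (\<lambda>i x. x)"
  show "null_htpy R R (\<lambda>i x. x)"
  proof (rule ccontr)
    assume "\<not> null_htpy R R (\<lambda>i x. x)"
    then obtain g where g: "chain_map P R g" "\<not> null_htpy P R g"
      using serre_hom_right[OF serre_R chain_map_id] by blast
    show False using null_left[OF g(1) n serre_bP serre_bP] g(2) by blast
  qed
next
  assume n: "null_htpy R R (\<lambda>i x. x)"
  show "null_htpy P P (\<lambda>i x. x)"
  proof (rule ccontr)
    assume "\<not> null_htpy P P (\<lambda>i x. x)"
    then obtain f where f: "chain_map P R f" "\<not> null_htpy P R f"
      using serre_hom_left[OF serre_P chain_map_id] by blast
    show False using null_right[OF f(1) n] f(2) by blast
  qed
qed

text \<open>Adjoint endomorphisms replace the action of a Serre functor on morphisms. If only one of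
  the two were null, nondegeneracy would provide a map on which the two sides of \<open>adj\<close>
  differ.\<close>

lemma serre_adjoint:
  assumes e: "e \<in> Ch P P" and \<epsilon>: "\<epsilon> \<in> Ch R R"
    and adj: "\<And>f. f \<in> Ch P R \<Longrightarrow> t (cc \<epsilon> f) = t (cc f e)"
  shows "null_htpy P P e \<longleftrightarrow> null_htpy R R \<epsilon>"
proof
  assume n: "null_htpy P P e"
  show "null_htpy R R \<epsilon>"
  proof (rule ccontr)
    assume "\<not> null_htpy R R \<epsilon>"
    then obtain g where g: "g \<in> Ch P R" "t (cc \<epsilon> g) = 1" using serre_nondeg_right[OF serre_R _ \<epsilon>] by blast
    have "null_htpy P R (cc g e)" by (rule null_left[OF Ch_chain[OF g(1)] n serre_bP serre_bP])
    then show False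
      using serre_null[OF Ch_comp[OF e Ch_chain[OF g(1)] serre_bP]] adj[OF g(1)] g(2) by simp
  qed
next
  assume n: "null_htpy R R \<epsilon>"
  show "null_htpy P P e"
  proof (rule ccontr)
    assume "\<not> null_htpy P P e"
    then obtain f where f: "f \<in> Ch P R" "t (cc f e) = 1" using serre_nondeg_left[OF serre_P _ e] by blast
    have "null_htpy P R (cc \<epsilon> f)" by (rule null_right[OF Ch_chain[OF f(1)] n])
    then show False
      using serre_null[OF Ch_comp[OF f(1) Ch_chain[OF \<epsilon>] serre_bR]] adj[OF f(1)] f(2) by simp
  qed
qed

lemma serre_adjoint_diff:
  assumes e: "e \<in> Ch P P" "e' \<in> Ch P P" and \<epsilon>: "\<epsilon> \<in> Ch R R" "\<epsilon>' \<in> Ch R R"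
    and adj: "\<And>f. f \<in> Ch P R \<Longrightarrow> t (cc \<epsilon> f) = t (cc f e)" "\<And>f. f \<in> Ch P R \<Longrightarrow> t (cc \<epsilon>' f) = t (cc f e')"
  shows "htpc P P e e' \<longleftrightarrow> htpc R R \<epsilon> \<epsilon>'"
proof -
  have "e - e' \<in> Ch P P" "\<epsilon> - \<epsilon>' \<in> Ch R R"
    using C.subspace_diff[OF Ch_subspace] serre_P serre_R e \<epsilon> by auto
  moreover have "t (cc (\<epsilon> - \<epsilon>') f) = t (cc f (e - e'))" if f: "f \<in> Ch P R" for f
  proof -
    note cf = Ch_chain[OF f]
    have fd: "f i (e i x - e' i x) = f i (e i x) - f i (e' i x)" for i x
    proof (cases "x \<in> car (ob P i)")
      case True
      then show ?thesis
        using hom_diff[OF bcplx_hmod[OF serre_bP] chain_hom[OF cf]] chain_car[OF Ch_chain[OF e(1)]] chain_car[OF Ch_chain[OF e(2)]] by blast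
    next
      case False
      then show ?thesis using e Ch_out hom_zero[OF bcplx_hmod[OF serre_bP] chain_hom[OF cf]] by simp
    qed
    have m: "cc \<epsilon> f \<in> Ch P R" "cc \<epsilon>' f \<in> Ch P R" "cc f e \<in> Ch P R" "cc f e' \<in> Ch P R"
      using Ch_comp[OF f Ch_chain serre_bR] Ch_comp[OF _ cf serre_bP] e \<epsilon> by auto
    note s = C.subspace_diff[OF Ch_subspace[OF serre_P serre_R]]
    have "cc (\<epsilon> - \<epsilon>') f = cc \<epsilon> f - cc \<epsilon>' f" "cc f (e - e') = cc f e - cc f e'"
      by (simp_all add: cmap_diff fd)
    then show ?thesis
      using lin_on_diff[OF serre_lin s[OF m(1,2)] m(2)] lin_on_diff[OF serre_lin s[OF m(3,4)] m(4)] adj[OF f]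
      by simp
  qed
  ultimately show ?thesis using serre_adjoint[of "e - e'" "\<epsilon> - \<epsilon>'"] by (simp add: htpc_def cmap_diff)
qed

lemma adjoint_comp:
  assumes e: "e \<in> Ch P P" and \<epsilon>: "\<epsilon> \<in> Ch R R"
    and adj: "\<And>f. f \<in> Ch P R \<Longrightarrow> t (cc \<epsilon> f) = t (cc f e)" and f: "f \<in> Ch P R"
  shows "t (cc (cc \<epsilon> \<epsilon>) f) = t (cc f (cc e e))"
  using adj[OF Ch_comp[OF f Ch_chain[OF \<epsilon>] serre_bR]] adj[OF Ch_comp[OF e Ch_chain[OF f] serre_bP]] by simp

lemma adjoint_id: "f \<in> Ch P R \<Longrightarrow> t (cc idR f) = t (cc f idP)"
proof -
  assume f: "f \<in> Ch P R"
  have "f i 0 = 0" for i by (rule hom_zero[OF bcplx_hmod[OF serre_bP] chain_hom[OF Ch_chain[OF f]]])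
  moreover have "f i x \<in> car (ob R i)" for i x
    using f chain_car[OF Ch_chain[OF f]] hmod_zero[OF bcplx_hmod[OF serre_bR]] Ch_out by (cases "x \<in> car (ob P i)") auto
  ultimately have "cc idR f = f" "cc f idP = f" using Ch_out[OF f] by (auto simp: rst_def fun_eq_iff)
  then show ?thesis by simp
qed

lemma htpc_rst: "htpc X Y (rst X f) (rst X g) \<longleftrightarrow> htpc X Y f g"
  unfolding htpc_def using null_cong[of X Y "\<lambda>i x. rst X f i x - rst X g i x" "\<lambda>i x. f i x - g i x"]
    null_cong[of X Y "\<lambda>i x. f i x - g i x" "\<lambda>i x. rst X f i x - rst X g i x"] by (auto simp: rst_def)

lemma htpc_rst_left: "htpc X Y (rst X f) g \<longleftrightarrow> htpc X Y f g"
proof -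
  have "rst X (rst X f) = rst X f" by (intro ext) (simp add: rst_def)
  then show ?thesis using htpc_rst[of X Y f g] htpc_rst[of X Y "rst X f" g] by simp
qed

lemma adjoint_triv:
  assumes e: "e \<in> Ch P P" and \<epsilon>: "\<epsilon> \<in> Ch R R"
    and adj: "\<And>f. f \<in> Ch P R \<Longrightarrow> t (cc \<epsilon> f) = t (cc f e)"
  shows "htpc P P (cc e e) e \<longleftrightarrow> htpc R R (cc \<epsilon> \<epsilon>) \<epsilon>" (is ?A)
    and "htpc P P e (\<lambda>i x. x) \<longleftrightarrow> htpc R R \<epsilon> (\<lambda>i x. x)" (is ?B)
proof -
  have ee: "cc e e \<in> Ch P P" and \<epsilon>\<epsilon>: "cc \<epsilon> \<epsilon> \<in> Ch R R"
    using Ch_comp[OF e Ch_chain[OF e] serre_bP] Ch_comp[OF \<epsilon> Ch_chain[OF \<epsilon>] serre_bR] by auto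
  show ?A by (rule serre_adjoint_diff[OF ee e \<epsilon>\<epsilon> \<epsilon> adjoint_comp[OF e \<epsilon> adj] adj])
  have "htpc P P e idP \<longleftrightarrow> htpc R R \<epsilon> idR"
    by (rule serre_adjoint_diff[OF e idP_Ch \<epsilon> idR_Ch adj adjoint_id])
  moreover have "rst P e = e" "rst R \<epsilon> = \<epsilon>" using Ch_out[OF e] Ch_out[OF \<epsilon>] by (auto simp: rst_def fun_eq_iff)
  ultimately show ?B using htpc_rst[of P P e "\<lambda>i x. x"] htpc_rst[of R R \<epsilon> "\<lambda>i x. x"] by simp
qed

lemma htpc_idem_rst:
  "chain_map X X e \<Longrightarrow> htpc X X (cc e e) e \<longleftrightarrow> htpc X X (cc (rst X e) (rst X e)) (rst X e)"
proof -
  assume e: "chain_map X X e"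
  have "cc (rst X e) (rst X e) i x - rst X e i x = cc e e i x - e i x" if "x \<in> car (ob X i)" for i x
    using that chain_car[OF e that] by (simp add: rst_def)
  then show ?thesis unfolding htpc_def
    using null_cong[of X X "\<lambda>i x. cc (rst X e) (rst X e) i x - rst X e i x" "\<lambda>i x. cc e e i x - e i x"]
      null_cong[of X X "\<lambda>i x. cc e e i x - e i x" "\<lambda>i x. cc (rst X e) (rst X e) i x - rst X e i x"] by auto
qed

text \<open>Composition with an idempotent of one object is a functional on Hom(P, R), and
  representing it gives an adjoint endomorphism of the other object. Adjunction respects
  idempotence, zero and the identity, so nontrivial idempotents occur on both sides or on
  neither.\<close>

lemma serre_triv_idem: "triv_idem P \<longleftrightarrow> triv_idem R"
proof
  assume tP: "triv_idem P"
  show "triv_idem R"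
    unfolding triv_idem_def
  proof (intro conjI allI impI)
    show "\<not> null_htpy R R (\<lambda>i x. x)" using tP null_id_iff unfolding triv_idem_def by blast
    fix \<epsilon>0 assume a: "chain_map R R \<epsilon>0 \<and> htpc R R (\<lambda>i x. \<epsilon>0 i (\<epsilon>0 i x)) \<epsilon>0"
    define \<epsilon> where "\<epsilon> = rst R \<epsilon>0"
    have \<epsilon>: "\<epsilon> \<in> Ch R R" and idem: "htpc R R (cc \<epsilon> \<epsilon>) \<epsilon>"
      unfolding \<epsilon>_def using rst_Ch[OF serre_bR] htpc_idem_rst a by auto
    note c\<epsilon> = Ch_chain[OF \<epsilon>]
    have lin: "lin_on scaleC (Ch P R) (\<lambda>f. t (cc \<epsilon> f))"
      unfolding lin_on_def
    proof (intro conjI ballI allI)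
      fix x assume x: "x \<in> Ch P R"
      note cx = Ch_comp[OF x c\<epsilon> serre_bR]
      have xc: "x i u \<in> car (ob R i)" if "x \<in> Ch P R" for x i u
        using chain_car[OF Ch_chain[OF that]] Ch_out[OF that] hmod_zero[OF bcplx_hmod[OF serre_bR]]
        by (cases "u \<in> car (ob P i)") auto
      show "t (cc \<epsilon> (scaleC c x)) = c * t (cc \<epsilon> x)" for c
      proof -
        have "cc \<epsilon> (scaleC c x) = scaleC c (cc \<epsilon> x)"
          using scaleE_hom(1)[OF pcplx_pmod[OF serre_R] pcplx_pmod[OF serre_R] chain_hom[OF c\<epsilon>] xc[OF x]]
          by (simp add: scaleC_def)
        then show ?thesis using lin_on_scale[OF serre_lin cx] by simp
      qed
      fix y assume y: "y \<in> Ch P R"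
      note cy = Ch_comp[OF y c\<epsilon> serre_bR]
      have "cc \<epsilon> (x + y) = cc \<epsilon> x + cc \<epsilon> y"
        using hom_add[OF chain_hom[OF c\<epsilon>] xc[OF x] xc[OF y]] by (simp add: cmap_add)
      then show "t (cc \<epsilon> (x + y)) = t (cc \<epsilon> x) + t (cc \<epsilon> y)" using lin_on_add[OF serre_lin cx cy] by simp
    qed
    have "t (cc \<epsilon> f) = 0" if "f \<in> Null P R" for f
      using that serre_null[OF Ch_comp[OF _ c\<epsilon> serre_bR]] null_left[OF c\<epsilon> _ serre_bP serre_bR] unfolding Null_def by blast
    then obtain e where e: "e \<in> Ch P P" "\<And>f. f \<in> Ch P R \<Longrightarrow> t (cc f e) = t (cc \<epsilon> f)"
      using serre_corep[OF serre_P lin] by blast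
    note adj = adjoint_triv[OF e(1) \<epsilon> e(2)[symmetric]] serre_adjoint[OF e(1) \<epsilon> e(2)[symmetric]]
    have "null_htpy P P e \<or> htpc P P e (\<lambda>i x. x)"
      using tP Ch_chain[OF e(1)] adj idem unfolding triv_idem_def by blast
    then show "null_htpy R R \<epsilon>0 \<or> htpc R R \<epsilon>0 (\<lambda>i x. x)"
      using adj unfolding \<epsilon>_def null_rst htpc_rst_left by blast
  qed
next
  assume tR: "triv_idem R"
  show "triv_idem P"
    unfolding triv_idem_def
  proof (intro conjI allI impI)
    show "\<not> null_htpy P P (\<lambda>i x. x)" using tR null_id_iff unfolding triv_idem_def by blast
    fix e0 assume a: "chain_map P P e0 \<and> htpc P P (\<lambda>i x. e0 i (e0 i x)) e0"
    define e where "e = rst P e0"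
    have e: "e \<in> Ch P P" and idem: "htpc P P (cc e e) e"
      unfolding e_def using rst_Ch[OF serre_bP] htpc_idem_rst a by auto
    note ce = Ch_chain[OF e]
    have lin: "lin_on scaleC (Ch P R) (\<lambda>f. t (cc f e))"
      unfolding lin_on_def
    proof (intro conjI ballI allI)
      fix x assume x: "x \<in> Ch P R"
      note cx = Ch_comp[OF e Ch_chain[OF x] serre_bP]
      have "cc (scaleC c x) e = scaleC c (cc x e)" for c by (simp add: scaleC_def)
      then show "t (cc (scaleC c x) e) = c * t (cc x e)" for c using lin_on_scale[OF serre_lin cx] by simp
      fix y assume y: "y \<in> Ch P R"
      note cy = Ch_comp[OF e Ch_chain[OF y] serre_bP]
      have "cc (x + y) e = cc x e + cc y e" by (simp add: cmap_add)
      then show "t (cc (x + y) e) = t (cc x e) + t (cc y e)" using lin_on_add[OF serre_lin cx cy] by simp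
    qed
    have "t (cc f e) = 0" if "f \<in> Null P R" for f
      using that serre_null[OF Ch_comp[OF e Ch_chain serre_bP]] null_right[OF ce] unfolding Null_def by blast
    then obtain \<epsilon> where \<epsilon>: "\<epsilon> \<in> Ch R R" "\<And>f. f \<in> Ch P R \<Longrightarrow> t (cc \<epsilon> f) = t (cc f e)"
      using serre_rep[OF serre_R lin] by blast
    note adj = adjoint_triv[OF e \<epsilon>] serre_adjoint[OF e \<epsilon>]
    have "null_htpy R R \<epsilon> \<or> htpc R R \<epsilon> (\<lambda>i x. x)"
      using tR Ch_chain[OF \<epsilon>(1)] adj idem unfolding triv_idem_def by blast
    then show "null_htpy P P e0 \<or> htpc P P e0 (\<lambda>i x. x)"
      using adj unfolding e_def null_rst htpc_rst_left by blast
  qed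
qed

lemma htpy_unit_cong:
  assumes c: "chain_map P P a" "chain_map P P b" and h: "htpc P P a b" and u: "htpy_unit P a"
  shows "htpy_unit P b"
proof -
  note bP = serre_bP
  obtain k l where k: "chain_map P P k" "htpc P P (cc k a) (\<lambda>i x. x)" and l: "chain_map P P l" "htpc P P (cc a l) (\<lambda>i x. x)"
    using u unfolding htpy_unit_def by blast
  have "htpc P P (cc k b) (\<lambda>i x. x)"
    by (rule htpc_trans[OF bP htpc_sym[OF bP htpc_left[OF k(1) h bP bP c]] k(2)])
  moreover have "htpc P P (cc b l) (\<lambda>i x. x)"
    by (rule htpc_trans[OF bP htpc_sym[OF bP htpc_right[OF l(1) h]] l(2)])
  ultimately show ?thesis using k(1) l(1) unfolding htpy_unit_def by blast
qed

text \<open>In a local ring one-sided inverses are two-sided: if v a = 1, then a v is idempotent,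
  and a v = 0 would give 1 = v (a v) a = 0, so a v = 1.\<close>

lemma nonunit_left:
  assumes l: "local_end P" and a: "chain_map P P a" "\<not> htpy_unit P a" and u: "chain_map P P u"
  shows "\<not> htpy_unit P (cc u a)"
proof
  note bP = serre_bP
  assume "htpy_unit P (cc u a)"
  then obtain b where b: "chain_map P P b" "htpc P P (cc b (cc u a)) (\<lambda>i x. x)" unfolding htpy_unit_def by blast
  define v where "v = cc b u"
  have v: "chain_map P P v" unfolding v_def by (rule chain_map_comp[OF u b(1)])
  have va: "htpc P P (cc v a) (\<lambda>i x. x)" using b(2) by (simp add: v_def)
  have av: "chain_map P P (cc a v)" by (rule chain_map_comp[OF v a(1)])
  have "htpc P P (cc a (cc (cc v a) v)) (cc a v)"
    by (rule htpc_left[OF a(1) htpc_right[OF v va] bP bP chain_map_comp[OF v chain_map_comp[OF a(1) v]] v])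
  then have "null_htpy P P (cc a v) \<or> htpc P P (cc a v) (\<lambda>i x. x)"
    using triv_idem_of_local[OF bP l] av unfolding triv_idem_def by simp
  then show False
  proof
    assume "htpc P P (cc a v) (\<lambda>i x. x)"
    then show False using a(2) v va unfolding htpy_unit_def by blast
  next
    assume n: "null_htpy P P (cc a v)"
    have "null_htpy P P (cc (cc a v) a)" by (rule null_right[OF a(1) n])
    then have "null_htpy P P (cc v (cc (cc a v) a))" by (rule null_left[OF v _ bP bP])
    moreover have "htpc P P (cc (cc v a) (cc v a)) (cc v a)" by (rule htpc_right[OF chain_map_comp[OF a(1) v] va])
    ultimately have "null_htpy P P (cc v a)" using htpc_null'[OF bP] by blast
    then have "null_htpy P P (\<lambda>i x. x)" using htpc_null'[OF bP va] by blast
    then show False using l unfolding local_end_def by blast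
  qed
qed

text \<open>If u (a + b) = 1, then u b is a nonunit, so u a = 1 - u b is a unit by locality, and
  hence a would be one.\<close>

lemma nonunit_add:
  assumes l: "local_end P" and a: "chain_map P P a" "\<not> htpy_unit P a" and b: "chain_map P P b" "\<not> htpy_unit P b"
  shows "\<not> htpy_unit P (\<lambda>i x. a i x + b i x)"
proof
  note bP = serre_bP
  assume "htpy_unit P (\<lambda>i x. a i x + b i x)"
  then obtain u where u: "chain_map P P u" "htpc P P (\<lambda>i x. u i (a i x + b i x)) (\<lambda>i x. x)"
    unfolding htpy_unit_def by blast
  have ub: "chain_map P P (cc u b)" and ua: "chain_map P P (cc u a)"
    using chain_map_comp[OF _ u(1)] a b by auto
  have "\<not> htpy_unit P (cc u b)" by (rule nonunit_left[OF l b u(1)])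
  then have un: "htpy_unit P (\<lambda>i x. x - u i (b i x))" using l ub unfolding local_end_def by blast
  have "null_htpy P P (\<lambda>i x. x - u i (a i x + b i x))"
    using htpc_sym[OF bP u(2)] by (simp add: htpc_def)
  then have "htpc P P (\<lambda>i x. x - u i (b i x)) (cc u a)"
    unfolding htpc_def
    by (rule null_cong) (simp add: hom_add[OF chain_hom[OF u(1)] chain_car[OF a(1)] chain_car[OF b(1)]])
  then have "htpy_unit P (cc u a)"
    by (rule htpy_unit_cong[OF chain_map_diff[OF bP chain_map_id ub] ua _ un])
  then show False using nonunit_left[OF l a u(1)] by blast
qed

text \<open>\<open>\<omega>\<close> represents a functional on \<open>End(P)\<close> that kills the nonunits but not the identity.\<close>

lemma serre_ar_mor:
  assumes l: "local_end P"
  obtains \<omega> where "ar_mor P R \<omega>"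
proof -
  note bP = serre_bP and bR = serre_bR
  note s = Ch_subspace[OF serre_P serre_P]
  have nid: "\<not> null_htpy P P (\<lambda>i x. x)" using l unfolding local_end_def by blast
  have nu: "\<not> htpy_unit P a" if n: "null_htpy P P a" and a: "chain_map P P a" for a
  proof
    assume "htpy_unit P a"
    then obtain b where b: "chain_map P P b" "htpc P P (cc b a) (\<lambda>i x. x)" unfolding htpy_unit_def by blast
    have "null_htpy P P (cc b a)" by (rule null_left[OF b(1) n bP bP])
    then show False using htpc_null'[OF bP b(2)] nid by blast
  qed
  define N where "N = {a \<in> Ch P P. \<not> htpy_unit P a}"
  have N: "C.subspace N"
  proof (rule C.subspaceI)
    show "0 \<in> N" using C.subspace_0[OF s] nu[OF null_zero[OF bP] chain_map_zero[OF bP bP]]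
      by (simp add: N_def cmap_zero)
    show "x + y \<in> N" if "x \<in> N" "y \<in> N" for x y
      using that C.subspace_add[OF s] nonunit_add[OF l, of x y] Ch_chain by (auto simp: N_def cmap_add)
    show "scaleC c x \<in> N" if "x \<in> N" for c x
      using that C.subspace_scale[OF s] nonunit_left[OF l, of x "scaleC c (\<lambda>i x. x)"] Ch_chain
        chain_map_scale[OF serre_P serre_P chain_map_id] by (auto simp: N_def scaleC_def)
  qed
  have "htpy_unit P (\<lambda>i x. x)" unfolding htpy_unit_def using chain_map_id htpc_refl[OF bP] by blast
  moreover have "htpc P P (\<lambda>i x. x) idP" by (rule htpc_eq[OF bP]) (simp add: rst_def)
  ultimately have "htpy_unit P idP" using htpy_unit_cong[OF chain_map_id Ch_chain[OF idP_Ch]] by blast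
  then have "idP \<notin> N" by (simp add: N_def)
  then obtain \<theta> where \<theta>: "lin_on scaleC UNIV \<theta>" "\<And>a. a \<in> N \<Longrightarrow> \<theta> a = 0" "\<theta> idP = 1"
    using C.functional_separate[OF N] by blast
  have "\<theta> a = 0" if "a \<in> Null P P" for a
    using that nu Ch_chain \<theta>(2) unfolding N_def Null_def by blast
  then obtain \<omega> where \<omega>: "\<omega> \<in> Ch P R" "\<And>a. a \<in> Ch P P \<Longrightarrow> t (cc \<omega> a) = \<theta> a"
    using serre_rep[OF serre_P lin_on_subset[OF \<theta>(1)]] by blast
  note c\<omega> = Ch_chain[OF \<omega>(1)]
  have "ar_mor P R \<omega>"
    unfolding ar_mor_def
  proof (intro conjI allI impI)
    show "chain_map P R \<omega>" by (rule c\<omega>)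
    show "\<not> null_htpy P R \<omega>"
    proof
      assume n: "null_htpy P R \<omega>"
      have "t (cc \<omega> idP) = 0"
        by (rule serre_null[OF Ch_comp[OF idP_Ch c\<omega> bP] null_right[OF Ch_chain[OF idP_Ch] n]])
      then show False using \<omega>(2)[OF idP_Ch] \<theta>(3) by simp
    qed
    fix Q p assume "pcplx Q \<and> chain_map Q P p \<and> \<not> split_epi Q P p"
    then have Q: "pcplx Q" and p0: "chain_map Q P p" and ns: "\<not> split_epi Q P p" by auto
    note bQ = pcplx_bcplx[OF Q]
    show "null_htpy Q R (\<lambda>i x. \<omega> i (p i x))"
    proof (rule ccontr)
      assume n: "\<not> null_htpy Q R (\<lambda>i x. \<omega> i (p i x))"
      have w: "chain_map Q R (\<lambda>i x. \<omega> i (p i x))" by (rule chain_map_comp[OF p0 c\<omega>])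
      \<comment> \<open>If \<omega> p is not null, some q pairs with it to 1. Then \<theta> (p q) =
        1, so p q is a unit and p is a split epimorphism.\<close>
      obtain q where q: "q \<in> Ch P Q" "t (cc (rst Q (\<lambda>i x. \<omega> i (p i x))) q) = 1"
        using serre_nondeg_right[OF Q _ rst_Ch[OF bQ w]] n null_rst by blast
      note cq = Ch_chain[OF q(1)]
      have "q i x \<in> car (ob Q i)" for i x
        using chain_car[OF cq] Ch_out[OF q(1)] hmod_zero[OF bcplx_hmod[OF bQ]] by (cases "x \<in> car (ob P i)") auto
      then have e: "cc (rst Q (\<lambda>i x. \<omega> i (p i x))) q = cc \<omega> (cc p q)" by (simp add: rst_def)
      have pq: "cc p q \<in> Ch P P" by (rule Ch_comp[OF q(1) p0 bQ])
      have "\<theta> (cc p q) = 1" using q(2) \<omega>(2)[OF pq] unfolding e by simp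
      then have "cc p q \<notin> N" using \<theta>(2) by fastforce
      then have "htpy_unit P (cc p q)" using pq by (simp add: N_def)
      then obtain r where r: "chain_map P P r" "htpc P P (cc (cc p q) r) (\<lambda>i x. x)" unfolding htpy_unit_def by blast
      then show False using ns chain_map_comp[OF r(1) cq] unfolding split_epi_def by blast
    qed
  qed
  then show thesis by (rule that)
qed

end

end

section \<open>The Nakayama correspondence\<close>

lemma lin_on_comp:
  assumes "lin_on sc W \<phi>" "\<And>x. x \<in> V \<Longrightarrow> L x \<in> W" "\<And>x y. x \<in> V \<Longrightarrow> y \<in> V \<Longrightarrow> L (x + y) = L x + L y"
    "\<And>c x. x \<in> V \<Longrightarrow> L (sc' c x) = sc c (L x)"
  shows "lin_on sc' V (\<lambda>x. \<phi> (L x))"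
  unfolding lin_on_def using assms lin_on_add[OF assms(1)] lin_on_scale[OF assms(1)] by simp

lemma lin_on_plus: "lin_on sc V \<phi> \<Longrightarrow> lin_on sc V \<psi> \<Longrightarrow> lin_on sc V (\<lambda>x. \<phi> x + \<psi> x)"
  unfolding lin_on_def by (simp add: algebra_simps)

lemma (in vector_space) lin_on_sum_subspace:
  "subspace V \<Longrightarrow> lin_on scale V \<phi> \<Longrightarrow> (\<And>i. i \<in> I \<Longrightarrow> f i \<in> V) \<Longrightarrow> \<phi> (sum f I) = (\<Sum>i\<in>I. \<phi> (f i))"
  by (induction I rule: infinite_finite_induct)
    (auto simp: lin_on_zero subspace_0 lin_on_add subspace_sum)

context hereditary_algebra
begin

text \<open>Modules on which \<open>k\<close> acts coordinatewise, so that \<open>scaleF\<close> is the scalar multiplication of all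
  spaces of homomorphisms between them.\<close>

definition nmod :: "('h, 'h elt) hmod \<Rightarrow> bool" where
  "nmod M \<longleftrightarrow> hmodule M \<and> (\<exists>n. car M \<subseteq> free n) \<and> (\<forall>c. \<forall>x\<in>car M. act M (kap c) x = scaleE c x)"

definition HomS :: "('h, 'h elt) hmod \<Rightarrow> ('h, 'h elt) hmod \<Rightarrow> ('h elt \<Rightarrow> 'h elt) set" where
  "HomS M N = {f. mod_hom M N f \<and> (\<forall>x. x \<notin> car M \<longrightarrow> f x = 0)}"

definition scaleF :: "'k \<Rightarrow> ('h elt \<Rightarrow> 'h elt) \<Rightarrow> ('h elt \<Rightarrow> 'h elt)" where "scaleF c f = (\<lambda>x. scaleE c (f x))"

definition rsm :: "('h, 'h elt) hmod \<Rightarrow> ('h elt \<Rightarrow> 'h elt) \<Rightarrow> 'h elt \<Rightarrow> 'h elt" where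
  "rsm M f = (\<lambda>x. if x \<in> car M then f x else 0)"

lemma map_add: "f + g = (\<lambda>x. f x + g x)" and map_zero: "0 = (\<lambda>x. 0)"
  for f g :: "'h elt \<Rightarrow> 'h elt"
  by (simp_all add: fun_eq_iff fun_apply)

sublocale F: vector_space scaleF
  by unfold_locales (simp_all add: scaleF_def map_add E.scale_right_distrib E.scale_left_distrib)

lemma pmod_nmod: "pmod M \<Longrightarrow> nmod M"
  unfolding pmod_def nmod_def by (auto simp: smul_kap)

lemma nmodD: "nmod M \<Longrightarrow> hmodule M" "nmod M \<Longrightarrow> x \<in> car M \<Longrightarrow> act M (kap c) x = scaleE c x"
  by (auto simp: nmod_def)

lemma nmod_scale: "nmod M \<Longrightarrow> x \<in> car M \<Longrightarrow> scaleE c x \<in> car M"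
  using hmod_act[OF nmodD(1), of M x "kap c"] nmodD(2) by simp

lemma nmod_subspace: "nmod M \<Longrightarrow> E.subspace (car M)"
  by (rule E.subspaceI) (auto simp: hmod_zero hmod_add nmodD(1) nmod_scale)

lemma nmod_span: assumes "nmod M" obtains F where "finite F" "car M \<subseteq> E.span F"
  using assms free_span unfolding nmod_def by (metis order_trans)

lemma nmod_mod_sum: assumes M: "nmod M" and N: "nmod N" shows "nmod (mod_sum M N)"
proof -
  obtain m n where "car M \<subseteq> free m" "car N \<subseteq> free n" using M N unfolding nmod_def by blast
  note mod_sum_free[OF this]
  moreover have "pr (scaleE c (lft z)) (scaleE c (rgt z)) = scaleE c z" for c z
    by (metis smul_kap smul_pr)
  ultimately show ?thesis
    using hmodule_mod_sum[OF nmodD(1)[OF M] nmodD(1)[OF N]] nmodD(2)[OF M] nmodD(2)[OF N] unfolding nmod_def by auto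
qed

lemma nmod_sub:
  assumes M: "nmod M" and A: "A \<subseteq> car M" "hmodule \<lparr>car = A, act = act M\<rparr>"
  shows "nmod \<lparr>car = A, act = act M\<rparr>"
  using assms unfolding nmod_def by (auto, meson order_trans)

lemma nmod_image:
  assumes "nmod M" "nmod N" "mod_hom M N f" shows "nmod \<lparr>car = f ` car M, act = act N\<rparr>"
  using nmod_sub[OF assms(2) _ hmodule_image[OF nmodD(1)[OF assms(1)] nmodD(1)[OF assms(2)] assms(3)]]
    hom_car[OF assms(3)] by blast

lemma HomS_hom: "f \<in> HomS M N \<Longrightarrow> mod_hom M N f" and HomS_out: "f \<in> HomS M N \<Longrightarrow> x \<notin> car M \<Longrightarrow> f x = 0"
  by (auto simp: HomS_def)

lemma HomS_car: "nmod N \<Longrightarrow> f \<in> HomS M N \<Longrightarrow> f x \<in> car N"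
  using hom_car HomS_hom HomS_out hmod_zero nmodD(1) by (metis (no_types, lifting))

lemma HomS_zero: "nmod M \<Longrightarrow> f \<in> HomS M N \<Longrightarrow> f 0 = 0"
  using hom_zero nmodD(1) HomS_hom by blast

lemma HomS_comp: "nmod M \<Longrightarrow> f \<in> HomS L M \<Longrightarrow> g \<in> HomS M N \<Longrightarrow> (\<lambda>x. g (f x)) \<in> HomS L N"
  unfolding HomS_def using mod_hom_comp[of L M f N g] hom_zero[OF nmodD(1), of M N g] by auto

lemma rsm_HomS: "nmod M \<Longrightarrow> mod_hom M N f \<Longrightarrow> rsm M f \<in> HomS M N"
  unfolding HomS_def using mod_hom_cong[OF nmodD(1), of M N f "rsm M f"] by (auto simp: rsm_def)

lemma HomS_eqI: "f \<in> HomS M N \<Longrightarrow> g \<in> HomS M N' \<Longrightarrow> (\<And>x. x \<in> car M \<Longrightarrow> f x = g x) \<Longrightarrow> f = g"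
  by (rule ext) (metis HomS_out)

lemma hom_scaleE: "nmod M \<Longrightarrow> nmod N \<Longrightarrow> mod_hom M N f \<Longrightarrow> x \<in> car M \<Longrightarrow> f (scaleE c x) = scaleE c (f x)"
  using hom_act[of M N f x "kap c"] nmodD(2) hom_car by metis

text \<open>Scalars are central in the algebra; this is what makes spaces of homomorphisms closed
  under scaling.\<close>

lemma act_scaleE: assumes M: "nmod M" and x: "x \<in> car M" shows "act M a (scaleE c x) = scaleE c (act M a x)"
proof -
  have "a * kap c = kap c * a" by (simp add: kap_def scale_mult_left[symmetric] scale_mult_right[symmetric])
  then have "act M a (act M (kap c) x) = act M (kap c) (act M a x)"
    using mult_act[OF nmodD(1)[OF M] x] by metis
  then show ?thesis by (simp add: nmodD(2)[OF M] x hmod_act[OF nmodD(1)[OF M]])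
qed

lemma HomS_subspace: assumes N: "nmod N" shows "F.subspace (HomS M N)"
proof (rule F.subspaceI)
  show "0 \<in> HomS M N" using mod_hom_zero[OF nmodD(1)[OF N]] by (simp add: HomS_def map_zero)
  show "x + y \<in> HomS M N" if "x \<in> HomS M N" "y \<in> HomS M N" for x y
    using that mod_hom_add[OF nmodD(1)[OF N], of M x y] by (simp add: HomS_def map_add)
  show "scaleF c x \<in> HomS M N" if "x \<in> HomS M N" for c x
    using that unfolding HomS_def mod_hom_def
    by (auto simp: scaleF_def E.scale_right_distrib nmod_scale[OF N] act_scaleE[OF N])
qed

text \<open>\<open>t\<close> pairs \<open>Hom(P, Q)\<close> and \<open>Hom(Q, I)\<close> perfectly, so \<open>I\<close> is the image \<open>D Hom(P, H)\<close> of \<open>P\<close> under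
  the Nakayama functor.\<close>

definition nak :: "('h, 'h elt) hmod \<Rightarrow> ('h, 'h elt) hmod \<Rightarrow> (('h elt \<Rightarrow> 'h elt) \<Rightarrow> 'k) \<Rightarrow> bool" where
  "nak P I t \<longleftrightarrow> nmod P \<and> nmod I \<and> lin_on scaleF (HomS P I) t \<and>
     (\<forall>Q \<phi>. nmod Q \<and> lin_on scaleF (HomS P Q) \<phi> \<longrightarrow>
        (\<exists>f\<in>HomS Q I. \<forall>g\<in>HomS P Q. t (\<lambda>x. f (g x)) = \<phi> g)) \<and>
     (\<forall>Q \<psi>. nmod Q \<and> lin_on scaleF (HomS Q I) \<psi> \<longrightarrow>
        (\<exists>g\<in>HomS P Q. \<forall>f\<in>HomS Q I. t (\<lambda>x. f (g x)) = \<psi> f))"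

lemma nakD: "nak P I t \<Longrightarrow> nmod P" "nak P I t \<Longrightarrow> nmod I" "nak P I t \<Longrightarrow> lin_on scaleF (HomS P I) t"
  unfolding nak_def by blast+

lemma nak_rep:
  assumes n: "nak P I t" and Q: "nmod Q" and \<phi>: "lin_on scaleF (HomS P Q) \<phi>"
  obtains f where "f \<in> HomS Q I" "\<And>g. g \<in> HomS P Q \<Longrightarrow> t (\<lambda>x. f (g x)) = \<phi> g"
proof -
  have "\<forall>Q \<phi>. nmod Q \<and> lin_on scaleF (HomS P Q) \<phi> \<longrightarrow>
        (\<exists>f\<in>HomS Q I. \<forall>g\<in>HomS P Q. t (\<lambda>x. f (g x)) = \<phi> g)"
    using n unfolding nak_def by (elim conjE) assumption
  from this[THEN spec, THEN spec, THEN mp, of Q \<phi>] Q \<phi>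
  have "\<exists>f\<in>HomS Q I. \<forall>g\<in>HomS P Q. t (\<lambda>x. f (g x)) = \<phi> g" by simp
  then show thesis by (elim bexE) (rule that, auto)
qed

lemma nak_corep:
  assumes n: "nak P I t" and Q: "nmod Q" and \<psi>: "lin_on scaleF (HomS Q I) \<psi>"
  obtains g where "g \<in> HomS P Q" "\<And>f. f \<in> HomS Q I \<Longrightarrow> t (\<lambda>x. f (g x)) = \<psi> f"
proof -
  have "\<forall>Q \<psi>. nmod Q \<and> lin_on scaleF (HomS Q I) \<psi> \<longrightarrow>
        (\<exists>g\<in>HomS P Q. \<forall>f\<in>HomS Q I. t (\<lambda>x. f (g x)) = \<psi> f)"
    using n unfolding nak_def by (elim conjE) assumption
  from this[THEN spec, THEN spec, THEN mp, of Q \<psi>] Q \<psi>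
  have "\<exists>g\<in>HomS P Q. \<forall>f\<in>HomS Q I. t (\<lambda>x. f (g x)) = \<psi> f" by simp
  then show thesis by (elim bexE) (rule that, auto)
qed

text \<open>A functional that separates f from f' is itself of the form
  \<open>t (\<lambda>x. f (g x))\<close> for some g, so t separates them too.\<close>

lemma nak_unique_right:
  assumes n: "nak P I t" and Q: "nmod Q" and f: "f \<in> HomS Q I" "f' \<in> HomS Q I"
    and eq: "\<And>g. g \<in> HomS P Q \<Longrightarrow> t (\<lambda>x. f (g x)) = t (\<lambda>x. f' (g x))"
  shows "f = f'"
proof (rule ccontr)
  assume "f \<noteq> f'"
  then have "f - f' \<notin> {0}" by simp
  then obtain \<psi> where \<psi>: "lin_on scaleF UNIV \<psi>" "\<psi> (f - f') = 1"
    using F.functional_separate[OF F.subspace_single_0] by metis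
  obtain g where "g \<in> HomS P Q" "\<And>f. f \<in> HomS Q I \<Longrightarrow> t (\<lambda>x. f (g x)) = \<psi> f"
    using nak_corep[OF n Q lin_on_subset[OF \<psi>(1)]] by blast
  then have "\<psi> f = \<psi> f'" using eq f by metis
  then show False using lin_on_diff[OF \<psi>(1), of f f'] \<psi>(2) by simp
qed

lemma nak_unique_left:
  assumes n: "nak P I t" and Q: "nmod Q" and g: "g \<in> HomS P Q" "g' \<in> HomS P Q"
    and eq: "\<And>f. f \<in> HomS Q I \<Longrightarrow> t (\<lambda>x. f (g x)) = t (\<lambda>x. f (g' x))"
  shows "g = g'"
proof (rule ccontr)
  assume "g \<noteq> g'"
  then have "g - g' \<notin> {0}" by simp
  then obtain \<phi> where \<phi>: "lin_on scaleF UNIV \<phi>" "\<phi> (g - g') = 1"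
    using F.functional_separate[OF F.subspace_single_0] by metis
  obtain f where "f \<in> HomS Q I" "\<And>g. g \<in> HomS P Q \<Longrightarrow> t (\<lambda>x. f (g x)) = \<phi> g"
    using nak_rep[OF n Q lin_on_subset[OF \<phi>(1)]] by blast
  then have "\<phi> g = \<phi> g'" using eq g by metis
  then show False using lin_on_diff[OF \<phi>(1), of g g'] \<phi>(2) by simp
qed

lemma lin_pre:
  assumes "lin_on scaleF (HomS L N) \<phi>" "nmod M" "g \<in> HomS L M"
  shows "lin_on scaleF (HomS M N) (\<lambda>f. \<phi> (\<lambda>x. f (g x)))"
  by (rule lin_on_comp[OF assms(1)]) (use HomS_comp[OF assms(2,3)] in \<open>auto simp: map_add scaleF_def\<close>)

lemma lin_post:
  assumes "lin_on scaleF (HomS L N) \<phi>" "nmod M" "nmod N" "g \<in> HomS M N"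
  shows "lin_on scaleF (HomS L M) (\<lambda>f. \<phi> (\<lambda>x. g (f x)))"
proof (rule lin_on_comp[OF assms(1)])
  show "(\<lambda>x. g (f x)) \<in> HomS L N" if "f \<in> HomS L M" for f by (rule HomS_comp[OF assms(2) that assms(4)])
qed (use HomS_car[OF assms(2)] hom_add[OF HomS_hom[OF assms(4)]] hom_scaleE[OF assms(2,3) HomS_hom[OF assms(4)]]
  in \<open>auto simp: map_add scaleF_def\<close>)

text \<open>P is cut out of F by the idempotent s p and I out of J by i r. By \<open>adj\<close>
  these idempotents are adjoint for \<open>t\<close>, so the pairing restricts to the two
  summands.\<close>

lemma nak_retract:
  assumes n: "nak F J t" and P: "nmod P" and I: "nmod I"
    and s: "s \<in> HomS P F" "p \<in> HomS F P" "\<And>x. x \<in> car P \<Longrightarrow> p (s x) = x"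
    and i: "i \<in> HomS I J" "r \<in> HomS J I" "\<And>x. x \<in> car I \<Longrightarrow> r (i x) = x"
    and adj: "\<And>f. f \<in> HomS F J \<Longrightarrow> t (\<lambda>x. i (r (f x))) = t (\<lambda>x. f (s (p x)))"
  shows "nak P I (\<lambda>h. t (\<lambda>x. i (h (p x))))"
  unfolding nak_def
proof (intro conjI allI impI P I)
  note F = nakD(1)[OF n] and J = nakD(2)[OF n]
  show "lin_on scaleF (HomS P I) (\<lambda>h. t (\<lambda>x. i (h (p x))))"
    using lin_post[OF lin_pre[OF nakD(3)[OF n] P s(2)] I J i(1)] .
  fix Q \<phi> assume "nmod Q \<and> lin_on scaleF (HomS P Q) \<phi>"
  then have Q: "nmod Q" and \<phi>: "lin_on scaleF (HomS P Q) \<phi>" by auto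
  obtain f where f: "f \<in> HomS Q J" "\<And>g. g \<in> HomS F Q \<Longrightarrow> t (\<lambda>x. f (g x)) = \<phi> (\<lambda>x. g (s x))"
    using nak_rep[OF n Q lin_pre[OF \<phi> F s(1)]] by blast
  show "\<exists>f\<in>HomS Q I. \<forall>g\<in>HomS P Q. t (\<lambda>x. i (f (g (p x)))) = \<phi> g"
  proof (intro bexI ballI)
    show "(\<lambda>x. r (f x)) \<in> HomS Q I" by (rule HomS_comp[OF J f(1) i(2)])
    fix g assume g: "g \<in> HomS P Q"
    have gp: "(\<lambda>x. g (p x)) \<in> HomS F Q" by (rule HomS_comp[OF P s(2) g])
    have fgp: "(\<lambda>x. f (g (p x))) \<in> HomS F J" by (rule HomS_comp[OF Q gp f(1)])
    have "t (\<lambda>x. i (r (f (g (p x))))) = t (\<lambda>x. f (g (p (s (p x)))))" using adj[OF fgp] .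
    also have "\<dots> = t (\<lambda>x. f (g (p x)))" using s(3)[OF HomS_car[OF P s(2)]] by simp
    also have "\<dots> = \<phi> (\<lambda>x. g (p (s x)))" by (rule f(2)[OF gp])
    also have "(\<lambda>x. g (p (s x))) = g"
      by (rule HomS_eqI[OF HomS_comp[OF P HomS_comp[OF F s(1) s(2)] g] g]) (simp add: s(3))
    finally show "t (\<lambda>x. i (r (f (g (p x))))) = \<phi> g" .
  qed
next
  note F = nakD(1)[OF n] and J = nakD(2)[OF n]
  fix Q \<psi> assume "nmod Q \<and> lin_on scaleF (HomS Q I) \<psi>"
  then have Q: "nmod Q" and \<psi>: "lin_on scaleF (HomS Q I) \<psi>" by auto
  obtain g where g: "g \<in> HomS F Q" "\<And>f. f \<in> HomS Q J \<Longrightarrow> t (\<lambda>x. f (g x)) = \<psi> (\<lambda>x. r (f x))"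
    using nak_corep[OF n Q lin_post[OF \<psi> J I i(2)]] by blast
  show "\<exists>g\<in>HomS P Q. \<forall>f\<in>HomS Q I. t (\<lambda>x. i (f (g (p x)))) = \<psi> f"
  proof (intro bexI ballI)
    show "(\<lambda>x. g (s x)) \<in> HomS P Q" by (rule HomS_comp[OF F s(1) g(1)])
    fix f assume f: "f \<in> HomS Q I"
    have if': "(\<lambda>x. i (f x)) \<in> HomS Q J" by (rule HomS_comp[OF I f i(1)])
    have ri: "r (i (f x)) = f x" for x by (rule i(3)[OF HomS_car[OF I f]])
    have ifr: "(\<lambda>x. i (f (g x))) \<in> HomS F J" by (rule HomS_comp[OF Q g(1) if'])
    have "t (\<lambda>x. i (f (g (s (p x))))) = t (\<lambda>x. i (r (i (f (g x)))))" using adj[OF ifr] by simp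
    also have "\<dots> = t (\<lambda>x. i (f (g x)))" by (simp add: ri)
    also have "\<dots> = \<psi> (\<lambda>x. r (i (f x)))" by (rule g(2)[OF if'])
    finally show "t (\<lambda>x. i (f (g (s (p x))))) = \<psi> f" by (simp add: ri)
  qed
qed

text \<open>The functional adds the values on the two diagonal entries, as a trace does.\<close>

lemma nak_sum:
  assumes n1: "nak P1 I1 t1" and n2: "nak P2 I2 t2"
  shows "nak (mod_sum P1 P2) (mod_sum I1 I2)
    (\<lambda>h. t1 (\<lambda>x. lft (h (pr x 0))) + t2 (\<lambda>x. rgt (h (pr 0 x))))"
  unfolding nak_def
proof (intro conjI allI impI)
  note P1 = nakD(1)[OF n1] and I1 = nakD(2)[OF n1] and P2 = nakD(1)[OF n2] and I2 = nakD(2)[OF n2]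
  let ?P = "mod_sum P1 P2" and ?I = "mod_sum I1 I2"
  show P: "nmod ?P" by (rule nmod_mod_sum[OF P1 P2])
  show I: "nmod ?I" by (rule nmod_mod_sum[OF I1 I2])
  have z: "0 \<in> car P1" "0 \<in> car P2" using hmod_zero nmodD(1) P1 P2 by auto
  have inl: "(\<lambda>x. h (pr x 0)) \<in> HomS P1 N" and inr: "(\<lambda>x. h (pr 0 x)) \<in> HomS P2 N"
    if h: "h \<in> HomS ?P N" for h N
  proof -
    have "mod_hom P1 ?P (\<lambda>x. pr x 0)" "mod_hom P2 ?P (\<lambda>x. pr 0 x)"
      by (simp_all add: mod_hom_pr_iff mod_hom_id mod_hom_zero nmodD P1 P2)
    then show "(\<lambda>x. h (pr x 0)) \<in> HomS P1 N" "(\<lambda>x. h (pr 0 x)) \<in> HomS P2 N"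
      using mod_hom_comp[OF _ HomS_hom[OF h]] HomS_out[OF h] unfolding HomS_def by auto
  qed
  have cl: "(\<lambda>x. lft (h x)) \<in> HomS M I1" and cr: "(\<lambda>x. rgt (h x)) \<in> HomS M I2" if "h \<in> HomS M ?I" for h M
    using that unfolding HomS_def mod_hom_pr_iff by auto
  show "lin_on scaleF (HomS ?P ?I) (\<lambda>h. t1 (\<lambda>x. lft (h (pr x 0))) + t2 (\<lambda>x. rgt (h (pr 0 x))))"
  proof (rule lin_on_plus)
    have [simp]: "lft (scaleE c z) = scaleE c (lft z)" "rgt (scaleE c z) = scaleE c (rgt z)" for c z
      by (simp_all add: scaleE_def lft_def rgt_def)
    show "lin_on scaleF (HomS ?P ?I) (\<lambda>h. t1 (\<lambda>x. lft (h (pr x 0))))"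
      by (rule lin_on_comp[OF nakD(3)[OF n1]]) (use cl[OF inl] in \<open>auto simp: map_add scaleF_def\<close>)
    show "lin_on scaleF (HomS ?P ?I) (\<lambda>h. t2 (\<lambda>x. rgt (h (pr 0 x))))"
      by (rule lin_on_comp[OF nakD(3)[OF n2]]) (use cr[OF inr] in \<open>auto simp: map_add scaleF_def\<close>)
  qed
  have rl: "rsm ?P (\<lambda>z. g (lft z)) \<in> HomS ?P N" if "g \<in> HomS P1 N" for g N
    by (rule rsm_HomS[OF P mod_hom_lft[OF HomS_hom[OF that]]])
  have rr: "rsm ?P (\<lambda>z. g (rgt z)) \<in> HomS ?P N" if "g \<in> HomS P2 N" for g N
    by (rule rsm_HomS[OF P mod_hom_rgt[OF HomS_hom[OF that]]])
  {
    fix Q \<phi> assume "nmod Q \<and> lin_on scaleF (HomS ?P Q) \<phi>"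
    then have Q: "nmod Q" and \<phi>: "lin_on scaleF (HomS ?P Q) \<phi>" by auto
    have l1: "lin_on scaleF (HomS P1 Q) (\<lambda>g. \<phi> (rsm ?P (\<lambda>z. g (lft z))))"
      by (rule lin_on_comp[OF \<phi>]) (use rl in \<open>auto simp: map_add scaleF_def rsm_def fun_eq_iff\<close>)
    have l2: "lin_on scaleF (HomS P2 Q) (\<lambda>g. \<phi> (rsm ?P (\<lambda>z. g (rgt z))))"
      by (rule lin_on_comp[OF \<phi>]) (use rr in \<open>auto simp: map_add scaleF_def rsm_def fun_eq_iff\<close>)
    obtain f1 where f1: "f1 \<in> HomS Q I1" "\<And>g. g \<in> HomS P1 Q \<Longrightarrow> t1 (\<lambda>x. f1 (g x)) = \<phi> (rsm ?P (\<lambda>z. g (lft z)))"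
      using nak_rep[OF n1 Q l1] by blast
    obtain f2 where f2: "f2 \<in> HomS Q I2" "\<And>g. g \<in> HomS P2 Q \<Longrightarrow> t2 (\<lambda>x. f2 (g x)) = \<phi> (rsm ?P (\<lambda>z. g (rgt z)))"
      using nak_rep[OF n2 Q l2] by blast
    show "\<exists>f\<in>HomS Q ?I. \<forall>g\<in>HomS ?P Q. t1 (\<lambda>x. lft (f (g (pr x 0)))) + t2 (\<lambda>x. rgt (f (g (pr 0 x)))) = \<phi> g"
    proof (intro bexI ballI)
      show "(\<lambda>x. pr (f1 x) (f2 x)) \<in> HomS Q ?I"
        using f1(1) f2(1) unfolding HomS_def mod_hom_pr_iff by auto
      fix g assume g: "g \<in> HomS ?P Q"
      have "g = rsm ?P (\<lambda>z. g (pr (lft z) 0)) + rsm ?P (\<lambda>z. g (pr 0 (rgt z)))"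
      proof (rule ext)
        fix u
        have "g u = g (pr (lft u) 0) + g (pr 0 (rgt u))" if "u \<in> car ?P"
          using hom_add[OF HomS_hom[OF g], of "pr (lft u) 0" "pr 0 (rgt u)"] that z by (simp add: pr_add)
        then show "g u = (rsm ?P (\<lambda>z. g (pr (lft z) 0)) + rsm ?P (\<lambda>z. g (pr 0 (rgt z)))) u"
          using HomS_out[OF g] by (auto simp: rsm_def map_add)
      qed
      then have "\<phi> g = \<phi> (rsm ?P (\<lambda>z. g (pr (lft z) 0))) + \<phi> (rsm ?P (\<lambda>z. g (pr 0 (rgt z))))"
        using lin_on_add[OF \<phi> rl[OF inl[OF g]] rr[OF inr[OF g]]] by simp
      then show "t1 (\<lambda>x. lft (pr (f1 (g (pr x 0))) (f2 (g (pr x 0))))) + t2 (\<lambda>x. rgt (pr (f1 (g (pr 0 x))) (f2 (g (pr 0 x))))) = \<phi> g"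
        using f1(2)[OF inl[OF g]] f2(2)[OF inr[OF g]] by simp
    qed
  next
    fix Q \<psi> assume "nmod Q \<and> lin_on scaleF (HomS Q ?I) \<psi>"
    then have Q: "nmod Q" and \<psi>: "lin_on scaleF (HomS Q ?I) \<psi>" by auto
    have ps: "pr (scaleE c x) (scaleE c y) = scaleE c (pr x y)" for c x y
      by (auto simp: scaleE_def pr_def)
    have s0: "scaleE c 0 = 0" for c by (rule E.scale_zero_right)
    have il: "(\<lambda>x. pr (f x) 0) \<in> HomS Q ?I" if "f \<in> HomS Q I1" for f
      using that mod_hom_zero[OF nmodD(1)[OF I2]] unfolding HomS_def mod_hom_pr_iff by auto
    have ir: "(\<lambda>x. pr 0 (f x)) \<in> HomS Q ?I" if "f \<in> HomS Q I2" for f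
      using that mod_hom_zero[OF nmodD(1)[OF I1]] unfolding HomS_def mod_hom_pr_iff by auto
    have l1: "lin_on scaleF (HomS Q I1) (\<lambda>f. \<psi> (\<lambda>x. pr (f x) 0))"
      by (rule lin_on_comp[OF \<psi>]) (use il ps[of _ _ 0] in \<open>auto simp: map_add scaleF_def pr_add s0\<close>)
    have l2: "lin_on scaleF (HomS Q I2) (\<lambda>f. \<psi> (\<lambda>x. pr 0 (f x)))"
      by (rule lin_on_comp[OF \<psi>]) (use ir ps[of _ 0] in \<open>auto simp: map_add scaleF_def pr_add s0\<close>)
    obtain g1 where g1: "g1 \<in> HomS P1 Q" "\<And>f. f \<in> HomS Q I1 \<Longrightarrow> t1 (\<lambda>x. f (g1 x)) = \<psi> (\<lambda>x. pr (f x) 0)"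
      using nak_corep[OF n1 Q l1] by blast
    obtain g2 where g2: "g2 \<in> HomS P2 Q" "\<And>f. f \<in> HomS Q I2 \<Longrightarrow> t2 (\<lambda>x. f (g2 x)) = \<psi> (\<lambda>x. pr 0 (f x))"
      using nak_corep[OF n2 Q l2] by blast
    show "\<exists>g\<in>HomS ?P Q. \<forall>f\<in>HomS Q ?I. t1 (\<lambda>x. lft (f (g (pr x 0)))) + t2 (\<lambda>x. rgt (f (g (pr 0 x)))) = \<psi> f"
    proof (intro bexI ballI)
      let ?g = "rsm ?P (\<lambda>z. g1 (lft z) + g2 (rgt z))"
      show "?g \<in> HomS ?P Q"
        by (rule rsm_HomS[OF P mod_hom_add[OF nmodD(1)[OF Q] mod_hom_lft[OF HomS_hom[OF g1(1)]] mod_hom_rgt[OF HomS_hom[OF g2(1)]]]])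
      have e1: "?g (pr x 0) = g1 x" for x
        using HomS_zero[OF P2 g2(1)] HomS_out[OF g1(1)] z by (auto simp: rsm_def)
      have e2: "?g (pr 0 x) = g2 x" for x
        using HomS_zero[OF P1 g1(1)] HomS_out[OF g2(1)] z by (auto simp: rsm_def)
      fix f assume f: "f \<in> HomS Q ?I"
      have "f = (\<lambda>x. pr (lft (f x)) 0) + (\<lambda>x. pr 0 (rgt (f x)))" by (simp add: map_add pr_add)
      then have "\<psi> f = \<psi> (\<lambda>x. pr (lft (f x)) 0) + \<psi> (\<lambda>x. pr 0 (rgt (f x)))"
        using lin_on_add[OF \<psi> il[OF cl[OF f]] ir[OF cr[OF f]]] by simp
      then show "t1 (\<lambda>x. lft (f (?g (pr x 0)))) + t2 (\<lambda>x. rgt (f (?g (pr 0 x)))) = \<psi> f"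
        unfolding e1 e2 using g1(2)[OF cl[OF f]] g2(2)[OF cr[OF f]] by simp
    qed
  }
qed

end

section \<open>The injective modules \<open>(DH)^n\<close> as Nakayama partners of free
  modules\<close>

context hereditary_algebra
begin

text \<open>The dual \<open>DH\<close> is identified with \<open>H\<close> as a vector space by the symmetric bilinear form
  of a basis, so that \<open>(DH)\<^sup>n\<close> has the same carrier as \<open>H\<^sup>n\<close>.\<close>

definition bas :: "'h set" where "bas = (SOME B. finite B \<and> independent B \<and> span B = UNIV)"

lemma bas: "finite bas" "independent bas" "x \<in> span bas"
proof -
  obtain S where S: "finite S" "span S = (UNIV :: 'h set)" using finite_spanning_set by blast
  obtain B where B: "B \<subseteq> S" "independent B" "S \<subseteq> span B" using maximal_independent_subset by metis
  have "span S \<subseteq> span B" by (rule span_minimal[OF B(3) subspace_span])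
  then have "finite B \<and> independent B \<and> span B = UNIV" using B(1,2) S finite_subset by auto
  then have "finite bas \<and> independent bas \<and> span bas = UNIV" unfolding bas_def by (rule someI)
  then show "finite bas" "independent bas" "x \<in> span bas" by auto
qed

abbreviation "coord \<equiv> representation bas"

lemma coord_add: "coord (x + y) b = coord x b + coord y b" and coord_scale: "coord (scale c x) b = c * coord x b"
  and sum_coord: "(\<Sum>b\<in>bas. scale (coord x b) b) = x"
  using representation_add[OF bas(2) bas(3) bas(3)] representation_scale[OF bas(2) bas(3)]
    sum_representation_eq[OF bas(2) bas(3) bas(1)] by auto

definition form :: "'h \<Rightarrow> 'h \<Rightarrow> 'k" where "form h a = (\<Sum>b\<in>bas. coord h b * coord a b)"

definition dual :: "('h \<Rightarrow> 'k) \<Rightarrow> 'h" where "dual \<xi> = (\<Sum>b\<in>bas. scale (\<xi> b) b)"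

lemma form_add_left: "form (h + h') a = form h a + form h' a" and form_add_right: "form h (a + a') = form h a + form h a'"
  and form_scale_left: "form (scale c h) a = c * form h a" and form_scale_right: "form h (scale c a) = c * form h a"
  by (simp_all add: form_def coord_add coord_scale sum.distrib sum_distrib_left algebra_simps)

lemma form_dual: assumes "lin_on scale UNIV \<xi>" shows "form (dual \<xi>) a = \<xi> a"
proof -
  have "coord (dual \<xi>) b = \<xi> b" if b: "b \<in> bas" for b
  proof -
    have "coord (dual \<xi>) b = (\<Sum>b'\<in>bas. \<xi> b' * coord b' b)"
      unfolding dual_def using representation_sum[OF bas(2), of bas "\<lambda>b. scale (\<xi> b) b"] bas(3) by (simp add: coord_scale)
    also have "\<dots> = (\<Sum>b'\<in>bas. if b' = b then \<xi> b' else 0)"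
      by (rule sum.cong) (auto simp: representation_basis[OF bas(2)])
    finally show ?thesis using b bas(1) by simp
  qed
  then have "form (dual \<xi>) a = (\<Sum>b\<in>bas. \<xi> (scale (coord a b) b))"
    unfolding form_def by (intro sum.cong) (auto simp: lin_on_scale[OF assms])
  also have "\<dots> = \<xi> a" using lin_on_sum[OF assms, of "\<lambda>b. scale (coord a b) b" bas] sum_coord by simp
  finally show ?thesis .
qed

lemma form_ext: assumes "\<And>a. form h a = form h' a" shows "h = h'"
proof -
  have "coord x b = form x b" if b: "b \<in> bas" for x b
  proof -
    have "form x b = (\<Sum>b'\<in>bas. if b' = b then coord x b' else 0)"
      unfolding form_def by (rule sum.cong) (auto simp: representation_basis[OF bas(2) b])
    then show ?thesis using b bas(1) by simp
  qed
  then have "(\<Sum>b\<in>bas. scale (coord h b) b) = (\<Sum>b\<in>bas. scale (coord h' b) b)" using assms by simp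
  then show ?thesis by (simp add: sum_coord)
qed

lemma form_zero: "form 0 a = 0" using form_scale_left[of 0 0 a] by simp

lemma form_sum: "form (sum w I) a = (\<Sum>k\<in>I. form (w k) a)"
  by (induction I rule: infinite_finite_induct) (auto simp: form_zero form_add_left)

text \<open>\<open>adj a\<close> is the transpose of right multiplication by \<open>a\<close>, so \<open>Jmod n\<close> below is \<open>(DH)\<^sup>n\<close>.\<close>

definition adj :: "'h \<Rightarrow> 'h \<Rightarrow> 'h" where "adj a h = dual (\<lambda>c. form h (c * a))"

lemma form_adj: "form (adj a h) c = form h (c * a)"
  unfolding adj_def
  by (rule form_dual) (simp add: lin_on_def form_add_right form_scale_right distrib_right scale_mult_left[symmetric])

definition Jmod :: "nat \<Rightarrow> ('h, 'h elt) hmod" where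
  "Jmod n = \<lparr>car = free n, act = (\<lambda>a z j. adj a (z j))\<rparr>"

lemma car_J [simp]: "car (Jmod n) = free n" and act_J [simp]: "act (Jmod n) a z j = adj a (z j)"
  by (simp_all add: Jmod_def)

lemma nmod_J: "nmod (Jmod n)"
proof -
  have a0: "adj a 0 = 0" for a by (rule form_ext) (simp add: form_adj form_zero)
  have "hmodule (Jmod n)"
    unfolding hmodule_def
  proof (intro conjI ballI allI)
    show "x - y \<in> car (Jmod n)" if "x \<in> car (Jmod n)" "y \<in> car (Jmod n)" for x y
      using that hmod_zero[OF hmodule_free[of n]] hmod_diff[OF hmodule_free[of n]] by auto
    show "0 \<in> car (Jmod n)" using hmod_zero[OF hmodule_free[of n]] by simp
    show "act (Jmod n) a x \<in> car (Jmod n)" if "x \<in> car (Jmod n)" for a x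
      using that by (simp add: free_def a0)
    show "act (Jmod n) a (x + y) = act (Jmod n) a x + act (Jmod n) a y" for a x y
      by (intro ext form_ext) (simp add: fun_apply form_adj form_add_left)
    show "act (Jmod n) (a + b) x = act (Jmod n) a x + act (Jmod n) b x" for a b x
      by (intro ext form_ext) (simp add: fun_apply form_adj form_add_left form_add_right distrib_left)
    show "act (Jmod n) (a * b) x = act (Jmod n) a (act (Jmod n) b x)" for a b x
      by (intro ext form_ext) (simp add: form_adj mult.assoc)
    show "act (Jmod n) 1 x = x" for x
      by (intro ext form_ext) (simp add: form_adj)
  qed
  moreover have "act (Jmod n) (kap c) x = scaleE c x" for c x
    by (intro ext form_ext) (simp add: form_adj scaleE_def form_scale_left form_scale_right kap_def scale_mult_right[symmetric])
  ultimately show ?thesis unfolding nmod_def by auto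
qed

lemma hom_J_form: assumes "mod_hom Q (Jmod n) f" "x \<in> car Q" shows "form (f x j) c = form (f (act Q c x) j) 1"
  using hom_act[OF assms, of c] by (simp add: form_adj)

lemma hom_J_eqI:
  assumes Q: "nmod Q" and f: "f \<in> HomS Q (Jmod n)" and g: "g \<in> HomS Q (Jmod n)"
    and eq: "\<And>x j. x \<in> car Q \<Longrightarrow> j < n \<Longrightarrow> form (f x j) 1 = form (g x j) 1"
  shows "f = g"
proof (rule HomS_eqI[OF f g])
  fix x assume x: "x \<in> car Q"
  show "f x = g x"
  proof (intro ext)
    fix j show "f x j = g x j"
    proof (cases "j < n")
      case True
      show ?thesis
        by (rule form_ext)
          (use hom_J_form[OF HomS_hom[OF f] x] hom_J_form[OF HomS_hom[OF g] x] eq[OF hmod_act[OF nmodD(1)[OF Q] x] True] in simp)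
    next
      case False
      then show ?thesis using hom_car[OF HomS_hom[OF f] x] hom_car[OF HomS_hom[OF g] x] by (simp add: free_def)
    qed
  qed
qed

text \<open>One direction of the isomorphism between \<open>Hom(Q, (DH)^n)\<close> and
  \<open>(DQ)^n\<close>: a functional \<eta> becomes x \<mapsto> (c \<mapsto> \<eta> (c x)). The
  opposite direction evaluates at 1.\<close>

definition toJ :: "('h, 'h elt) hmod \<Rightarrow> nat \<Rightarrow> (nat \<Rightarrow> 'h elt \<Rightarrow> 'k) \<Rightarrow> 'h elt \<Rightarrow> 'h elt" where
  "toJ Q n \<eta> = rsm Q (\<lambda>x j. if j < n then dual (\<lambda>c. \<eta> j (act Q c x)) else 0)"

lemma form_toJ:
  assumes Q: "nmod Q" and \<eta>: "lin_on scaleE (car Q) (\<eta> j)" and x: "x \<in> car Q" and j: "j < n"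
  shows "form (toJ Q n \<eta> x j) c = \<eta> j (act Q c x)"
proof -
  note H = nmodD(1)[OF Q]
  have k: "scale s c = kap s * c" for s c by (simp add: kap_def scale_mult_left[symmetric])
  have "lin_on scale UNIV (\<lambda>c. \<eta> j (act Q c x))"
    unfolding lin_on_def
    by (simp add: add_act[OF H x] lin_on_add[OF \<eta>] hmod_act[OF H x] k mult_act[OF H x] nmodD(2)[OF Q] lin_on_scale[OF \<eta>])
  then show ?thesis using x j by (simp add: toJ_def rsm_def form_dual)
qed

lemma toJ_HomS:
  assumes Q: "nmod Q" and \<eta>: "\<And>j. j < n \<Longrightarrow> lin_on scaleE (car Q) (\<eta> j)"
  shows "toJ Q n \<eta> \<in> HomS Q (Jmod n)"
proof -
  note H = nmodD(1)[OF Q]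
  have o: "toJ Q n \<eta> x j = 0" if "\<not> j < n" for x j using that by (auto simp: toJ_def rsm_def fun_apply)
  have "mod_hom Q (Jmod n) (toJ Q n \<eta>)"
    unfolding mod_hom_def
  proof (intro conjI ballI allI)
    fix x assume x: "x \<in> car Q"
    show "toJ Q n \<eta> x \<in> car (Jmod n)" using o by (auto simp: free_def)
    show "toJ Q n \<eta> (act Q a x) = act (Jmod n) a (toJ Q n \<eta> x)" for a
    proof (intro ext)
      fix j show "toJ Q n \<eta> (act Q a x) j = act (Jmod n) a (toJ Q n \<eta> x) j"
      proof (cases "j < n")
        case True
        show ?thesis
          by (rule form_ext) (simp add: form_adj form_toJ[where \<eta> = \<eta> and j = j, OF Q \<eta>[OF True] _ True] x hmod_act[OF H] mult_act[OF H])
      next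
        case False
        moreover have "adj a 0 = 0" by (rule form_ext) (simp add: form_adj form_zero)
        ultimately show ?thesis by (simp add: o)
      qed
    qed
    fix y assume y: "y \<in> car Q"
    show "toJ Q n \<eta> (x + y) = toJ Q n \<eta> x + toJ Q n \<eta> y"
    proof (intro ext)
      fix j show "toJ Q n \<eta> (x + y) j = (toJ Q n \<eta> x + toJ Q n \<eta> y) j"
      proof (cases "j < n")
        case True
        show ?thesis
          by (rule form_ext) (simp add: fun_apply form_add_left form_toJ[where \<eta> = \<eta> and j = j, OF Q \<eta>[OF True] _ True] x y hmod_add[OF H]
              act_add[OF H] lin_on_add[OF \<eta>[OF True]] hmod_act[OF H])
      next
        case False then show ?thesis by (simp add: o fun_apply)
      qed
    qed
  qed
  then show ?thesis by (auto simp: HomS_def toJ_def rsm_def)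
qed

lemma hom_J_lin:
  assumes Q: "nmod Q" and f: "mod_hom Q (Jmod n) f"
  shows "lin_on scaleE (car Q) (\<lambda>x. form (f x j) 1)"
  unfolding lin_on_def
  by (simp add: hom_add[OF f] fun_apply form_add_left hom_scaleE[OF Q nmod_J f]) (simp add: scaleE_def form_scale_left)

text \<open>\<open>(DH)^n\<close> is injective because homomorphisms into it are tuples of linear
  functionals, and these extend from a subspace.\<close>

lemma J_extend:
  assumes A: "nmod A" and B: "nmod B" and AB: "car A \<subseteq> car B" "act A = act B" and f: "mod_hom A (Jmod n) f"
  obtains g where "g \<in> HomS B (Jmod n)" "\<And>x. x \<in> car A \<Longrightarrow> g x = f x"
proof -
  have "\<exists>\<Phi>. lin_on scaleE UNIV \<Phi> \<and> (\<forall>x\<in>car A. \<Phi> x = form (f x j) 1)" for j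
    by (rule E.functional_extend[OF nmod_subspace[OF A] hom_J_lin[OF A f, of j]]) blast
  then obtain \<Phi> where \<Phi>: "\<And>j. lin_on scaleE UNIV (\<Phi> j)" "\<And>j x. x \<in> car A \<Longrightarrow> \<Phi> j x = form (f x j) 1" by metis
  have l: "lin_on scaleE (car B) (\<Phi> j)" for j by (rule lin_on_subset[OF \<Phi>(1)]) simp
  have g: "toJ B n \<Phi> \<in> HomS B (Jmod n)" by (rule toJ_HomS[OF B l])
  have "toJ B n \<Phi> x = f x" if x: "x \<in> car A" for x
  proof (intro ext)
    fix j show "toJ B n \<Phi> x j = f x j"
    proof (cases "j < n")
      case True
      show ?thesis
        by (rule form_ext) (use AB x in \<open>simp add: form_toJ[where j = j, OF B l _ True] subsetD
          hom_J_form[OF f x] \<Phi>(2) AB(2)[symmetric] hmod_act[OF nmodD(1)[OF A]]\<close>)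
    next
      case False
      then show ?thesis using hom_car[OF f x] by (simp add: toJ_def rsm_def free_def fun_apply)
    qed
  qed
  then show thesis using that[OF g] by blast
qed

text \<open>Finitely many functionals cut V out of W. As V is a submodule, the homomorphism that
  they define has kernel exactly V, so W/V embeds into \<open>(DH)^n\<close>. The last clause again
  serves boundedness.\<close>

lemma J_quotient:
  assumes W: "nmod W" and V: "V \<subseteq> car W" "hmodule \<lparr>car = V, act = act W\<rparr>"
  obtains n q where "q \<in> HomS W (Jmod n)" "\<And>x. x \<in> car W \<Longrightarrow> q x = 0 \<longleftrightarrow> x \<in> V" "V = car W \<Longrightarrow> n = 0"
proof (cases "V = car W")
  case True
  show thesis
  proof (rule that[of "\<lambda>x. 0" 0])
    show "(\<lambda>x. 0) \<in> HomS W (Jmod 0)" using mod_hom_zero[OF nmodD(1)[OF nmod_J]] by (simp add: HomS_def)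
  qed (use True in auto)
next
  case False
  have nV: "nmod \<lparr>car = V, act = act W\<rparr>" by (rule nmod_sub[OF W V])
  obtain F where F: "finite F" "car W \<subseteq> E.span F" using nmod_span[OF W] by blast
  obtain n \<eta> where \<eta>: "\<And>j. j < (n::nat) \<Longrightarrow> lin_on scaleE UNIV (\<eta> j)"
    "\<And>x. x \<in> car W \<Longrightarrow> (\<forall>j<n. \<eta> j x = 0) \<longleftrightarrow> x \<in> V"
    using E.separating_functionals[OF nmod_subspace[OF nV] nmod_subspace[OF W] _ F] V(1) by auto
  have l: "lin_on scaleE (car W) (\<eta> j)" if "j < n" for j by (rule lin_on_subset[OF \<eta>(1)[OF that]]) simp
  have q: "toJ W n \<eta> \<in> HomS W (Jmod n)" by (rule toJ_HomS[OF W l])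
  have "toJ W n \<eta> x = 0 \<longleftrightarrow> x \<in> V" if x: "x \<in> car W" for x
  proof
    assume z: "toJ W n \<eta> x = 0"
    have "\<eta> j x = 0" if j: "j < n" for j
      using form_toJ[where \<eta> = \<eta> and j = j, OF W l[OF j] x j, of 1] one_act[OF nmodD(1)[OF W] x] by (simp add: z fun_apply form_zero)
    then show "x \<in> V" using \<eta>(2)[OF x] by blast
  next
    assume v: "x \<in> V"
    show "toJ W n \<eta> x = 0"
    proof (intro ext)
      fix j show "toJ W n \<eta> x j = 0 j"
      proof (cases "j < n")
        case True
        have "act W c x \<in> V" for c using hmod_act[OF V(2), of x c] v by simp
        then have "\<eta> j (act W c x) = 0" for c using \<eta>(2)[OF hmod_act[OF nmodD(1)[OF W] x]] True by blast
        then show ?thesis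
          by (intro form_ext) (simp add: form_toJ[where \<eta> = \<eta> and j = j, OF W l[OF True] x True] fun_apply form_zero)
      next
        case False then show ?thesis by (simp add: toJ_def rsm_def fun_apply)
      qed
    qed
  qed
  then show thesis using that[OF q] False by blast
qed

lemma free_hom_HomS:
  assumes Q: "nmod Q" and y: "\<And>j. j < n \<Longrightarrow> y j \<in> car Q"
  shows "rsm (std (free n)) (free_hom Q n y) \<in> HomS (std (free n)) Q"
  by (rule rsm_HomS[OF pmod_nmod[OF pmod_free] free_hom[OF nmodD(1)[OF Q] y]])

text \<open>\<open>Hom(H^n, Q)\<close> is \<open>Q^n\<close> and \<open>Hom(Q, (DH)^n)\<close> is
  \<open>(DQ)^n\<close>. The functional, a sum of diagonal entries evaluated at 1, turns composition
  into the evaluation pairing between them.\<close>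

lemma nak_free: "nak (std (free n)) (Jmod n) (\<lambda>h. \<Sum>j<n. form (h (unit_elt j 1) j) 1)"
  unfolding nak_def
proof (intro conjI allI impI)
  let ?F = "std (free n) :: ('h, 'h elt) hmod" and ?t = "\<lambda>h::'h elt \<Rightarrow> 'h elt. \<Sum>j<n. form (h (unit_elt j 1) j) 1"
  show F: "nmod ?F" by (rule pmod_nmod[OF pmod_free])
  show "nmod (Jmod n)" by (rule nmod_J)
  show "lin_on scaleF (HomS ?F (Jmod n)) ?t"
    by (simp add: lin_on_def fun_apply form_add_left sum.distrib scaleF_def scaleE_def form_scale_left sum_distrib_left)
  have u: "unit_elt j 1 \<in> free n" if "j < n" for j :: nat using that by (rule unit_free)
  {
    fix Q \<phi> assume "nmod Q \<and> lin_on scaleF (HomS ?F Q) \<phi>"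
    then have Q: "nmod Q" and \<phi>: "lin_on scaleF (HomS ?F Q) \<phi>" by auto
    note H = nmodD(1)[OF Q]
    \<comment> \<open>The homomorphism that sends the j-th unit vector to y and the others to
      0.\<close>
    define G where "G j y = rsm ?F (\<lambda>x. act Q (x j) y)" for j y
    have G: "G j y \<in> HomS ?F Q" if "y \<in> car Q" for j y
      unfolding G_def
      by (rule rsm_HomS[OF F]) (simp add: mod_hom_def hmod_act[OF H that] add_act[OF H that] fun_apply smul_def mult_act[OF H that])
    have \<eta>: "lin_on scaleE (car Q) (\<lambda>y. \<phi> (G j y))" for j
      by (rule lin_on_comp[OF \<phi> G])
        (auto simp: G_def rsm_def map_add scaleF_def act_add[OF H] act_scaleE[OF Q] fun_eq_iff[of "\<lambda>x. if _ x then _ x else _ x"])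
    let ?f = "toJ Q n (\<lambda>j y. \<phi> (G j y))"
    show "\<exists>f\<in>HomS Q (Jmod n). \<forall>g\<in>HomS ?F Q. ?t (\<lambda>x. f (g x)) = \<phi> g"
    proof (intro bexI ballI)
      show "?f \<in> HomS Q (Jmod n)" by (rule toJ_HomS[OF Q \<eta>])
      fix g assume g: "g \<in> HomS ?F Q"
      note gh = HomS_hom[OF g]
      have gc: "g x \<in> car Q" for x by (rule HomS_car[OF Q g])
      have geq: "g = (\<Sum>j<n. G j (g (unit_elt j 1)))"
      proof (rule HomS_eqI[OF g F.subspace_sum[OF HomS_subspace[OF Q] G[OF gc]]])
        fix x assume "x \<in> car ?F"
        then have x: "x \<in> free n" by simp
        have "g x = g (\<Sum>j<n. smul (x j) (unit_elt j 1))" using free_expand[OF x] by simp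
        also have "\<dots> = (\<Sum>j<n. g (smul (x j) (unit_elt j 1)))"
          by (rule hom_sum[OF nmodD(1)[OF F] gh]) (use hmod_act[OF nmodD(1)[OF F]] u in auto)
        also have "\<dots> = (\<Sum>j<n. act Q (x j) (g (unit_elt j 1)))"
          by (rule sum.cong) (use hom_act[OF gh] u in auto)
        finally show "g x = (\<Sum>j<n. G j (g (unit_elt j 1))) x"
          using x by (simp add: sum_fun_eval G_def rsm_def)
      qed
      have "?t (\<lambda>x. ?f (g x)) = (\<Sum>j<n. \<phi> (G j (g (unit_elt j 1))))"
        by (rule sum.cong) (simp_all add: form_toJ[where \<eta> = "\<lambda>j y. \<phi> (G j y)", OF Q \<eta> gc] one_act[OF H gc])
      also have "\<dots> = \<phi> g"
        using F.lin_on_sum_subspace[OF HomS_subspace[OF Q] \<phi>, of "{..<n}" "\<lambda>j. G j (g (unit_elt j 1))"] G[OF gc] geq by simp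
      finally show "?t (\<lambda>x. ?f (g x)) = \<phi> g" .
    qed
  next
    fix Q \<psi> assume "nmod Q \<and> lin_on scaleF (HomS Q (Jmod n)) \<psi>"
    then have Q: "nmod Q" and \<psi>: "lin_on scaleF (HomS Q (Jmod n)) \<psi>" by auto
    note H = nmodD(1)[OF Q]
    obtain F where F: "finite F" "car Q \<subseteq> E.span F" using nmod_span[OF Q] by blast
    obtain C where C: "C \<subseteq> car Q" "E.independent C" "car Q \<subseteq> E.span C" using E.maximal_independent_subset by metis
    have fC: "finite C" using E.independent_span_bound[OF F(1) C(2)] C(1) F(2) by blast
    define \<zeta> where "\<zeta> c x = E.representation C x c" for c x
    have \<zeta>: "lin_on scaleE (car Q) (\<zeta> c)" for c
      using C(3) by (auto simp: lin_on_def \<zeta>_def E.representation_add[OF C(2)] E.representation_scale[OF C(2)] subset_iff)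
    have ex: "x = (\<Sum>c\<in>C. scaleE (\<zeta> c x) c)" if "x \<in> car Q" for x
      using E.sum_representation_eq[OF C(2) _ fC, of x] C(3) that by (auto simp: \<zeta>_def)
    \<comment> \<open>With \<open>\<zeta> c\<close> the coordinate functionals of the basis C of Q,
      the maps \<open>f0 j c\<close> span \<open>Hom(Q, (DH)^n)\<close> over k. The values of \<psi>
      on them prescribe the images \<open>y j\<close> of the unit vectors under the map
      sought.\<close>
    define f0 where "f0 j c = toJ Q n (\<lambda>i. if i = j then \<zeta> c else (\<lambda>x. 0))" for j c
    have l0: "lin_on scaleE (car Q) (if i = j then \<zeta> c else (\<lambda>x. 0))" for i j c
      using \<zeta> by (simp add: lin_on_def)
    have f0: "f0 j c \<in> HomS Q (Jmod n)" for j c unfolding f0_def by (rule toJ_HomS[OF Q l0])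
    have f0f: "form (f0 j c x i) 1 = (if i = j then \<zeta> c x else 0)" if "x \<in> car Q" "i < n" for i j c x
      unfolding f0_def form_toJ[where \<eta> = "\<lambda>i. if i = j then \<zeta> c else (\<lambda>x. 0)", OF Q l0 that] by (simp add: one_act[OF H that(1)])
    define y where "y j = (\<Sum>c\<in>C. scaleE (\<psi> (f0 j c)) c)" for j
    have yQ: "y j \<in> car Q" for j
      unfolding y_def by (rule hmod_sum[OF H]) (use C(1) nmod_scale[OF Q] in auto)
    let ?g = "rsm ?F (free_hom Q n y)"
    show "\<exists>g\<in>HomS ?F Q. \<forall>f\<in>HomS Q (Jmod n). ?t (\<lambda>x. f (g x)) = \<psi> f"
    proof (intro bexI ballI)
      show "?g \<in> HomS ?F Q" by (rule free_hom_HomS[OF Q yQ])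
      fix f assume f: "f \<in> HomS Q (Jmod n)"
      define \<eta> where "\<eta> j x = form (f x j) 1" for j x
      have \<eta>: "lin_on scaleE (car Q) (\<eta> j)" for j unfolding \<eta>_def by (rule hom_J_lin[OF Q HomS_hom[OF f]])
      note S = HomS_subspace[OF nmod_J, of Q n]
      have sc: "scaleF (\<eta> j c) (f0 j c) \<in> HomS Q (Jmod n)" for j c by (rule F.subspace_scale[OF S f0])
      have CQ: "c \<in> car Q" if "c \<in> C" for c using that C(1) by blast
      have feq: "f = (\<Sum>j<n. \<Sum>c\<in>C. scaleF (\<eta> j c) (f0 j c))"
      proof (rule hom_J_eqI[OF Q f])
        show "(\<Sum>j<n. \<Sum>c\<in>C. scaleF (\<eta> j c) (f0 j c)) \<in> HomS Q (Jmod n)"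
          by (intro F.subspace_sum[OF S] sc)
        fix x i assume x: "x \<in> car Q" and i: "i < n"
        have "form (f x i) 1 = \<eta> i (\<Sum>c\<in>C. scaleE (\<zeta> c x) c)" using ex[OF x] by (simp add: \<eta>_def)
        also have "\<dots> = (\<Sum>c\<in>C. \<eta> i (scaleE (\<zeta> c x) c))"
          by (rule E.lin_on_sum_subspace[OF nmod_subspace[OF Q] \<eta>]) (rule nmod_scale[OF Q CQ])
        also have "\<dots> = (\<Sum>c\<in>C. \<zeta> c x * \<eta> i c)" by (rule sum.cong) (auto simp: lin_on_scale[OF \<eta> CQ])
        finally have 1: "form (f x i) 1 = (\<Sum>c\<in>C. \<zeta> c x * \<eta> i c)" .
        have "form ((\<Sum>j<n. \<Sum>c\<in>C. scaleF (\<eta> j c) (f0 j c)) x i) 1 = (\<Sum>j<n. \<Sum>c\<in>C. \<eta> j c * form (f0 j c x i) 1)"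
          by (simp add: sum_fun_eval form_sum scaleF_def scaleE_def form_scale_left)
        also have "\<dots> = (\<Sum>j<n. if j = i then \<Sum>c\<in>C. \<eta> i c * \<zeta> c x else 0)"
          by (rule sum.cong) (auto simp: f0f[OF x i])
        also have "\<dots> = (\<Sum>c\<in>C. \<eta> i c * \<zeta> c x)" using i by simp
        finally show "form (f x i) 1 = form ((\<Sum>j<n. \<Sum>c\<in>C. scaleF (\<eta> j c) (f0 j c)) x i) 1"
          using 1 by (simp add: mult.commute)
      qed
      have "\<psi> f = (\<Sum>j<n. \<psi> (\<Sum>c\<in>C. scaleF (\<eta> j c) (f0 j c)))"
        by (subst feq, rule F.lin_on_sum_subspace[OF S \<psi>], rule F.subspace_sum[OF S sc])
      also have "\<dots> = (\<Sum>j<n. \<Sum>c\<in>C. \<eta> j c * \<psi> (f0 j c))"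
        by (rule sum.cong) (simp_all add: F.lin_on_sum_subspace[OF S \<psi> sc] lin_on_scale[OF \<psi> f0])
      also have "\<dots> = (\<Sum>j<n. \<eta> j (y j))"
      proof (rule sum.cong)
        fix j
        have "\<eta> j (y j) = (\<Sum>c\<in>C. \<eta> j (scaleE (\<psi> (f0 j c)) c))" unfolding y_def
          by (rule E.lin_on_sum_subspace[OF nmod_subspace[OF Q] \<eta>]) (rule nmod_scale[OF Q CQ])
        then show "(\<Sum>c\<in>C. \<eta> j c * \<psi> (f0 j c)) = \<eta> j (y j)" by (simp add: lin_on_scale[OF \<eta> CQ] mult.commute)
      qed simp
      also have "\<dots> = ?t (\<lambda>x. f (?g x))"
        by (rule sum.cong) (simp_all add: \<eta>_def rsm_def u free_hom_unit[OF H yQ])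
      finally show "?t (\<lambda>x. f (?g x)) = \<psi> f" by simp
    qed
  }
qed

end

section \<open>Partners of projectives and of injectives; injective resolutions\<close>

context hereditary_algebra
begin

lemma nmod_fin_gen: assumes M: "nmod M" shows "fin_gen M"
proof -
  obtain F where F: "finite F" "car M \<subseteq> E.span F" using nmod_span[OF M] by blast
  obtain B where B: "B \<subseteq> car M" "E.independent B" "car M \<subseteq> E.span B"
    using E.maximal_independent_subset by metis
  have fB: "finite B" using E.independent_span_bound[OF F(1) B(2)] B(1) F(2) by blast
  show ?thesis
  proof (rule fin_genI[where I = B and s = "\<lambda>x. x", OF nmodD(1)[OF M] fB])
    fix x assume "x \<in> car M"
    then obtain u where "x = (\<Sum>b\<in>B. scaleE (u b) b)" using B(3) E.span_finite[OF fB] by auto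
    then have "x = (\<Sum>b\<in>B. act M (kap (u b)) b)" using B(1) nmodD(2)[OF M] by (simp add: subset_iff)
    then show "\<exists>r. x = (\<Sum>b\<in>B. act M (r b) b)" by (rule exI[of _ "\<lambda>b. kap (u b)"])
  qed (use B in auto)
qed

lemma pmod_image:
  assumes P: "pmod (P :: ('h, 'h elt) hmod)" and e: "mod_hom P P e" shows "pmod (std (e ` car P))"
proof (rule pmod_sub[OF P])
  show "e ` car P \<subseteq> car P" using hom_car[OF e] by blast
  show "hmodule (std (e ` car P))"
    using hmodule_image[OF pmodD(1)[OF P] pmodD(1)[OF P] e] pmodD(2)[OF P] by (simp add: std_def)
qed

text \<open>A projective module is a retract of a free one; the Nakayama partner of the corresponding
  idempotent splits off the partner of the projective module.\<close>

lemma nak_projective: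
  assumes P: "pmod (P :: ('h, 'h elt) hmod)"
  obtains I t where "nak P I t"
proof -
  note nP = pmod_nmod[OF P]
  obtain n \<pi> where \<pi>: "mod_hom (std (free n)) P \<pi>" "\<pi> ` free n = car P"
    by (rule free_cover[OF pmodD(1)[OF P] pmod_fin_gen[OF P]]) (rule that)
  let ?F = "std (free n) :: ('h, 'h elt) hmod" and ?J = "Jmod n"
  have F: "nmod ?F" by (rule pmod_nmod[OF pmod_free])
  obtain t where n: "nak ?F ?J t" using nak_free by blast
  note J = nakD(2)[OF n]
  have sub: "x \<in> \<pi> ` car ?F" if "x \<in> car P" for x using that \<pi>(2) by simp
  obtain s where s: "mod_hom P ?F s" "\<And>x. x \<in> car P \<Longrightarrow> \<pi> (s x) = x"
    using projectiveE[OF pmod_projective[OF P] nmodD(1)[OF F] pmodD(1)[OF P] \<pi>(1) mod_hom_id sub] by blast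
  let ?s = "rsm P s" and ?p = "rsm ?F \<pi>"
  have s': "?s \<in> HomS P ?F" and p': "?p \<in> HomS ?F P" by (rule rsm_HomS[OF nP s(1)], rule rsm_HomS[OF F \<pi>(1)])
  have ps: "?p (?s x) = x" if "x \<in> car P" for x using that s hom_car[OF s(1)] by (simp add: rsm_def)
  let ?e = "\<lambda>x. ?s (?p x)"
  have e: "?e \<in> HomS ?F ?F" by (rule HomS_comp[OF nP p' s'])
  have ee: "?e (?e x) = ?e x" for x using ps[OF HomS_car[OF nP p']] by simp
  obtain \<epsilon> where \<epsilon>: "\<epsilon> \<in> HomS ?J ?J" "\<And>g. g \<in> HomS ?F ?J \<Longrightarrow> t (\<lambda>x. \<epsilon> (g x)) = t (\<lambda>x. g (?e x))"
    using nak_rep[OF n J lin_pre[OF nakD(3)[OF n] F e]] by blast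
  have "(\<lambda>x. \<epsilon> (\<epsilon> x)) = \<epsilon>"
  proof (rule nak_unique_right[OF n J HomS_comp[OF J \<epsilon>(1) \<epsilon>(1)] \<epsilon>(1)])
    fix g assume g: "g \<in> HomS ?F ?J"
    have "t (\<lambda>x. \<epsilon> (\<epsilon> (g x))) = t (\<lambda>x. \<epsilon> (g (?e x)))" using \<epsilon>(2)[OF HomS_comp[OF J g \<epsilon>(1)]] .
    also have "\<dots> = t (\<lambda>x. g (?e (?e x)))" using \<epsilon>(2)[OF HomS_comp[OF F e g]] .
    finally show "t (\<lambda>x. \<epsilon> (\<epsilon> (g x))) = t (\<lambda>x. \<epsilon> (g x))" unfolding ee using \<epsilon>(2)[OF g] by simp
  qed
  then have \<epsilon>\<epsilon>: "\<epsilon> (\<epsilon> x) = \<epsilon> x" for x by metis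
  let ?I = "\<lparr>car = \<epsilon> ` car ?J, act = act ?J\<rparr>"
  note \<epsilon>h = HomS_hom[OF \<epsilon>(1)]
  have I: "nmod ?I" by (rule nmod_image[OF J J \<epsilon>h])
  have i: "rsm ?I (\<lambda>x. x) \<in> HomS ?I ?J"
    by (rule rsm_HomS[OF I]) (use hom_car[OF \<epsilon>h] in \<open>auto simp: mod_hom_def\<close>)
  have r: "\<epsilon> \<in> HomS ?J ?I"
    using \<epsilon>(1) unfolding HomS_def mod_hom_def by auto
  have "nak P ?I (\<lambda>h. t (\<lambda>x. rsm ?I (\<lambda>x. x) (h (?p x))))"
  proof (rule nak_retract[OF n nP I s' p' ps i r])
    show "\<epsilon> (rsm ?I (\<lambda>x. x) x) = x" if "x \<in> car ?I" for x using that \<epsilon>\<epsilon> by (auto simp: rsm_def)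
    fix f assume f: "f \<in> HomS ?F ?J"
    have "rsm ?I (\<lambda>x. x) (\<epsilon> (f x)) = \<epsilon> (f x)" for x using HomS_car[OF J f] by (auto simp: rsm_def)
    then show "t (\<lambda>x. rsm ?I (\<lambda>x. x) (\<epsilon> (f x))) = t (\<lambda>x. f (?s (?p x)))" using \<epsilon>(2)[OF f] by simp
  qed
  then show thesis by (rule that)
qed

text \<open>The mirror image of the projective case: the retraction onto C gives an idempotent of
  \<open>(DH)^m\<close>, and its adjoint e is an idempotent of the free module. The image of e is
  the projective partner.\<close>

lemma nak_injective:
  assumes C: "C \<subseteq> free m" and I: "nmod \<lparr>car = C, act = act (Jmod m)\<rparr>"
    and \<rho>: "mod_hom (Jmod m) \<lparr>car = C, act = act (Jmod m)\<rparr> \<rho>" "\<And>x. x \<in> C \<Longrightarrow> \<rho> x = x"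
  obtains P t where "pmod P" "nak P \<lparr>car = C, act = act (Jmod m)\<rparr> t"
proof -
  let ?I = "\<lparr>car = C, act = act (Jmod m)\<rparr>"
  let ?F = "std (free m) :: ('h, 'h elt) hmod" and ?J = "Jmod m"
  have F: "nmod ?F" by (rule pmod_nmod[OF pmod_free])
  obtain t where n: "nak ?F ?J t" using nak_free by blast
  note J = nakD(2)[OF n]
  let ?i = "rsm ?I (\<lambda>x. x)" and ?r = "rsm ?J \<rho>"
  have i: "?i \<in> HomS ?I ?J" by (rule rsm_HomS[OF I]) (use C in \<open>auto simp: mod_hom_def\<close>)
  have r: "?r \<in> HomS ?J ?I" by (rule rsm_HomS[OF J \<rho>(1)])
  have ri: "?r (?i x) = x" if "x \<in> car ?I" for x using that C \<rho>(2) by (auto simp: rsm_def)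
  let ?\<epsilon> = "\<lambda>x. ?i (?r x)"
  have \<epsilon>: "?\<epsilon> \<in> HomS ?J ?J" by (rule HomS_comp[OF I r i])
  have \<epsilon>\<epsilon>: "?\<epsilon> (?\<epsilon> x) = ?\<epsilon> x" for x using ri[OF HomS_car[OF I r]] by simp
  obtain e where e: "e \<in> HomS ?F ?F" "\<And>f. f \<in> HomS ?F ?J \<Longrightarrow> t (\<lambda>x. f (e x)) = t (\<lambda>x. ?\<epsilon> (f x))"
    using nak_corep[OF n F lin_post[OF nakD(3)[OF n] J J \<epsilon>]] by blast
  have "(\<lambda>x. e (e x)) = e"
  proof (rule nak_unique_left[OF n F HomS_comp[OF F e(1) e(1)] e(1)])
    fix f assume f: "f \<in> HomS ?F ?J"
    have "t (\<lambda>x. f (e (e x))) = t (\<lambda>x. ?\<epsilon> (f (e x)))" using e(2)[OF HomS_comp[OF F e(1) f]] .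
    also have "\<dots> = t (\<lambda>x. ?\<epsilon> (?\<epsilon> (f x)))" using e(2)[OF HomS_comp[OF J f \<epsilon>]] .
    finally show "t (\<lambda>x. f (e (e x))) = t (\<lambda>x. f (e x))" unfolding \<epsilon>\<epsilon> using e(2)[OF f] by simp
  qed
  then have ee: "e (e x) = e x" for x by metis
  note eh = HomS_hom[OF e(1)]
  let ?P = "std (e ` free m)"
  have P: "pmod ?P" using pmod_image[OF pmod_free eh] by simp
  note nP = pmod_nmod[OF P]
  have s: "rsm ?P (\<lambda>x. x) \<in> HomS ?P ?F"
    by (rule rsm_HomS[OF nP]) (use hom_car[OF eh] in \<open>auto simp: mod_hom_def\<close>)
  have p: "e \<in> HomS ?F ?P" using e(1) unfolding HomS_def mod_hom_def by auto
  have "nak ?P ?I (\<lambda>h. t (\<lambda>x. ?i (h (e x))))"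
  proof (rule nak_retract[OF n nP I s p _ i r ri])
    show "e (rsm ?P (\<lambda>x. x) x) = x" if "x \<in> car ?P" for x using that ee by (auto simp: rsm_def)
    fix f assume f: "f \<in> HomS ?F ?J"
    have "rsm ?P (\<lambda>x. x) (e x) = e x" for x
      using HomS_out[OF e(1), of x] by (cases "x \<in> free m") (auto simp: rsm_def)
    then show "t (\<lambda>x. ?i (?r (f x))) = t (\<lambda>x. f (rsm ?P (\<lambda>x. x) (e x)))" using e(2)[OF f] by simp
  qed
  then show thesis by (rule that[OF P])
qed

text \<open>Over a hereditary algebra quotients of injectives are injective: a map from a submodule
  \<open>K\<close> of a free module \<open>F\<close> to the quotient lifts, as \<open>K\<close> is projective, and then extends to \<open>F\<close>.\<close>

lemma quotient_retract:
  assumes G: "nmod G" and q: "mod_hom G (Jmod m) q"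
    and ext: "\<And>A n f. A \<subseteq> free n \<Longrightarrow> hmodule (std A) \<Longrightarrow> mod_hom (std A) G f \<Longrightarrow>
       \<exists>g. mod_hom (std (free n)) G g \<and> (\<forall>x\<in>A. g x = f x)"
  obtains \<rho> where "mod_hom (Jmod m) \<lparr>car = q ` car G, act = act (Jmod m)\<rparr> \<rho>" "\<And>x. x \<in> q ` car G \<Longrightarrow> \<rho> x = x"
proof -
  let ?J = "Jmod m" and ?C = "q ` car G"
  let ?I = "\<lparr>car = ?C, act = act ?J\<rparr>"
  note J = nmod_J[of m]
  note hJ = nmodD(1)[OF J] and hG = nmodD(1)[OF G]
  have hI: "hmodule ?I" by (rule hmodule_image[OF hG hJ q])
  obtain n \<sigma> where \<sigma>: "mod_hom (std (free n)) ?J \<sigma>" "\<sigma> ` free n = car ?J"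
    by (rule free_cover[OF hJ nmod_fin_gen[OF J]]) (rule that)
  let ?F = "std (free n) :: ('h, 'h elt) hmod"
  have hF: "hmodule ?F" by (rule hmodule_free)
  \<comment> \<open>The preimage of the quotient in a free cover of J. The map \<sigma> from K to
    the quotient is the one that is lifted to G and then extended to all of F.\<close>
  let ?K = "{x \<in> free n. \<sigma> x \<in> ?C}"
  have hK: "hmodule (std ?K)"
  proof (rule hmodule_smulI)
    show "0 \<in> car (std ?K)" using hmod_zero[OF hF] hom_zero[OF hF \<sigma>(1)] hmod_zero[OF hI] by simp
    show "x - y \<in> car (std ?K)" if "x \<in> car (std ?K)" "y \<in> car (std ?K)" for x y
      using that hmod_diff[OF hF, of x y] hom_diff[OF hF \<sigma>(1), of x y] hmod_diff[OF hI, of "\<sigma> x" "\<sigma> y"] by simp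
    show "smul a x \<in> car (std ?K)" if "x \<in> car (std ?K)" for a x
      using that hmod_act[OF hF, of x a] hom_act[OF \<sigma>(1), of x a] hmod_act[OF hI, of "\<sigma> x" a] by simp
  qed simp
  have K: "pmod (std ?K)" by (rule pmod_sub[OF pmod_free[of n] _ hK]) auto
  have \<sigma>K: "mod_hom (std ?K) ?J \<sigma>" using \<sigma>(1) unfolding mod_hom_def by auto
  have sub: "\<sigma> x \<in> ?C" if "x \<in> car (std ?K)" for x using that by simp
  obtain k where k: "mod_hom (std ?K) G k" "\<And>x. x \<in> ?K \<Longrightarrow> q (k x) = \<sigma> x"
    using projectiveE[OF pmod_projective[OF K] hG hJ q \<sigma>K sub] unfolding car_std by blast
  obtain k' where k': "mod_hom ?F G k'" "\<And>x. x \<in> ?K \<Longrightarrow> k' x = k x"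
    using ext[of ?K n k, OF _ hK k(1)] by blast
  define r where "r x = q (k' x)" for x
  have r: "mod_hom ?F ?I r"
    using mod_hom_comp[OF k'(1) q] hom_car[OF k'(1)] unfolding mod_hom_def r_def by simp
  have rK: "r x = \<sigma> x" if "x \<in> ?K" for x using that k(2) k'(2) by (simp add: r_def)
  \<comment> \<open>The kernel of \<sigma> lies in K, where r agrees with \<sigma>. Hence r kills it
    and descends to J.\<close>
  have rw: "r x = r x'" if "x \<in> free n" "x' \<in> free n" "\<sigma> x = \<sigma> x'" for x x'
  proof -
    have "\<sigma> (x - x') = 0" using hom_diff[OF hF \<sigma>(1), of x x'] that by simp
    moreover have "x - x' \<in> ?K" using hmod_diff[OF hF, of x x'] that hmod_zero[OF hI] \<open>\<sigma> (x - x') = 0\<close> by simp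
    ultimately have "r (x - x') = 0" using rK by simp
    then show ?thesis using hom_diff[OF hF r, of x x'] that by simp
  qed
  define u where "u y = (SOME x. x \<in> free n \<and> \<sigma> x = y)" for y
  have u: "u y \<in> free n" "\<sigma> (u y) = y" if "y \<in> car ?J" for y
  proof -
    have "\<exists>x. x \<in> free n \<and> \<sigma> x = y" using that \<sigma>(2) by (metis imageE)
    then have "u y \<in> free n \<and> \<sigma> (u y) = y" unfolding u_def by (rule someI_ex)
    then show "u y \<in> free n" "\<sigma> (u y) = y" by auto
  qed
  show thesis
  proof (rule that[of "\<lambda>y. r (u y)"])
    show "mod_hom ?J ?I (\<lambda>y. r (u y))"
      unfolding mod_hom_def
    proof (intro conjI ballI allI)
      fix x assume x: "x \<in> car ?J"
      show "r (u x) \<in> car ?I" using hom_car[OF r, of "u x"] u[OF x] by simp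
      show "r (u (act ?J a x)) = act ?I a (r (u x))" for a
        using rw[of "u (act ?J a x)" "smul a (u x)"] u[OF x] u[OF hmod_act[OF hJ x]] hmod_act[OF hF, of "u x" a]
          hom_act[OF \<sigma>(1), of "u x" a] hom_act[OF r, of "u x" a] by simp
      fix y assume y: "y \<in> car ?J"
      show "r (u (x + y)) = r (u x) + r (u y)"
        using rw[of "u (x + y)" "u x + u y"] u[OF x] u[OF y] u[OF hmod_add[OF hJ x y]] hmod_add[OF hF, of "u x" "u y"]
          hom_add[OF \<sigma>(1), of "u x" "u y"] hom_add[OF r, of "u x" "u y"] by simp
    qed
    show "r (u x) = x" if "x \<in> ?C" for x
    proof -
      have "x \<in> car ?J" using that hom_car[OF q] by blast
      then show ?thesis using rK[of "u x"] u[of x] that by simp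
    qed
  qed
qed

definition ncplx :: "'h cplx \<Rightarrow> bool" where
  "ncplx X \<longleftrightarrow> bcplx X \<and> (\<forall>i. nmod (ob X i))"

lemma ncplxI:
  assumes "\<And>i. nmod (ob P i)" "\<And>i. mod_hom (ob P i) (ob P (i + 1)) (dif P i)"
    "\<And>i x. x \<in> car (ob P i) \<Longrightarrow> dif P (i + 1) (dif P i x) = 0" "finite {i. car (ob P i) \<noteq> {0}}"
  shows "ncplx P"
  unfolding ncplx_def bcplx_def using assms nmod_fin_gen by (auto simp: nmodD)

lemma pcplx_ncplx: "pcplx P \<Longrightarrow> ncplx P"
  unfolding pcplx_def ncplx_def using pmod_nmod by blast

text \<open>Dual to \<open>resolution\<close>: Q embeds into a complex G of injectives, and its
  cokernel C consists of injectives too because the algebra is hereditary. The cone of G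
  \<rightarrow> C is then a model of Q[1], which explains the shift.\<close>

lemma injective_resolution:
  assumes Q: "pcplx (Q :: 'h cplx)"
  obtains I where "ncplx I" "d_iso (shift Q) I" "\<And>i. \<exists>P t. pmod P \<and> nak P (ob I i) t"
proof -
  note bQ = pcplx_bcplx[OF Q]
  have nQ: "nmod (ob Q i)" for i by (rule pmod_nmod[OF pcplx_pmod[OF Q]])
  note HQ = bcplx_hmod[OF bQ] and dQ = bcplx_dif[OF bQ]
  have "\<exists>n \<iota>. \<iota> \<in> HomS (ob Q i) (Jmod n) \<and> (\<forall>x\<in>car (ob Q i). \<iota> x = 0 \<longrightarrow> x = 0) \<and> (car (ob Q i) = {0} \<longrightarrow> n = 0)" for i
  proof -
    have "hmodule \<lparr>car = {0}, act = act (ob Q i)\<rparr>"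
      by (rule hmodule_sub[OF HQ]) (auto simp: act_zero[OF HQ] hmod_zero[OF HQ])
    moreover have "{0} \<subseteq> car (ob Q i)" using hmod_zero[OF HQ[of i]] by blast
    ultimately obtain n \<iota> where "\<iota> \<in> HomS (ob Q i) (Jmod n)" "\<And>x. x \<in> car (ob Q i) \<Longrightarrow> \<iota> x = 0 \<longleftrightarrow> x \<in> {0}"
      "{0} = car (ob Q i) \<Longrightarrow> n = 0"
      using J_quotient[OF nQ[of i]] by metis
    then show ?thesis by (intro exI[of _ n] exI[of _ \<iota>]) auto
  qed
  then have "\<exists>n. \<forall>i. \<exists>\<iota>. \<iota> \<in> HomS (ob Q i) (Jmod (n i)) \<and> (\<forall>x\<in>car (ob Q i). \<iota> x = 0 \<longrightarrow> x = 0) \<and> (car (ob Q i) = {0} \<longrightarrow> n i = 0)"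
    by (intro choice) auto
  then obtain n where "\<forall>i. \<exists>\<iota>. \<iota> \<in> HomS (ob Q i) (Jmod (n i)) \<and> (\<forall>x\<in>car (ob Q i). \<iota> x = 0 \<longrightarrow> x = 0) \<and> (car (ob Q i) = {0} \<longrightarrow> n i = 0)" ..
  from choice[OF this] obtain \<iota> where \<iota>: "\<And>i. \<iota> i \<in> HomS (ob Q i) (Jmod (n i))"
    "\<And>i x. x \<in> car (ob Q i) \<Longrightarrow> \<iota> i x = 0 \<Longrightarrow> x = 0" and n: "\<And>i. car (ob Q i) = {0} \<Longrightarrow> n i = 0"
    by blast
  note \<iota>h = HomS_hom[OF \<iota>(1)]
  \<comment> \<open>Contractible, with \<open>Jmod (n i)\<close> in degrees i - 1 and i. The
    degreewise embeddings \<iota> together with their composites with the differential of Q form a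
    chain map into it.\<close>
  define G where "G = \<lparr>ob = (\<lambda>i. mod_sum (Jmod (n i)) (Jmod (n (i + 1)))), dif = (\<lambda>(i::int) z. pr (rgt z) 0)\<rparr>"
  have obG: "ob G i = mod_sum (Jmod (n i)) (Jmod (n (i + 1)))" and dG: "dif G i z = pr (rgt z) 0" for i z by (simp_all add: G_def)
  have nG: "nmod (ob G i)" for i unfolding obG by (rule nmod_mod_sum[OF nmod_J nmod_J])
  have G: "ncplx G"
  proof (rule ncplxI[OF nG])
    show "mod_hom (ob G i) (ob G (i + 1)) (dif G i)" for i
      unfolding obG mod_hom_pr_iff dG lft_pr rgt_pr
      by (intro conjI mod_hom_rgt[OF mod_hom_id] mod_hom_zero[OF nmodD(1)[OF nmod_J]])
    show "dif G (i + 1) (dif G i x) = 0" for i x by (simp add: dG)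
    have f1: "finite {i. car (Jmod (n i)) \<noteq> {0}}"
      by (rule finite_subset[OF _ bcplx_fin[OF bQ]]) (use n in \<open>auto simp: free_0\<close>)
    then have f2: "finite {i. car (Jmod (n (i + 1))) \<noteq> {0}}"
      using finite_vimageI[OF f1, of "\<lambda>i. i + 1"] by (simp add: vimage_def inj_def)
    show "finite {i. car (ob G i) \<noteq> {0}}" unfolding obG by (rule finite_support_mod_sum[OF f1 f2])
  qed
  then have bG: "bcplx G" by (simp add: ncplx_def)
  note HG = bcplx_hmod[OF bG]
  define j where "j i x = pr (\<iota> i x) (\<iota> (i + 1) (dif Q i x))" for i x
  have \<iota>0: "\<iota> i 0 = 0" for i by (rule hom_zero[OF HQ \<iota>h])
  have j: "chain_map Q G j"
    unfolding chain_map_def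
  proof (intro conjI allI ballI)
    fix i show "mod_hom (ob Q i) (ob G i) (j i)"
      unfolding obG mod_hom_pr_iff j_def lft_pr rgt_pr by (intro conjI \<iota>h mod_hom_comp[OF dQ \<iota>h])
    fix x assume x: "x \<in> car (ob Q i)"
    then show "j (i + 1) (dif Q i x) = dif G i (j i x)"
      using bcplx_dd[OF bQ x] by (simp only: j_def dG rgt_pr \<iota>0)
  qed
  note jh = chain_hom[OF j]
  have j0: "x = 0" if "x \<in> car (ob Q i)" "j i x = 0" for x i
    using that \<iota>(2) by (simp add: j_def)
  have "\<exists>m q. q \<in> HomS (ob G i) (Jmod m) \<and> (\<forall>z\<in>car (ob G i). q z = 0 \<longleftrightarrow> z \<in> j i ` car (ob Q i))" for i
  proof -
    have "j i ` car (ob Q i) \<subseteq> car (ob G i)" using hom_car[OF jh[of i]] by blast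
    then show ?thesis by (rule J_quotient[OF nG[of i] _ hmodule_image[OF HQ HG jh]]) blast
  qed
  then have "\<exists>m. \<forall>i. \<exists>q. q \<in> HomS (ob G i) (Jmod (m i)) \<and> (\<forall>z\<in>car (ob G i). q z = 0 \<longleftrightarrow> z \<in> j i ` car (ob Q i))"
    by (intro choice) auto
  then obtain m where "\<forall>i. \<exists>q. q \<in> HomS (ob G i) (Jmod (m i)) \<and> (\<forall>z\<in>car (ob G i). q z = 0 \<longleftrightarrow> z \<in> j i ` car (ob Q i))" ..
  from choice[OF this] obtain q where q: "\<And>i. q i \<in> HomS (ob G i) (Jmod (m i))"
    "\<And>i z. z \<in> car (ob G i) \<Longrightarrow> q i z = 0 \<longleftrightarrow> z \<in> j i ` car (ob Q i)" by blast
  note qh = HomS_hom[OF q(1)]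
  have qeq: "\<exists>x\<in>car (ob Q i). z - z' = j i x" if "z \<in> car (ob G i)" "z' \<in> car (ob G i)" "q i z = q i z'" for i z z'
    using that q(2)[OF hmod_diff[OF HG that(1,2)]] hom_diff[OF HG qh that(1,2)] by auto
  have qj: "q i (j i x) = 0" if "x \<in> car (ob Q i)" for i x
    using q(2)[OF hom_car[OF jh that]] that by blast
  \<comment> \<open>The cokernel is realized as the image of q in \<open>(DH)^m\<close>, not as a
    set of cosets, so that its elements have type \<open>'h elt\<close>.\<close>
  define obC where "obC i = \<lparr>car = q i ` car (ob G i), act = act (Jmod (m i))\<rparr>" for i
  define w where "w i c = (SOME z. z \<in> car (ob G i) \<and> q i z = c)" for i c
  have w: "w i c \<in> car (ob G i)" "q i (w i c) = c" if "c \<in> q i ` car (ob G i)" for i c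
  proof -
    have "\<exists>z. z \<in> car (ob G i) \<and> q i z = c" using that by (metis imageE)
    then have "w i c \<in> car (ob G i) \<and> q i (w i c) = c" unfolding w_def by (rule someI_ex)
    then show "w i c \<in> car (ob G i)" "q i (w i c) = c" by auto
  qed
  define C where "C = \<lparr>ob = obC, dif = (\<lambda>i c. q (i + 1) (dif G i (w i c)))\<rparr>"
  have obC: "ob C i = obC i" "car (obC i) = q i ` car (ob G i)" and dC: "dif C i c = q (i + 1) (dif G i (w i c))" for i c
    by (simp_all add: C_def obC_def)
  have nC: "nmod (obC i)" for i unfolding obC_def by (rule nmod_image[OF nG nmod_J qh])
  have qC: "mod_hom (ob G i) (obC i) (q i)" for i
    using qh[of i] unfolding mod_hom_def obC_def by simp
  have dCq: "dif C i (q i z) = q (i + 1) (dif G i z)" if z: "z \<in> car (ob G i)" for i z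
  proof -
    have c: "q i z \<in> q i ` car (ob G i)" using z by blast
    note w' = w[OF c]
    obtain x where x: "x \<in> car (ob Q i)" "w i (q i z) - z = j i x" using qeq[OF w'(1) z w'(2)] by blast
    have "q (i + 1) (dif G i (w i (q i z))) - q (i + 1) (dif G i z) = q (i + 1) (dif G i (j i x))"
      using hom_diff[OF HG qh bcplx_dif_car[OF bG w'(1)] bcplx_dif_car[OF bG z]] hom_diff[OF HG bcplx_dif[OF bG] w'(1) z] x(2) by simp
    also have "\<dots> = 0" using chain_dif[OF j x(1)] qj[OF bcplx_dif_car[OF bQ x(1)]] by simp
    finally show ?thesis by (simp add: dC)
  qed
  have C: "ncplx C"
  proof (rule ncplxI)
    show "nmod (ob C i)" for i unfolding obC by (rule nC)
    fix i
    show "mod_hom (ob C i) (ob C (i + 1)) (dif C i)"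
      unfolding mod_hom_def obC
    proof (intro conjI ballI allI)
      fix c assume "c \<in> q i ` car (ob G i)"
      then obtain z where z: "z \<in> car (ob G i)" "c = q i z" by blast
      note dz = bcplx_dif_car[OF bG z(1)]
      show "dif C i c \<in> q (i + 1) ` car (ob G (i + 1))" unfolding z(2) dCq[OF z(1)] by (rule imageI[OF dz])
      show "dif C i (act (obC i) a c) = act (obC (i + 1)) a (dif C i c)" for a
        using hom_act[OF qC z(1), of a] hom_act[OF bcplx_dif[OF bG] z(1), of a] hom_act[OF qC dz, of a] dCq[OF z(1)]
          dCq[OF hmod_act[OF HG z(1), of a]] z(2) by simp
      fix c' assume "c' \<in> q i ` car (ob G i)"
      then obtain z' where z': "z' \<in> car (ob G i)" "c' = q i z'" by blast
      show "dif C i (c + c') = dif C i c + dif C i c'"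
        using hom_add[OF qC z(1) z'(1)] hom_add[OF bcplx_dif[OF bG] z(1) z'(1)] hom_add[OF qC dz bcplx_dif_car[OF bG z'(1)]] dCq[OF z(1)] dCq[OF z'(1)]
          dCq[OF hmod_add[OF HG z(1) z'(1)]] z(2) z'(2) by simp
    qed
    show "dif C (i + 1) (dif C i c) = 0" if c: "c \<in> car (ob C i)" for c
    proof -
      obtain z where z: "z \<in> car (ob G i)" "c = q i z" using c unfolding obC by blast
      show ?thesis
        unfolding z(2) dCq[OF z(1)] dCq[OF bcplx_dif_car[OF bG z(1)]] bcplx_dd[OF bG z(1)] by (rule hom_zero[OF HG qC])
    qed
  next
    show "finite {i. car (ob C i) \<noteq> {0}}"
    proof (rule finite_subset[OF _ bcplx_fin[OF bG]], intro subsetI CollectI notI)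
      fix i assume "i \<in> {i. car (ob C i) \<noteq> {0}}" "car (ob G i) = {0}"
      then show False using hom_zero[OF HG qC] by (auto simp: obC)
    qed
  qed
  then have bC: "bcplx C" by (simp add: ncplx_def)
  note HC = bcplx_hmod[OF bC]
  have qc: "chain_map G C q"
    unfolding chain_map_def obC using qC dCq by simp
  let ?I = "cone G C q"
  have bI: "bcplx ?I" by (rule bcplx_cone[OF bG bC qc])
  have "ncplx ?I" using bI nG nC unfolding ncplx_def by (simp add: nmod_mod_sum obC)
  moreover have "d_iso (shift Q) ?I"
  proof (rule d_iso_quasi_iso[OF bcplx_shift[OF bQ] bI, of "\<lambda>i x. pr (j (i + 1) x) 0"], unfold quasi_iso_def, intro conjI allI ballI impI)
    have C0: "dif C i 0 = 0" for i by (rule hom_zero[OF HC bcplx_dif[OF bC]])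
    have jm: "j i (- x) = - j i x" if "x \<in> car (ob Q i)" for i x by (rule hom_uminus[OF HQ jh that])
    show "chain_map (shift Q) ?I (\<lambda>i x. pr (j (i + 1) x) 0)"
      unfolding chain_map_def
    proof (intro conjI allI ballI)
      fix i show "mod_hom (ob (shift Q) i) (ob ?I i) (\<lambda>x. pr (j (i + 1) x) 0)"
        unfolding ob_cone mod_hom_pr_iff lft_pr rgt_pr ob_shift by (intro conjI jh mod_hom_zero[OF HC])
      fix x assume "x \<in> car (ob (shift Q) i)"
      then have x: "x \<in> car (ob Q (i + 1))" by simp
      show "pr (j (i + 1 + 1) (dif (shift Q) i x)) 0 = dif ?I i (pr (j (i + 1) x) 0)"
        using jm[OF bcplx_dif_car[OF bQ x]] chain_dif[OF j x] qj[OF x] by (simp add: C0)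
    qed
    fix i
    {
      fix x assume x: "x \<in> cycles (shift Q) i" "pr (j (i + 1) x) 0 \<in> boundaries ?I i"
      then obtain u where u: "u \<in> car (ob ?I (i - 1))" "pr (j (i + 1) x) 0 = dif ?I (i - 1) u" unfolding boundaries_def by blast
      have xQ: "x \<in> car (ob Q (i + 1))" using x(1) by (simp add: cycles_def)
      have g: "lft u \<in> car (ob G i)" and "rgt u \<in> car (ob C (i - 1))" using u(1) by simp_all
      then obtain z where z: "z \<in> car (ob G (i - 1))" "rgt u = q (i - 1) z" unfolding obC by blast
      have e1: "j (i + 1) x = - dif G i (lft u)" and e2: "q i (lft u) + q i (dif G (i - 1) z) = 0"
        using u(2) dCq[OF z(1)] z(2) by simp_all
      note dz = bcplx_dif_car'[OF bG z(1)]
      have "q i (lft u + dif G (i - 1) z) = 0" using hom_add[OF qC g dz] e2 by simp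
      then obtain y where y: "y \<in> car (ob Q i)" "lft u + dif G (i - 1) z = j i y"
        using q(2)[OF hmod_add[OF HG g dz]] by blast
      have "j (i + 1) (dif Q i y) = dif G i (lft u)"
        using chain_dif[OF j y(1)] y(2) hom_add[OF bcplx_dif[OF bG] g dz] bcplx_dd'[OF bG z(1)] by simp
      then have "j (i + 1) (x + dif Q i y) = 0"
        using hom_add[OF jh xQ bcplx_dif_car[OF bQ y(1)]] e1 by simp
      then have "x + dif Q i y = 0" by (rule j0[OF hmod_add[OF HQ xQ bcplx_dif_car[OF bQ y(1)]]])
      then have "x = dif (shift Q) (i - 1) y" by (simp add: eq_neg_iff_add_eq_0)
      then show "x \<in> boundaries (shift Q) i" unfolding boundaries_def using y(1) by simp
    }
    fix u assume "u \<in> cycles ?I i"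
    then have u: "lft u \<in> car (ob G (i + 1))" "rgt u \<in> car (ob C i)" "dif G (i + 1) (lft u) = 0"
      "q (i + 1) (lft u) + dif C i (rgt u) = 0"
      by (simp_all add: cycles_def)
    obtain z where z: "z \<in> car (ob G i)" "rgt u = q i z" using u(2) unfolding obC by blast
    note dz = bcplx_dif_car[OF bG z(1)]
    have "q (i + 1) (lft u + dif G i z) = 0" using hom_add[OF qC u(1) dz] u(4) dCq[OF z(1)] z(2) by simp
    then obtain x where x: "x \<in> car (ob Q (i + 1))" "lft u + dif G i z = j (i + 1) x"
      using q(2)[OF hmod_add[OF HG u(1) dz]] by blast
    have "j (i + 1 + 1) (dif Q (i + 1) x) = 0"
      using chain_dif[OF j x(1)] x(2) hom_add[OF bcplx_dif[OF bG] u(1) dz] bcplx_dd[OF bG z(1)] u(3) by simp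
    then have "dif Q (i + 1) x = 0" by (rule j0[OF bcplx_dif_car[OF bQ x(1)]])
    then have "x \<in> cycles (shift Q) i" using x(1) by (simp add: cycles_def)
    moreover have "u - pr (j (i + 1) x) 0 = dif ?I (i - 1) (pr z 0)"
      by (rule elt_eqI) (simp_all add: z(2) x(2)[symmetric] C0)
    then have "u - pr (j (i + 1) x) 0 \<in> boundaries ?I i"
      unfolding boundaries_def using z(1) hmod_zero[OF HC] by (intro image_eqI[of _ _ "pr z 0"]) simp_all
    ultimately show "\<exists>x\<in>cycles (shift Q) i. u - pr (j (i + 1) x) 0 \<in> boundaries ?I i" by blast
  qed
  moreover have "\<exists>P t. pmod P \<and> nak P (ob ?I i) t" for i
  proof -
    \<comment> \<open>G is a sum of two injectives in each degree, so
      \<open>quotient_retract\<close> applies to it and makes C a retract of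
      \<open>(DH)^m\<close>.\<close>
    have ext: "\<exists>g. mod_hom (std (free k)) (ob G i) g \<and> (\<forall>x\<in>A. g x = f x)"
      if A: "A \<subseteq> free k" "hmodule (std A)" and f: "mod_hom (std A) (ob G i) f" for A k f i
    proof -
      have nA: "nmod (std A)" by (rule pmod_nmod[OF pmod_sub[OF pmod_free[of k]]]) (use A in auto)
      have nF: "nmod (std (free k))" by (rule pmod_nmod[OF pmod_free])
      have fl: "mod_hom (std A) (Jmod (n i)) (\<lambda>x. lft (f x))" "mod_hom (std A) (Jmod (n (i + 1))) (\<lambda>x. rgt (f x))"
        using f unfolding obG mod_hom_pr_iff by auto
      obtain g1 where g1: "g1 \<in> HomS (std (free k)) (Jmod (n i))" "\<And>x. x \<in> A \<Longrightarrow> g1 x = lft (f x)"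
        using J_extend[OF nA nF _ _ fl(1)] A(1) by auto
      obtain g2 where g2: "g2 \<in> HomS (std (free k)) (Jmod (n (i + 1)))" "\<And>x. x \<in> A \<Longrightarrow> g2 x = rgt (f x)"
        using J_extend[OF nA nF _ _ fl(2)] A(1) by auto
      show ?thesis
        by (rule exI[of _ "\<lambda>x. pr (g1 x) (g2 x)"])
          (simp add: obG mod_hom_pr_iff HomS_hom[OF g1(1)] HomS_hom[OF g2(1)] g1(2) g2(2))
    qed
    obtain \<rho> where \<rho>: "mod_hom (Jmod (m i)) (obC i) \<rho>" "\<And>x. x \<in> q i ` car (ob G i) \<Longrightarrow> \<rho> x = x"
      using quotient_retract[OF nG qh ext, of i] unfolding obC_def by blast
    have "q i ` car (ob G i) \<subseteq> free (m i)" using hom_car[OF qh[of i]] by auto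
    then obtain PC tC where PC: "pmod PC" "nak PC (obC i) tC"
      using nak_injective[of "q i ` car (ob G i)" "m i" \<rho>] nC[of i] \<rho> unfolding obC_def by blast
    have "nak (mod_sum (std (free (n (i + 1)))) (std (free (n (i + 1 + 1))))) (ob G (i + 1))
       (\<lambda>h. (\<Sum>ja<n (i + 1). form (lft (h (pr (unit_elt ja 1) 0)) ja) 1) + (\<Sum>ja<n (i + 1 + 1). form (rgt (h (pr 0 (unit_elt ja 1))) ja) 1))"
      unfolding obG by (rule nak_sum[OF nak_free nak_free])
    then show ?thesis
      unfolding ob_cone obC using nak_sum[OF _ PC(2)] pmod_mod_sum[OF pmod_mod_sum[OF pmod_free pmod_free] PC(1)] by blast
  qed
  ultimately show thesis by (rule that)
qed

end

lemma null_chain_map: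
  assumes X: "bcplx X" and Y: "bcplx Y" and h: "\<And>i. mod_hom (ob X i) (ob Y (i - 1)) (h i)"
  shows "chain_map X Y (\<lambda>i x. dif Y (i - 1) (h i x) + h (i + 1) (dif X i x))"
  unfolding chain_map_def
proof (intro conjI allI ballI)
  fix i
  have h': "mod_hom (ob X (i + 1)) (ob Y i) (h (i + 1))" using h[of "i + 1"] by simp
  show "mod_hom (ob X i) (ob Y i) (\<lambda>x. dif Y (i - 1) (h i x) + h (i + 1) (dif X i x))"
    by (rule mod_hom_add[OF bcplx_hmod[OF Y] mod_hom_comp[OF h bcplx_dif'[OF Y]] mod_hom_comp[OF bcplx_dif[OF X] h']])
  fix x assume x: "x \<in> car (ob X i)"
  note dx = bcplx_dif_car[OF X x]
  show "dif Y (i + 1 - 1) (h (i + 1) (dif X i x)) + h (i + 1 + 1) (dif X (i + 1) (dif X i x)) =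
    dif Y i (dif Y (i - 1) (h i x) + h (i + 1) (dif X i x))"
    using hom_add[OF bcplx_dif[OF Y] bcplx_dif_car'[OF Y hom_car[OF h x]] hom_car[OF h' dx]]
      bcplx_dd'[OF Y hom_car[OF h x]] bcplx_dd[OF X x] hom_zero[OF bcplx_hmod[OF X] h[of "i + 1 + 1"]] by simp
qed

section \<open>Nakayama partners of complexes and the supertrace pairing\<close>

context hereditary_algebra
begin

definition sg :: "int \<Rightarrow> 'k" where "sg i = (if even i then 1 else - 1)"

definition dh :: "'h cplx \<Rightarrow> int \<Rightarrow> 'h elt \<Rightarrow> 'h elt" where "dh X i = rsm (ob X i) (dif X i)"

definition single :: "int \<Rightarrow> ('h elt \<Rightarrow> 'h elt) \<Rightarrow> 'h cmap" where
  "single i g = (\<lambda>k. if k = i then g else (\<lambda>x. 0))"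

lemma sg_Suc: "sg (i + 1) = - sg i" and sg_sg: "sg i * sg i = 1"
  by (auto simp: sg_def)

lemma ncplxD: "ncplx X \<Longrightarrow> bcplx X" "ncplx X \<Longrightarrow> nmod (ob X i)"
  by (auto simp: ncplx_def)

lemma dh_HomS: "ncplx X \<Longrightarrow> dh X i \<in> HomS (ob X i) (ob X (i + 1))"
  unfolding dh_def by (rule rsm_HomS[OF ncplxD(2) bcplx_dif[OF ncplxD(1)]])

lemma dh_eq: "x \<in> car (ob X i) \<Longrightarrow> dh X i x = dif X i x"
  by (simp add: dh_def rsm_def)

lemma dh_dh: assumes X: "ncplx X" shows "dh X (i + 1) (dh X i x) = 0"
proof (cases "x \<in> car (ob X i)")
  case True
  then show ?thesis using bcplx_dd[OF ncplxD(1)[OF X] True] bcplx_dif_car[OF ncplxD(1)[OF X] True] by (simp add: dh_eq)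
next
  case False
  then show ?thesis using HomS_zero[OF ncplxD(2)[OF X] dh_HomS[OF X]] by (simp add: dh_def rsm_def)
qed

lemma Ch_HomS: "f \<in> Ch X Y \<Longrightarrow> f i \<in> HomS (ob X i) (ob Y i)"
  unfolding Ch_def HomS_def using chain_hom by auto

lemma ChI:
  assumes X: "ncplx X" and Y: "ncplx Y" and f: "\<And>i. f i \<in> HomS (ob X i) (ob Y i)"
    and c: "\<And>i. (\<lambda>x. f (i + 1) (dh X i x)) = (\<lambda>x. dh Y i (f i x))"
  shows "f \<in> Ch X Y"
proof -
  have "f (i + 1) (dif X i x) = dif Y i (f i x)" if x: "x \<in> car (ob X i)" for i x
    using fun_cong[OF c, of i x] x HomS_car[OF ncplxD(2)[OF Y] f] by (simp add: dh_eq)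
  then show ?thesis using HomS_hom[OF f] HomS_out[OF f] unfolding Ch_def chain_map_def by auto
qed

lemma Ch_nsubspace: assumes Y: "ncplx Y" and X: "bcplx X" shows "C.subspace (Ch X Y)"
proof (rule C.subspaceI)
  note bY = ncplxD(1)[OF Y]
  show "0 \<in> Ch X Y" using chain_map_zero[OF X bY] by (simp add: Ch_def cmap_zero)
  show "f + g \<in> Ch X Y" if "f \<in> Ch X Y" "g \<in> Ch X Y" for f g
    using that chain_map_add[OF bY, of X f g] by (simp add: Ch_def cmap_add)
  fix c f assume f: "f \<in> Ch X Y"
  have "scaleF c (f i) \<in> HomS (ob X i) (ob Y i)" for i
    by (rule F.subspace_scale[OF HomS_subspace[OF ncplxD(2)[OF Y]] Ch_HomS[OF f]])
  moreover have "scaleE c (f (i + 1) (dif X i x)) = dif Y i (scaleE c (f i x))" if "x \<in> car (ob X i)" for i x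
    using chain_dif[OF Ch_chain[OF f] that] chain_car[OF Ch_chain[OF f] that]
      hom_scaleE[OF ncplxD(2)[OF Y] ncplxD(2)[OF Y] bcplx_dif[OF bY]] by simp
  ultimately show "scaleC c f \<in> Ch X Y" unfolding Ch_def chain_map_def scaleC_def HomS_def scaleF_def by auto
qed

text \<open>The null-homotopic map whose homotopy has a single component h. Testing a functional on
  such maps yields the commutation with differentials of whatever represents it.\<close>

lemma single_htpy:
  assumes X: "ncplx X" and Y: "ncplx Y" and h: "h \<in> HomS (ob X (i + 1)) (ob Y i)"
  shows "single (i + 1) (\<lambda>x. dh Y i (h x)) + single i (\<lambda>x. h (dh X i x)) \<in> Null X Y" (is "?n \<in> _")
proof -
  note bX = ncplxD(1)[OF X] and bY = ncplxD(1)[OF Y] and nX = ncplxD(2)[OF X] and nY = ncplxD(2)[OF Y]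
  let ?H = "single (i + 1) h"
  have H: "mod_hom (ob X k) (ob Y (k - 1)) (?H k)" for k
    using HomS_hom[OF h] by (simp add: single_def mod_hom_zero bcplx_hmod[OF bY])
  have d0: "dif Y k 0 = 0" for k by (rule hom_zero[OF bcplx_hmod[OF bY] bcplx_dif[OF bY]])
  have eq: "?n k x = dif Y (k - 1) (?H k x) + ?H (k + 1) (dif X k x)" if x: "x \<in> car (ob X k)" for k x
  proof -
    consider "k = i + 1" | "k = i" | "k \<noteq> i + 1" "k \<noteq> i" by blast
    then show ?thesis
      by cases (use x HomS_car[OF nY h] in \<open>simp_all add: single_def cmap_add d0 dh_eq\<close>)
  qed
  have "chain_map X Y ?n"
    by (rule chain_map_cong[OF bX null_chain_map[OF bX bY H]]) (simp add: eq)
  moreover have "?n k x = 0" if "x \<notin> car (ob X k)" for k x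
  proof -
    have "dh Y i 0 = 0" "h 0 = 0" by (rule HomS_zero[OF nY dh_HomS[OF Y]], rule HomS_zero[OF nX h])
    then show ?thesis using that HomS_out[OF h, of x] HomS_out[OF dh_HomS[OF X], of x i] by (auto simp: single_def cmap_add)
  qed
  moreover have "null_htpy X Y ?n" by (rule null_htpyI[where h = ?H, OF H eq])
  ultimately show ?thesis by (simp add: Null_def Ch_def)
qed

lemma single_lin:
  assumes "lin_on scaleC UNIV \<Phi>" shows "lin_on scaleF V (\<lambda>g. \<Phi> (single i g))"
  by (rule lin_on_comp[OF assms]) (auto simp: single_def map_add cmap_add scaleC_def scaleF_def fun_eq_iff)

lemma trivial_HomS: "car M = {0} \<Longrightarrow> nmod M \<Longrightarrow> f \<in> HomS M N \<Longrightarrow> f = (\<lambda>x. 0)"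
  using HomS_zero HomS_out by (metis (no_types, lifting) ext singletonD)

lemma Ch_decomp:
  assumes X: "ncplx X" and S: "finite S" "\<And>i. car (ob X i) \<noteq> {0} \<Longrightarrow> i \<in> S" and f: "f \<in> Ch X Y"
  shows "f = (\<Sum>i\<in>S. single i (f i))"
proof
  fix k
  have "(\<Sum>i\<in>S. single i (f i)) k = (\<Sum>i\<in>S. if k = i then f k else 0)"
    by (subst sum_fun_eval) (rule sum.cong, auto simp: single_def map_zero)
  also have "\<dots> = f k"
  proof (cases "k \<in> S")
    case True then show ?thesis using S(1) by simp
  next
    case False
    then have "f k = (\<lambda>x. 0)" using trivial_HomS[OF _ ncplxD(2)[OF X] Ch_HomS[OF f]] S(2) by blast
    then show ?thesis using False S(1) by (simp add: map_zero)
  qed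
  finally show "f k = (\<Sum>i\<in>S. single i (f i)) k" by simp
qed

text \<open>A complex \<open>P\<close> of projectives and its Nakayama partner \<open>I\<close>; the differentials are adjoint.\<close>

definition nakc :: "'h cplx \<Rightarrow> 'h cplx \<Rightarrow> (int \<Rightarrow> ('h elt \<Rightarrow> 'h elt) \<Rightarrow> 'k) \<Rightarrow> bool" where
  "nakc P I t \<longleftrightarrow> pcplx P \<and> ncplx I \<and> (\<forall>i. nak (ob P i) (ob I i) (t i)) \<and>
     (\<forall>i. \<forall>g\<in>HomS (ob P (i + 1)) (ob I i). t i (\<lambda>x. g (dh P i x)) = t (i + 1) (\<lambda>x. dh I i (g x)))"

definition supp :: "'h cplx \<Rightarrow> int set" where "supp X = {i. car (ob X i) \<noteq> {0}}"

text \<open>The supertrace; its signs make null-homotopic maps traceless.\<close>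

definition strace :: "'h cplx \<Rightarrow> (int \<Rightarrow> ('h elt \<Rightarrow> 'h elt) \<Rightarrow> 'k) \<Rightarrow> 'h cmap \<Rightarrow> 'k" where
  "strace P t h = (\<Sum>i\<in>supp P. sg i * t i (h i))"

context
  fixes P I :: "'h cplx" and t
  assumes nc: "nakc P I t"
begin

lemma nP: "ncplx P" and nI: "ncplx I" and pP: "pcplx P" and nk: "nak (ob P i) (ob I i) (t i)"
  and compat: "g \<in> HomS (ob P (i + 1)) (ob I i) \<Longrightarrow> t i (\<lambda>x. g (dh P i x)) = t (i + 1) (\<lambda>x. dh I i (g x))"
  using nc pcplx_ncplx unfolding nakc_def by auto

lemma t_zero: "t i (\<lambda>x. 0) = 0"
  using lin_on_zero[OF nakD(3)[OF nk] F.subspace_0[OF HomS_subspace[OF ncplxD(2)[OF nI]]]] by (simp add: map_zero)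

lemma fin_supp: "ncplx X \<Longrightarrow> finite (supp X)"
  unfolding supp_def by (rule bcplx_fin[OF ncplxD(1)])

lemma off_supp: "ncplx X \<Longrightarrow> i \<notin> supp X \<Longrightarrow> f \<in> HomS (ob X i) N \<Longrightarrow> f = (\<lambda>x. 0)"
  by (rule trivial_HomS[of "ob X i"]) (auto simp: supp_def ncplxD)

lemma strace_lin: "lin_on scaleC (Ch P I) (strace P t)"
  unfolding lin_on_def strace_def
proof (intro conjI ballI allI)
  fix f assume f: "f \<in> Ch P I"
  note l = nakD(3)[OF nk]
  have "t i (scaleC c f i) = c * t i (f i)" for i c
    using lin_on_scale[OF l Ch_HomS[OF f]] by (simp add: scaleC_def scaleF_def)
  then show "(\<Sum>i\<in>supp P. sg i * t i (scaleC c f i)) = c * (\<Sum>i\<in>supp P. sg i * t i (f i))" for c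
    by (simp add: sum_distrib_left algebra_simps)
  fix g assume g: "g \<in> Ch P I"
  have "t i ((f + g) i) = t i (f i) + t i (g i)" for i
    using lin_on_add[OF l Ch_HomS[OF f] Ch_HomS[OF g]] by (simp add: fun_apply)
  then show "(\<Sum>i\<in>supp P. sg i * t i ((f + g) i)) = (\<Sum>i\<in>supp P. sg i * t i (f i)) + (\<Sum>i\<in>supp P. sg i * t i (g i))"
    by (simp add: algebra_simps sum.distrib)
qed

text \<open>With a(i) the value of t on d h in degree i, compatibility of the differentials gives
  t(f i) = a(i) + a(i + 1), and under the alternating signs the sum telescopes to zero.\<close>

lemma strace_null:
  assumes f: "f \<in> Null P I" shows "strace P t f = 0"
proof -
  note bP = ncplxD(1)[OF nP] and bI = ncplxD(1)[OF nI]
  have f': "f \<in> Ch P I" "null_htpy P I f" using f by (auto simp: Null_def)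
  obtain h0 where h0: "\<And>i. mod_hom (ob P i) (ob I (i - 1)) (h0 i)"
    "\<And>i x. x \<in> car (ob P i) \<Longrightarrow> f i x = dif I (i - 1) (h0 i x) + h0 (i + 1) (dif P i x)"
    using f'(2) by (rule null_htpyE) blast
  define h where "h i = rsm (ob P i) (h0 i)" for i
  have h: "h i \<in> HomS (ob P i) (ob I (i - 1))" for i unfolding h_def by (rule rsm_HomS[OF ncplxD(2)[OF nP] h0(1)])
  have h': "h (i + 1) \<in> HomS (ob P (i + 1)) (ob I i)" for i using h[of "i + 1"] by simp
  have d': "dh I (i - 1) \<in> HomS (ob I (i - 1)) (ob I i)" for i using dh_HomS[OF nI, of "i - 1"] by simp
  have m: "(\<lambda>x. dh I (i - 1) (h i x)) \<in> HomS (ob P i) (ob I i)" "(\<lambda>x. h (i + 1) (dh P i x)) \<in> HomS (ob P i) (ob I i)" for i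
    by (rule HomS_comp[OF ncplxD(2)[OF nI] h d'], rule HomS_comp[OF ncplxD(2)[OF nP] dh_HomS[OF nP] h'])
  have fi: "f i = (\<lambda>x. dh I (i - 1) (h i x)) + (\<lambda>x. h (i + 1) (dh P i x))" for i
  proof (rule HomS_eqI[OF Ch_HomS[OF f'(1)] F.subspace_add[OF HomS_subspace[OF ncplxD(2)[OF nI]] m]])
    fix x assume x: "x \<in> car (ob P i)"
    show "f i x = ((\<lambda>x. dh I (i - 1) (h i x)) + (\<lambda>x. h (i + 1) (dh P i x))) x"
      using x hom_car[OF h0(1) x] bcplx_dif_car[OF bP x] h0(2)[OF x] by (simp add: map_add h_def rsm_def dh_eq)
  qed
  define a where "a i = t i (\<lambda>x. dh I (i - 1) (h i x))" for i
  have tf: "t i (f i) = a i + a (i + 1)" for i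
    unfolding fi lin_on_add[OF nakD(3)[OF nk] m] a_def using compat[OF h', of i] by simp
  have a0: "a i = 0" if "i \<notin> supp P" for i
    unfolding a_def using off_supp[OF nP that m(1)] t_zero by simp
  have a1: "a (i + 1) = 0" if "i \<notin> supp P" for i
    using tf[of i] a0[OF that] off_supp[OF nP that Ch_HomS[OF f'(1)]] t_zero by simp
  let ?U = "supp P \<union> (\<lambda>i. i + 1) ` supp P"
  have fU: "finite ?U" using fin_supp[OF nP] by simp
  have "strace P t f = (\<Sum>i\<in>supp P. sg i * a i) + (\<Sum>i\<in>supp P. sg i * a (i + 1))"
    by (simp add: strace_def tf distrib_left sum.distrib)
  also have "(\<Sum>i\<in>supp P. sg i * a i) = (\<Sum>i\<in>?U. sg i * a i)"
    by (rule sum.mono_neutral_left[OF fU]) (auto simp: a0)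
  also have "(\<Sum>i\<in>supp P. sg i * a (i + 1)) = (\<Sum>j\<in>(\<lambda>i. i + 1) ` supp P. - sg j * a j)"
    by (subst sum.reindex) (auto simp: inj_on_def sg_Suc)
  also have "\<dots> = (\<Sum>j\<in>?U. - sg j * a j)"
  proof (rule sum.mono_neutral_left[OF fU])
    show "\<forall>i\<in>?U - (\<lambda>i. i + 1) ` supp P. - sg i * a i = 0"
    proof
      fix i assume "i \<in> ?U - (\<lambda>i. i + 1) ` supp P"
      then have "i - 1 \<notin> supp P" by (auto simp: image_iff)
      then show "- sg i * a i = 0" using a1[of "i - 1"] by simp
    qed
  qed auto
  also have "(\<Sum>i\<in>?U. sg i * a i) + (\<Sum>j\<in>?U. - sg j * a j) = 0" by (simp add: sum_negf)
  finally show ?thesis .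
qed

text \<open>The functional is represented in each degree separately. That it vanishes on the
  null-homotopic maps with a one-component homotopy says that the resulting family is a chain map;
  the sign of the supertrace compensates that of the homotopy relation.\<close>

lemma strace_rep:
  assumes Q: "ncplx Q" and \<phi>: "lin_on scaleC (Ch P Q) \<phi>" "\<And>g. g \<in> Null P Q \<Longrightarrow> \<phi> g = 0"
  obtains f where "f \<in> Ch Q I" "\<And>g. g \<in> Ch P Q \<Longrightarrow> strace P t (cc f g) = \<phi> g"
proof -
  note nQ = ncplxD(2)[OF Q]
  \<comment> \<open>A chain map is the sum of its components, which are in general not chain maps.
    Extending \<phi> to all families of maps gives it a value on each of them.\<close>
  obtain \<Phi> where \<Phi>: "lin_on scaleC UNIV \<Phi>" "\<And>g. g \<in> Ch P Q \<Longrightarrow> \<Phi> g = \<phi> g"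
    using C.functional_extend[OF Ch_nsubspace[OF Q ncplxD(1)[OF nP]] \<phi>(1)] by blast
  have l: "lin_on scaleF (HomS (ob P i) (ob Q i)) (\<lambda>g. sg i * \<Phi> (single i g))" for i
    using single_lin[OF \<Phi>(1)] unfolding lin_on_def by (simp add: algebra_simps)
  have "\<exists>f. f \<in> HomS (ob Q i) (ob I i) \<and> (\<forall>g\<in>HomS (ob P i) (ob Q i). t i (\<lambda>x. f (g x)) = sg i * \<Phi> (single i g))" for i
    by (rule nak_rep[OF nk nQ l]) blast
  then have "\<forall>i. \<exists>f. f \<in> HomS (ob Q i) (ob I i) \<and> (\<forall>g\<in>HomS (ob P i) (ob Q i). t i (\<lambda>x. f (g x)) = sg i * \<Phi> (single i g))" by blast
  from choice[OF this] obtain f where f: "\<And>i. f i \<in> HomS (ob Q i) (ob I i)"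
    "\<And>i g. g \<in> HomS (ob P i) (ob Q i) \<Longrightarrow> t i (\<lambda>x. f i (g x)) = sg i * \<Phi> (single i g)" by blast
  have "f \<in> Ch Q I"
  proof (rule ChI[OF Q nI f(1)])
    fix i
    show "(\<lambda>x. f (i + 1) (dh Q i x)) = (\<lambda>x. dh I i (f i x))"
    proof (rule nak_unique_right[OF nk nQ HomS_comp[OF nQ dh_HomS[OF Q] f(1)] HomS_comp[OF ncplxD(2)[OF nI] f(1) dh_HomS[OF nI]]])
      fix h assume h: "h \<in> HomS (ob P (i + 1)) (ob Q i)"
      have m1: "(\<lambda>x. dh Q i (h x)) \<in> HomS (ob P (i + 1)) (ob Q (i + 1))" by (rule HomS_comp[OF nQ h dh_HomS[OF Q]])
      have m2: "(\<lambda>x. h (dh P i x)) \<in> HomS (ob P i) (ob Q i)" by (rule HomS_comp[OF ncplxD(2)[OF nP] dh_HomS[OF nP] h])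
      have fh: "(\<lambda>x. f i (h x)) \<in> HomS (ob P (i + 1)) (ob I i)" by (rule HomS_comp[OF nQ h f(1)])
      have n: "single (i + 1) (\<lambda>x. dh Q i (h x)) + single i (\<lambda>x. h (dh P i x)) \<in> Null P Q"
        by (rule single_htpy[OF nP Q h])
      then have "\<Phi> (single (i + 1) (\<lambda>x. dh Q i (h x)) + single i (\<lambda>x. h (dh P i x))) = 0"
        using \<phi>(2)[OF n] \<Phi>(2) by (simp add: Null_def)
      then have z: "\<Phi> (single (i + 1) (\<lambda>x. dh Q i (h x))) + \<Phi> (single i (\<lambda>x. h (dh P i x))) = 0"
        using lin_on_add[OF \<Phi>(1)] by simp
      have "t (i + 1) (\<lambda>x. f (i + 1) (dh Q i (h x))) = - sg i * \<Phi> (single (i + 1) (\<lambda>x. dh Q i (h x)))"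
        using f(2)[OF m1] by (simp add: sg_Suc)
      also have "\<dots> = sg i * \<Phi> (single i (\<lambda>x. h (dh P i x)))"
        using eq_neg_iff_add_eq_0[THEN iffD2, OF z] by simp
      also have "\<dots> = t i (\<lambda>x. f i (h (dh P i x)))" using f(2)[OF m2] by simp
      also have "\<dots> = t (i + 1) (\<lambda>x. dh I i (f i (h x)))" using compat[OF fh] .
      finally show "t (i + 1) (\<lambda>x. f (i + 1) (dh Q i (h x))) = t (i + 1) (\<lambda>x. dh I i (f i (h x)))" .
    qed
  qed
  moreover have "strace P t (cc f g) = \<phi> g" if g: "g \<in> Ch P Q" for g
  proof -
    have "strace P t (cc f g) = (\<Sum>i\<in>supp P. \<Phi> (single i (g i)))"
      unfolding strace_def by (rule sum.cong) (simp_all add: f(2)[OF Ch_HomS[OF g]] mult.assoc[symmetric] sg_sg)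
    also have "\<dots> = \<Phi> (\<Sum>i\<in>supp P. single i (g i))" by (simp add: lin_on_sum[OF \<Phi>(1)])
    also have "(\<Sum>i\<in>supp P. single i (g i)) = g"
      by (rule Ch_decomp[OF nP fin_supp[OF nP] _ g, symmetric]) (simp add: supp_def)
    finally show ?thesis using \<Phi>(2)[OF g] by simp
  qed
  ultimately show thesis by (rule that)
qed

lemma strace_corep:
  assumes Q: "ncplx Q" and \<psi>: "lin_on scaleC (Ch Q I) \<psi>" "\<And>f. f \<in> Null Q I \<Longrightarrow> \<psi> f = 0"
  obtains g where "g \<in> Ch P Q" "\<And>f. f \<in> Ch Q I \<Longrightarrow> strace P t (cc f g) = \<psi> f"
proof -
  note nQ = ncplxD(2)[OF Q]
  obtain \<Psi> where \<Psi>: "lin_on scaleC UNIV \<Psi>" "\<And>f. f \<in> Ch Q I \<Longrightarrow> \<Psi> f = \<psi> f"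
    using C.functional_extend[OF Ch_nsubspace[OF nI ncplxD(1)[OF Q]] \<psi>(1)] by blast
  have l: "lin_on scaleF (HomS (ob Q i) (ob I i)) (\<lambda>f. sg i * \<Psi> (single i f))" for i
    using single_lin[OF \<Psi>(1)] unfolding lin_on_def by (simp add: algebra_simps)
  have "\<exists>g. g \<in> HomS (ob P i) (ob Q i) \<and> (\<forall>f\<in>HomS (ob Q i) (ob I i). t i (\<lambda>x. f (g x)) = sg i * \<Psi> (single i f))" for i
    by (rule nak_corep[OF nk nQ l]) blast
  then have "\<forall>i. \<exists>g. g \<in> HomS (ob P i) (ob Q i) \<and> (\<forall>f\<in>HomS (ob Q i) (ob I i). t i (\<lambda>x. f (g x)) = sg i * \<Psi> (single i f))" by blast
  from choice[OF this] obtain g where g: "\<And>i. g i \<in> HomS (ob P i) (ob Q i)"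
    "\<And>i f. f \<in> HomS (ob Q i) (ob I i) \<Longrightarrow> t i (\<lambda>x. f (g i x)) = sg i * \<Psi> (single i f)" by blast
  have "g \<in> Ch P Q"
  proof (rule ChI[OF nP Q g(1)])
    fix i
    show "(\<lambda>x. g (i + 1) (dh P i x)) = (\<lambda>x. dh Q i (g i x))"
    proof (rule nak_unique_left[OF nk nQ HomS_comp[OF ncplxD(2)[OF nP] dh_HomS[OF nP] g(1)] HomS_comp[OF nQ g(1) dh_HomS[OF Q]]])
      fix h assume h: "h \<in> HomS (ob Q (i + 1)) (ob I i)"
      have m1: "(\<lambda>x. dh I i (h x)) \<in> HomS (ob Q (i + 1)) (ob I (i + 1))" by (rule HomS_comp[OF ncplxD(2)[OF nI] h dh_HomS[OF nI]])
      have m2: "(\<lambda>x. h (dh Q i x)) \<in> HomS (ob Q i) (ob I i)" by (rule HomS_comp[OF nQ dh_HomS[OF Q] h])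
      have hg: "(\<lambda>x. h (g (i + 1) x)) \<in> HomS (ob P (i + 1)) (ob I i)" by (rule HomS_comp[OF nQ g(1) h])
      have n: "single (i + 1) (\<lambda>x. dh I i (h x)) + single i (\<lambda>x. h (dh Q i x)) \<in> Null Q I"
        by (rule single_htpy[OF Q nI h])
      then have "\<Psi> (single (i + 1) (\<lambda>x. dh I i (h x)) + single i (\<lambda>x. h (dh Q i x))) = 0"
        using \<psi>(2)[OF n] \<Psi>(2) by (simp add: Null_def)
      then have z: "\<Psi> (single (i + 1) (\<lambda>x. dh I i (h x))) + \<Psi> (single i (\<lambda>x. h (dh Q i x))) = 0"
        using lin_on_add[OF \<Psi>(1)] by simp
      have "t i (\<lambda>x. h (g (i + 1) (dh P i x))) = t (i + 1) (\<lambda>x. dh I i (h (g (i + 1) x)))" using compat[OF hg] .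
      also have "\<dots> = - sg i * \<Psi> (single (i + 1) (\<lambda>x. dh I i (h x)))" using g(2)[OF m1] by (simp add: sg_Suc)
      also have "\<dots> = sg i * \<Psi> (single i (\<lambda>x. h (dh Q i x)))"
        using eq_neg_iff_add_eq_0[THEN iffD2, OF z] by simp
      also have "\<dots> = t i (\<lambda>x. h (dh Q i (g i x)))" using g(2)[OF m2] by simp
      finally show "t i (\<lambda>x. h (g (i + 1) (dh P i x))) = t i (\<lambda>x. h (dh Q i (g i x)))" .
    qed
  qed
  moreover have "strace P t (cc f g) = \<psi> f" if f: "f \<in> Ch Q I" for f
  proof -
    \<comment> \<open>The supertrace sums over the support of P while f decomposes over that of Q.
      In degrees outside the support of P the added traces vanish.\<close>
    let ?S = "supp P \<union> supp Q"
    have fS: "finite ?S" using fin_supp nP Q by simp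
    have e: "sg i * t i (\<lambda>x. f i (g i x)) = \<Psi> (single i (f i))" for i
      using g(2)[OF Ch_HomS[OF f], of i] by (simp add: mult.assoc[symmetric] sg_sg)
    have f0: "f i 0 = 0" for i by (rule HomS_zero[OF nQ Ch_HomS[OF f]])
    have "strace P t (cc f g) = (\<Sum>i\<in>?S. sg i * t i (\<lambda>x. f i (g i x)))"
      unfolding strace_def
    proof (rule sum.mono_neutral_left[OF fS])
      show "\<forall>i\<in>?S - supp P. sg i * t i (\<lambda>x. f i (g i x)) = 0"
        using off_supp[OF nP _ g(1)] t_zero f0 by simp
    qed auto
    also have "\<dots> = \<Psi> (\<Sum>i\<in>?S. single i (f i))" unfolding e lin_on_sum[OF \<Psi>(1)] ..
    also have "(\<Sum>i\<in>?S. single i (f i)) = f"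
      by (rule Ch_decomp[OF Q fS _ f, symmetric]) (simp add: supp_def)
    finally show ?thesis using \<Psi>(2)[OF f] by simp
  qed
  ultimately show thesis by (rule that)
qed

lemma strace_htpc:
  assumes "f \<in> Ch P I" "g \<in> Ch P I" "htpc P I f g" shows "strace P t f = strace P t g"
proof -
  have "f - g \<in> Ch P I" by (rule C.subspace_diff[OF Ch_nsubspace[OF nI ncplxD(1)[OF nP]] assms(1,2)])
  moreover then have "f - g \<in> Null P I" using assms(3) by (simp add: Null_def htpc_def cmap_diff)
  ultimately show ?thesis using lin_on_diff[OF strace_lin _ assms(2), of f] strace_null by simp
qed

text \<open>Composition with \<open>s\<close> is bijective on homotopy classes of maps out of a
  complex of projectives, so the pairing with I carries over to its projective resolution R.\<close>

lemma serre_of_nakc: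
  assumes R: "pcplx R" and s: "quasi_iso R I s"
  shows "serre P R (\<lambda>h. strace P t (cc s h))"
  unfolding serre_def
proof (intro conjI allI impI ballI)
  note bP = ncplxD(1)[OF nP] and bI = ncplxD(1)[OF nI] and bR = pcplx_bcplx[OF R] and nR = pcplx_ncplx[OF R]
  note sc = quasi_iso_chain[OF s]
  show "pcplx P" "pcplx R" by (rule pP, rule R)
  have cs: "cc s h \<in> Ch X I" if "h \<in> Ch X R" for h X by (rule Ch_comp[OF that sc bR])
  have Rc: "h i x \<in> car (ob R i)" if "h \<in> Ch X R" for h i x X
    by (rule HomS_car[OF ncplxD(2)[OF nR] Ch_HomS[OF that]])
  have s_add: "cc s (x + y) = cc s x + cc s y" if "x \<in> Ch X R" "y \<in> Ch X R" for x y X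
    using hom_add[OF chain_hom[OF sc] Rc[OF that(1)] Rc[OF that(2)]] by (simp add: cmap_add)
  have s_scale: "cc s (scaleC c x) = scaleC c (cc s x)" if "x \<in> Ch X R" for x X c
    using hom_scaleE[OF ncplxD(2)[OF nR] ncplxD(2)[OF nI] chain_hom[OF sc] Rc[OF that]] by (simp add: scaleC_def)
  show "lin_on scaleC (Ch P R) (\<lambda>h. strace P t (cc s h))"
    by (rule lin_on_comp[where L = "cc s", OF strace_lin cs s_add s_scale])
  show "strace P t (cc s f) = 0" if "f \<in> Null P R" for f
    using that strace_null[of "cc s f"] cs null_left[OF sc _ bP bR] unfolding Null_def by blast
  have lift: "\<exists>f'\<in>Ch Q R. htpc Q I (cc s f') f" if Q: "pcplx Q" and f: "f \<in> Ch Q I" for Q f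
  proof -
    obtain f' where f': "chain_map Q R f'" "htpc Q I (cc s f') f"
      using lift_quasi_iso[OF pcplx_proj[OF Q] bR bI s Ch_chain[OF f]] by blast
    have "htpc Q I (cc s (rst Q f')) f"
      by (rule htpc_trans[OF bI htpc_eq[OF bI] f'(2)]) (simp add: rst_def)
    then show ?thesis using rst_Ch[OF pcplx_bcplx[OF Q] f'(1)] by blast
  qed
  {
    fix Q \<phi> assume a: "pcplx Q \<and> lin_on scaleC (Ch P Q) \<phi> \<and> (\<forall>g\<in>Null P Q. \<phi> g = 0)"
    then have Q: "pcplx Q" and \<phi>: "lin_on scaleC (Ch P Q) \<phi>" "\<And>g. g \<in> Null P Q \<Longrightarrow> \<phi> g = 0" by auto
    note bQ = pcplx_bcplx[OF Q]
    obtain f where f: "f \<in> Ch Q I" "\<And>g. g \<in> Ch P Q \<Longrightarrow> strace P t (cc f g) = \<phi> g"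
      by (rule strace_rep[OF pcplx_ncplx[OF Q] \<phi>], assumption, rule that)
    obtain f' where f': "f' \<in> Ch Q R" "htpc Q I (cc s f') f" using lift[OF Q f(1)] by blast
    show "\<exists>f\<in>Ch Q R. \<forall>g\<in>Ch P Q. strace P t (\<lambda>i x. s i (f i (g i x))) = \<phi> g"
    proof (intro bexI[OF _ f'(1)] ballI)
      fix g assume g: "g \<in> Ch P Q"
      have "strace P t (cc (cc s f') g) = strace P t (cc f g)"
        by (rule strace_htpc[OF Ch_comp[OF g Ch_chain[OF cs[OF f'(1)]] bQ] Ch_comp[OF g Ch_chain[OF f(1)] bQ]
          htpc_right[OF Ch_chain[OF g] f'(2)]])
      then show "strace P t (\<lambda>i x. s i (f' i (g i x))) = \<phi> g" using f(2)[OF g] by simp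
    qed
  next
    fix Q \<psi> assume a: "pcplx Q \<and> lin_on scaleC (Ch Q R) \<psi> \<and> (\<forall>f\<in>Null Q R. \<psi> f = 0)"
    then have Q: "pcplx Q" and \<psi>: "lin_on scaleC (Ch Q R) \<psi>" "\<And>f. f \<in> Null Q R \<Longrightarrow> \<psi> f = 0" by auto
    note bQ = pcplx_bcplx[OF Q]
    note S = Ch_subspace[OF Q R]
    \<comment> \<open>A choice of lifts along s. It is linear only up to homotopy, which is enough
      because \<psi> kills the null maps.\<close>
    define L where "L f = (SOME f'. f' \<in> Ch Q R \<and> htpc Q I (cc s f') f)" for f
    have L: "L f \<in> Ch Q R" "htpc Q I (cc s (L f)) f" if "f \<in> Ch Q I" for f
    proof -
      have "\<exists>f'. f' \<in> Ch Q R \<and> htpc Q I (cc s f') f" using lift[OF Q that] by blast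
      then have "L f \<in> Ch Q R \<and> htpc Q I (cc s (L f)) f" unfolding L_def by (rule someI_ex)
      then show "L f \<in> Ch Q R" "htpc Q I (cc s (L f)) f" by auto
    qed
    have eq: "\<psi> f1 = \<psi> f2" if f: "f1 \<in> Ch Q R" "f2 \<in> Ch Q R" and h: "htpc Q I (cc s f1) (cc s f2)" for f1 f2
    proof -
      note d = C.subspace_diff[OF S f]
      have "htpc Q R f1 f2"
        by (rule htpc_quasi_iso_cancel[OF pcplx_proj[OF Q] bR bI s Ch_chain[OF f(1)] Ch_chain[OF f(2)] h])
      then have "f1 - f2 \<in> Null Q R" using d by (simp add: Null_def htpc_def cmap_diff)
      then show ?thesis using \<psi>(2) lin_on_diff[OF \<psi>(1) d f(2)] by simp
    qed
    note SI = Ch_nsubspace[OF nI bQ]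
    have l: "lin_on scaleC (Ch Q I) (\<lambda>f. \<psi> (L f))"
      unfolding lin_on_def
    proof (intro conjI ballI allI)
      fix f assume f: "f \<in> Ch Q I"
      have "htpc Q I (cc s (L (scaleC c f))) (cc s (scaleC c (L f)))" for c
      proof -
        have sid: "chain_map I I (scaleC c (\<lambda>i x. x))"
          unfolding chain_map_def scaleC_def mod_hom_def
          using nmod_scale[OF ncplxD(2)[OF nI]] act_scaleE[OF ncplxD(2)[OF nI]]
            hom_scaleE[OF ncplxD(2)[OF nI] ncplxD(2)[OF nI] bcplx_dif[OF bI]] by (simp add: E.scale_right_distrib)
        have "htpc Q I (\<lambda>i x. scaleC c (\<lambda>i x. x) i (cc s (L f) i x)) (\<lambda>i x. scaleC c (\<lambda>i x. x) i (f i x))"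
          by (rule htpc_left[OF sid L(2)[OF f] bQ bI Ch_chain[OF cs[OF L(1)[OF f]]] Ch_chain[OF f]])
        then have "htpc Q I (cc s (scaleC c (L f))) (scaleC c f)"
          unfolding s_scale[OF L(1)[OF f]] by (simp add: scaleC_def)
        then show ?thesis using htpc_trans[OF bI L(2)[OF C.subspace_scale[OF SI f]] htpc_sym[OF bI]] by blast
      qed
      then have "\<psi> (L (scaleC c f)) = \<psi> (scaleC c (L f))" for c
        using eq[OF L(1)[OF C.subspace_scale[OF SI f]] C.subspace_scale[OF S L(1)[OF f]]] by blast
      then show "\<psi> (L (scaleC c f)) = c * \<psi> (L f)" for c using lin_on_scale[OF \<psi>(1) L(1)[OF f]] by simp
      fix g assume g: "g \<in> Ch Q I"
      have "htpc Q I (cc s (L f + L g)) (f + g)"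
        unfolding s_add[OF L(1)[OF f] L(1)[OF g]] htpc_def
        by (rule null_cong[OF null_add[OF bI L(2)[OF f, unfolded htpc_def] L(2)[OF g, unfolded htpc_def]]]) (simp add: cmap_add)
      then have "htpc Q I (cc s (L (f + g))) (cc s (L f + L g))"
        using htpc_trans[OF bI L(2)[OF C.subspace_add[OF SI f g]] htpc_sym[OF bI]] by blast
      then have "\<psi> (L (f + g)) = \<psi> (L f + L g)"
        using eq[OF L(1)[OF C.subspace_add[OF SI f g]] C.subspace_add[OF S L(1)[OF f] L(1)[OF g]]] by blast
      then show "\<psi> (L (f + g)) = \<psi> (L f) + \<psi> (L g)" using lin_on_add[OF \<psi>(1) L(1)[OF f] L(1)[OF g]] by simp
    qed
    have n: "\<psi> (L f) = 0" if "f \<in> Null Q I" for f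
    proof -
      have f: "f \<in> Ch Q I" "null_htpy Q I f" using that by (auto simp: Null_def)
      have "null_htpy Q R (L f)"
        by (rule quasi_iso_mono[OF pcplx_proj[OF Q] bR bI s Ch_chain[OF L(1)[OF f(1)]] htpc_null[OF bI L(2)[OF f(1)] f(2)]])
      then show ?thesis using \<psi>(2) L(1)[OF f(1)] by (simp add: Null_def)
    qed
    obtain g where g: "g \<in> Ch P Q" "\<And>f. f \<in> Ch Q I \<Longrightarrow> strace P t (cc f g) = \<psi> (L f)"
      by (rule strace_corep[OF pcplx_ncplx[OF Q] l n], assumption, rule that)
    show "\<exists>g\<in>Ch P Q. \<forall>f\<in>Ch Q R. strace P t (\<lambda>i x. s i (f i (g i x))) = \<psi> f"
    proof (intro bexI[OF _ g(1)] ballI)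
      fix f assume f: "f \<in> Ch Q R"
      show "strace P t (\<lambda>i x. s i (f i (g i x))) = \<psi> f"
        using g(2)[OF cs[OF f]] eq[OF L(1)[OF cs[OF f]] f L(2)[OF cs[OF f]]] by simp
    qed
  }
qed

end

end

section \<open>Existence of Serre partners and of Auslander--Reiten triangles\<close>

context hereditary_algebra
begin

lemma rsm_id: "f \<in> HomS M N \<Longrightarrow> rsm M f = f"
  using HomS_out by (auto simp: rsm_def fun_eq_iff)

lemma zero_HomS: "nmod N \<Longrightarrow> (\<lambda>x. 0) \<in> HomS M N"
  using F.subspace_0[OF HomS_subspace, of N M] by (simp add: map_zero)

lemma nak_zero: assumes n: "nak P I t" shows "t (\<lambda>x. 0) = 0"
  using lin_on_zero[OF nakD(3)[OF n] F.subspace_0[OF HomS_subspace[OF nakD(2)[OF n]]]] by (simp add: map_zero)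

text \<open>This keeps the partner of a bounded complex bounded. If one module is zero, the identity
  of the other pairs to zero with everything and is therefore zero.\<close>

lemma nak_trivial:
  assumes n: "nak P I t" shows "car P = {0} \<longleftrightarrow> car I = {0}"
proof
  note nP = nakD(1)[OF n] and nI = nakD(2)[OF n]
  have z: "0 \<in> car P" "0 \<in> car I" using E.subspace_0[OF nmod_subspace] nP nI by auto
  {
    assume P: "car P = {0}"
    have r: "rsm I (\<lambda>x. x) \<in> HomS I I" by (rule rsm_HomS[OF nI]) (simp add: mod_hom_def)
    have "rsm I (\<lambda>x. x) = (\<lambda>x. 0)"
    proof (rule nak_unique_right[OF n nI r zero_HomS[OF nI]])
      fix g assume "g \<in> HomS P I"
      then have "g = (\<lambda>x. 0)" by (rule trivial_HomS[OF P nP])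
      then show "t (\<lambda>x. rsm I (\<lambda>x. x) (g x)) = t (\<lambda>x. 0)" by (simp add: rsm_def)
    qed
    then have "x = 0" if "x \<in> car I" for x using that by (auto simp: rsm_def fun_eq_iff split: if_splits)
    then show "car I = {0}" using z by blast
  }
  assume I: "car I = {0}"
  have r: "rsm P (\<lambda>x. x) \<in> HomS P P" by (rule rsm_HomS[OF nP]) (simp add: mod_hom_def)
  have "rsm P (\<lambda>x. x) = (\<lambda>x. 0)"
  proof (rule nak_unique_left[OF n nP r zero_HomS[OF nP]])
    fix f assume f: "f \<in> HomS P I"
    have "f = (\<lambda>x. 0)" using HomS_car[OF nI f] I by auto
    then show "t (\<lambda>x. f (rsm P (\<lambda>x. x) x)) = t (\<lambda>x. f 0)" by simp
  qed
  then have "x = 0" if "x \<in> car P" for x using that by (auto simp: rsm_def fun_eq_iff split: if_splits)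
  then show "car P = {0}" using z by blast
qed

text \<open>The differential of the partner is the adjoint of that of \<open>P\<close>. Its square
  is the adjoint of zero, hence zero by the uniqueness of representing maps.\<close>

lemma nakc_of_projective:
  assumes P: "pcplx P" obtains I t where "nakc P I t"
proof -
  note nP = ncplxD(2)[OF pcplx_ncplx[OF P]] and dP = dh_HomS[OF pcplx_ncplx[OF P]]
  have "\<exists>p. nak (ob P i) (fst p) (snd p)" for i
  proof -
    obtain I t where "nak (ob P i) I t" by (rule nak_projective[OF pcplx_pmod[OF P]])
    then show ?thesis by (intro exI[of _ "(I, t)"]) simp
  qed
  then have "\<forall>i. \<exists>p. nak (ob P i) (fst p) (snd p)" by blast
  from choice[OF this] obtain p where p: "\<And>i. nak (ob P i) (fst (p i)) (snd (p i))" by blast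
  define J t where "J i = fst (p i)" and "t i = snd (p i)" for i
  have nk: "nak (ob P i) (J i) (t i)" for i using p by (simp add: J_def t_def)
  note nJ = nakD(2)[OF nk] and tl = nakD(3)[OF nk]
  have l: "lin_on scaleF (HomS (ob P (i + 1)) (J i)) (\<lambda>g. t i (\<lambda>x. g (dh P i x)))" for i
    by (rule lin_pre[OF tl nP dP])
  have "\<exists>d. d \<in> HomS (J i) (J (i + 1)) \<and> (\<forall>g\<in>HomS (ob P (i + 1)) (J i). t (i + 1) (\<lambda>x. d (g x)) = t i (\<lambda>x. g (dh P i x)))" for i
    by (rule nak_rep[OF nk nJ l]) blast
  then have "\<forall>i. \<exists>d. d \<in> HomS (J i) (J (i + 1)) \<and> (\<forall>g\<in>HomS (ob P (i + 1)) (J i). t (i + 1) (\<lambda>x. d (g x)) = t i (\<lambda>x. g (dh P i x)))" by blast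
  from choice[OF this] obtain d where d: "\<And>i. d i \<in> HomS (J i) (J (i + 1))"
    "\<And>i g. g \<in> HomS (ob P (i + 1)) (J i) \<Longrightarrow> t (i + 1) (\<lambda>x. d i (g x)) = t i (\<lambda>x. g (dh P i x))" by blast
  have dd: "(\<lambda>x. d (i + 1) (d i x)) = (\<lambda>x. 0)" for i
  proof (rule nak_unique_right[OF nk nJ HomS_comp[OF nJ d(1) d(1)] zero_HomS[OF nJ]])
    fix g assume g: "g \<in> HomS (ob P (i + 1 + 1)) (J i)"
    have "t (i + 1 + 1) (\<lambda>x. d (i + 1) (d i (g x))) = t (i + 1) (\<lambda>x. d i (g (dh P (i + 1) x)))"
      by (rule d(2)[OF HomS_comp[OF nJ g d(1)]])
    also have "\<dots> = t i (\<lambda>x. g (dh P (i + 1) (dh P i x)))" by (rule d(2)[OF HomS_comp[OF nP dP g]])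
    also have "\<dots> = 0" unfolding dh_dh[OF pcplx_ncplx[OF P]] HomS_zero[OF nP g] by (rule nak_zero[OF nk])
    also have "\<dots> = t (i + 1 + 1) (\<lambda>x. 0)" by (rule nak_zero[OF nk, symmetric])
    finally show "t (i + 1 + 1) (\<lambda>x. d (i + 1) (d i (g x))) = t (i + 1 + 1) (\<lambda>x. 0)" .
  qed
  let ?I = "\<lparr>ob = J, dif = d\<rparr>"
  have I: "ncplx ?I"
  proof (rule ncplxI)
    show "finite {i. car (ob ?I i) \<noteq> {0}}" using bcplx_fin[OF pcplx_bcplx[OF P]] nak_trivial[OF nk] by simp
  qed (use nJ HomS_hom[OF d(1)] fun_cong[OF dd] in simp_all)
  have di: "dh ?I i = d i" for i using rsm_id[OF d(1)] by (simp add: dh_def)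
  have "nakc P ?I t" unfolding nakc_def di using P I nk d(2) by simp
  then show thesis by (rule that)
qed

lemma nakc_of_injective:
  assumes I: "ncplx I" and ex: "\<And>i. \<exists>P t. pmod P \<and> nak P (ob I i) t"
  obtains P t where "nakc P I t"
proof -
  note nI = ncplxD(2)[OF I] and dI = dh_HomS[OF I]
  have "\<exists>p. pmod (fst p) \<and> nak (fst p) (ob I i) (snd p)" for i
    using ex[of i] by simp
  then have "\<forall>i. \<exists>p. pmod (fst p) \<and> nak (fst p) (ob I i) (snd p)" by blast
  from choice[OF this] obtain p where p: "\<And>i. pmod (fst (p i)) \<and> nak (fst (p i)) (ob I i) (snd (p i))" by blast
  define J t where "J i = fst (p i)" and "t i = snd (p i)" for i
  have nk: "nak (J i) (ob I i) (t i)" and pJ: "pmod (J i)" for i using p by (auto simp: J_def t_def)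
  note nJ = nakD(1)[OF nk] and tl = nakD(3)[OF nk]
  have l: "lin_on scaleF (HomS (J (i + 1)) (ob I i)) (\<lambda>g. t (i + 1) (\<lambda>x. dh I i (g x)))" for i
    by (rule lin_post[OF tl nI nI dI])
  have "\<exists>d. d \<in> HomS (J i) (J (i + 1)) \<and> (\<forall>g\<in>HomS (J (i + 1)) (ob I i). t i (\<lambda>x. g (d x)) = t (i + 1) (\<lambda>x. dh I i (g x)))" for i
    by (rule nak_corep[OF nk nJ l]) blast
  then have "\<forall>i. \<exists>d. d \<in> HomS (J i) (J (i + 1)) \<and> (\<forall>g\<in>HomS (J (i + 1)) (ob I i). t i (\<lambda>x. g (d x)) = t (i + 1) (\<lambda>x. dh I i (g x)))" by blast
  from choice[OF this] obtain d where d: "\<And>i. d i \<in> HomS (J i) (J (i + 1))"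
    "\<And>i g. g \<in> HomS (J (i + 1)) (ob I i) \<Longrightarrow> t i (\<lambda>x. g (d i x)) = t (i + 1) (\<lambda>x. dh I i (g x))" by blast
  have dd: "(\<lambda>x. d (i + 1) (d i x)) = (\<lambda>x. 0)" for i
  proof (rule nak_unique_left[OF nk nJ HomS_comp[OF nJ d(1) d(1)] zero_HomS[OF nJ]])
    fix g assume g: "g \<in> HomS (J (i + 1 + 1)) (ob I i)"
    have "t i (\<lambda>x. g (d (i + 1) (d i x))) = t (i + 1) (\<lambda>x. dh I i (g (d (i + 1) x)))"
      by (rule d(2)[OF HomS_comp[OF nJ d(1) g]])
    also have "\<dots> = t (i + 1 + 1) (\<lambda>x. dh I (i + 1) (dh I i (g x)))" by (rule d(2)[OF HomS_comp[OF nI g dI]])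
    also have "\<dots> = 0" unfolding dh_dh[OF I] by (rule nak_zero[OF nk])
    also have "\<dots> = t i (\<lambda>x. g 0)" unfolding HomS_zero[OF nJ g] by (rule nak_zero[OF nk, symmetric])
    finally show "t i (\<lambda>x. g (d (i + 1) (d i x))) = t i (\<lambda>x. g 0)" .
  qed
  let ?P = "\<lparr>ob = J, dif = d\<rparr>"
  have P: "pcplx ?P"
  proof (rule pcplxI)
    show "finite {i. car (ob ?P i) \<noteq> {0}}" using bcplx_fin[OF ncplxD(1)[OF I]] nak_trivial[OF nk] by simp
  qed (use pJ HomS_hom[OF d(1)] fun_cong[OF dd] in simp_all)
  have di: "dh ?P i = d i" for i using rsm_id[OF d(1)] by (simp add: dh_def)
  have "nakc ?P I t" unfolding nakc_def di using P I nk d(2) by simp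
  then show thesis by (rule that)
qed

lemma serre_of_projective:
  assumes P: "pcplx P" obtains R t where "serre P R t"
proof -
  obtain I t where n: "nakc P I t" by (rule nakc_of_projective[OF P])
  obtain R s where R: "pcplx R" "quasi_iso R I s" by (rule resolution[OF ncplxD(1)[OF nI[OF n]]])
  show thesis by (rule that[OF serre_of_nakc[OF n R]])
qed

lemma serre_of_target:
  assumes S: "bcplx S" obtains P R t where "serre P R t" "d_iso R S"
proof -
  \<comment> \<open>The injective resolution at hand is that of a shift, so the start is
    S[-1].\<close>
  obtain Q where Q: "pcplx Q" "d_iso Q (unshift S)" by (rule resolution_iso[OF bcplx_unshift[OF S]])
  obtain I where I: "ncplx I" "d_iso (shift Q) I" "\<And>i. \<exists>P t. pmod P \<and> nak P (ob I i) t"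
    by (rule injective_resolution[OF Q(1)]) (rule that)
  obtain P t where n: "nakc P I t" by (rule nakc_of_injective[OF I(1,3)])
  note bI = ncplxD(1)[OF I(1)]
  obtain R s where R: "pcplx R" "quasi_iso R I s" by (rule resolution[OF bI])
  have "d_iso R I" by (rule d_iso_quasi_iso[OF pcplx_bcplx[OF R(1)] bI R(2)])
  moreover have "d_iso (shift Q) S" using d_iso_shift[OF Q(2)] by simp
  ultimately have "d_iso R S" using d_iso_trans d_iso_sym[OF I(2)] by blast
  with serre_of_nakc[OF n R] show thesis by (rule that)
qed

lemma local_end_resolution:
  assumes "pcplx P" "d_iso P X" "indecomposable (X :: 'h cplx)" shows "local_end P"
  by (rule local_end_of_indecomposable[OF assms(1) indecomposable_iso[OF assms(3) d_iso_sym[OF assms(2)]]])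

text \<open>Idempotents are carried along the shift, not decompositions, which would have to be
  shifted back together with the words of their isomorphisms.\<close>

lemma indecomposable_shift:
  assumes X: "indecomposable (X :: 'h cplx)" shows "indecomposable (shift X)"
proof -
  have bX: "bcplx X" using X by (simp add: indecomposable_def)
  obtain P where P: "pcplx P" "d_iso P X" by (rule resolution_iso[OF bX])
  have "triv_idem P" by (rule triv_idem_of_local[OF pcplx_bcplx[OF P(1)] local_end_resolution[OF P X]])
  then have "triv_idem (shift P)" by (rule triv_idem_shift[OF pcplx_bcplx[OF P(1)]])
  then have "indecomposable (shift P)" by (rule indecomposableI[OF pcplx_proj[OF pcplx_shift[OF P(1)]]])
  then show ?thesis by (rule indecomposable_iso[OF _ d_iso_shift[OF P(2)]])
qed

text \<open>The Serre functor is \<tau>[1], so the complex P whose Serre partner is M[1] is the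
  candidate for \<open>\<tau>\<^sup>-\<^sup>1 M\<close>. Its indecomposability comes from that of
  M[1] by way of idempotents.\<close>

lemma tau_inv_exists:
  assumes M: "indecomposable (M :: 'h cplx)" shows "is_tau M (tau_inv M)"
proof -
  have iS: "indecomposable (shift M)" by (rule indecomposable_shift[OF M])
  then have bS: "bcplx (shift M)" by (simp add: indecomposable_def)
  obtain P R t where s: "serre P R t" and R: "d_iso R (shift M)" by (rule serre_of_target[OF bS])
  note pP = serre_P[OF s] and pR = serre_R[OF s]
  have "triv_idem R" by (rule triv_idem_of_local[OF pcplx_bcplx[OF pR] local_end_resolution[OF pR R iS]])
  then have "triv_idem P" using serre_triv_idem[OF s] by blast
  then have iP: "indecomposable P" by (rule indecomposableI[OF pcplx_proj[OF pP]])
  obtain \<omega> where "ar_mor P R \<omega>" by (rule serre_ar_mor[OF s local_end_of_indecomposable[OF pP iP]])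
  then have "is_tau M P" by (rule is_tau_of_ar_mor[OF pP iP M pR R])
  then show ?thesis unfolding tau_inv_def by (rule someI)
qed

section \<open>Ext-configurations\<close>

lemma not_hom_vanishes_iff:
  assumes P: "pcplx P" "d_iso P (X :: 'h cplx)" and Q: "bcplx Q" "d_iso Q Y"
  shows "\<not> hom_vanishes X Y \<longleftrightarrow> (\<exists>f. chain_map P Q f \<and> \<not> null_htpy P Q f)"
  using hom_vanishes_iso[OF P(2) Q(2)] hom_vanishes_iso[OF d_iso_sym[OF P(2)] d_iso_sym[OF Q(2)]] hom_vanishes_iff[OF pcplx_proj[OF P(1)] Q(1)] by blast

lemma ext_configuration_F:
  fixes T :: "'h cplx set"
  assumes T: "ext_configuration T" and M: "indecomposable M"
  shows "mem_iso M T \<longleftrightarrow> mem_iso (F_obj M) T"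
proof -
  have ind: "\<And>X. X \<in> T \<Longrightarrow> indecomposable X" and E1: "\<And>X Y. X \<in> T \<Longrightarrow> Y \<in> T \<Longrightarrow> ext1_vanishes X Y"
    and E2: "\<And>Z. indecomposable Z \<Longrightarrow> \<not> mem_iso Z T \<Longrightarrow> \<exists>X\<in>T. \<not> ext1_vanishes X Z"
    using T unfolding ext_configuration_def by blast+
  have indb: "\<And>X. X \<in> T \<Longrightarrow> bcplx X" using ind by (simp add: indecomposable_def)
  have ext: "hom_vanishes X (shift Y)" if "d_iso X X'" "d_iso Y Y'" "X' \<in> T" "Y' \<in> T" for X Y X' Y'
    using E1[OF that(3,4)] hom_vanishes_iso[OF d_iso_sym[OF that(1)] d_iso_shift[OF d_iso_sym[OF that(2)]]] by (simp add: ext1_vanishes_def)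
  let ?N = "tau_inv M"
  obtain Y u v w where tri: "ar_triangle M Y ?N u v w"
    using tau_inv_exists[OF M] unfolding is_tau_def by blast
  have N: "indecomposable ?N" using tri by (simp add: ar_triangle_def)
  have bN: "bcplx ?N" and bM: "bcplx M" using N M by (simp_all add: indecomposable_def)
  have iS: "indecomposable (shift M)" by (rule indecomposable_shift[OF M])
  obtain P where P: "pcplx P" "d_iso P ?N" by (rule resolution_iso[OF bN])
  obtain R where R: "pcplx R" "d_iso R (shift M)" by (rule resolution_iso[OF bcplx_shift[OF bM]])
  note lR = local_end_resolution[OF R iS]
  obtain \<omega> where ar: "ar_mor P R \<omega>" by (rule ar_mor_of_triangle[OF tri P R])
  note bP = pcplx_bcplx[OF P(1)] and bR = pcplx_bcplx[OF R(1)]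
  show ?thesis
  proof
    assume "mem_iso (F_obj M) T"
    then obtain G where G: "G \<in> T" "d_iso (shift ?N) G" unfolding mem_iso_def F_obj_def by blast
    show "mem_iso M T"
    proof (rule ccontr)
      assume "\<not> mem_iso M T"
      then obtain X where X: "X \<in> T" "\<not> hom_vanishes X (shift M)"
        using E2[OF M] unfolding ext1_vanishes_def by blast
      obtain Q where Q: "pcplx Q" "d_iso Q X" by (rule resolution_iso[OF indb[OF X(1)]])
      obtain f where f: "chain_map Q R f" "\<not> null_htpy Q R f"
        using X(2) not_hom_vanishes_iff[OF Q bR R(2)] by blast
      obtain g where g: "chain_map P Q g" "\<not> null_htpy P Q g"
        by (rule ar_mor_right[OF P(1) R(1) Q(1) ar lR f])
      have "\<not> hom_vanishes (shift ?N) (shift X)"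
        using not_hom_vanishes_iff[OF pcplx_shift[OF P(1)] d_iso_shift[OF P(2)] bcplx_shift[OF pcplx_bcplx[OF Q(1)]] d_iso_shift[OF Q(2)]]
          chain_map_shift[OF g(1) bP] null_shift_iff[OF bP pcplx_bcplx[OF Q(1)], of g] g(2) by blast
      then show False using ext[OF G(2) d_iso_refl[OF indb[OF X(1)]] G(1) X(1)] by blast
    qed
  next
    assume "mem_iso M T"
    then obtain M0 where M0: "M0 \<in> T" "d_iso M M0" unfolding mem_iso_def by blast
    show "mem_iso (F_obj M) T"
    proof (rule ccontr)
      assume "\<not> mem_iso (F_obj M) T"
      then obtain X where X: "X \<in> T" "\<not> hom_vanishes X (shift (shift ?N))"
        using E2[OF indecomposable_shift[OF N]] unfolding ext1_vanishes_def F_obj_def by blast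
      obtain A where A: "pcplx A" "d_iso A X" by (rule resolution_iso[OF indb[OF X(1)]])
      obtain B t where s: "serre A B t" by (rule serre_of_projective[OF A(1)])
      note pB = serre_R[OF s]
      \<comment> \<open>B models \<tau>X[1], so B[-2] models \<tau>X[-1], which is the inverse of F
        applied to X.\<close>
      let ?Z = "unshift (unshift B)"
      have pZ: "pcplx ?Z" "pcplx (unshift B)" using pB pcplx_unshift by blast+
      have "triv_idem A" by (rule triv_idem_of_local[OF pcplx_bcplx[OF A(1)] local_end_resolution[OF A ind[OF X(1)]]])
      then have "triv_idem ?Z" using serre_triv_idem[OF s] triv_idem_unshift pcplx_bcplx pB pZ(2) by blast
      then have iZ: "indecomposable ?Z" by (rule indecomposableI[OF pcplx_proj[OF pZ(1)]])
      \<comment> \<open>For V in T, Hom(V, Z[1]) is Hom(V[1], B), which is dual to Hom(X, V[1]). The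
        latter vanishes by the first axiom, so the second axiom puts Z into T.\<close>
      have "mem_iso ?Z T"
      proof (rule ccontr)
        assume "\<not> mem_iso ?Z T"
        then obtain V where V: "V \<in> T" "\<not> hom_vanishes V (unshift B)"
          using E2[OF iZ] unfolding ext1_vanishes_def by auto
        obtain Q where Q: "pcplx Q" "d_iso Q V" by (rule resolution_iso[OF indb[OF V(1)]])
        obtain f where f: "chain_map Q (unshift B) f" "\<not> null_htpy Q (unshift B) f"
          using V(2) not_hom_vanishes_iff[OF Q pcplx_bcplx[OF pZ(2)] d_iso_refl[OF pcplx_bcplx[OF pZ(2)]]] by blast
        have f': "chain_map (shift Q) B (\<lambda>i. f (i + 1))" "\<not> null_htpy (shift Q) B (\<lambda>i. f (i + 1))"
          using chain_map_shift[OF f(1) pcplx_bcplx[OF Q(1)]] null_shift_iff[OF pcplx_bcplx[OF Q(1)] pcplx_bcplx[OF pZ(2)], of f] f(2) by simp_all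
        obtain g where g: "chain_map A (shift Q) g" "\<not> null_htpy A (shift Q) g"
          by (rule serre_hom_right[OF s pcplx_shift[OF Q(1)] f'])
        have "\<not> hom_vanishes X (shift V)"
          using not_hom_vanishes_iff[OF A bcplx_shift[OF pcplx_bcplx[OF Q(1)]] d_iso_shift[OF Q(2)]] g by blast
        then show False using E1[OF X(1) V(1)] by (simp add: ext1_vanishes_def)
      qed
      then obtain Z0 where Z0: "Z0 \<in> T" "d_iso ?Z Z0" unfolding mem_iso_def by blast
      obtain h where h: "chain_map A (shift (shift P)) h" "\<not> null_htpy A (shift (shift P)) h"
        using X(2) not_hom_vanishes_iff[OF A bcplx_shift[OF bcplx_shift[OF bP]] d_iso_shift[OF d_iso_shift[OF P(2)]]] by blast
      obtain f where f: "chain_map (shift (shift P)) B f" "\<not> null_htpy (shift (shift P)) B f"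
        by (rule serre_hom_left[OF s pcplx_shift[OF pcplx_shift[OF P(1)]] h])
      note bPP = bcplx_shift[OF bcplx_shift[OF bP]]
      let ?f = "\<lambda>i. f (i - 1 - 1)"
      have f': "chain_map P ?Z ?f" "\<not> null_htpy P ?Z ?f"
        using chain_map_unshift[OF chain_map_unshift[OF f(1) bPP] bcplx_unshift[OF bPP]] f(2)
          null_unshift_iff[OF bPP pcplx_bcplx[OF pB], of f]
          null_unshift_iff[OF bcplx_shift[OF bP] pcplx_bcplx[OF pZ(2)], of "\<lambda>i. f (i - 1)"] by simp_all
      obtain e where e: "chain_map ?Z R e" "\<not> null_htpy ?Z R e"
        by (rule ar_mor_left[OF P(1) R(1) pZ(1) ar f'])
      have "\<not> hom_vanishes ?Z (shift M)"
        using not_hom_vanishes_iff[OF pZ(1) d_iso_refl[OF pcplx_bcplx[OF pZ(1)]] bR R(2)] e by blast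
      then show False using ext[OF Z0(2) M0(2) Z0(1) M0(1)] by blast
    qed
  qed
qed

end

theorem proposition2p1:
  fixes scale :: "'k::field \<Rightarrow> 'h::ring_1 \<Rightarrow> 'h"
    and T :: "'h cplx set"
    and M :: "'h cplx"
  assumes "fd_algebra scale"
    and "hereditary TYPE('h)"
    and "ext_configuration T"
    and "indecomposable M"
  shows "mem_iso M T \<longleftrightarrow> mem_iso (F_obj M) T"
proof -
  interpret hereditary_algebra scale
    using assms(1,2) by (intro hereditary_algebra.intro hereditary_algebra_axioms.intro)
  show ?thesis by (rule ext_configuration_F[OF assms(3,4)])
qed

end
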